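(* Let $n\ge 3$, let $M$ be a closed (connected) smooth $n$-dimensional manifold, let $g$ be a unit-volume Riemannian metric on $M$ with constant sectional curvature $0$, and let $s,\tau\in\mathbb{R}$. When the variation is restricted to conformal directions, the second variation of $\mathcal{F}_{s,\tau}$ at $g$ is non-negative if $s+4\tau>\frac{4}{n}(\tau-1)$ and non-positive if $s+4\tau<\frac{4}{n}(\tau-1)$; that is, for every $f\in C^\infty(M)$ with $\int_M f\,dV_g=0$ one has $D^2\mathcal{F}_{s,\tau}(fg)\ge 0$ in the first case and $D^2\mathcal{F}_{s,\tau}(fg)\le 0$ in the second case.
   Context: For a Riemannian metric $\bar g$ on $M$ let $Rm$, $Ric$, $R$ denote its Riemann curvature tensor, Ricci tensor and scalar curvature, with $|Rm|^2=R_{ijkl}R^{ijkl}$ and $|Ric|^2=R_{ij}R^{ij}$, and set $$\mathcal{F}_{s,\tau}[\bar g]=\int_M|Rm|^2\,dV_{\bar g}+s\int_M|Ric|^2\,dV_{\bar g}+\tau\int_M R^2\,dV_{\bar g}.$$ The functional is considered on the space $\mathscr{M}_1$ of smooth Riemannian metrics on $M$ with unit volume. Conformal directions at $g$ are the tensors $h=fg$ with $f\in C^\infty(M)$, $\int_M f\,dV_g=0$. For such $h$, the second variation is $D^2\mathcal{F}_{s,\tau}(h)=\frac{d^2}{dt^2}\big|_{t=0}\mathcal{F}_{s,\tau}[g(t)]$, where $g(t)$ is any smooth curve in $\mathscr{M}_1$ with $g(0)=g$ and $g'(0)=h$ (the value depends only on $h$, since $g$ is a critical point of $\mathcal{F}_{s,\tau}$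 on $\mathscr{M}_1$). *)

theory Defs
  imports "HOL-Analysis.Analysis"
begin

section \<open>Smooth maps between normed spaces\<close>

fun Ck_on :: "nat \<Rightarrow> 'a::real_normed_vector set \<Rightarrow> ('a \<Rightarrow> 'b::real_normed_vector) \<Rightarrow> bool" where
  "Ck_on 0 S f \<longleftrightarrow> continuous_on S f"
| "Ck_on (Suc k) S f \<longleftrightarrow>
     (\<forall>x\<in>S. f differentiable (at x)) \<and> (\<forall>v. Ck_on k S (\<lambda>x. frechet_derivative f (at x) v))"

text \<open>Only used for open \<open>S\<close> in a finite-dimensional space, where directional derivatives in all
  fixed directions being \<open>C\<^sup>k\<close> is the same as \<open>f\<close> being \<open>C\<^sup>k\<^sup>+\<^sup>1\<close>.\<close>

definition smooth_on :: "'a::real_normed_vector set \<Rightarrow> ('a \<Rightarrow> 'b::real_normed_vector) \<Rightarrow> bool" where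
  "smooth_on S f \<longleftrightarrow> (\<forall>k. Ck_on k S f)"


section \<open>Smooth manifolds\<close>

text \<open>The manifold is a whole type \<open>'m\<close> (Hausdorff and second countable by its type class) with a
  smooth atlas, not necessarily maximal; its dimension is \<open>CARD('n)\<close>. A chart is its domain
  together with its coordinate map, whose values outside the domain are irrelevant.\<close>

type_synonym ('m, 'n) chart = "'m set \<times> ('m \<Rightarrow> (real, 'n) vec)"

abbreviation chart_dom :: "('m, 'n::finite) chart \<Rightarrow> 'm set" where
  "chart_dom c \<equiv> fst c"

abbreviation chart_map :: "('m, 'n::finite) chart \<Rightarrow> 'm \<Rightarrow> real^'n" where
  "chart_map c \<equiv> snd c"

definition chart_inv :: "('m, 'n::finite) chart \<Rightarrow> real^'n \<Rightarrow> 'm" where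
  "chart_inv c = inv_into (chart_dom c) (chart_map c)"

definition chart_img :: "('m, 'n::finite) chart \<Rightarrow> (real^'n) set" where
  "chart_img c = chart_map c ` chart_dom c"

definition transition :: "('m, 'n::finite) chart \<Rightarrow> ('m, 'n) chart \<Rightarrow> real^'n \<Rightarrow> real^'n" where
  "transition c d = chart_map d \<circ> chart_inv c"

definition smooth_atlas ::
  "('m::{t2_space, second_countable_topology}, 'n::finite) chart set \<Rightarrow> bool" where
  "smooth_atlas A \<longleftrightarrow>
     (\<Union>c\<in>A. chart_dom c) = UNIV \<and>
     (\<forall>c\<in>A. open (chart_dom c) \<and> open (chart_img c) \<and>
        homeomorphism (chart_dom c) (chart_img c) (chart_map c) (chart_inv c)) \<and>
     (\<forall>c\<in>A. \<forall>d\<in>A. smooth_on (chart_map c ` (chart_dom c \<inter> chart_dom d)) (transition c d))"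

definition closed_connected_manifold ::
  "('m::{t2_space, second_countable_topology}, 'n::finite) chart set \<Rightarrow> bool" where
  "closed_connected_manifold A \<longleftrightarrow>
     smooth_atlas A \<and> compact (UNIV :: 'm set) \<and> connected (UNIV :: 'm set)"

definition smooth_function :: "('m, 'n::finite) chart set \<Rightarrow> ('m \<Rightarrow> real) \<Rightarrow> bool" where
  "smooth_function A f \<longleftrightarrow> (\<forall>c\<in>A. smooth_on (chart_img c) (f \<circ> chart_inv c))"


section \<open>Riemannian metrics\<close>

text \<open>A covariant 2-tensor field is given by its component matrices in every chart \<open>c\<close>, as
  functions of the coordinates: \<open>g c x $ i $ j\<close> is \<open>g(\<partial>\<^sub>i, \<partial>\<^sub>j)\<close> at the point with
  coordinates \<open>x\<close>. Values for \<open>c\<close> outside the atlas or \<open>x\<close> outside the image of \<open>c\<close> are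
  irrelevant.\<close>

type_synonym ('m, 'n) tensor2 =
  "('m, 'n) chart \<Rightarrow> (real, 'n) vec \<Rightarrow> ((real, 'n) vec, 'n) vec"

definition riemannian_metric :: "('m, 'n::finite) chart set \<Rightarrow> ('m, 'n) tensor2 \<Rightarrow> bool" where
  "riemannian_metric A g \<longleftrightarrow>
     (\<forall>c\<in>A. smooth_on (chart_img c) (g c)) \<and>
     (\<forall>c\<in>A. \<forall>x\<in>chart_img c.
        transpose (g c x) = g c x \<and> (\<forall>v. v \<noteq> 0 \<longrightarrow> v \<bullet> (g c x *v v) > 0)) \<and>
     (\<forall>c\<in>A. \<forall>d\<in>A. \<forall>x\<in>chart_map c ` (chart_dom c \<inter> chart_dom d).
        let J = matrix (frechet_derivative (transition c d) (at x))
        in g c x = transpose J ** g d (transition c d x) ** J)"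

definition conformal_tensor ::
  "('m \<Rightarrow> real) \<Rightarrow> ('m, 'n::finite) tensor2 \<Rightarrow> ('m, 'n) tensor2" where
  "conformal_tensor f g = (\<lambda>c x. f (chart_inv c x) *\<^sub>R g c x)"

text \<open>A Borel measure satisfying this exists and is unique when \<open>A\<close> is a smooth atlas (the manifold is
  second countable) and \<open>g\<close> a Riemannian metric.\<close>

definition is_volume_measure ::
  "('m::topological_space, 'n::finite) chart set \<Rightarrow> ('m, 'n) tensor2 \<Rightarrow> 'm measure \<Rightarrow> bool" where
  "is_volume_measure A g \<mu> \<longleftrightarrow>
     sets \<mu> = sets borel \<and>
     (\<forall>c\<in>A. \<forall>E\<in>sets borel. E \<subseteq> chart_dom c \<longrightarrow>
        emeasure \<mu> E =
          (\<integral>\<^sup>+x. ennreal (sqrt (det (g c x))) * indicator (chart_map c ` E) x \<partial>lborel))"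

definition vol ::
  "('m::topological_space, 'n::finite) chart set \<Rightarrow> ('m, 'n) tensor2 \<Rightarrow> 'm measure" where
  "vol A g = (THE \<mu>. is_volume_measure A g \<mu>)"

definition unit_metric ::
  "('m::topological_space, 'n::finite) chart set \<Rightarrow> ('m, 'n) tensor2 \<Rightarrow> bool" where
  "unit_metric A g \<longleftrightarrow> riemannian_metric A g \<and> measure (vol A g) UNIV = 1"


section \<open>Curvature in coordinates\<close>

text \<open>Here \<open>G\<close> is the matrix function representing the metric in a coordinate domain.\<close>

definition partial :: "'n::finite \<Rightarrow> (real^'n \<Rightarrow> real) \<Rightarrow> real^'n \<Rightarrow> real" where
  "partial i f x = frechet_derivative f (at x) (axis i 1)"

definition ginv :: "real^'n^'n \<Rightarrow> 'n::finite \<Rightarrow> 'n \<Rightarrow> real" where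
  "ginv H i j = matrix_inv H $ i $ j"

text \<open>\<open>christoffel G k i j x\<close> is \<open>\<Gamma>\<^sup>k\<^sub>i\<^sub>j\<close>.\<close>

definition christoffel ::
  "(real^'n \<Rightarrow> real^'n^'n) \<Rightarrow> 'n::finite \<Rightarrow> 'n \<Rightarrow> 'n \<Rightarrow> real^'n \<Rightarrow> real" where
  "christoffel G k i j x =
     (1/2) * (\<Sum>l\<in>UNIV. ginv (G x) k l *
        (partial i (\<lambda>y. G y $ j $ l) x + partial j (\<lambda>y. G y $ i $ l) x
          - partial l (\<lambda>y. G y $ i $ j) x))"

text \<open>\<open>riem_up G l i j k x\<close> is the coefficient of \<open>\<partial>\<^sub>l\<close> in
  \<open>R(\<partial>\<^sub>i, \<partial>\<^sub>j)\<partial>\<^sub>k = \<nabla>\<^sub>i\<nabla>\<^sub>j\<partial>\<^sub>k - \<nabla>\<^sub>j\<nabla>\<^sub>i\<partial>\<^sub>k\<close>, and \<open>riem G i j k l\<close> is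
  \<open>\<langle>R(\<partial>\<^sub>i, \<partial>\<^sub>j)\<partial>\<^sub>k, \<partial>\<^sub>l\<rangle>\<close>; with this sign the sectional curvature of the plane spanned by
  \<open>X\<close> and \<open>Y\<close> has numerator \<open>\<langle>R(X,Y)Y, X\<rangle>\<close>.\<close>

definition riem_up ::
  "(real^'n \<Rightarrow> real^'n^'n) \<Rightarrow> 'n::finite \<Rightarrow> 'n \<Rightarrow> 'n \<Rightarrow> 'n \<Rightarrow> real^'n \<Rightarrow> real" where
  "riem_up G l i j k x =
     partial i (christoffel G l j k) x - partial j (christoffel G l i k) x
     + (\<Sum>m\<in>UNIV. christoffel G l i m x * christoffel G m j k x
                  - christoffel G l j m x * christoffel G m i k x)"

definition riem ::
  "(real^'n \<Rightarrow> real^'n^'n) \<Rightarrow> 'n::finite \<Rightarrow> 'n \<Rightarrow> 'n \<Rightarrow> 'n \<Rightarrow> real^'n \<Rightarrow> real" where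
  "riem G i j k l x = (\<Sum>m\<in>UNIV. G x $ l $ m * riem_up G m i j k x)"

definition ricci :: "(real^'n \<Rightarrow> real^'n^'n) \<Rightarrow> 'n::finite \<Rightarrow> 'n \<Rightarrow> real^'n \<Rightarrow> real" where
  "ricci G j k x = (\<Sum>i\<in>UNIV. riem_up G i i j k x)"

definition scalar_curv :: "(real^'n \<Rightarrow> real^'n^'n) \<Rightarrow> real^'n::finite \<Rightarrow> real" where
  "scalar_curv G x = (\<Sum>j\<in>UNIV. \<Sum>k\<in>UNIV. ginv (G x) j k * ricci G j k x)"

definition riem_sq :: "(real^'n \<Rightarrow> real^'n^'n) \<Rightarrow> real^'n::finite \<Rightarrow> real" where
  "riem_sq G x =
     (\<Sum>i\<in>UNIV. \<Sum>j\<in>UNIV. \<Sum>k\<in>UNIV. \<Sum>l\<in>UNIV. \<Sum>a\<in>UNIV. \<Sum>b\<in>UNIV. \<Sum>c\<in>UNIV. \<Sum>d\<in>UNIV.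
        riem G i j k l x * riem G a b c d x *
        (ginv (G x) i a * ginv (G x) j b * ginv (G x) k c * ginv (G x) l d))"

definition ricci_sq :: "(real^'n \<Rightarrow> real^'n^'n) \<Rightarrow> real^'n::finite \<Rightarrow> real" where
  "ricci_sq G x =
     (\<Sum>i\<in>UNIV. \<Sum>j\<in>UNIV. \<Sum>a\<in>UNIV. \<Sum>b\<in>UNIV.
        ricci G i j x * ricci G a b x * (ginv (G x) i a * ginv (G x) j b))"

definition sectional_curv ::
  "(real^'n \<Rightarrow> real^'n^'n) \<Rightarrow> real^'n::finite \<Rightarrow> real^'n \<Rightarrow> real^'n \<Rightarrow> real" where
  "sectional_curv G x X Y =
     (\<Sum>i\<in>UNIV. \<Sum>j\<in>UNIV. \<Sum>k\<in>UNIV. \<Sum>l\<in>UNIV. riem G i j k l x * X $ i * Y $ j * Y $ k * X $ l) /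
     ((X \<bullet> (G x *v X)) * (Y \<bullet> (G x *v Y)) - (X \<bullet> (G x *v Y))\<^sup>2)"

definition constant_sectional_curvature ::
  "('m, 'n::finite) chart set \<Rightarrow> ('m, 'n) tensor2 \<Rightarrow> real \<Rightarrow> bool" where
  "constant_sectional_curvature A g \<kappa> \<longleftrightarrow>
     (\<forall>c\<in>A. \<forall>x\<in>chart_img c. \<forall>X Y. X \<noteq> Y \<and> independent {X, Y} \<longrightarrow>
        sectional_curv (g c) x X Y = \<kappa>)"


section \<open>The functional and its second variation\<close>

text \<open>A scalar invariant \<open>q\<close> of a metric, evaluated at a point of the manifold. The three
  invariants used below do not depend on the chart chosen around \<open>p\<close>.\<close>

definition at_point ::
  "('m, 'n::finite) chart set \<Rightarrow> ((real^'n \<Rightarrow> real^'n^'n) \<Rightarrow> real^'n \<Rightarrow> real)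
     \<Rightarrow> ('m, 'n) tensor2 \<Rightarrow> 'm \<Rightarrow> real" where
  "at_point A q g p =
     (let c = (SOME c. c \<in> A \<and> p \<in> chart_dom c) in q (g c) (chart_map c p))"

definition curv_functional ::
  "('m::topological_space, 'n::finite) chart set \<Rightarrow> real \<Rightarrow> real \<Rightarrow> ('m, 'n) tensor2 \<Rightarrow> real" where
  "curv_functional A s \<tau> g =
     (LINT p|vol A g. at_point A riem_sq g p)
     + s * (LINT p|vol A g. at_point A ricci_sq g p)
     + \<tau> * (LINT p|vol A g. (at_point A scalar_curv g p)\<^sup>2)"

text \<open>Smooth curves of unit-volume metrics through \<open>g\<close> with initial velocity \<open>h\<close>, smoothness
  being joint smoothness of the components in time and the coordinates.\<close>

definition unit_metric_curve ::
  "('m::topological_space, 'n::finite) chart set \<Rightarrow> ('m, 'n) tensor2 \<Rightarrow> ('m, 'n) tensor2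
     \<Rightarrow> (real \<Rightarrow> ('m, 'n) tensor2) \<Rightarrow> bool" where
  "unit_metric_curve A g h \<gamma> \<longleftrightarrow>
     (\<exists>\<epsilon>>0. (\<forall>t\<in>{-\<epsilon><..<\<epsilon>}. unit_metric A (\<gamma> t)) \<and>
            (\<forall>c\<in>A. smooth_on ({-\<epsilon><..<\<epsilon>} \<times> chart_img c) (\<lambda>(t, x). \<gamma> t c x))) \<and>
     (\<forall>c\<in>A. \<forall>x\<in>chart_img c.
        \<gamma> 0 c x = g c x \<and> ((\<lambda>t. \<gamma> t c x) has_vector_derivative h c x) (at 0))"

definition has_second_derivative_at :: "(real \<Rightarrow> real) \<Rightarrow> real \<Rightarrow> real \<Rightarrow> bool" where
  "has_second_derivative_at \<phi> D t0 \<longleftrightarrow>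
     (\<exists>\<phi>'. (\<forall>\<^sub>F t in nhds t0. (\<phi> has_real_derivative \<phi>' t) (at t)) \<and>
           (\<phi>' has_real_derivative D) (at t0))"

text \<open>The second variation in direction \<open>h\<close> is the common second derivative along all admissible
  curves; requiring that such a curve exists makes its value unique.\<close>

definition has_second_variation ::
  "('m::topological_space, 'n::finite) chart set \<Rightarrow> real \<Rightarrow> real \<Rightarrow> ('m, 'n) tensor2
     \<Rightarrow> ('m, 'n) tensor2 \<Rightarrow> real \<Rightarrow> bool" where
  "has_second_variation A s \<tau> g h D \<longleftrightarrow>
     (\<exists>\<gamma>. unit_metric_curve A g h \<gamma>) \<and>
     (\<forall>\<gamma>. unit_metric_curve A g h \<gamma> \<longrightarrow>
        has_second_derivative_at (\<lambda>t. curv_functional A s \<tau> (\<gamma> t)) D 0)"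

end

theory Submission
  imports Defs
begin

text \<open>Since \<open>g\<close> is flat, \<open>Rm\<close>, \<open>Ric\<close> and \<open>R\<close> vanish at \<open>t = 0\<close>, so the second derivative of the
  integrand along a curve of metrics only involves the squares of their first variations. For the
  direction \<open>f g\<close> these are, with \<open>H\<close> the Hessian of \<open>f\<close>, the Kulkarni-Nomizu product
  \<open>- 1/2 (g \<and> H)\<close>, the tensor \<open>- 1/2 ((n - 2) H + (\<Delta> f) g)\<close> and \<open>- (n - 1) \<Delta> f\<close>. Integrating Bochner's
  formula gives \<open>\<integral> |H|\<^sup>2 = \<integral> (\<Delta> f)\<^sup>2\<close>, and the second variation becomes
  \<open>2 (n - 1) (1 + s n / 4 + \<tau> (n - 1)) \<integral> (\<Delta> f)\<^sup>2\<close>, whose coefficient is a positive multiple of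
  \<open>s + 4 \<tau> - (4 / n) (\<tau> - 1)\<close>.\<close>

section \<open>Calculus of smooth functions\<close>

text \<open>The second variation quantifies over all admissible curves, not only conformal ones, so
  the second-order behaviour of the curve is unknown. The value depends on \<open>f\<close> alone
  because each summand of the integrand is a product of two curvature components, both zero at
  \<open>t = 0\<close>, and a weight: its second derivative at \<open>0\<close> contains neither
  second derivatives of curvature nor derivatives of the weight. An admissible curve must also be
  exhibited, and there the condition \<open>\<integral> f = 0\<close> enters. The obstacles are
  global. \<open>vol\<close> is a definite description and \<open>at_point\<close> evaluates in a
  chosen chart, so existence and uniqueness of the volume measure and chart independence of the
  invariants have to be established. Two localisations serve the integrals. For differentiation in
  \<open>t\<close> the manifold is cut into disjoint Borel pieces inside compact coordinate balls,
  so that only integrals over fixed subsets of compact sets are differentiated. For Bochner's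
  formula a divergence has to integrate to zero; there a partition of unity is used, for which class
  \<open>C\<^sup>1\<close> suffices.\<close>

abbreviation sum_univ :: "('a \<Rightarrow> 'b::comm_monoid_add) \<Rightarrow> 'b" (binder "\<Oplus>" 10) where
  "sum_univ f \<equiv> sum f UNIV"

section \<open>The classes \<open>C\<^sup>k\<close> and smooth functions\<close>

lemma frechet_derivative_eqI:
  "(f has_derivative f') (at x) \<Longrightarrow> frechet_derivative f (at x) v = f' v"
  using frechet_derivative_at by metis

text \<open>\<open>frechet_derivative f (at x)\<close> looks at a full neighbourhood of
  \<open>x\<close>. Openness of \<open>S\<close> provides one inside \<open>S\<close>, so the
  directional derivatives of \<open>f\<close> and \<open>g\<close> agree on \<open>S\<close> and the
  induction continues with them.\<close>

lemma Ck_on_cong_imp: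
  assumes "open S" "\<And>x. x \<in> S \<Longrightarrow> f x = g x" "Ck_on k S f"
  shows "Ck_on k S g"
  using assms(2,3)
proof (induction k arbitrary: f g)
  case 0
  then show ?case using continuous_on_cong[of S S f g] by simp
next
  case (Suc k)
  have D: "(g has_derivative frechet_derivative f (at x)) (at x)" if "x \<in> S" for x
    using Suc.prems that \<open>open S\<close> 
    by (auto intro!: has_derivative_transform_within_open[of f _ x UNIV S g] simp: frechet_derivative_works)
  have eq: "frechet_derivative f (at x) v = frechet_derivative g (at x) v" if "x \<in> S" for x v
    using frechet_derivative_eqI[OF D[OF that]] by simp
  have "Ck_on k S (\<lambda>x. frechet_derivative g (at x) v)" for v
    by (rule Suc.IH[of "\<lambda>x. frechet_derivative f (at x) v"]) (use Suc.prems eq in auto)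
  then show ?case using D by (auto simp: differentiable_def)
qed

lemma Ck_on_cong:
  assumes "open S" "\<And>x. x \<in> S \<Longrightarrow> f x = g x"
  shows "Ck_on k S f \<longleftrightarrow> Ck_on k S g"
  using Ck_on_cong_imp[OF assms] Ck_on_cong_imp[OF assms(1), of g f] assms(2) by auto

lemma Ck_on_subset: "Ck_on k S f \<Longrightarrow> T \<subseteq> S \<Longrightarrow> Ck_on k T f"
  by (induction k arbitrary: f) (auto intro: continuous_on_subset)

lemma Ck_on_SucD: "Ck_on (Suc k) S f \<Longrightarrow> Ck_on k S f"
proof (induction k arbitrary: f)
  case 0
  then show ?case
    by (auto intro!: continuous_at_imp_continuous_on differentiable_imp_continuous_within)
next
  case (Suc k)
  then show ?case by (metis Ck_on.simps(2))
qed

lemma Ck_on_mono: "Ck_on k S f \<Longrightarrow> j \<le> k \<Longrightarrow> Ck_on j S f"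
  by (induction k) (auto simp: le_Suc_eq dest: Ck_on_SucD simp del: Ck_on.simps)

lemma Ck_on_imp_continuous_on: "Ck_on k S f \<Longrightarrow> continuous_on S f"
  using Ck_on_mono[of k S f 0] by simp

text \<open>Lets an explicit derivative \<open>f'\<close> be supplied in place of the one selected
  by \<open>frechet_derivative\<close>; the closure properties below rest on it.\<close>

lemma Ck_on_SucI:
  assumes "open S" "\<And>x. x \<in> S \<Longrightarrow> (f has_derivative f' x) (at x)" "\<And>v. Ck_on k S (\<lambda>x. f' x v)"
  shows "Ck_on (Suc k) S f"
proof -
  have "Ck_on k S (\<lambda>x. frechet_derivative f (at x) v)" for v
    by (rule Ck_on_cong_imp[OF assms(1) _ assms(3)[of v]]) (simp add: frechet_derivative_eqI[OF assms(2)])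
  then show ?thesis using assms(2) by (auto simp: differentiable_def)
qed

lemma Ck_on_Suc_has_derivative:
  "Ck_on (Suc k) S f \<Longrightarrow> x \<in> S \<Longrightarrow> (f has_derivative frechet_derivative f (at x)) (at x)"
  by (auto simp: frechet_derivative_works)

lemma Ck_on_const: "open S \<Longrightarrow> Ck_on k S (\<lambda>x. c)"
  by (induction k arbitrary: c) (auto intro: Ck_on_SucI has_derivative_const simp del: Ck_on.simps(2))

lemma Ck_on_add:
  assumes "open S" "Ck_on k S f" "Ck_on k S g"
  shows "Ck_on k S (\<lambda>x. f x + g x)"
  using assms(2,3)
proof (induction k arbitrary: f g)
  case 0 then show ?case by (auto intro: continuous_intros)
next
  case (Suc k)
  show ?case
    by (rule Ck_on_SucI[OF assms(1) has_derivative_add[OF Suc.prems[THEN Ck_on_Suc_has_derivative]]])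
       (use Suc in auto)
qed

lemma Ck_on_sum:
  assumes "open S" "\<And>i. i \<in> I \<Longrightarrow> Ck_on k S (f i)"
  shows "Ck_on k S (\<lambda>x. \<Sum>i\<in>I. f i x)"
  using assms(2)
  by (induction I rule: infinite_finite_induct) (auto intro!: Ck_on_const Ck_on_add assms(1))

lemma Ck_on_bounded_linear:
  assumes "open S" "bounded_linear L" "Ck_on k S f"
  shows "Ck_on k S (\<lambda>x. L (f x))"
  using assms(3)
proof (induction k arbitrary: f)
  case 0 then show ?case using assms(2) by (auto intro: bounded_linear.continuous_on)
next
  case (Suc k)
  show ?case
    by (rule Ck_on_SucI[OF assms(1) bounded_linear.has_derivative[OF assms(2) Ck_on_Suc_has_derivative[OF Suc.prems]]])
       (use Suc in auto)
qed

lemma Ck_on_linear: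
  assumes "open S" "bounded_linear L"
  shows "Ck_on k S L"
proof (cases k)
  case 0 then show ?thesis using assms linear_continuous_on by auto
next
  case (Suc m)
  then show ?thesis using assms
    by (auto intro!: Ck_on_SucI[OF assms(1) bounded_linear_imp_has_derivative] Ck_on_const simp del: Ck_on.simps)
qed

lemma Ck_on_bilinear:
  assumes "open S" "bounded_bilinear m" "Ck_on k S f" "Ck_on k S g"
  shows "Ck_on k S (\<lambda>x. m (f x) (g x))"
  using assms(3,4)
proof (induction k arbitrary: f g)
  case 0 then show ?case using assms(2) by (auto intro: bounded_bilinear.continuous_on)
next
  case (Suc k)
  have fg: "Ck_on k S f" "Ck_on k S g" using Suc.prems Ck_on_SucD by blast+
  show ?case
    by (rule Ck_on_SucI[OF assms(1) bounded_bilinear.FDERIV[OF assms(2) Suc.prems[THEN Ck_on_Suc_has_derivative]]])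
       (use Suc fg in \<open>auto intro!: Ck_on_add assms(1)\<close>)
qed

text \<open>\<open>Ck_on\<close> controls derivatives of \<open>f\<close> only in fixed directions,
  whereas the chain rule evaluates the derivative of \<open>f\<close> in the moving direction
  \<open>D\<phi>(x) v\<close>. Expanding that direction in the basis leaves sums of products of
  functions to which the induction hypothesis applies; hence the Euclidean intermediate
  space.\<close>

lemma Ck_on_compose:
  fixes \<phi> :: "'a::real_normed_vector \<Rightarrow> 'b::euclidean_space"
  assumes "open S" "open T" "\<phi> ` S \<subseteq> T" "Ck_on k S \<phi>" "Ck_on k T f"
  shows "Ck_on k S (\<lambda>x. f (\<phi> x))"
  using assms(4,5)
proof (induction k arbitrary: f)
  case 0 then show ?case using assms(3) by (auto intro: continuous_on_compose2)
next
  case (Suc k)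
  have fk: "Ck_on k S \<phi>" using Suc.prems Ck_on_SucD by blast
  have D: "((\<lambda>x. f (\<phi> x)) has_derivative
     (\<lambda>v. \<Sum>b\<in>Basis. (frechet_derivative \<phi> (at x) v \<bullet> b) *\<^sub>R frechet_derivative f (at (\<phi> x)) b)) (at x)"
    if x: "x \<in> S" for x
  proof -
    have 1: "(\<phi> has_derivative frechet_derivative \<phi> (at x)) (at x)"
      using Suc.prems(1) x by (rule Ck_on_Suc_has_derivative)
    have 2: "(f has_derivative frechet_derivative f (at (\<phi> x))) (at (\<phi> x))"
      using Suc.prems(2) x assms(3) by (auto intro: Ck_on_Suc_has_derivative simp del: Ck_on.simps)
    have L: "linear (frechet_derivative f (at (\<phi> x)))"
      using 2 has_derivative_linear by blast
    have "frechet_derivative f (at (\<phi> x)) w = (\<Sum>b\<in>Basis. (w \<bullet> b) *\<^sub>R frechet_derivative f (at (\<phi> x)) b)" for w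
    proof -
      have "frechet_derivative f (at (\<phi> x)) w = frechet_derivative f (at (\<phi> x)) (\<Sum>b\<in>Basis. (w \<bullet> b) *\<^sub>R b)"
        by (simp add: euclidean_representation)
      then show ?thesis by (simp add: linear_sum[OF L] linear_cmul[OF L])
    qed
    then show ?thesis
      by (intro has_derivative_eq_rhs[OF has_derivative_compose[OF 1 2]] ext)
  qed
  show ?case
    by (rule Ck_on_SucI[OF assms(1) D]; (assumption)?)
       (intro Ck_on_sum assms(1) Ck_on_bilinear[OF assms(1) bounded_bilinear_scaleR]
          Ck_on_bounded_linear[OF assms(1) bounded_linear_inner_left] Suc.IH[OF fk]; use Suc.prems in auto)
qed

text \<open>The derivative of a power is a multiple of a power, so the induction runs over all
  exponents at once. Square roots, reciprocals and the conformal factor with exponent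
  \<open>2 / n\<close> are all instances.\<close>

lemma Ck_on_powr: "Ck_on k {0<..} (\<lambda>x::real. x powr a)"
proof (induction k arbitrary: a)
  case 0 then show ?case by (auto intro!: continuous_intros)
next
  case (Suc k)
  have D: "((\<lambda>x. x powr a) has_derivative (\<lambda>v. v * (a * x powr (a - 1)))) (at x)" if "x \<in> {0<..}" for x :: real
    using has_real_derivative_powr[of x a] that
    unfolding has_field_derivative_def by (auto elim!: has_derivative_eq_rhs intro!: ext)
  show ?case
    by (rule Ck_on_SucI[OF _ D])
       (auto intro!: Ck_on_bilinear[OF _ bounded_bilinear_mult] Ck_on_const Suc.IH)
qed

lemma smooth_onD: "smooth_on S f \<Longrightarrow> Ck_on k S f"
  by (simp add: smooth_on_def)

lemma smooth_on_imp_continuous_on: "smooth_on S f \<Longrightarrow> continuous_on S f"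
  by (rule Ck_on_imp_continuous_on[OF smooth_onD[of S f 0]])

lemma smooth_on_has_derivative:
  "smooth_on S f \<Longrightarrow> x \<in> S \<Longrightarrow> (f has_derivative frechet_derivative f (at x)) (at x)"
  by (rule Ck_on_Suc_has_derivative[OF smooth_onD])

lemma smooth_on_differentiable: "smooth_on S f \<Longrightarrow> x \<in> S \<Longrightarrow> f differentiable (at x)"
  unfolding differentiable_def using smooth_on_has_derivative[of S f x] by blast

lemma smooth_on_cong:
  "open S \<Longrightarrow> (\<And>x. x \<in> S \<Longrightarrow> f x = g x) \<Longrightarrow> smooth_on S f \<longleftrightarrow> smooth_on S g"
  using Ck_on_cong[of S f g] by (auto simp: smooth_on_def)

lemma smooth_on_subset: "smooth_on S f \<Longrightarrow> T \<subseteq> S \<Longrightarrow> smooth_on T f"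
  using Ck_on_subset[of _ S f T] by (auto simp: smooth_on_def)

lemma smooth_on_const: "open S \<Longrightarrow> smooth_on S (\<lambda>x. c)"
  by (simp add: smooth_on_def Ck_on_const)

lemma smooth_on_add: "open S \<Longrightarrow> smooth_on S f \<Longrightarrow> smooth_on S g \<Longrightarrow> smooth_on S (\<lambda>x. f x + g x)"
  by (simp add: smooth_on_def Ck_on_add)

lemma smooth_on_sum: "open S \<Longrightarrow> (\<And>i. i \<in> I \<Longrightarrow> smooth_on S (f i)) \<Longrightarrow> smooth_on S (\<lambda>x. \<Sum>i\<in>I. f i x)"
  by (simp add: smooth_on_def Ck_on_sum)

lemma smooth_on_bounded_linear:
  "open S \<Longrightarrow> bounded_linear L \<Longrightarrow> smooth_on S f \<Longrightarrow> smooth_on S (\<lambda>x. L (f x))"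
  by (simp add: smooth_on_def Ck_on_bounded_linear)

lemma smooth_on_linear: "open S \<Longrightarrow> bounded_linear L \<Longrightarrow> smooth_on S L"
  by (simp add: smooth_on_def Ck_on_linear)

lemma smooth_on_mult:
  fixes f g :: "'a::real_normed_vector \<Rightarrow> real"
  shows "open S \<Longrightarrow> smooth_on S f \<Longrightarrow> smooth_on S g \<Longrightarrow> smooth_on S (\<lambda>x. f x * g x)"
  by (simp add: smooth_on_def Ck_on_bilinear[OF _ bounded_bilinear_mult])

lemma smooth_on_scaleR:
  "open S \<Longrightarrow> smooth_on S f \<Longrightarrow> smooth_on S g \<Longrightarrow> smooth_on S (\<lambda>x. f x *\<^sub>R g x)"
  by (simp add: smooth_on_def Ck_on_bilinear[OF _ bounded_bilinear_scaleR])

lemma smooth_on_uminus: "open S \<Longrightarrow> smooth_on S f \<Longrightarrow> smooth_on S (\<lambda>x. - f x)"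
  by (rule smooth_on_bounded_linear[OF _ bounded_linear_minus[OF bounded_linear_ident]])

lemma smooth_on_diff: "open S \<Longrightarrow> smooth_on S f \<Longrightarrow> smooth_on S g \<Longrightarrow> smooth_on S (\<lambda>x. f x - g x)"
  using smooth_on_add[of S f "\<lambda>x. - g x"] smooth_on_uminus[of S g] by simp

lemma smooth_on_power:
  fixes f :: "'a::real_normed_vector \<Rightarrow> real"
  shows "open S \<Longrightarrow> smooth_on S f \<Longrightarrow> smooth_on S (\<lambda>x. f x ^ k)"
  by (induction k) (auto intro: smooth_on_const smooth_on_mult)

lemma smooth_on_prod:
  fixes f :: "'i \<Rightarrow> 'a::real_normed_vector \<Rightarrow> real"
  assumes "open S" "\<And>i. i \<in> I \<Longrightarrow> smooth_on S (f i)"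
  shows "smooth_on S (\<lambda>x. \<Prod>i\<in>I. f i x)"
  using assms(2)
  by (induction I rule: infinite_finite_induct) (auto intro!: smooth_on_const smooth_on_mult assms(1))

lemma smooth_on_compose:
  fixes \<phi> :: "'a::real_normed_vector \<Rightarrow> 'b::euclidean_space"
  shows "open S \<Longrightarrow> open T \<Longrightarrow> \<phi> ` S \<subseteq> T \<Longrightarrow> smooth_on S \<phi> \<Longrightarrow> smooth_on T f \<Longrightarrow> smooth_on S (\<lambda>x. f (\<phi> x))"
  using Ck_on_compose[of S T \<phi> _ f] by (auto simp: smooth_on_def)

lemma smooth_on_powr:
  fixes f :: "'a::real_normed_vector \<Rightarrow> real"
  assumes "open S" "smooth_on S f" "\<And>x. x \<in> S \<Longrightarrow> f x > 0"
  shows "smooth_on S (\<lambda>x. f x powr a)"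
  by (rule smooth_on_compose[OF assms(1) open_greaterThan _ assms(2)])
     (use assms(3) Ck_on_powr in \<open>auto simp: smooth_on_def\<close>)

lemma smooth_on_sqrt:
  fixes f :: "'a::real_normed_vector \<Rightarrow> real"
  assumes "open S" "smooth_on S f" "\<And>x. x \<in> S \<Longrightarrow> f x > 0"
  shows "smooth_on S (\<lambda>x. sqrt (f x))"
proof -
  have "smooth_on S (\<lambda>x. sqrt (f x)) \<longleftrightarrow> smooth_on S (\<lambda>x. f x powr (1/2))"
    by (rule smooth_on_cong[OF assms(1)]) (simp add: powr_half_sqrt assms(3) less_imp_le)
  then show ?thesis using smooth_on_powr[OF assms] by simp
qed

lemma smooth_on_inverse:
  fixes f :: "'a::real_normed_vector \<Rightarrow> real"
  assumes "open S" "smooth_on S f" "\<And>x. x \<in> S \<Longrightarrow> f x > 0"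
  shows "smooth_on S (\<lambda>x. inverse (f x))"
proof -
  have "smooth_on S (\<lambda>x. inverse (f x)) \<longleftrightarrow> smooth_on S (\<lambda>x. f x powr (-1))"
    by (rule smooth_on_cong[OF assms(1)]) (use assms(3) in \<open>simp add: powr_minus less_imp_le powr_one\<close>)
  then show ?thesis using smooth_on_powr[OF assms, of "-1"] by blast
qed

lemma smooth_on_vec_nth: "open S \<Longrightarrow> smooth_on S f \<Longrightarrow> smooth_on S (\<lambda>x. f x $ i)"
  by (rule smooth_on_bounded_linear[OF _ bounded_linear_vec_nth])

lemmas smooth_on_intros =
  smooth_on_const smooth_on_add smooth_on_diff smooth_on_uminus smooth_on_mult smooth_on_sum
  smooth_on_prod smooth_on_power smooth_on_vec_nth smooth_on_scaleR

lemma smooth_on_frechet_derivative: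
  "smooth_on S f \<Longrightarrow> smooth_on S (\<lambda>x. frechet_derivative f (at x) v)"
  unfolding smooth_on_def[of S "\<lambda>x. frechet_derivative f (at x) v"]
proof
  fix k assume "smooth_on S f"
  then have "Ck_on (Suc k) S f" by (rule smooth_onD)
  then show "Ck_on k S (\<lambda>x. frechet_derivative f (at x) v)" by simp
qed

lemma smooth_on_partial: "smooth_on S f \<Longrightarrow> smooth_on S (partial i f)"
  using smooth_on_frechet_derivative[of S f "axis i 1"] by (simp add: partial_def[abs_def])

lemma smooth_on_slice:
  fixes F :: "real \<Rightarrow> 'a::euclidean_space \<Rightarrow> 'b::real_normed_vector"
  assumes "open T" "open U" "smooth_on (T \<times> U) (\<lambda>p. F (fst p) (snd p))" "t \<in> T"
  shows "smooth_on U (F t)"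
proof -
  have "smooth_on U (\<lambda>x. (t, x))"
  proof -
    have "smooth_on U (\<lambda>x::'a. (t, 0::'a) + (0, x))"
      by (rule smooth_on_add[OF assms(2) smooth_on_const[OF assms(2)] smooth_on_linear[OF assms(2)]]) 
         (intro bounded_linear_Pair bounded_linear_zero bounded_linear_ident)
    then show ?thesis by simp
  qed
  then have "smooth_on U (\<lambda>x. F (fst (t, x)) (snd (t, x)))"
    by (intro smooth_on_compose[where \<phi>="Pair t" and S=U and T="T \<times> U", OF assms(2) open_Times[OF assms(1,2)] _ _ assms(3)])
       (use assms(4) in auto)
  then show ?thesis by simp
qed

section \<open>Time derivatives of families\<close>

definition tder :: "(real \<Rightarrow> 'a \<Rightarrow> real) \<Rightarrow> real \<Rightarrow> 'a \<Rightarrow> real" where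
  "tder F t x = deriv (\<lambda>s. F s x) t"

text \<open>Time derivatives become directional derivatives of the joint function of
  \<open>(t, x)\<close>, and \<open>partial_joint\<close> does the same in space. Smoothness and
  commutation of both are then inherited from \<open>frechet_derivative\<close>.\<close>

lemma tder_joint:
  fixes F :: "real \<Rightarrow> 'a::euclidean_space \<Rightarrow> real"
  assumes "open T" "open U" "Ck_on (Suc k) (T \<times> U) (\<lambda>p. F (fst p) (snd p))" "t \<in> T" "x \<in> U"
  shows "((\<lambda>s. F s x) has_real_derivative tder F t x) (at t)"
    and "tder F t x = frechet_derivative (\<lambda>p. F (fst p) (snd p)) (at (t, x)) (1, 0)"
proof -
  let ?D = "frechet_derivative (\<lambda>p. F (fst p) (snd p)) (at (t, x))"
  have D: "((\<lambda>p. F (fst p) (snd p)) has_derivative ?D) (at (t, x))"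
    using assms(4,5) by (intro Ck_on_Suc_has_derivative[OF assms(3)]) auto
  have "((\<lambda>s. (s, x)) has_derivative (\<lambda>s. (s, 0))) (at t)"
    by (auto intro!: derivative_eq_intros)
  from has_derivative_compose[OF this D]
  have *: "((\<lambda>s. F s x) has_derivative (\<lambda>s. ?D (s, 0))) (at t)" by simp
  have "?D (s, 0) = ?D (1, 0) * s" for s
    using linear_cmul[OF has_derivative_linear[OF D], of s "(1, 0)"] by (simp add: mult.commute)
  then have "((\<lambda>s. F s x) has_real_derivative ?D (1, 0)) (at t)"
    unfolding has_field_derivative_def by (intro has_derivative_eq_rhs[OF *] ext)
  with DERIV_imp_deriv[OF this]
  show "((\<lambda>s. F s x) has_real_derivative tder F t x) (at t)" "tder F t x = ?D (1, 0)"
    by (auto simp: tder_def)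
qed

lemma partial_joint:
  fixes F :: "real \<Rightarrow> real^'n::finite \<Rightarrow> real"
  assumes "open T" "open U" "Ck_on (Suc k) (T \<times> U) (\<lambda>p. F (fst p) (snd p))" "t \<in> T" "x \<in> U"
  shows "partial i (F t) x = frechet_derivative (\<lambda>p. F (fst p) (snd p)) (at (t, x)) (0, axis i 1)"
proof -
  let ?D = "frechet_derivative (\<lambda>p. F (fst p) (snd p)) (at (t, x))"
  have D: "((\<lambda>p. F (fst p) (snd p)) has_derivative ?D) (at (t, x))"
    using assms(4,5) by (intro Ck_on_Suc_has_derivative[OF assms(3)]) auto
  have "((\<lambda>y. (t, y)) has_derivative (\<lambda>y. (0, y))) (at x)"
    by (auto intro!: derivative_eq_intros)
  from has_derivative_compose[OF this D]
  have *: "(F t has_derivative (\<lambda>y. ?D (0, y))) (at x)" by simp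
  show ?thesis unfolding partial_def using frechet_derivative_eqI[OF *] by simp
qed

lemma smooth_on_tder:
  fixes F :: "real \<Rightarrow> 'a::euclidean_space \<Rightarrow> real"
  assumes "open T" "open U" "smooth_on (T \<times> U) (\<lambda>p. F (fst p) (snd p))"
  shows "smooth_on (T \<times> U) (\<lambda>p. tder F (fst p) (snd p))"
proof -
  have "smooth_on (T \<times> U) (\<lambda>p. tder F (fst p) (snd p)) \<longleftrightarrow>
     smooth_on (T \<times> U) (\<lambda>p. frechet_derivative (\<lambda>p. F (fst p) (snd p)) (at p) (1, 0))"
    by (rule smooth_on_cong) (auto intro!: open_Times tder_joint[OF assms(1,2) smooth_onD] assms)
  then show ?thesis using smooth_on_frechet_derivative[OF assms(3)] by simp
qed

lemma smooth_on_partial_joint: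
  fixes F :: "real \<Rightarrow> real^'n::finite \<Rightarrow> real"
  assumes "open T" "open U" "smooth_on (T \<times> U) (\<lambda>p. F (fst p) (snd p))"
  shows "smooth_on (T \<times> U) (\<lambda>p. partial i (F (fst p)) (snd p))"
proof -
  have "smooth_on (T \<times> U) (\<lambda>p. partial i (F (fst p)) (snd p)) \<longleftrightarrow>
     smooth_on (T \<times> U) (\<lambda>p. frechet_derivative (\<lambda>p. F (fst p) (snd p)) (at p) (0, axis i 1))"
    by (rule smooth_on_cong) (auto intro!: open_Times partial_joint[OF assms(1,2) smooth_onD] assms)
  then show ?thesis using smooth_on_frechet_derivative[OF assms(3)] by simp
qed

text \<open>Meant for functions glued from a chart expression and zero, such as cut-off functions,
  whose regularity is known on each member of an open cover.\<close>

lemma Ck_on_local: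
  assumes "\<And>x. x \<in> S \<Longrightarrow> \<exists>N. open N \<and> x \<in> N \<and> Ck_on k N f"
  shows "Ck_on k S f"
  using assms
proof (induction k arbitrary: f)
  case 0
  show ?case unfolding Ck_on.simps
  proof (rule continuous_at_imp_continuous_on, intro ballI)
    fix x assume "x \<in> S"
    from 0[OF this] show "isCont f x"
      using continuous_on_eq_continuous_at by auto
  qed
next
  case (Suc k)
  have "Ck_on k S (\<lambda>x. frechet_derivative f (at x) v)" for v
  proof (rule Suc.IH)
    fix x assume "x \<in> S"
    from Suc.prems[OF this] show "\<exists>N. open N \<and> x \<in> N \<and> Ck_on k N (\<lambda>x. frechet_derivative f (at x) v)"
      by auto
  qed
  then show ?case using Suc.prems by fastforce
qed

text \<open>The second difference is the increment in direction \<open>v\<close> of the increment of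
  \<open>f\<close> in direction \<open>w\<close>. One application of the mean value theorem along
  each direction turns it into \<open>h\<^sup>2\<close> times a mixed derivative at an intermediate
  point.\<close>

lemma second_difference_mean_value:
  fixes f :: "'a::real_normed_vector \<Rightarrow> real"
  assumes B: "ball x \<delta> \<subseteq> S" and h: "h > 0" "h * (norm v + norm w) < \<delta>"
    and f: "\<And>y. y \<in> S \<Longrightarrow> (f has_derivative frechet_derivative f (at y)) (at y)"
    and A: "\<And>y. y \<in> S \<Longrightarrow> ((\<lambda>y. frechet_derivative f (at y) v) has_derivative A y) (at y)"
  shows "\<exists>p\<in>ball x \<delta>. f (x + h *\<^sub>R v + h *\<^sub>R w) - f (x + h *\<^sub>R v) - f (x + h *\<^sub>R w) + f x = h * (h * A p w)"
proof -
  have in_ball: "x + s *\<^sub>R v + t *\<^sub>R w \<in> ball x \<delta>" if "0 \<le> s" "s \<le> h" "0 \<le> t" "t \<le> h" for s t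
  proof -
    have "norm (s *\<^sub>R v + t *\<^sub>R w) \<le> h * norm v + h * norm w"
      using that by (intro norm_triangle_le add_mono) (auto intro: mult_right_mono)
    also have "\<dots> < \<delta>" using h by (simp add: algebra_simps)
    finally show ?thesis
      using norm_minus_cancel[of "s *\<^sub>R v + t *\<^sub>R w"] by (simp add: dist_norm add.assoc)
  qed
  have line: "((\<lambda>s. f (a + s *\<^sub>R u)) has_real_derivative frechet_derivative f (at (a + s *\<^sub>R u)) u) (at s)"
    if "a + s *\<^sub>R u \<in> S" for a s u
  proof -
    have "((\<lambda>s. a + s *\<^sub>R u) has_derivative (\<lambda>r. r *\<^sub>R u)) (at s)" by (auto intro!: derivative_eq_intros)
    from has_derivative_compose[OF this f[OF that]]
    show ?thesis
      by (rule has_derivative_imp_has_field_derivative) 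
         (simp add: linear_cmul[OF has_derivative_linear[OF f[OF that]]])
  qed
  \<comment> \<open>The derivative in \<open>s\<close> of the increment in direction
    \<open>w\<close>; at the intermediate parameter \<open>\<xi>\<close> it is itself an increment,
    to which the second mean value theorem applies.\<close>
  define D where "D s = frechet_derivative f (at (x + h *\<^sub>R w + s *\<^sub>R v)) v - frechet_derivative f (at (x + s *\<^sub>R v)) v" for s
  have "\<exists>z>0. z < h \<and> (f (x + h *\<^sub>R w + h *\<^sub>R v) - f (x + h *\<^sub>R v)) - (f (x + h *\<^sub>R w + 0 *\<^sub>R v) - f (x + 0 *\<^sub>R v)) = (h - 0) * D z"
  proof (rule MVT2[OF h(1)])
    fix s assume s: "0 \<le> s" "s \<le> h"
    have "x + h *\<^sub>R w + s *\<^sub>R v \<in> S" "x + s *\<^sub>R v \<in> S"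
      using in_ball[OF s, of h] in_ball[OF s, of 0] h B by (auto simp: algebra_simps)
    from DERIV_diff[OF this[THEN line]]
    show "((\<lambda>s. f (x + h *\<^sub>R w + s *\<^sub>R v) - f (x + s *\<^sub>R v)) has_real_derivative D s) (at s)"
      unfolding D_def .
  qed
  then obtain \<xi> where \<xi>: "0 < \<xi>" "\<xi> < h"
    and 1: "f (x + h *\<^sub>R w + h *\<^sub>R v) - f (x + h *\<^sub>R v) - (f (x + h *\<^sub>R w) - f x) = h * D \<xi>" by auto
  have "\<exists>z>0. z < h \<and> frechet_derivative f (at (x + \<xi> *\<^sub>R v + h *\<^sub>R w)) v - frechet_derivative f (at (x + \<xi> *\<^sub>R v + 0 *\<^sub>R w)) v
      = (h - 0) * A (x + \<xi> *\<^sub>R v + z *\<^sub>R w) w"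
  proof (rule MVT2[OF h(1)])
    fix t assume t: "0 \<le> t" "t \<le> h"
    have S: "x + \<xi> *\<^sub>R v + t *\<^sub>R w \<in> S" using in_ball[of \<xi> t] \<xi> t B by auto
    have "((\<lambda>t. x + \<xi> *\<^sub>R v + t *\<^sub>R w) has_derivative (\<lambda>r. r *\<^sub>R w)) (at t)" by (auto intro!: derivative_eq_intros)
    from has_derivative_compose[OF this A[OF S]]
    show "((\<lambda>t. frechet_derivative f (at (x + \<xi> *\<^sub>R v + t *\<^sub>R w)) v) has_real_derivative A (x + \<xi> *\<^sub>R v + t *\<^sub>R w) w) (at t)"
      by (rule has_derivative_imp_has_field_derivative)
         (simp add: linear_cmul[OF has_derivative_linear[OF A[OF S]]])
  qed
  then obtain \<eta> where \<eta>: "0 < \<eta>" "\<eta> < h" and 2: "D \<xi> = h * A (x + \<xi> *\<^sub>R v + \<eta> *\<^sub>R w) w"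
    by (auto simp: D_def algebra_simps)
  show ?thesis
    by (rule bexI[of _ "x + \<xi> *\<^sub>R v + \<eta> *\<^sub>R w"]) (use 1 2 in_ball[of \<xi> \<eta>] \<xi> \<eta> in \<open>auto simp: algebra_simps\<close>)
qed

text \<open>Schwarz's theorem. The second difference is symmetric in \<open>v\<close> and
  \<open>w\<close>, so the two mixed derivatives take a common value at two points of any small ball
  around \<open>x\<close>; continuity at \<open>x\<close> forces equality there.\<close>

lemma frechet_derivative_commute:
  fixes f :: "'a::real_normed_vector \<Rightarrow> real"
  assumes "open S" "x \<in> S" "Ck_on (Suc (Suc 0)) S f"
  shows "frechet_derivative (\<lambda>y. frechet_derivative f (at y) v) (at x) w =
         frechet_derivative (\<lambda>y. frechet_derivative f (at y) w) (at x) v"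
proof -
  define A where "A v y = frechet_derivative (\<lambda>y. frechet_derivative f (at y) v) (at y)" for v y
  have f: "(f has_derivative frechet_derivative f (at y)) (at y)" if "y \<in> S" for y
    using Ck_on_Suc_has_derivative[OF assms(3) that] .
  have C1: "Ck_on (Suc 0) S (\<lambda>y. frechet_derivative f (at y) v)" for v
    using assms(3) Ck_on.simps(2) by blast
  have A: "((\<lambda>y. frechet_derivative f (at y) v) has_derivative A v y) (at y)" if "y \<in> S" for y v
    unfolding A_def using Ck_on_Suc_has_derivative[OF C1 that] .
  have cont: "isCont (\<lambda>y. A v y w) x" for v w
  proof -
    have "continuous_on S (\<lambda>y. A v y w)" unfolding A_def using C1[of v] by auto
    then show ?thesis using assms(1,2) continuous_on_eq_continuous_at by blast
  qed
  have "\<bar>A v x w - A w x v\<bar> < 2 * e" if "e > 0" for e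
  proof -
    obtain d1 where d1: "d1 > 0" "\<And>y. dist y x < d1 \<Longrightarrow> dist (A v y w) (A v x w) < e"
      using cont[of v w] \<open>e > 0\<close> unfolding continuous_at_eps_delta by meson
    obtain d2 where d2: "d2 > 0" "\<And>y. dist y x < d2 \<Longrightarrow> dist (A w y v) (A w x v) < e"
      using cont[of w v] \<open>e > 0\<close> unfolding continuous_at_eps_delta by meson
    obtain d3 where d3: "d3 > 0" "ball x d3 \<subseteq> S" using assms(1,2) open_contains_ball by blast
    define d where "d = min d1 (min d2 d3)"
    have d: "d > 0" "ball x d \<subseteq> S" using d1(1) d2(1) d3 by (auto simp: d_def)
    \<comment> \<open>The summand \<open>1\<close> keeps the denominator positive when both
      directions vanish and makes the bound \<open>h * (norm v + norm w) < d\<close> strict.\<close>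
    define h where "h = d / (norm v + norm w + 1)"
    have n: "norm v + norm w + 1 > 0" using norm_ge_zero[of v] norm_ge_zero[of w] by linarith
    have "h * (norm v + norm w) < h * (norm v + norm w + 1)"
      using d n by (intro mult_strict_left_mono) (auto simp: h_def)
    then have h: "h > 0" "h * (norm v + norm w) < d" "h * (norm w + norm v) < d" 
      using d n by (auto simp: h_def field_simps)
    obtain p where p: "p \<in> ball x d" "f (x + h *\<^sub>R v + h *\<^sub>R w) - f (x + h *\<^sub>R v) - f (x + h *\<^sub>R w) + f x = h * (h * A v p w)"
      using second_difference_mean_value[OF d(2) h(1,2) f A] by blast
    obtain q where q: "q \<in> ball x d" "f (x + h *\<^sub>R w + h *\<^sub>R v) - f (x + h *\<^sub>R w) - f (x + h *\<^sub>R v) + f x = h * (h * A w q v)"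
      using second_difference_mean_value[OF d(2) h(1,3) f A] by blast
    have "h * (h * A v p w) = h * (h * A w q v)" using p(2) q(2) by (simp add: algebra_simps)
    then have eq: "A v p w = A w q v" using h(1) by simp
    have "dist (A v p w) (A v x w) < e" using d1(2)[of p] p(1) by (auto simp: d_def dist_commute)
    moreover have "dist (A w q v) (A w x v) < e" using d2(2)[of q] q(1) by (auto simp: d_def dist_commute)
    ultimately show ?thesis using eq by (auto simp: dist_real_def)
  qed
  from this[of "\<bar>A v x w - A w x v\<bar> / 2"] have "A v x w = A w x v" by auto
  then show ?thesis by (simp add: A_def)
qed

lemma partial_commute:
  assumes "open U" "smooth_on U f" "x \<in> U"
  shows "partial i (partial j f) x = partial j (partial i f) x"
  unfolding partial_def[abs_def]
  by (rule frechet_derivative_commute[OF assms(1,3) smooth_onD[OF assms(2)]])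

text \<open>Both sides are mixed directional derivatives of the joint function, in the directions
  \<open>(1, 0)\<close> and \<open>(0, axis i 1)\<close>.\<close>

lemma tder_partial_commute:
  fixes F :: "real \<Rightarrow> real^'n::finite \<Rightarrow> real"
  assumes "open T" "open U" "smooth_on (T \<times> U) (\<lambda>p. F (fst p) (snd p))" "t \<in> T" "x \<in> U"
  shows "tder (\<lambda>t. partial i (F t)) t x = partial i (tder F t) x"
proof -
  let ?F = "\<lambda>p. F (fst p) (snd p)"
  have op: "open (T \<times> U)" "(t, x) \<in> T \<times> U" using assms by (auto intro: open_Times)
  have "tder (\<lambda>t. partial i (F t)) t x
    = frechet_derivative (\<lambda>p. partial i (F (fst p)) (snd p)) (at (t, x)) (1, 0)"
    by (rule tder_joint[OF assms(1,2) smooth_onD[OF smooth_on_partial_joint[OF assms(1-3)]] assms(4,5)])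
  also have "\<dots> = frechet_derivative (\<lambda>p. frechet_derivative ?F (at p) (0, axis i 1)) (at (t, x)) (1, 0)"
    by (intro fun_cong[OF frechet_derivative_transform_within_open[OF _ op]]
        smooth_on_differentiable[OF smooth_on_partial_joint[OF assms(1-3)] op(2)])
      (auto intro!: partial_joint[OF assms(1,2) smooth_onD[OF assms(3)]])
  also have "\<dots> = frechet_derivative (\<lambda>p. frechet_derivative ?F (at p) (1, 0)) (at (t, x)) (0, axis i 1)"
    by (rule frechet_derivative_commute[OF op smooth_onD[OF assms(3)]])
  also have "\<dots> = frechet_derivative (\<lambda>p. tder F (fst p) (snd p)) (at (t, x)) (0, axis i 1)"
    by (intro fun_cong[OF frechet_derivative_transform_within_open[OF _ op]]
        smooth_on_differentiable[OF smooth_on_frechet_derivative[OF assms(3)] op(2)])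
      (auto intro!: tder_joint(2)[OF assms(1,2) smooth_onD[OF assms(3)], symmetric])
  also have "\<dots> = partial i (tder F t) x"
    by (rule partial_joint[OF assms(1,2) smooth_onD[OF smooth_on_tder[OF assms(1-3)]] assms(4,5), symmetric])
  finally show ?thesis .
qed

section \<open>Differentiation under the integral and integrals of partial derivatives\<close>

lemma set_integrable_continuous_compact:
  fixes f :: "'a::euclidean_space \<Rightarrow> real"
  assumes "compact K" "continuous_on K f" "E \<in> sets lborel" "E \<subseteq> K"
  shows "set_integrable lborel E f"
  by (rule set_integrable_subset[OF _ assms(3,4)])
     (use borel_integrable_compact[OF assms(1,2)] in \<open>simp add: set_integrable_def\<close>)

text \<open>The time derivative is uniformly continuous on a compact time interval times
  \<open>K\<close>, so the difference quotients converge uniformly on \<open>E\<close>, and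
  \<open>E\<close> has finite measure.\<close>

lemma leibniz_rule_compact:
  fixes I :: "real \<Rightarrow> 'a::euclidean_space \<Rightarrow> real"
  assumes "open T" "open U" "Ck_on (Suc 0) (T \<times> U) (\<lambda>p. I (fst p) (snd p))"
    and K: "compact K" "K \<subseteq> U" "E \<in> sets lborel" "E \<subseteq> K" and "t \<in> T"
  shows "((\<lambda>t. LINT x:E|lborel. I t x) has_real_derivative (LINT x:E|lborel. tder I t x)) (at t)"
proof -
  have der: "((\<lambda>s. I s x) has_real_derivative tder I s x) (at s)" if "s \<in> T" "x \<in> U" for s x
    by (rule tder_joint[OF assms(1-3) that])
  have opTU: "open (T \<times> U)" using assms by (auto intro: open_Times)
  have contI: "continuous_on (T \<times> U) (\<lambda>p. I (fst p) (snd p))"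
    using Ck_on_imp_continuous_on[OF assms(3)] .
  have "Ck_on 0 (T \<times> U) (\<lambda>p. frechet_derivative (\<lambda>p. I (fst p) (snd p)) (at p) (1, 0))"
    using assms(3) by auto
  moreover have "tder I (fst p) (snd p) = frechet_derivative (\<lambda>p. I (fst p) (snd p)) (at p) (1, 0)"
    if "p \<in> T \<times> U" for p
    using tder_joint(2)[OF assms(1-3), of "fst p" "snd p"] that by auto
  ultimately have contD: "continuous_on (T \<times> U) (\<lambda>p. tder I (fst p) (snd p))"
    using continuous_on_cong[OF refl, of "T \<times> U" "\<lambda>p. tder I (fst p) (snd p)"] by auto
  have slice: "set_integrable lborel E (I s)" "set_integrable lborel E (tder I s)" if "s \<in> T" for s
  proof -
    have "continuous_on K (\<lambda>x. (s, x))" "(\<lambda>x. (s, x)) ` K \<subseteq> T \<times> U"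
      using that K by (auto intro!: continuous_intros)
    from continuous_on_compose2[OF contI this] continuous_on_compose2[OF contD this]
    show "set_integrable lborel E (I s)" "set_integrable lborel E (tder I s)"
      by (auto intro!: set_integrable_continuous_compact[OF K(1) _ K(3,4)])
  qed
  obtain r where r: "r > 0" "cball t r \<subseteq> T" using assms(1,8) open_contains_cball by blast
  have "compact (cball t r \<times> K)" using K by (intro compact_Times compact_cball)
  then have uc: "uniformly_continuous_on (cball t r \<times> K) (\<lambda>p. tder I (fst p) (snd p))"
    using r K by (intro compact_uniformly_continuous continuous_on_subset[OF contD]) auto
  have Efin: "emeasure lborel E \<noteq> \<infinity>"
    using emeasure_mono[OF K(4)] K(1) emeasure_lborel_cball_finite emeasure_bounded_finite[OF bounded_subset[OF compact_imp_bounded[OF K(1)] K(4)]] by auto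
  show ?thesis unfolding has_field_derivative_iff
  proof (rule LIM_I)
    fix e :: real assume "e > 0"
    \<comment> \<open>With \<open>+ 1\<close> the quotient \<open>e / m\<close> makes sense for a
      null set \<open>E\<close>, and the final error \<open>measure lborel E * (e / m)\<close> stays
      strictly below \<open>e\<close>.\<close>
    define m where "m = measure lborel E + 1"
    have m: "m > 0" by (simp add: m_def add_nonneg_pos)
    obtain d where d: "d > 0" "\<And>p q. p \<in> cball t r \<times> K \<Longrightarrow> q \<in> cball t r \<times> K \<Longrightarrow> dist p q < d \<Longrightarrow>
       dist (tder I (fst p) (snd p)) (tder I (fst q) (snd q)) < e / m"
      using uc \<open>e > 0\<close> m unfolding uniformly_continuous_on_def by (metis divide_pos_pos)
    show "\<exists>s>0. \<forall>y. y \<noteq> t \<and> norm (y - t) < s \<longrightarrow>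
        norm (((LINT x:E|lborel. I y x) - (LINT x:E|lborel. I t x)) / (y - t) - (LINT x:E|lborel. tder I t x)) < e"
    proof (intro exI[of _ "min d r"] conjI allI impI)
      show "min d r > 0" using d r by simp
      fix y assume y: "y \<noteq> t \<and> norm (y - t) < min d r"
      then have yT: "y \<in> T" using r by (auto simp: dist_real_def)
      have bd: "\<bar>(I y x - I t x) / (y - t) - tder I t x\<bar> \<le> e / m" if x: "x \<in> K" for x
      proof -
        \<comment> \<open>The mean value inequality is applied to
          \<open>I z x - z * tder I t x\<close>, whose derivative in \<open>z\<close> is the
          deviation of \<open>tder I z x\<close> from its value at \<open>t\<close>.\<close>
        have "norm ((I y x - y * tder I t x) - (I t x - t * tder I t x)) \<le> e / m * norm (y - t)"
        proof (rule field_differentiable_bound[where S="ball t (min d r)" and f'="\<lambda>z. tder I z x - tder I t x"])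
          fix z assume z: "z \<in> ball t (min d r)"
          have zT: "z \<in> T" "z \<in> cball t r" using z r by auto
          show "((\<lambda>z. I z x - z * tder I t x) has_field_derivative tder I z x - tder I t x) (at z within ball t (min d r))"
            using x K zT by (auto intro!: derivative_eq_intros der[THEN has_field_derivative_at_within])
          have "dist (tder I z x) (tder I t x) < e / m"
            using d(2)[of "(z, x)" "(t, x)"] zT x z r by (auto simp: dist_Pair_Pair dist_commute)
          then show "norm (tder I z x - tder I t x) \<le> e / m" by (simp add: dist_norm)
        qed (use y d r in \<open>auto simp: dist_real_def abs_minus_commute\<close>)
        moreover have "(I y x - I t x) / (y - t) - tder I t x = ((I y x - y * tder I t x) - (I t x - t * tder I t x)) / (y - t)"
          using y by (simp add: field_simps)
        ultimately show ?thesis using y by (simp add: abs_divide divide_le_eq)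
      qed
      have int1: "set_integrable lborel E (\<lambda>x. (I y x - I t x) / (y - t))"
        using slice(1)[OF yT] slice(1)[OF \<open>t \<in> T\<close>] by (intro set_integrable_divide set_integral_diff) auto
      have int2: "set_integrable lborel E (\<lambda>x. (I y x - I t x) / (y - t) - tder I t x)"
        using int1 slice(2)[OF \<open>t \<in> T\<close>] by (rule set_integral_diff)
      have "((LINT x:E|lborel. I y x) - (LINT x:E|lborel. I t x)) / (y - t) - (LINT x:E|lborel. tder I t x)
         = (LINT x:E|lborel. (I y x - I t x) / (y - t) - tder I t x)"
        using set_integral_diff(2)[OF int1 slice(2)[OF \<open>t \<in> T\<close>]]
          set_integral_diff(2)[OF slice(1)[OF yT] slice(1)[OF \<open>t \<in> T\<close>]] by simp
      also have "norm \<dots> \<le> (LINT x:E|lborel. norm ((I y x - I t x) / (y - t) - tder I t x))"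
        by (rule set_integral_norm_bound[OF int2])
      also have "\<dots> \<le> (LINT x:E|lborel. e / m)"
        using bd K Efin by (intro set_integral_mono set_integrable_norm int2)
           (auto simp: set_integrable_def less_top)
      also have "\<dots> = measure lborel E * (e / m)"
        using K Efin by (subst set_integral_const) auto
      also have "\<dots> < e" using \<open>e > 0\<close> m by (simp add: field_simps m_def)
      finally show "norm (((LINT x:E|lborel. I y x) - (LINT x:E|lborel. I t x)) / (y - t) - (LINT x:E|lborel. tder I t x)) < e" .
    qed
  qed
qed

text \<open>Translating the integrand does not change its integral, so the derivative of the translated
  integral, which is the integral of the partial derivative, vanishes.\<close>

lemma integral_partial_eq_0:
  fixes F :: "real^'n::finite \<Rightarrow> real"
  assumes F: "Ck_on (Suc 0) UNIV F" and K: "compact K" and 0: "\<And>x. x \<notin> K \<Longrightarrow> F x = 0"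
  shows "(LINT x|lborel. partial i F x) = 0"
proof -
  define I where "I t x = F (x + t *\<^sub>R axis i 1)" for t x
  obtain R where R: "\<And>x. x \<in> K \<Longrightarrow> norm x \<le> R" using compact_imp_bounded[OF K] bounded_iff by blast
  \<comment> \<open>The radius is enlarged by \<open>1\<close> so that all translates of the support
    by \<open>\<bar>t\<bar> < 1\<close> stay inside one fixed compact ball.\<close>
  define C where "C = cball (0::real^'n) (R + 1)"
  have "bounded_linear (\<lambda>p::real \<times> (real^'n). snd p + fst p *\<^sub>R axis i 1)"
    by (intro bounded_linear_add bounded_linear_snd bounded_linear_scaleR_const bounded_linear_fst)
  then have C1: "Ck_on (Suc 0) (UNIV \<times> UNIV) (\<lambda>p. I (fst p) (snd p))"
    unfolding I_def by (intro Ck_on_compose[OF _ _ _ Ck_on_linear F]) auto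
  have D: "((\<lambda>t. LINT x:C|lborel. I t x) has_real_derivative (LINT x:C|lborel. tder I 0 x)) (at 0)"
    by (rule leibniz_rule_compact[OF _ _ C1, where K=C]) (auto simp: C_def)
  have Fm: "F \<in> borel_measurable lborel"
    using Ck_on_imp_continuous_on[OF F] by (simp add: borel_measurable_continuous_onI)
  have const: "(LINT x:C|lborel. I t x) = (LINT x|lborel. F x)" if "t \<in> {-1<..<1}" for t
  proof -
    have "indicator C x *\<^sub>R I t x = I t x" for x
    proof (cases "x \<in> C")
      case False
      have "norm x - norm (- t *\<^sub>R axis i 1 :: real^'n) \<le> norm (x - - t *\<^sub>R axis i 1)"
        by (rule norm_triangle_ineq2)
      then have "x + t *\<^sub>R axis i 1 \<notin> K" using R[of "x + t *\<^sub>R axis i 1"] False that by (auto simp: C_def)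
      then show ?thesis using False 0 by (simp add: I_def)
    qed simp
    then have "(LINT x:C|lborel. I t x) = (LINT x|lborel. F (t *\<^sub>R axis i 1 + x))"
      unfolding set_lebesgue_integral_def by (simp only: I_def add.commute)
    also have "\<dots> = (LINT x|distr lborel borel ((+) (t *\<^sub>R axis i 1)). F x)"
      using Fm by (subst integral_distr) auto
    finally show ?thesis by (simp add: lborel_distr_plus)
  qed
  have "((\<lambda>t. LINT x:C|lborel. I t x) has_real_derivative 0) (at 0)"
    by (rule has_field_derivative_transform_within_open[OF DERIV_const open_greaterThanLessThan[of "-1" 1]])
       (use const in auto)
  with D have "(LINT x:C|lborel. tder I 0 x) = 0" by (rule DERIV_unique)
  moreover have "tder I 0 x = partial i F x" for x
  proof -
    have D: "(F has_derivative frechet_derivative F (at x)) (at x)"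
      using Ck_on_Suc_has_derivative[OF F] by simp
    have "((\<lambda>s. x + s *\<^sub>R axis i 1) has_derivative (\<lambda>r. r *\<^sub>R axis i 1)) (at 0)" by (auto intro!: derivative_eq_intros)
    from has_derivative_compose[OF this, of F "frechet_derivative F (at x)"] D
    have "((\<lambda>s. I s x) has_real_derivative partial i F x) (at 0)"
      unfolding partial_def I_def
      by (intro has_derivative_imp_has_field_derivative[where D="\<lambda>r. frechet_derivative F (at x) (r *\<^sub>R axis i 1)"])
         (simp_all add: linear_cmul[OF has_derivative_linear[OF D]])
    then show ?thesis by (simp add: tder_def DERIV_imp_deriv)
  qed
  moreover have "partial i F x = 0" if "x \<notin> C" for x
  proof -
    have "x \<in> - K" "open (- K)" using that R[of x] compact_imp_closed[OF K] by (auto simp: C_def open_Compl)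
    then have "(F has_derivative (\<lambda>_. 0)) (at x)"
      by (intro has_derivative_transform_within_open[OF has_derivative_const _ _, of "- K" x 0]) (use 0 in auto)
    then show ?thesis unfolding partial_def by (simp add: frechet_derivative_eqI)
  qed
  then have "indicator C x * partial i F x = partial i F x" for x by (cases "x \<in> C") auto
  ultimately show ?thesis by (simp add: set_lebesgue_integral_def)
qed

text \<open>Extension by zero is \<open>C\<^sup>1\<close> on \<open>U\<close> and on the complement
  of \<open>K\<close>; these two open sets cover the space, which reduces the claim to functions
  defined everywhere.\<close>

lemma set_integral_partial_eq_0:
  fixes F :: "real^'n::finite \<Rightarrow> real"
  assumes U: "open U" and F: "Ck_on (Suc 0) U F" and K: "compact K" "K \<subseteq> U" and 0: "\<And>x. x \<in> U - K \<Longrightarrow> F x = 0"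
  shows "(LINT x:U|lborel. partial i F x) = 0"
proof -
  define H where "H x = (if x \<in> U then F x else 0)" for x
  have 1: "Ck_on (Suc 0) U H" using Ck_on_cong[OF U, of F H] F by (simp add: H_def)
  have oK: "open (- K)" using compact_imp_closed[OF K(1)] by (simp add: open_Compl)
  have 2: "Ck_on (Suc 0) (- K) H"
    by (rule Ck_on_cong_imp[OF oK _ Ck_on_const[OF oK, of "Suc 0" 0]]) (use 0 in \<open>auto simp: H_def\<close>)
  have C1: "Ck_on (Suc 0) UNIV H"
    by (rule Ck_on_local) (use 1 2 U oK K in blast)
  have "indicator U x *\<^sub>R partial i F x = partial i H x" for x
  proof (cases "x \<in> U")
    case True
    have "partial i F x = partial i H x" unfolding partial_def
      using F True by (intro fun_cong[OF frechet_derivative_transform_within_open[OF _ U True]]) (auto simp: H_def)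
    then show ?thesis using True by simp
  next
    case False
    then have "x \<in> - K" using K by auto
    then have "(H has_derivative (\<lambda>_. 0)) (at x)"
      by (intro has_derivative_transform_within_open[OF has_derivative_const oK, of x 0]) (use 0 in \<open>auto simp: H_def\<close>)
    then show ?thesis using False unfolding partial_def by (simp add: frechet_derivative_eqI)
  qed
  then show ?thesis unfolding set_lebesgue_integral_def
    using integral_partial_eq_0[OF C1 K(1)] 0 by (auto simp: H_def)
qed

section \<open>Change of variables for arbitrary finite index types\<close>

text \<open>The library proves the change of variables formula only for coordinates indexed by a
  well-ordered type, so arbitrary finite index types are copied to an initial segment of the
  natural numbers.\<close>

typedef ('a::finite) index_copy = "{..<CARD('a)}"
  by (rule exI[of _ 0]) simp

instance index_copy :: (finite) finite
proof
  have "(UNIV :: 'a index_copy set) = Abs_index_copy ` {..<CARD('a)}"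
    using type_definition.Abs_image[OF type_definition_index_copy] by metis
  then show "finite (UNIV :: 'a index_copy set)" by (metis finite_imageI finite_lessThan)
qed

instantiation index_copy :: (finite) wellorder
begin

definition "a \<le> b \<longleftrightarrow> Rep_index_copy a \<le> Rep_index_copy b" for a b :: "'a index_copy"
definition "a < b \<longleftrightarrow> Rep_index_copy a < Rep_index_copy b" for a b :: "'a index_copy"

instance
proof
  fix P :: "'a index_copy \<Rightarrow> bool" and a
  assume step: "\<And>x. (\<And>y. y < x \<Longrightarrow> P y) \<Longrightarrow> P x"
  show "P a"
  proof (induction a rule: measure_induct_rule[of Rep_index_copy])
    case (less x)
    show ?case by (rule step) (simp add: less less_index_copy_def)
  qed
qed (auto simp: less_eq_index_copy_def less_index_copy_def Rep_index_copy_inject)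

end

lemma ex_bij_index_copy: "\<exists>\<beta> :: 'a::finite index_copy \<Rightarrow> 'a. bij \<beta>"
proof -
  have "card (UNIV :: 'a index_copy set) = CARD('a)"
    using type_definition.card[OF type_definition_index_copy] by (metis card_lessThan)
  then show ?thesis using finite_same_card_bij[of "UNIV :: 'a index_copy set" "UNIV :: 'a set"] by auto
qed

text \<open>Conjugation by \<open>\<beta>\<close> is a sign-preserving bijection between the
  permutations of the two index types, and it matches the Leibniz expansions term by term.\<close>

lemma det_reindex:
  fixes M :: "real^'n^'n" and \<beta> :: "'m::finite \<Rightarrow> 'n::finite"
  assumes "bij \<beta>"
  shows "det (\<chi> i j. M $ \<beta> i $ \<beta> j) = det M"
proof -
  have inj: "inj \<beta>" and surj: "surj \<beta>" using assms by (auto simp: bij_def)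
  have sgn: "sign (\<beta> \<circ> p \<circ> inv \<beta>) = sign p" if "p permutes UNIV" for p
    using sign_map_permutation[OF inj that] surj
    by (simp add: map_permutation_def restrict_id_def comp_def)
  show ?thesis unfolding det_def
  proof (rule sum.reindex_bij_witness[of _ "\<lambda>q. inv \<beta> \<circ> q \<circ> \<beta>" "\<lambda>p. \<beta> \<circ> p \<circ> inv \<beta>"])
    fix p :: "'m \<Rightarrow> 'm" assume "p \<in> {p. p permutes UNIV}"
    then have p: "p permutes UNIV" by simp
    show "inv \<beta> \<circ> (\<beta> \<circ> p \<circ> inv \<beta>) \<circ> \<beta> = p" using inj by (simp add: fun_eq_iff)
    show "\<beta> \<circ> p \<circ> inv \<beta> \<in> {p. p permutes UNIV}"
      using bij_comp[OF bij_comp[OF bij_imp_bij_inv[OF assms] permutes_bij[OF p]] assms]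
      by (intro CollectI bij_imp_permutes) (auto simp: comp_assoc)
    have "(\<Prod>i\<in>UNIV. M $ i $ (\<beta> \<circ> p \<circ> inv \<beta>) i) = (\<Prod>i\<in>UNIV. M $ \<beta> i $ \<beta> (p i))"
      using prod.reindex_bij_betw[OF assms, of "\<lambda>i. M $ i $ (\<beta> \<circ> p \<circ> inv \<beta>) i"] inj by simp
    then show "of_int (sign (\<beta> \<circ> p \<circ> inv \<beta>)) * (\<Prod>i\<in>UNIV. M $ i $ (\<beta> \<circ> p \<circ> inv \<beta>) i)
      = of_int (sign p) * (\<Prod>i\<in>UNIV. (\<chi> i j. M $ \<beta> i $ \<beta> j) $ i $ p i)"
      using sgn[OF p] by simp
  next
    fix q :: "'n \<Rightarrow> 'n" assume "q \<in> {p. p permutes UNIV}"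
    then have q: "q permutes UNIV" by simp
    show "\<beta> \<circ> (inv \<beta> \<circ> q \<circ> \<beta>) \<circ> inv \<beta> = q" using surj by (simp add: fun_eq_iff surj_f_inv_f)
    show "inv \<beta> \<circ> q \<circ> \<beta> \<in> {p. p permutes UNIV}"
      using bij_comp[OF bij_comp[OF assms permutes_bij[OF q]] bij_imp_bij_inv[OF assms]]
      by (intro CollectI bij_imp_permutes) (auto simp: comp_assoc)
  qed
qed

text \<open>A bridge from \<open>absolutely_integrable_on\<close> and \<open>integral\<close>, the
  language of the change of variables theorem, to nonnegative integrals over \<open>lborel\<close>.
  Borel measurability makes the completion of the measure harmless.\<close>

lemma nn_integral_eq_integral_iff:
  fixes w :: "'a::euclidean_space \<Rightarrow> real"
  assumes "(\<lambda>y. indicator T y * w y) \<in> borel_measurable borel" "\<And>y. y \<in> T \<Longrightarrow> 0 \<le> w y"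
  shows "w absolutely_integrable_on T \<longleftrightarrow> (\<integral>\<^sup>+y. ennreal (indicator T y * w y) \<partial>lborel) < \<infinity>"
    and "w absolutely_integrable_on T \<Longrightarrow> (\<integral>\<^sup>+y. ennreal (indicator T y * w y) \<partial>lborel) = ennreal (integral T w)"
    and "w absolutely_integrable_on T \<Longrightarrow> integral T w \<ge> 0"
proof -
  have nn: "0 \<le> indicator T y * w y" for y using assms(2) by (cases "y \<in> T") auto
  have iff: "w absolutely_integrable_on T \<longleftrightarrow> integrable lborel (\<lambda>y. indicator T y * w y)"
    unfolding set_integrable_def using assms(1) by (simp add: integrable_completion)
  then show "w absolutely_integrable_on T \<longleftrightarrow> (\<integral>\<^sup>+y. ennreal (indicator T y * w y) \<partial>lborel) < \<infinity>"
    using assms(1) nn by (simp add: integrable_iff_bounded)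
  assume w: "w absolutely_integrable_on T"
  have "integral T w = (LINT y|lborel. indicator T y * w y)"
    using set_lebesgue_integral_eq_integral(2)[OF w] assms(1)
    by (simp add: set_lebesgue_integral_def integral_completion)
  then show "(\<integral>\<^sup>+y. ennreal (indicator T y * w y) \<partial>lborel) = ennreal (integral T w)" "integral T w \<ge> 0"
    using nn_integral_eq_integral[of lborel "\<lambda>y. indicator T y * w y"] iff w nn by (auto simp: integral_nonneg)
qed

text \<open>The equivalence behind the formula transfers integrability together with the value, so
  the two nonnegative integrals are either both finite and equal or both infinite.\<close>

lemma nn_integral_change_of_variables_wellorder:
  fixes \<phi> :: "real^'m::{finite,wellorder} \<Rightarrow> real^'m::_" and w :: "real^'m::_ \<Rightarrow> real"
  assumes S: "S \<in> sets borel" and inj: "inj_on \<phi> S"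
    and der: "\<And>x. x \<in> S \<Longrightarrow> (\<phi> has_derivative \<phi>' x) (at x)"
    and w: "(\<lambda>y. indicator (\<phi> ` S) y * w y) \<in> borel_measurable borel" "\<And>y. y \<in> \<phi> ` S \<Longrightarrow> 0 \<le> w y"
    and dw: "(\<lambda>x. indicator S x * (\<bar>det (matrix (\<phi>' x))\<bar> * w (\<phi> x))) \<in> borel_measurable borel"
  shows "(\<integral>\<^sup>+y. ennreal (indicator (\<phi> ` S) y * w y) \<partial>lborel) =
    (\<integral>\<^sup>+x. ennreal (indicator S x * (\<bar>det (matrix (\<phi>' x))\<bar> * w (\<phi> x))) \<partial>lborel)"
proof -
  let ?v = "\<lambda>x. \<bar>det (matrix (\<phi>' x))\<bar> * w (\<phi> x)"
  have "S \<in> sets lebesgue" using S by simp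
  \<comment> \<open>The formula concerns vector-valued integrands; the scalar weight is passed as a
    vector of length one.\<close>
  have iff: "?v absolutely_integrable_on S \<and> integral S ?v = b
     \<longleftrightarrow> w absolutely_integrable_on (\<phi> ` S) \<and> integral (\<phi> ` S) w = b" for b
    using has_absolute_integral_change_of_variables[OF \<open>S \<in> sets lebesgue\<close> has_derivative_at_withinI[OF der] inj,
      of "\<lambda>y. vec (w y) :: real^1" "vec b"]
    unfolding absolutely_integrable_on_1_iff integral_on_1_eq by (simp add: vec_eq_iff)
  have v: "\<And>x. x \<in> S \<Longrightarrow> 0 \<le> ?v x" using w(2) by auto
  show ?thesis
  proof (cases "w absolutely_integrable_on (\<phi> ` S)")
    case True
    then have "?v absolutely_integrable_on S" "integral S ?v = integral (\<phi> ` S) w" using iff by blast+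
    then show ?thesis
      using nn_integral_eq_integral_iff(2)[OF w True] nn_integral_eq_integral_iff(2)[OF dw v] by simp
  next
    case False
    then have "\<not> ?v absolutely_integrable_on S" using iff by blast
    then have "(\<integral>\<^sup>+x. ennreal (indicator S x * ?v x) \<partial>lborel) = \<infinity>"
      using nn_integral_eq_integral_iff(1)[OF dw v] by (simp add: less_top[symmetric])
    moreover have "(\<integral>\<^sup>+y. ennreal (indicator (\<phi> ` S) y * w y) \<partial>lborel) = \<infinity>"
      using False nn_integral_eq_integral_iff(1)[OF w] by (simp add: less_top[symmetric])
    ultimately show ?thesis by simp
  qed
qed

lemma prod_Basis_vec: "(\<Prod>b\<in>(Basis :: (real^'n::finite) set). f b) = (\<Prod>i\<in>UNIV. f (axis i 1))"
proof -
  have "(Basis :: (real^'n) set) = range (\<lambda>i. axis i 1)" by (auto simp: Basis_vec_def)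
  show ?thesis unfolding \<open>Basis = _\<close> by (subst prod.reindex) (auto simp: inj_on_def axis_eq_axis)
qed

text \<open>Relabelling coordinates carries boxes to boxes with the same side lengths, and Lebesgue
  measure is determined by its values on boxes.\<close>

lemma distr_lborel_reindex:
  fixes \<beta> :: "'m::finite \<Rightarrow> 'n::finite"
  assumes "bij \<beta>"
  shows "distr lborel borel (\<lambda>x::real^'m. \<chi> i. x $ inv \<beta> i) = (lborel :: (real^'n) measure)"
proof (rule lborel_eqI[symmetric])
  have inj: "inj \<beta>" and surj: "surj \<beta>" using assms by (auto simp: bij_def)
  let ?R = "\<lambda>x::real^'m. (\<chi> i. x $ inv \<beta> i) :: real^'n"
  have "continuous_on UNIV ?R" by (intro continuous_on_vec_lambda continuous_intros)
  then have R: "?R \<in> borel_measurable lborel" by (simp add: borel_measurable_continuous_onI)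
  fix l u :: "real^'n" assume "\<And>b. b \<in> Basis \<Longrightarrow> l \<bullet> b \<le> u \<bullet> b"
  moreover have "axis i 1 \<in> (Basis :: (real^'n) set)" for i by (auto simp: Basis_vec_def)
  ultimately have "l \<bullet> axis i 1 \<le> u \<bullet> axis i 1" for i by blast
  then have le: "l $ i \<le> u $ i" for i by (simp add: inner_axis)
  have all: "(\<forall>i. P i) \<longleftrightarrow> (\<forall>j. P (\<beta> j))" for P using surj by (metis surjD)
  have "?R -` box l u = box (\<chi> j. l $ \<beta> j) (\<chi> j. u $ \<beta> j)"
    by (rule set_eqI) (use inj in \<open>simp add: mem_box_cart all\<close>)
  then have "emeasure (distr lborel borel ?R) (box l u) = emeasure lborel (box (\<chi> j. l $ \<beta> j) (\<chi> j. u $ \<beta> j :: real^'m))"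
    using R by (simp add: emeasure_distr)
  also have "\<dots> = ennreal (\<Prod>j\<in>UNIV. u $ \<beta> j - l $ \<beta> j)"
    using le by (subst emeasure_lborel_box) (simp_all only: prod_Basis_vec, auto simp: Basis_vec_def inner_axis)
  also have "(\<Prod>j\<in>UNIV. u $ \<beta> j - l $ \<beta> j) = (\<Prod>i\<in>UNIV. u $ i - l $ i)"
    by (rule prod.reindex_bij_betw[OF assms])
  also have "\<dots> = (\<Prod>b\<in>Basis. (u - l) \<bullet> b)"
    by (simp add: prod_Basis_vec inner_axis)
  finally show "emeasure (distr lborel borel ?R) (box l u) = ennreal (\<Prod>b\<in>Basis. (u - l) \<bullet> b)" .
qed simp

text \<open>The relabelling \<open>R\<close> with inverse \<open>Q\<close> preserves Lebesgue
  measure, and conjugating \<open>\<phi>\<close> by it keeps the Jacobian determinant by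
  \<open>det_reindex\<close>; so the case of well-ordered indices carries over.\<close>

lemma nn_integral_change_of_variables:
  fixes \<phi> :: "real^'n::finite \<Rightarrow> real^'n" and w :: "real^'n \<Rightarrow> real"
  assumes S: "S \<in> sets borel" and inj: "inj_on \<phi> S"
    and der: "\<And>x. x \<in> S \<Longrightarrow> (\<phi> has_derivative \<phi>' x) (at x)"
    and w: "(\<lambda>y. indicator (\<phi> ` S) y * w y) \<in> borel_measurable borel" "\<And>y. y \<in> \<phi> ` S \<Longrightarrow> 0 \<le> w y"
    and dw: "(\<lambda>x. indicator S x * (\<bar>det (matrix (\<phi>' x))\<bar> * w (\<phi> x))) \<in> borel_measurable borel"
  shows "(\<integral>\<^sup>+y. ennreal (indicator (\<phi> ` S) y * w y) \<partial>lborel) =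
    (\<integral>\<^sup>+x. ennreal (indicator S x * (\<bar>det (matrix (\<phi>' x))\<bar> * w (\<phi> x))) \<partial>lborel)"
proof -
  obtain \<beta> :: "'n index_copy \<Rightarrow> 'n" where \<beta>: "bij \<beta>" using ex_bij_index_copy by blast
  then have injb: "inj \<beta>" and surjb: "surj \<beta>" by (auto simp: bij_def)
  define R where "R x = (\<chi> i. x $ inv \<beta> i)" for x :: "real^'n index_copy"
  define Q where "Q y = (\<chi> j. y $ \<beta> j)" for y :: "real^'n"
  have QR: "Q (R x) = x" for x using injb by (simp add: Q_def R_def vec_eq_iff)
  have RQ: "R (Q y) = y" for y using surjb by (simp add: Q_def R_def vec_eq_iff surj_f_inv_f)
  have linR: "bounded_linear R" unfolding R_def
    by (intro linear_conv_bounded_linear[THEN iffD1] linearI) (auto simp: vec_eq_iff)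
  have linQ: "bounded_linear Q" unfolding Q_def
    by (intro linear_conv_bounded_linear[THEN iffD1] linearI) (auto simp: vec_eq_iff)
  have Rm[measurable]: "R \<in> borel_measurable borel"
    by (intro borel_measurable_continuous_onI linear_continuous_on linR)
  have lb: "nn_integral lborel g = (\<integral>\<^sup>+x. g (R x) \<partial>lborel)" if "g \<in> borel_measurable borel" for g :: "_ \<Rightarrow> ennreal"
  proof -
    have "distr lborel borel R = lborel" using distr_lborel_reindex[OF \<beta>] by (simp add: R_def[abs_def])
    then show ?thesis using that nn_integral_distr[of R lborel borel g] by simp
  qed
  let ?T = "Q ` S" and ?f = "\<lambda>x. Q (\<phi> (R x))" and ?f' = "\<lambda>x v. Q (\<phi>' (R x) (R v))"
  have mem: "x \<in> ?T \<longleftrightarrow> R x \<in> S" "x \<in> ?f ` ?T \<longleftrightarrow> R x \<in> \<phi> ` S" for x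
  proof -
    have Q: "x = Q y \<longleftrightarrow> R x = y" for y using QR[of x] RQ[of y] by auto
    show "x \<in> ?T \<longleftrightarrow> R x \<in> S" by (auto simp: image_iff Q)
    show "x \<in> ?f ` ?T \<longleftrightarrow> R x \<in> \<phi> ` S" by (auto simp: image_iff Q RQ)
  qed
  have det: "det (matrix (?f' x)) = det (matrix (\<phi>' (R x)))" for x
  proof -
    have R1: "R (axis j 1) = axis (\<beta> j) 1" for j
      using injb surjb by (auto simp: R_def axis_def vec_eq_iff inv_f_f surj_f_inv_f)
    have "matrix (?f' x) = (\<chi> i j. matrix (\<phi>' (R x)) $ \<beta> i $ \<beta> j)"
      by (simp add: matrix_def R1 vec_eq_iff) (simp add: Q_def)
    then show ?thesis by (simp only: det_reindex[OF \<beta>])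
  qed
  have ind: "indicator ?T x = (indicator S (R x) :: real)" "indicator (?f ` ?T) x = (indicator (\<phi> ` S) (R x) :: real)" for x
    by (simp_all only: mem indicator_def)
  have T: "?T \<in> sets borel"
  proof -
    have "?T = R -` S \<inter> space borel" by (rule set_eqI) (simp only: mem(1) vimage_eq space_borel Int_UNIV_right)
    then show ?thesis using measurable_sets[OF Rm S] by simp
  qed
  have 1: "(\<integral>\<^sup>+y. ennreal (indicator (?f ` ?T) y * w (R y)) \<partial>lborel) =
    (\<integral>\<^sup>+x. ennreal (indicator ?T x * (\<bar>det (matrix (?f' x))\<bar> * w (R (?f x)))) \<partial>lborel)"
  proof (rule nn_integral_change_of_variables_wellorder[OF T])
    show "inj_on ?f ?T" 
    proof (rule inj_onI)
      fix x y assume xy: "x \<in> ?T" "y \<in> ?T" "Q (\<phi> (R x)) = Q (\<phi> (R y))"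
      have S: "R x \<in> S" "R y \<in> S" using xy(1,2) unfolding mem(1) by this+
      have "\<phi> (R x) = \<phi> (R y)" using arg_cong[OF xy(3), of R] by (simp only: RQ)
      then have "R x = R y" by (rule inj_onD[OF inj _ S])
      from arg_cong[OF this, of Q] show "x = y" by (simp only: QR)
    qed
    show "(?f has_derivative ?f' x) (at x)" if "x \<in> ?T" for x
      using that unfolding mem(1)
      by (intro bounded_linear.has_derivative[OF linQ] has_derivative_compose[OF bounded_linear_imp_has_derivative[OF linR] der]) auto
    show "(\<lambda>y. indicator (?f ` ?T) y * w (R y)) \<in> borel_measurable borel"
      unfolding ind using measurable_compose[OF Rm w(1)] .
    show "0 \<le> w (R y)" if "y \<in> ?f ` ?T" for y using that unfolding mem(2) by (rule w(2))
    show "(\<lambda>x. indicator ?T x * (\<bar>det (matrix (?f' x))\<bar> * w (R (?f x)))) \<in> borel_measurable borel"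
      unfolding ind det RQ using measurable_compose[OF Rm dw] .
  qed
  have "(\<integral>\<^sup>+y. ennreal (indicator (\<phi> ` S) y * w y) \<partial>lborel) = (\<integral>\<^sup>+y. ennreal (indicator (?f ` ?T) y * w (R y)) \<partial>lborel)"
    unfolding ind by (rule lb[OF measurable_compose[OF w(1) measurable_ennreal]])
  also note 1
  also have "(\<integral>\<^sup>+x. ennreal (indicator ?T x * (\<bar>det (matrix (?f' x))\<bar> * w (R (?f x)))) \<partial>lborel)
      = (\<integral>\<^sup>+x. ennreal (indicator S x * (\<bar>det (matrix (\<phi>' x))\<bar> * w (\<phi> x))) \<partial>lborel)"
    unfolding ind det RQ by (rule lb[OF measurable_compose[OF dw measurable_ennreal], symmetric])
  finally show ?thesis .
qed

section \<open>Partial derivatives and positive definite matrices\<close>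

lemma partialI: "(f has_derivative f') (at x) \<Longrightarrow> partial i f x = f' (axis i 1)"
  by (simp add: partial_def frechet_derivative_eqI)

lemma partial_cong:
  assumes "open U" "x \<in> U" "\<And>y. y \<in> U \<Longrightarrow> f y = h y" "f differentiable (at x)"
  shows "partial i f x = partial i h x"
  unfolding partial_def using frechet_derivative_transform_within_open[OF assms(4,1,2)] assms(3) by metis

lemma partial_const [simp]: "partial i (\<lambda>x. c) x = 0"
  by (rule partialI[OF has_derivative_const])

lemma partial_add:
  assumes "f differentiable (at x)" "h differentiable (at x)"
  shows "partial i (\<lambda>y. f y + h y) x = partial i f x + partial i h x"
  using assms unfolding frechet_derivative_works
  by (intro trans[OF partialI[OF has_derivative_add]]) (auto simp: partial_def)

lemma partial_diff:
  assumes "f differentiable (at x)" "h differentiable (at x)"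
  shows "partial i (\<lambda>y. f y - h y) x = partial i f x - partial i h x"
  using assms unfolding frechet_derivative_works
  by (intro trans[OF partialI[OF has_derivative_diff]]) (auto simp: partial_def)

lemma partial_mult:
  assumes "f differentiable (at x)" "h differentiable (at x)"
  shows "partial i (\<lambda>y. f y * h y) x = partial i f x * h x + f x * partial i h x"
  using assms unfolding frechet_derivative_works
  by (intro trans[OF partialI[OF has_derivative_mult]]) (auto simp: partial_def)

lemma partial_cmult:
  "f differentiable (at x) \<Longrightarrow> partial i (\<lambda>y. c * f y) x = c * partial i f x"
  using partial_mult[of "\<lambda>_. c" x f i] by simp

lemma partial_sum:
  assumes "\<And>k. k \<in> K \<Longrightarrow> f k differentiable (at x)"
  shows "partial i (\<lambda>y. \<Sum>k\<in>K. f k y) x = (\<Sum>k\<in>K. partial i (f k) x)"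
  using assms unfolding frechet_derivative_works
  by (intro trans[OF partialI[OF has_derivative_sum]]) (auto simp: partial_def)

lemma partial_line:
  assumes "f differentiable (at x)"
  shows "((\<lambda>s. f (x + s *\<^sub>R axis i 1)) has_real_derivative partial i f x) (at 0)"
proof -
  have D: "(f has_derivative frechet_derivative f (at (x + 0 *\<^sub>R axis i 1))) (at (x + 0 *\<^sub>R axis i 1))"
    using assms by (simp add: frechet_derivative_works)
  have "((\<lambda>s. x + s *\<^sub>R axis i 1) has_derivative (\<lambda>r. r *\<^sub>R axis i 1)) (at 0)"
    by (auto intro!: derivative_eq_intros)
  from has_derivative_compose[OF this D] show ?thesis
    by (rule has_derivative_imp_has_field_derivative)
       (simp add: partial_def linear_cmul[OF has_derivative_linear[OF D], simplified])
qed

lemma partial_chain: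
  fixes \<phi> :: "real^'n::finite \<Rightarrow> real^'n"
  assumes \<phi>: "\<phi> differentiable (at x)" and f: "f differentiable (at (\<phi> x))"
  shows "partial i (\<lambda>y. f (\<phi> y)) x = (\<Oplus>a. partial i (\<lambda>y. \<phi> y $ a) x * partial a f (\<phi> x))"
proof -
  let ?D = "frechet_derivative f (at (\<phi> x))"
  have 1: "(\<phi> has_derivative frechet_derivative \<phi> (at x)) (at x)" using \<phi> frechet_derivative_works by blast
  have 2: "(f has_derivative ?D) (at (\<phi> x))" using f frechet_derivative_works by blast
  have comp: "partial i (\<lambda>y. \<phi> y $ a) x = frechet_derivative \<phi> (at x) (axis i 1) $ a" for a
    by (rule partialI[OF bounded_linear.has_derivative[OF bounded_linear_vec_nth 1]])
  have L: "linear ?D" using 2 has_derivative_linear by blast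
  have "?D v = (\<Oplus>a. v $ a * ?D (axis a 1))" for v
  proof -
    have "?D v = ?D (\<Oplus>a. v $ a *\<^sub>R axis a 1)"
      using basis_expansion[of v] by (simp add: scalar_mult_eq_scaleR)
    then show ?thesis by (simp add: linear_sum[OF L] linear_cmul[OF L])
  qed
  then show ?thesis
    unfolding partialI[OF has_derivative_compose[OF 1 2]] comp partial_def[of _ f] .
qed

lemma matrix_frechet_derivative:
  fixes \<phi> :: "real^'n::finite \<Rightarrow> real^'n"
  assumes "\<phi> differentiable (at x)"
  shows "matrix (frechet_derivative \<phi> (at x)) $ a $ i = partial i (\<lambda>y. \<phi> y $ a) x"
proof -
  have 1: "(\<phi> has_derivative frechet_derivative \<phi> (at x)) (at x)" using assms frechet_derivative_works by blast
  show ?thesis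
    using partialI[OF bounded_linear.has_derivative[OF bounded_linear_vec_nth 1]] by (simp add: matrix_def)
qed

section \<open>Positive definite matrices: orthonormal frames, inverse and determinant\<close>

definition posdef_sym :: "real^'n^'n \<Rightarrow> bool" where
  "posdef_sym G \<longleftrightarrow> transpose G = G \<and> (\<forall>v. v \<noteq> 0 \<longrightarrow> v \<bullet> (G *v v) > 0)"

text \<open>Gram-Schmidt with respect to \<open>G\<close>: fewer than \<open>CARD('n)\<close>
  vectors do not span, so a vector outside the span remains and can be orthogonalised and
  normalised. The sequence is indexed by \<open>nat\<close> because \<open>'n\<close> carries no
  order to induct on.\<close>

lemma ex_orthonormal_sequence:
  fixes G :: "real^'n::finite^'n"
  assumes G: "posdef_sym G" and "k \<le> CARD('n)"
  shows "\<exists>f :: nat \<Rightarrow> real^'n. \<forall>i<k. \<forall>j<k. f i \<bullet> (G *v f j) = (if i = j then 1 else 0)"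
  using assms(2)
proof (induction k)
  case 0 then show ?case by simp
next
  case (Suc k)
  then obtain f :: "nat \<Rightarrow> real^'n" where f: "\<And>i j. i < k \<Longrightarrow> j < k \<Longrightarrow> f i \<bullet> (G *v f j) = (if i = j then 1 else 0)"
    by auto
  have sym: "u \<bullet> (G *v v) = v \<bullet> (G *v u)" for u v
    using G dot_lmul_matrix[of u G v] transpose_matrix_vector[of G u]
    by (simp add: posdef_sym_def inner_commute)
  have "dim (f ` {..<k}) \<le> k" using dim_le_card'[of "f ` {..<k}"] card_image_le[of "{..<k}" f] by simp
  then have "span (f ` {..<k}) \<noteq> UNIV" using Suc.prems dim_span[of "f ` {..<k}"] by (metis dim_UNIV not_less_eq_eq DIM_cart DIM_real mult.right_neutral)
  then obtain w where w: "w \<notin> span (f ` {..<k})" by blast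
  define u where "u = w - (\<Sum>i<k. (f i \<bullet> (G *v w)) *\<^sub>R f i)"
  have "(\<Sum>i<k. (f i \<bullet> (G *v w)) *\<^sub>R f i) \<in> span (f ` {..<k})"
    by (intro span_sum span_scale span_base) auto
  then have "u \<noteq> 0" using w by (auto simp: u_def)
  then have pos: "u \<bullet> (G *v u) > 0" using G by (auto simp: posdef_sym_def)
  have orth: "f j \<bullet> (G *v u) = 0" if "j < k" for j
  proof -
    have "f j \<bullet> (G *v u) = f j \<bullet> (G *v w) - (\<Sum>i<k. (f i \<bullet> (G *v w)) * (f j \<bullet> (G *v f i)))"
      by (simp add: u_def matrix_vector_mult_diff_distrib inner_diff_right
          matrix_vector_mul_linear linear_sum[OF matrix_vector_mul_linear] inner_sum_right
          matrix_vector_mult_scaleR)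
    also have "(\<Sum>i<k. (f i \<bullet> (G *v w)) * (f j \<bullet> (G *v f i))) = (\<Sum>i<k. if i = j then f i \<bullet> (G *v w) else 0)"
      using f that by (intro sum.cong) auto
    finally show ?thesis using that by simp
  qed
  define z where "z = (1 / sqrt (u \<bullet> (G *v u))) *\<^sub>R u"
  have zz: "z \<bullet> (G *v z) = 1" using pos by (simp add: z_def matrix_vector_mult_scaleR)
  have fz: "f j \<bullet> (G *v z) = 0" if "j < k" for j using orth[OF that] by (simp add: z_def matrix_vector_mult_scaleR)
  have zf: "z \<bullet> (G *v f j) = 0" if "j < k" for j using fz[OF that] by (subst sym)
  have "\<forall>i<Suc k. \<forall>j<Suc k. (f(k := z)) i \<bullet> (G *v (f(k := z)) j) = (if i = j then 1 else 0)"
    using f zz fz zf by (auto simp: less_Suc_eq)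
  then show ?case by blast
qed

text \<open>The frame vectors are the columns of \<open>E\<close>. Invertibility and positive
  determinant of \<open>G\<close>, the formula \<open>E ** transpose E\<close> for its inverse, and
  later all metric contractions are read off from such a matrix.\<close>

lemma ex_orthonormal_frame:
  fixes G :: "real^'n::finite^'n"
  assumes G: "posdef_sym G"
  shows "\<exists>E :: real^'n^'n. transpose E ** G ** E = mat 1"
proof -
  obtain f :: "nat \<Rightarrow> real^'n" where f: "\<And>i j. i < CARD('n) \<Longrightarrow> j < CARD('n) \<Longrightarrow> f i \<bullet> (G *v f j) = (if i = j then 1 else 0)"
    using ex_orthonormal_sequence[OF G order_refl] by auto
  obtain b :: "'n \<Rightarrow> nat" where b: "bij_betw b UNIV {..<CARD('n)}"
    using ex_bij_betw_finite_nat[of "UNIV :: 'n set"] by (auto simp: atLeast0LessThan)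
  then have lt: "b i < CARD('n)" for i by (auto dest: bij_betwE)
  have inj: "b i = b j \<longleftrightarrow> i = j" for i j using b by (auto simp: bij_betw_def inj_on_def)
  define E :: "real^'n^'n" where "E = (\<chi> i j. f (b j) $ i)"
  have "(transpose E ** G ** E) $ i $ j = f (b i) \<bullet> (G *v f (b j))" for i j
  proof -
    have "(transpose E ** G ** E) $ i $ j = (transpose E ** (G ** E)) $ i $ j" by (simp add: matrix_mul_assoc)
    then show ?thesis by (simp add: matrix_matrix_mult_def matrix_vector_mult_def transpose_def E_def inner_vec_def)
  qed
  then have "transpose E ** G ** E = mat 1" using f lt inj by (simp add: vec_eq_iff mat_def)
  then show ?thesis by blast
qed

lemma
  fixes G :: "real^'n::finite^'n"
  assumes "invertible G"
  shows matrix_inv_right: "G ** matrix_inv G = mat 1" and matrix_inv_left: "matrix_inv G ** G = mat 1"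
  using someI_ex[of "\<lambda>A'. G ** A' = mat 1 \<and> A' ** G = mat 1"] assms
  by (auto simp: invertible_def matrix_inv_def)

lemma frame_matrix_inv:
  fixes G E :: "real^'n::finite^'n"
  assumes "transpose E ** G ** E = mat 1"
  shows "invertible G" "matrix_inv G = E ** transpose E" "det G > 0"
proof -
  have "E ** (transpose E ** G) = mat 1" using assms matrix_left_right_inverse by metis
  then have l: "(E ** transpose E) ** G = mat 1" by (simp add: matrix_mul_assoc)
  then have r: "G ** (E ** transpose E) = mat 1" using matrix_left_right_inverse by metis
  show "invertible G" using l r by (auto simp: invertible_def)
  then have "matrix_inv G ** G = mat 1" by (simp add: matrix_inv_left)
  then show "matrix_inv G = E ** transpose E"
    by (metis l r matrix_mul_assoc matrix_mul_lid matrix_mul_rid)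
  have "det E * det E * det G = 1"
    using arg_cong[OF assms, of det] by (simp add: det_mul mult.commute mult.left_commute)
  then show "det G > 0"
    by (metis mult_eq_0_iff not_square_less_zero zero_less_mult_iff zero_less_one linorder_neqE_linordered_idom)
qed

lemma
  fixes G :: "real^'n::finite^'n"
  assumes G: "posdef_sym G"
  shows posdef_sym_invertible: "invertible G"
    and posdef_sym_det: "det G > 0"
    and ginv_left: "(\<Oplus>j. ginv G i j * G $ j $ k) = (if i = k then 1 else 0)"
    and ginv_right: "(\<Oplus>j. G $ i $ j * ginv G j k) = (if i = k then 1 else 0)"
    and ginv_sym: "ginv G i j = ginv G j i"
    and posdef_sym_sym: "G $ i $ j = G $ j $ i"
proof -
  obtain E :: "real^'n^'n" where E: "transpose E ** G ** E = mat 1" using ex_orthonormal_frame[OF G] by blast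
  show inv: "invertible G" and "det G > 0" using frame_matrix_inv[OF E] by auto
  show "(\<Oplus>j. ginv G i j * G $ j $ k) = (if i = k then 1 else 0)"
    using matrix_inv_left[OF inv] by (simp add: vec_eq_iff matrix_matrix_mult_def mat_def ginv_def)
  show "(\<Oplus>j. G $ i $ j * ginv G j k) = (if i = k then 1 else 0)"
    using matrix_inv_right[OF inv] by (simp add: vec_eq_iff matrix_matrix_mult_def mat_def ginv_def)
  show "ginv G i j = ginv G j i"
    unfolding ginv_def frame_matrix_inv(2)[OF E]
    by (simp add: matrix_matrix_mult_def transpose_def mult.commute)
  have "transpose G $ i $ j = G $ i $ j" using G by (simp add: posdef_sym_def)
  then show "G $ i $ j = G $ j $ i" by (simp add: transpose_def)
qed

lemma ginv_frame:
  fixes G E :: "real^'n::finite^'n"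
  assumes "transpose E ** G ** E = mat 1"
  shows "ginv G i j = (\<Oplus>p. E $ i $ p * E $ j $ p)"
  unfolding ginv_def frame_matrix_inv(2)[OF assms] by (simp add: matrix_matrix_mult_def transpose_def)

lemma smooth_on_det:
  fixes M :: "'a::real_normed_vector \<Rightarrow> real^'n::finite^'n"
  assumes "open S" "\<And>i j. smooth_on S (\<lambda>x. M x $ i $ j)"
  shows "smooth_on S (\<lambda>x. det (M x))"
  unfolding det_def by (intro smooth_on_intros assms)

text \<open>For smoothness of the inverse metric: Cramer's rule writes each entry as a polynomial in
  the entries of \<open>G\<close> divided by the determinant.\<close>

lemma ginv_cramer:
  fixes G :: "real^'n::finite^'n"
  assumes "det G \<noteq> 0"
  shows "ginv G k l = det (\<chi> i j. if j = k then axis l 1 $ i else G $ i $ j) * inverse (det G)"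
proof -
  have "invertible G" using assms invertible_det_nz by blast
  then have "G *v (matrix_inv G *v axis l 1) = axis l 1"
    by (simp add: matrix_vector_mul_assoc matrix_inv_right)
  then have eq: "matrix_inv G *v axis l 1 = (\<chi> k. det (\<chi> i j. if j = k then axis l 1 $ i else G $ i $ j) / det G)"
    by (rule cramer[OF assms, THEN iffD1])
  have "(matrix_inv G *v axis l 1) $ k = det (\<chi> i j. if j = k then axis l 1 $ i else G $ i $ j) / det G"
    unfolding eq by simp
  moreover have "(matrix_inv G *v axis l 1) $ k = ginv G k l"
    by (simp add: ginv_def matrix_vector_mult_def axis_def if_distrib cong: if_cong)
  ultimately show ?thesis by (simp add: divide_inverse)
qed

lemma smooth_on_ginv:
  fixes M :: "'a::real_normed_vector \<Rightarrow> real^'n::finite^'n"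
  assumes "open S" "\<And>i j. smooth_on S (\<lambda>x. M x $ i $ j)" "\<And>x. x \<in> S \<Longrightarrow> posdef_sym (M x)"
  shows "smooth_on S (\<lambda>x. ginv (M x) k l)"
proof -
  have "smooth_on S (\<lambda>x. det (\<chi> i j. if j = k then axis l 1 $ i else M x $ i $ j) * inverse (det (M x)))"
  proof (intro smooth_on_mult smooth_on_inverse smooth_on_det assms posdef_sym_det)
    fix i j show "smooth_on S (\<lambda>x. (\<chi> i j. if j = k then axis l 1 $ i else M x $ i $ j) $ i $ j)"
      by (cases "j = k") (auto intro: smooth_on_const assms)
  qed
  then show ?thesis
    by (subst smooth_on_cong[OF assms(1)]) (auto intro!: ginv_cramer dest: assms(3)[THEN posdef_sym_det])
qed

text \<open>In the Leibniz expansion the derivative hits one factor and leaves a product of identity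
  entries over the other rows. Such a product vanishes unless the permutation is the identity, which
  leaves the trace.\<close>

lemma DERIV_det_at_identity:
  fixes N :: "real \<Rightarrow> real^'n::finite^'n"
  assumes N: "\<And>i j. ((\<lambda>s. N s $ i $ j) has_real_derivative N' i j) (at a)" and 1: "N a = mat 1"
  shows "((\<lambda>s. det (N s)) has_real_derivative (\<Oplus>k. N' k k)) (at a)"
proof -
  have prod0: "(\<Prod>i\<in>UNIV-{k}. (mat 1 :: real^'n^'n) $ i $ p i) = (if p = id then 1 else 0)"
    if p: "p permutes UNIV" for p k
  proof (cases "p = id")
    case True
    have "(\<Prod>i\<in>UNIV-{k}. (mat 1 :: real^'n^'n) $ i $ p i) = (\<Prod>i\<in>UNIV-{k}. 1)"
      by (rule prod.cong) (auto simp: True mat_def)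
    then show ?thesis using True by simp
  next
    case False
    \<comment> \<open>A permutation fixing every index other than \<open>k\<close> fixes
      \<open>k\<close> as well by injectivity, so a non-identity permutation moves some index whose
      factor is still in the product.\<close>
    have "\<exists>i. i \<noteq> k \<and> p i \<noteq> i"
    proof (rule ccontr)
      assume "\<not> ?thesis"
      then have "p i = i" if "i \<noteq> k" for i using that by blast
      moreover from this have "p k = k" using permutes_inj[OF p] by (metis injD)
      ultimately have "p = id" by (metis eq_id_iff)
      with False show False by simp
    qed
    then obtain i where "i \<in> UNIV - {k}" "p i \<noteq> i" by auto
    then show ?thesis using False by (auto intro!: prod_zero simp: mat_def intro!: bexI[of _ i])
  qed
  have D: "((\<lambda>s. \<Prod>i\<in>UNIV. N s $ i $ p i) has_real_derivative
      (\<Oplus>k. N' k (p k) * (\<Prod>i\<in>UNIV-{k}. N a $ i $ p i))) (at a)" for p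
  proof (rule has_derivative_imp_has_field_derivative[OF has_derivative_prod])
    show "((\<lambda>s. N s $ i $ p i) has_derivative (\<lambda>y. y * N' i (p i))) (at a)" for i
      using N[of i "p i"] unfolding has_field_derivative_def by (simp add: mult.commute[of _ "N' i (p i)"])
    show "y * (\<Oplus>k. N' k (p k) * (\<Prod>i\<in>UNIV-{k}. N a $ i $ p i)) =
       (\<Oplus>i. y * N' i (p i) * (\<Prod>j\<in>UNIV-{i}. N a $ j $ p j))" for y
      by (simp add: sum_distrib_left mult.assoc)
  qed
  have "((\<lambda>s. \<Sum>p | p permutes UNIV. of_int (sign p) * (\<Prod>i\<in>UNIV. N s $ i $ p i)) has_real_derivative
     (\<Sum>p | p permutes (UNIV :: 'n set). of_int (sign p) * (\<Oplus>k. N' k (p k) * (\<Prod>i\<in>UNIV-{k}. N a $ i $ p i)))) (at a)"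
    by (intro DERIV_sum DERIV_cmult D)
  also have "(\<Sum>p | p permutes (UNIV :: 'n set). of_int (sign p) * (\<Oplus>k. N' k (p k) * (\<Prod>i\<in>UNIV-{k}. N a $ i $ p i)))
     = (\<Sum>p | p permutes (UNIV :: 'n set). if p = id then \<Oplus>k. N' k k else 0)"
    unfolding 1 by (rule sum.cong) (auto simp: prod0 sign_id)
  also have "\<dots> = (\<Oplus>k. N' k k)"
    by (simp add: permutes_id finite_permutations)
  finally show ?thesis unfolding det_def .
qed

text \<open>Jacobi's formula. Factoring out \<open>M a\<close> reduces the claim to a curve through
  the identity matrix.\<close>

lemma DERIV_det:
  fixes M :: "real \<Rightarrow> real^'n::finite^'n"
  assumes M: "\<And>i j. ((\<lambda>s. M s $ i $ j) has_real_derivative M' i j) (at a)" and inv: "invertible (M a)"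
  shows "((\<lambda>s. det (M s)) has_real_derivative det (M a) * (\<Oplus>k l. ginv (M a) k l * M' l k)) (at a)"
proof -
  let ?I = "matrix_inv (M a)"
  have "((\<lambda>s. det (?I ** M s)) has_real_derivative (\<Oplus>k l. ginv (M a) k l * M' l k)) (at a)"
  proof (rule DERIV_det_at_identity[where N'="\<lambda>i j. \<Oplus>l. ginv (M a) i l * M' l j"])
    show "((\<lambda>s. (?I ** M s) $ i $ j) has_real_derivative (\<Oplus>l. ginv (M a) i l * M' l j)) (at a)" for i j
      unfolding ginv_def by (simp add: matrix_matrix_mult_def) (intro DERIV_sum DERIV_cmult M)
    show "?I ** M a = mat 1" by (rule matrix_inv_left[OF inv])
  qed
  from DERIV_cmult[OF this, of "det (M a)"]
  have "((\<lambda>s. det (M a) * det (?I ** M s)) has_real_derivative det (M a) * (\<Oplus>k l. ginv (M a) k l * M' l k)) (at a)" .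
  moreover have "det (M a) * det (?I ** M s) = det (M s)" for s
    using det_mul[of "M a" "?I ** M s"] matrix_inv_right[OF inv] by (simp add: matrix_mul_assoc)
  ultimately show ?thesis by simp
qed

lemma sum_swap_pairs:
  "(\<Oplus>i p k m. f i p k m) = (\<Oplus>k m i p. (f i p k m :: 'a::comm_monoid_add))"
proof -
  have "(\<Oplus>i p k m. f i p k m) = (\<Oplus>i k p m. f i p k m)" by (rule sum.cong[OF refl], rule sum.swap)
  also have "\<dots> = (\<Oplus>k i p m. f i p k m)" by (rule sum.swap)
  also have "\<dots> = (\<Oplus>k i m p. f i p k m)" by (rule sum.cong[OF refl], rule sum.cong[OF refl], rule sum.swap)
  also have "\<dots> = (\<Oplus>k m i p. f i p k m)" by (rule sum.cong[OF refl], rule sum.swap)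
  finally show ?thesis .
qed

lemma sum_delta_mult [simp]:
  fixes b :: "'a::finite \<Rightarrow> real"
  shows "(\<Oplus>m. (if l = m then 1 else 0) * b m) = b l" "(\<Oplus>m. (if m = l then 1 else 0) * b m) = b l"
    "(\<Oplus>m. b m * (if l = m then 1 else 0)) = b l" "(\<Oplus>m. b m * (if m = l then 1 else 0)) = b l"
  by (simp_all add: if_distrib[of "\<lambda>x. x * _"] if_distrib[of "\<lambda>x. _ * x"] cong: if_cong)

section \<open>Curvature in coordinates\<close>

text \<open>Smoothness is kept jointly in time and space, since derivatives of curvature in
  \<open>t\<close> are needed. A single metric is treated as a constant family through the sublocale
  below, so each smoothness fact is proved only once.\<close>

locale metric_family =
  fixes T :: "real set" and U :: "(real^'n::finite) set" and G :: "real \<Rightarrow> real^'n \<Rightarrow> real^'n^'n"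
  assumes open_T: "open T" and open_U: "open U"
    and smooth_G: "smooth_on (T \<times> U) (\<lambda>p. G (fst p) (snd p))"
    and posdef: "t \<in> T \<Longrightarrow> x \<in> U \<Longrightarrow> posdef_sym (G t x)"
begin

lemma open_TU: "open (T \<times> U)"
  using open_T open_U by (rule open_Times)

lemma smooth_component: "smooth_on (T \<times> U) (\<lambda>p. G (fst p) (snd p) $ i $ j)"
  by (intro smooth_on_vec_nth open_TU smooth_G)

lemma smooth_ginv: "smooth_on (T \<times> U) (\<lambda>p. ginv (G (fst p) (snd p)) k l)"
  by (intro smooth_on_ginv open_TU smooth_component) (auto intro: posdef)

lemma smooth_christoffel: "smooth_on (T \<times> U) (\<lambda>p. christoffel (G (fst p)) k i j (snd p))"
  unfolding christoffel_def
  by (intro smooth_on_mult smooth_on_add smooth_on_diff smooth_on_sum smooth_on_const smooth_ginv open_TU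
      smooth_on_partial_joint[where F="\<lambda>t y. G t y $ _ $ _"] open_T open_U smooth_component)

lemma smooth_riem_up: "smooth_on (T \<times> U) (\<lambda>p. riem_up (G (fst p)) l i j k (snd p))"
  unfolding riem_up_def
  by (intro smooth_on_mult smooth_on_add smooth_on_diff smooth_on_sum smooth_on_const smooth_christoffel open_TU
      smooth_on_partial_joint[where F="\<lambda>t. christoffel (G t) _ _ _"] open_T open_U)

lemma smooth_riem: "smooth_on (T \<times> U) (\<lambda>p. riem (G (fst p)) i j k l (snd p))"
  unfolding riem_def by (intro smooth_on_mult smooth_on_sum smooth_component smooth_riem_up open_TU)

lemma smooth_ricci: "smooth_on (T \<times> U) (\<lambda>p. ricci (G (fst p)) j k (snd p))"
  unfolding ricci_def by (intro smooth_on_sum smooth_riem_up open_TU)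

lemma smooth_scalar_curv: "smooth_on (T \<times> U) (\<lambda>p. scalar_curv (G (fst p)) (snd p))"
  unfolding scalar_curv_def by (intro smooth_on_mult smooth_on_sum smooth_ginv smooth_ricci open_TU)

lemma smooth_riem_sq: "smooth_on (T \<times> U) (\<lambda>p. riem_sq (G (fst p)) (snd p))"
  unfolding riem_sq_def by (intro smooth_on_mult smooth_on_sum smooth_ginv smooth_riem open_TU)

lemma smooth_ricci_sq: "smooth_on (T \<times> U) (\<lambda>p. ricci_sq (G (fst p)) (snd p))"
  unfolding ricci_sq_def by (intro smooth_on_mult smooth_on_sum smooth_ginv smooth_ricci open_TU)

lemma smooth_volume_density: "smooth_on (T \<times> U) (\<lambda>p. sqrt (det (G (fst p) (snd p))))"
  by (intro smooth_on_sqrt smooth_on_det open_TU smooth_component) (auto intro!: posdef_sym_det posdef)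

end

locale metric_patch =
  fixes U :: "(real^'n::finite) set" and G :: "real^'n \<Rightarrow> real^'n^'n"
  assumes open_U: "open U" and smooth_G: "smooth_on U G"
    and posdef: "x \<in> U \<Longrightarrow> posdef_sym (G x)"

sublocale metric_patch \<subseteq> const: metric_family UNIV U "\<lambda>_. G"
proof
  have "smooth_on (UNIV \<times> U) (snd :: real \<times> (real^'n) \<Rightarrow> _)"
    by (intro smooth_on_linear bounded_linear_snd open_Times open_U open_UNIV)
  from smooth_on_compose[OF open_Times[OF open_UNIV open_U] open_U _ this smooth_G]
  show "smooth_on ((UNIV :: real set) \<times> U) (\<lambda>p. G (snd p))" by auto
qed (auto simp: open_U posdef)

lemma (in metric_family) patch: "t \<in> T \<Longrightarrow> metric_patch U (G t)"
  using smooth_on_slice[OF open_T open_U smooth_G] posdef open_U by unfold_locales auto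

context metric_patch
begin

lemmas static = smooth_on_slice[OF open_UNIV open_U _ UNIV_I[of 0]]

lemma smooth_metric: "smooth_on U (\<lambda>x. G x $ i $ j)"
  by (intro smooth_on_vec_nth open_U smooth_G)

lemma smooth_Gamma: "smooth_on U (christoffel G k i j)"
  using static[where F="\<lambda>_. christoffel G k i j", OF const.smooth_christoffel] .

lemma smooth_ginv_static: "smooth_on U (\<lambda>x. ginv (G x) i j)"
  using static[where F="\<lambda>_ x. ginv (G x) i j", OF const.smooth_ginv] .

lemma smooth_density: "smooth_on U (\<lambda>x. sqrt (det (G x)))"
  using static[where F="\<lambda>_ x. sqrt (det (G x))", OF const.smooth_volume_density] .

lemmas differentiable_metric = smooth_on_differentiable[OF smooth_metric]
lemmas differentiable_Gamma = smooth_on_differentiable[OF smooth_Gamma]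

lemma metric_sym: "x \<in> U \<Longrightarrow> G x $ i $ j = G x $ j $ i"
  using posdef_sym_sym[OF posdef] .

lemma partial_metric_sym: "x \<in> U \<Longrightarrow> partial k (\<lambda>y. G y $ i $ j) x = partial k (\<lambda>y. G y $ j $ i) x"
  by (rule partial_cong[OF open_U]) (auto intro: metric_sym differentiable_metric)

lemma christoffel_sym: "x \<in> U \<Longrightarrow> christoffel G k i j x = christoffel G k j i x"
  unfolding christoffel_def by (simp add: partial_metric_sym[of x _ i j] add.commute)

lemma partial_christoffel_sym:
  "x \<in> U \<Longrightarrow> partial l (christoffel G k i j) x = partial l (christoffel G k j i) x"
  by (rule partial_cong[OF open_U]) (auto intro: christoffel_sym differentiable_Gamma)

text \<open>The Christoffel symbols of the first kind. By \<open>gamma_low_eq\<close> they involve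
  no inverse metric.\<close>

definition gamma_low :: "'n \<Rightarrow> 'n \<Rightarrow> 'n \<Rightarrow> real^'n \<Rightarrow> real" where
  "gamma_low l i j x = (\<Oplus>k. G x $ l $ k * christoffel G k i j x)"

lemma gamma_low_eq:
  assumes "x \<in> U"
  shows "gamma_low l i j x = (1/2) * (partial i (\<lambda>y. G y $ j $ l) x + partial j (\<lambda>y. G y $ i $ l) x - partial l (\<lambda>y. G y $ i $ j) x)"
proof -
  define b where "b m = (1/2) * (partial i (\<lambda>y. G y $ j $ m) x + partial j (\<lambda>y. G y $ i $ m) x - partial m (\<lambda>y. G y $ i $ j) x)" for m
  have "gamma_low l i j x = (\<Oplus>k m. G x $ l $ k * (ginv (G x) k m * b m))"
    by (simp add: gamma_low_def christoffel_def b_def sum_distrib_left mult.left_commute)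
  also have "\<dots> = (\<Oplus>m k. (G x $ l $ k * ginv (G x) k m) * b m)" by (subst sum.swap) (simp add: mult.assoc)
  also have "\<dots> = (\<Oplus>m. (if l = m then 1 else 0) * b m)"
    by (simp only: sum_distrib_right[symmetric] ginv_right[OF posdef[OF assms]])
  also have "\<dots> = b l" by simp
  finally show ?thesis by (simp add: b_def)
qed

text \<open>The coordinate form of \<open>\<nabla> g = 0\<close>: in the sum of the two symbols all
  metric derivatives but one cancel.\<close>

lemma metric_compatible: "x \<in> U \<Longrightarrow> partial k (\<lambda>y. G y $ i $ j) x = gamma_low j k i x + gamma_low i k j x"
  by (simp add: gamma_low_eq partial_metric_sym[of x k j i] field_simps)

lemma riem_up_antisym: "riem_up G l j i k x = - riem_up G l i j k x"
  by (simp add: riem_up_def sum_subtractf)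

lemma riem_up_bianchi:
  assumes "x \<in> U"
  shows "riem_up G l i j k x + riem_up G l j k i x + riem_up G l k i j x = 0"
  by (simp add: riem_up_def sum_subtractf partial_christoffel_sym[OF assms, of _ _ k i] christoffel_sym[OF assms, of _ k i]
     partial_christoffel_sym[OF assms, of _ _ k j] christoffel_sym[OF assms, of _ k j]
     partial_christoffel_sym[OF assms, of _ _ j i] christoffel_sym[OF assms, of _ j i])

lemma smooth_gamma_low: "smooth_on U (gamma_low l i j)"
  unfolding gamma_low_def[abs_def] by (intro smooth_on_sum smooth_on_mult smooth_metric smooth_Gamma open_U)

text \<open>Prepares the antisymmetry in the last two indices. Pulling the lowering under the
  derivative costs a term with \<open>\<partial> g\<close>; expanding it by
  \<open>metric_compatible\<close> absorbs the quadratic part of the curvature and leaves products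
  of lowered and raised symbols with opposite signs.\<close>

lemma riem_eq:
  assumes x: "x \<in> U"
  shows "riem G i j k l x = partial i (gamma_low l j k) x - partial j (gamma_low l i k) x
     - (\<Oplus>m. gamma_low m i l x * christoffel G m j k x) + (\<Oplus>m. gamma_low m j l x * christoffel G m i k x)"
proof -
  have d: "partial i (gamma_low l j k) x =
     (\<Oplus>m. (gamma_low m i l x + gamma_low l i m x) * christoffel G m j k x) + (\<Oplus>m. G x $ l $ m * partial i (christoffel G m j k) x)" for i j
  proof -
    have "gamma_low l j k = (\<lambda>x. \<Oplus>m. G x $ l $ m * christoffel G m j k x)" by (rule ext) (rule gamma_low_def)
    then show ?thesis
    using x by (simp only:) (subst partial_sum
,
     auto intro!: differentiable_mult differentiable_metric differentiable_Gamma
        simp: partial_mult differentiable_metric differentiable_Gamma metric_compatible sum.distrib)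
  qed
  have e: "(\<Oplus>m. G x $ l $ m * (\<Oplus>p. christoffel G m i p x * christoffel G p j k x)) =
      (\<Oplus>p. gamma_low l i p x * christoffel G p j k x)" for i j
    by (simp add: gamma_low_def sum_distrib_left sum_distrib_right mult.assoc) (rule sum.swap)
  have "riem G i j k l x = (\<Oplus>m. G x $ l $ m * partial i (christoffel G m j k) x) - (\<Oplus>m. G x $ l $ m * partial j (christoffel G m i k) x)
    + (\<Oplus>m. G x $ l $ m * (\<Oplus>p. christoffel G m i p x * christoffel G p j k x))
    - (\<Oplus>m. G x $ l $ m * (\<Oplus>p. christoffel G m j p x * christoffel G p i k x))"
    by (simp add: riem_def riem_up_def sum_subtractf sum.distrib algebra_simps)
  then show ?thesis
    unfolding e by (simp add: d sum.distrib distrib_right)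
qed

lemma riem_antisym1: "riem G j i k l x = - riem G i j k l x"
  unfolding riem_def riem_up_antisym[of _ j i] by (simp add: sum_negf)

text \<open>Adding the two expressions from \<open>riem_eq\<close>, the derivative terms combine to
  second partial derivatives of the metric, which commute (\<open>P\<close>), and the quadratic
  terms cancel in pairs (\<open>Q\<close>).\<close>

lemma riem_antisym2:
  assumes x: "x \<in> U"
  shows "riem G i j l k x = - riem G i j k l x"
proof -
  have Q: "(\<Oplus>m. gamma_low m a b x * christoffel G m c d x) = (\<Oplus>m. gamma_low m c d x * christoffel G m a b x)" for a b c d
    unfolding gamma_low_def sum_distrib_right
    by (subst sum.swap) (simp add: metric_sym[OF x] mult_ac)
  have P: "partial i (gamma_low l j k) x + partial i (gamma_low k j l) x = partial i (partial j (\<lambda>y. G y $ k $ l)) x" for i j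
  proof -
    have "partial i (partial j (\<lambda>y. G y $ k $ l)) x = partial i (\<lambda>y. gamma_low l j k y + gamma_low k j l y) x"
      by (rule partial_cong[OF open_U x metric_compatible])
         (auto intro!: smooth_on_differentiable[OF smooth_on_partial[OF smooth_metric]] x)
    also have "\<dots> = partial i (gamma_low l j k) x + partial i (gamma_low k j l) x"
      by (intro partial_add smooth_on_differentiable[OF smooth_gamma_low] x)
    finally show ?thesis by simp
  qed
  have "partial i (partial j (\<lambda>y. G y $ k $ l)) x = partial j (partial i (\<lambda>y. G y $ k $ l)) x"
    by (rule partial_commute[OF open_U smooth_metric x])
  then show ?thesis
    unfolding riem_eq[OF x] using P[of i j] P[of j i] Q[of i k j l] Q[of j k i l] by simp
qed

lemma riem_bianchi:
  assumes x: "x \<in> U"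
  shows "riem G i j k l x + riem G j k i l x + riem G k i j l x = 0"
proof -
  have "riem G i j k l x + riem G j k i l x + riem G k i j l x =
    (\<Oplus>m. G x $ l $ m * (riem_up G m i j k x + riem_up G m j k i x + riem_up G m k i j x))"
    by (simp add: riem_def distrib_left sum.distrib)
  then show ?thesis by (simp add: riem_up_bianchi[OF x])
qed

end

section \<open>Vanishing sectional curvature implies vanishing curvature tensor\<close>

definition quadrilinear :: "('n \<Rightarrow> 'n \<Rightarrow> 'n \<Rightarrow> 'n \<Rightarrow> real) \<Rightarrow> real^'n::finite \<Rightarrow> real^'n \<Rightarrow> real^'n \<Rightarrow> real^'n \<Rightarrow> real" where
  "quadrilinear R X Y Z W = (\<Oplus>i j k l. R i j k l * X $ i * Y $ j * Z $ k * W $ l)"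

lemma quadrilinear_add:
  "quadrilinear R (X + X') Y Z W = quadrilinear R X Y Z W + quadrilinear R X' Y Z W"
  "quadrilinear R X (Y + Y') Z W = quadrilinear R X Y Z W + quadrilinear R X Y' Z W"
  "quadrilinear R X Y (Z + Z') W = quadrilinear R X Y Z W + quadrilinear R X Y Z' W"
  "quadrilinear R X Y Z (W + W') = quadrilinear R X Y Z W + quadrilinear R X Y Z W'"
  by (simp_all add: quadrilinear_def algebra_simps sum.distrib)

lemma quadrilinear_scale:
  "quadrilinear R (c *\<^sub>R X) Y Z W = c * quadrilinear R X Y Z W"
  "quadrilinear R X (c *\<^sub>R Y) Z W = c * quadrilinear R X Y Z W"
  by (simp_all add: quadrilinear_def sum_distrib_left mult_ac)

lemma quadrilinear_axis: "quadrilinear R (axis i 1) (axis j 1) (axis k 1) (axis l 1) = R i j k l"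
  by (simp add: quadrilinear_def axis_def if_distrib[of "\<lambda>x. _ * x"] cong: if_cong)

lemma quadrilinear_antisym:
  assumes "\<And>i j k l. R j i k l = - R i j k l"
  shows "quadrilinear R Y X Z W = - quadrilinear R X Y Z W"
  unfolding quadrilinear_def
  by (subst sum.swap, subst assms) (simp add: sum_negf mult_ac)

text \<open>Polarisation. The form \<open>R(X, Y, Y, X)\<close> is polarised first in
  \<open>X\<close>, which with pair symmetry gives \<open>R i j j l = 0\<close>, then in
  \<open>Y\<close>, which gives antisymmetry in the two middle indices.\<close>

lemma curvature_tensor_eq_0:
  fixes R :: "'n::finite \<Rightarrow> 'n \<Rightarrow> 'n \<Rightarrow> 'n \<Rightarrow> real"
  assumes a1: "\<And>i j k l. R j i k l = - R i j k l" and a2: "\<And>i j k l. R i j l k = - R i j k l"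
    and b: "\<And>i j k l. R i j k l + R j k i l + R k i j l = 0"
    and 0: "\<And>X Y. quadrilinear R X Y Y X = 0"
  shows "R i j k l = 0"
proof -
  \<comment> \<open>Pair symmetry comes from combining the Bianchi identities for the four cyclic
    shifts of the indices with the two antisymmetries.\<close>
  have pair: "R i j k l = R k l i j" for i j k l
    using b[of i j k l] b[of j k l i] b[of k l i j] b[of l i j k] a1 a2
    by (smt (verit))
  have "R i j j l = 0" for i j l
  proof -
    have "R i j j i = 0" for i j using 0[of "axis i 1" "axis j 1"] by (simp add: quadrilinear_axis)
    moreover have "R i j j i + R i j j l + R l j j i + R l j j l = 0"
      using 0[of "axis i 1 + axis l 1" "axis j 1"] by (simp add: quadrilinear_add quadrilinear_axis)
    ultimately have "R i j j l + R l j j i = 0" by simp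
    moreover have "R l j j i = R i j j l" using pair[of l j j i] a1[of i j l j] a2[of i j j l] by linarith
    ultimately show ?thesis by simp
  qed
  note z = this
  have anti: "R i j k l = - R i k j l" for i j k l
  proof -
    have e: "quadrilinear R X Y Y (axis l 1) = 0" if "X = axis i 1" "Y = axis j 1 + axis k 1" for X Y
    proof -
      have "quadrilinear R X Y Y X = 0" "quadrilinear R (axis l 1) Y Y (axis l 1) = 0"
        "quadrilinear R (X + axis l 1) Y Y (X + axis l 1) = 0" using 0 by auto
      then have "quadrilinear R X Y Y (axis l 1) + quadrilinear R (axis l 1) Y Y X = 0"
        by (simp add: quadrilinear_add)
      moreover have "quadrilinear R (axis l 1) Y Y X = quadrilinear R X Y Y (axis l 1)"
        using pair[of l j k i] pair[of l k j i] a1[of i k l j] a2[of i k j l] a1[of i j l k] a2[of i j k l]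
          z[of l j i] z[of l k i] z[of i j l] z[of i k l]
        unfolding that quadrilinear_add quadrilinear_axis by linarith
      ultimately show ?thesis by simp
    qed
    from e[OF refl refl] show ?thesis
      using z[of i j l] z[of i k l] unfolding quadrilinear_add quadrilinear_axis by linarith
  qed
  \<comment> \<open>With antisymmetry in the first and in the middle pair, the three terms of the
    Bianchi identity are equal, so it reads \<open>3 * R i j k l = 0\<close>.\<close>
  show ?thesis using b[of i j k l] anti[of i j k l] anti[of j i k l] a1[of i j k l] a1[of i k j l] by linarith
qed

context metric_patch
begin

text \<open>For independent vectors the denominator of the sectional curvature is positive, so the
  numerator has to vanish; for dependent ones the numerator vanishes by antisymmetry. Excluding
  division by zero is the main work.\<close>

lemma flat_imp_riem_eq_0:
  assumes x: "x \<in> U" and flat: "\<And>X Y. X \<noteq> Y \<Longrightarrow> independent {X, Y} \<Longrightarrow> sectional_curv G x X Y = 0"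
  shows "riem G i j k l x = 0"
proof (rule curvature_tensor_eq_0[where R="\<lambda>i j k l. riem G i j k l x"])
  let ?R = "\<lambda>i j k l. riem G i j k l x"
  have anti: "quadrilinear ?R X X Z W = 0" for X Z W
    using quadrilinear_antisym[of ?R X X Z W, OF riem_antisym1] by simp
  fix X Y
  show "quadrilinear ?R X Y Y X = 0"
  proof (cases "X \<noteq> Y \<and> independent {X, Y}")
    case True
    define a b c where "a = X \<bullet> (G x *v X)" and "b = Y \<bullet> (G x *v Y)" and "c = X \<bullet> (G x *v Y)"
    have sym: "u \<bullet> (G x *v v) = v \<bullet> (G x *v u)" for u v
      using posdef[OF x] dot_lmul_matrix[of u "G x" v] transpose_matrix_vector[of "G x" u]
      by (simp add: posdef_sym_def inner_commute)
    have "Y \<noteq> 0" using True dependent_zero[of "{X, Y}"] by auto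
    then have b: "b > 0" using posdef[OF x] by (simp add: b_def posdef_sym_def)
    \<comment> \<open>Strict Cauchy-Schwarz: this vector is \<open>b\<close> times the component of
      \<open>X\<close> orthogonal to \<open>Y\<close>, and its squared length is
      \<open>b * (a * b - c\<^sup>2)\<close>.\<close>
    have "b *\<^sub>R X - c *\<^sub>R Y \<noteq> 0"
    proof
      assume "b *\<^sub>R X - c *\<^sub>R Y = 0"
      then have "X = (c / b) *\<^sub>R Y" using b by (simp add: field_simps vec_eq_iff)
      then have "X \<in> span {Y}" by (simp add: span_breakdown_eq span_mul span_base)
      with True show False by (auto simp: independent_insert)
    qed
    then have "(b *\<^sub>R X - c *\<^sub>R Y) \<bullet> (G x *v (b *\<^sub>R X - c *\<^sub>R Y)) > 0"
      using posdef[OF x] by (simp add: posdef_sym_def)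
    also have "(b *\<^sub>R X - c *\<^sub>R Y) \<bullet> (G x *v (b *\<^sub>R X - c *\<^sub>R Y)) = b * (a * b - c\<^sup>2)"
      by (simp add: matrix_vector_mult_diff_distrib matrix_vector_mult_scaleR inner_diff_left inner_diff_right
          a_def[symmetric] b_def[symmetric] c_def[symmetric] sym[of Y X] power2_eq_square algebra_simps)
    finally have "a * b - c\<^sup>2 > 0" using b by (simp add: zero_less_mult_iff)
    then show ?thesis using flat[of X Y] True
      by (simp add: sectional_curv_def quadrilinear_def a_def b_def c_def)
  next
    case False
    have "\<exists>c. X = c *\<^sub>R Y \<or> Y = c *\<^sub>R X"
    proof (cases "X = Y")
      case True then show ?thesis by (intro exI[of _ 1]) simp
    next
      case neq: False
      then have "dependent {Y} \<or> X \<in> span {Y}" using False by (auto simp: independent_insert)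
      then show ?thesis
      proof
        assume "dependent {Y}" then have "Y = 0 *\<^sub>R X" by (simp add: dependent_single)
        then show ?thesis by blast
      next
        assume "X \<in> span {Y}" then show ?thesis by (auto simp: span_singleton)
      qed
    qed
    then show ?thesis
      using anti by (auto simp: quadrilinear_scale)
  qed
qed (rule riem_antisym1 riem_antisym2[OF x] riem_bianchi[OF x])+

lemma riem_up_from_riem:
  assumes x: "x \<in> U"
  shows "riem_up G m i j k x = (\<Oplus>l. ginv (G x) m l * riem G i j k l x)"
proof -
  have "(\<Oplus>l. ginv (G x) m l * riem G i j k l x) = (\<Oplus>p l. (ginv (G x) m l * G x $ l $ p) * riem_up G p i j k x)"
    unfolding riem_def sum_distrib_left by (subst sum.swap) (simp add: mult.assoc)
  also have "\<dots> = (\<Oplus>p. (if m = p then 1 else 0) * riem_up G p i j k x)"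
    by (simp only: sum_distrib_right[symmetric] ginv_left[OF posdef[OF x]])
  finally show ?thesis by simp
qed

end

section \<open>Bochner's formula\<close>

text \<open>The component \<open>\<nabla>\<^sub>k V\<^sup>i\<close> of the covariant derivative of a
  vector field, with the upper index first.\<close>

definition nabla :: "(real^'n \<Rightarrow> real^'n^'n) \<Rightarrow> ('n::finite \<Rightarrow> real^'n \<Rightarrow> real) \<Rightarrow> 'n \<Rightarrow> 'n \<Rightarrow> real^'n \<Rightarrow> real" where
  "nabla G V i k x = partial k (V i) x + (\<Oplus>m. christoffel G i k m x * V m x)"

text \<open>The components of \<open>\<nabla>\<^sub>V V - (div V) V\<close>.\<close>

definition bochner_field :: "(real^'n \<Rightarrow> real^'n^'n) \<Rightarrow> ('n::finite \<Rightarrow> real^'n \<Rightarrow> real) \<Rightarrow> 'n \<Rightarrow> real^'n \<Rightarrow> real" where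
  "bochner_field G V i x = (\<Oplus>k. V k x * nabla G V i k x) - V i x * (\<Oplus>k. nabla G V k k x)"

text \<open>Here \<open>B i k\<close> stands for \<open>\<partial>\<^sub>i V\<^sup>k\<close>, \<open>DD l k i\<close> for \<open>\<partial>\<^sub>l \<partial>\<^sub>k V\<^sup>i\<close>, \<open>d\<Gamma> l i k m\<close> for
  \<open>\<partial>\<^sub>l \<Gamma>\<^sup>i\<^sub>k\<^sub>m\<close> and \<open>A i k\<close> for \<open>\<nabla>\<^sub>k V\<^sup>i\<close>.\<close>

lemma bochner_algebra:
  fixes \<Gamma> :: "'n::finite \<Rightarrow> 'n \<Rightarrow> 'n \<Rightarrow> real" and V :: "'n \<Rightarrow> real" and B :: "'n \<Rightarrow> 'n \<Rightarrow> real"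
  assumes sym: "\<And>i k m. \<Gamma> i k m = \<Gamma> i m k" and DD: "\<And>l k i. DD l k i = DD k l i"
    and ric: "\<And>k m. (\<Oplus>i. d\<Gamma> i i k m - d\<Gamma> k i i m) + (\<Oplus>i p. \<Gamma> i i p * \<Gamma> p k m - \<Gamma> i k p * \<Gamma> p i m) = 0"
    and A: "\<And>i k. A i k = B k i + (\<Oplus>m. \<Gamma> i k m * V m)"
    and dA: "\<And>l i k. dA l i k = DD l k i + (\<Oplus>m. d\<Gamma> l i k m * V m + \<Gamma> i k m * B l m)"
  shows "(\<Oplus>i. (\<Oplus>k. B i k * A i k + V k * dA i i k) - (B i i * (\<Oplus>k. A k k) + V i * (\<Oplus>k. dA i k k)))
     + (\<Oplus>i. (\<Oplus>m. \<Gamma> m m i) * ((\<Oplus>k. V k * A i k) - V i * (\<Oplus>k. A k k)))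
     = (\<Oplus>i k. A i k * A k i) - (\<Oplus>k. A k k)\<^sup>2"
proof -
  \<comment> \<open>\<open>N\<close> is the connection part of the covariant derivative;
    \<open>T\<close> is the contracted Christoffel symbol, which is the logarithmic derivative of
    the volume density.\<close>
  define N where "N i k = (\<Oplus>m. \<Gamma> i k m * V m)" for i k
  define T where "T i = (\<Oplus>m. \<Gamma> m m i)" for i
  define trA where "trA = (\<Oplus>k. A k k)"
  have AN: "A i k = B k i + N i k" for i k using A by (simp add: N_def)
  have 1: "(\<Oplus>i k. V k * dA i i k) - (\<Oplus>i k. V i * dA i k k) = (\<Oplus>k. V k * (\<Oplus>i. dA i i k - dA k i i))"
    by (subst sum.swap) (simp add: sum_distrib_left right_diff_distrib sum_subtractf)
  have TN: "(\<Oplus>m. V m * (\<Oplus>i p. \<Gamma> i i p * \<Gamma> p k m)) = (\<Oplus>p. T p * N p k)" for k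
  proof -
    have "(\<Oplus>p. T p * N p k) = (\<Oplus>p m i. V m * (\<Gamma> i i p * \<Gamma> p k m))"
      by (simp add: T_def N_def sum_distrib_left sum_distrib_right mult_ac)
    also have "\<dots> = (\<Oplus>m p i. V m * (\<Gamma> i i p * \<Gamma> p k m))" by (rule sum.swap)
    also have "\<dots> = (\<Oplus>m i p. V m * (\<Gamma> i i p * \<Gamma> p k m))" by (rule sum.cong[OF refl], rule sum.swap)
    finally show ?thesis by (simp add: sum_distrib_left)
  qed
  have GN: "(\<Oplus>m. V m * (\<Oplus>i p. \<Gamma> i k p * \<Gamma> p i m)) = (\<Oplus>i p. \<Gamma> i k p * N p i)" for k
  proof -
    have "(\<Oplus>m. V m * (\<Oplus>i p. \<Gamma> i k p * \<Gamma> p i m)) = (\<Oplus>m i p. \<Gamma> i k p * (\<Gamma> p i m * V m))"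
      by (simp add: sum_distrib_left mult_ac)
    also have "\<dots> = (\<Oplus>i m p. \<Gamma> i k p * (\<Gamma> p i m * V m))" by (rule sum.swap)
    also have "\<dots> = (\<Oplus>i p m. \<Gamma> i k p * (\<Gamma> p i m * V m))" by (rule sum.cong[OF refl], rule sum.swap)
    finally show ?thesis by (simp add: N_def sum_distrib_left)
  qed
  \<comment> \<open>The contracted Ricci identity: the derivatives of \<open>\<Gamma>\<close> occur
    only in the combination entering the Ricci tensor, so \<open>ric\<close> replaces them by
    products of Christoffel symbols. These complete \<open>B\<close> to the covariant derivative
    \<open>A\<close>.\<close>
  have 2: "(\<Oplus>i. dA i i k - dA k i i) = (\<Oplus>i p. \<Gamma> i k p * A p i) - (\<Oplus>p. T p * A p k)" for k
  proof -
    have "(\<Oplus>i. dA i i k - dA k i i) =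
      (\<Oplus>i m. (d\<Gamma> i i k m - d\<Gamma> k i i m) * V m) + (\<Oplus>i m. \<Gamma> i k m * B i m) - (\<Oplus>i m. \<Gamma> i i m * B k m)"
      unfolding dA by (simp add: DD[of _ k] sum.distrib sum_subtractf algebra_simps)
    also have "(\<Oplus>i m. (d\<Gamma> i i k m - d\<Gamma> k i i m) * V m) = (\<Oplus>m. V m * (\<Oplus>i. d\<Gamma> i i k m - d\<Gamma> k i i m))"
      by (subst sum.swap) (simp add: sum_distrib_left mult.commute)
    also have "\<dots> = - (\<Oplus>m. V m * (\<Oplus>i p. \<Gamma> i i p * \<Gamma> p k m - \<Gamma> i k p * \<Gamma> p i m))"
      using ric[of k] by (simp add: eq_neg_iff_add_eq_0[symmetric] sum_negf)
    also have "\<dots> = (\<Oplus>i p. \<Gamma> i k p * N p i) - (\<Oplus>p. T p * N p k)"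
      by (simp add: sum_subtractf right_diff_distrib TN GN)
    also have "(\<Oplus>i m. \<Gamma> i i m * B k m) = (\<Oplus>m. T m * B k m)"
      by (subst sum.swap) (simp add: T_def sum_distrib_right)
    finally show ?thesis by (simp add: AN sum.distrib distrib_left)
  qed
  have 3: "(\<Oplus>k. V k * (\<Oplus>i p. \<Gamma> i k p * A p i)) = (\<Oplus>i p. N i p * A p i)"
  proof -
    have "(\<Oplus>k. V k * (\<Oplus>i p. \<Gamma> i k p * A p i)) = (\<Oplus>k i p. \<Gamma> i p k * V k * A p i)"
      by (simp add: sum_distrib_left mult_ac sym[of _ _ p for p])
    also have "\<dots> = (\<Oplus>i k p. \<Gamma> i p k * V k * A p i)" by (rule sum.swap)
    also have "\<dots> = (\<Oplus>i p k. \<Gamma> i p k * V k * A p i)" by (rule sum.cong[OF refl], rule sum.swap)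
    finally show ?thesis by (simp add: N_def sum_distrib_right)
  qed
  have 4: "(\<Oplus>k. V k * (\<Oplus>p. T p * A p k)) = (\<Oplus>i. T i * (\<Oplus>k. V k * A i k))"
    by (simp add: sum_distrib_left mult_ac) (rule sum.swap)
  have P: "(\<Oplus>k. V k * (\<Oplus>i. dA i i k - dA k i i)) = (\<Oplus>i p. N i p * A p i) - (\<Oplus>i. T i * (\<Oplus>k. V k * A i k))"
    unfolding 2 unfolding right_diff_distrib sum_subtractf 3 4 ..
  have 5: "(\<Oplus>i k. A i k * A k i) = (\<Oplus>i k. B i k * A i k) + (\<Oplus>i k. N i k * A k i)"
  proof -
    have "(\<Oplus>i k. A i k * A k i) = (\<Oplus>i k. B k i * A k i) + (\<Oplus>i k. N i k * A k i)"
      by (subst AN) (simp add: distrib_right sum.distrib)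
    also have "(\<Oplus>i k. B k i * A k i) = (\<Oplus>i k. B i k * A i k)" by (rule sum.swap)
    finally show ?thesis .
  qed
  have 6: "(\<Oplus>i. T i * V i) = (\<Oplus>i. N i i)"
    by (simp add: T_def N_def sum_distrib_right) (rule sum.swap)
  have tr: "trA = (\<Oplus>i. B i i) + (\<Oplus>i. N i i)" by (simp add: trA_def AN sum.distrib)
  have "(\<Oplus>i. (\<Oplus>k. B i k * A i k + V k * dA i i k) - (B i i * trA + V i * (\<Oplus>k. dA i k k)))
     + (\<Oplus>i. T i * ((\<Oplus>k. V k * A i k) - V i * trA))
     = (\<Oplus>i k. B i k * A i k) + ((\<Oplus>i k. V k * dA i i k) - (\<Oplus>i k. V i * dA i k k))
       - (\<Oplus>i. B i i) * trA + (\<Oplus>i. T i * (\<Oplus>k. V k * A i k)) - (\<Oplus>i. T i * V i) * trA"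
    by (simp add: sum.distrib sum_subtractf sum_distrib_left sum_distrib_right algebra_simps)
  also have "\<dots> = (\<Oplus>i k. A i k * A k i) - trA\<^sup>2"
    unfolding 1 P 5 6 by (simp add: tr power2_eq_square algebra_simps)
  finally show ?thesis unfolding trA_def T_def .
qed

context metric_patch
begin

lemma raise_gamma_low:
  assumes x: "x \<in> U"
  shows "(\<Oplus>l. ginv (G x) k l * gamma_low l i j x) = christoffel G k i j x"
proof -
  have "(\<Oplus>l. ginv (G x) k l * gamma_low l i j x) = (\<Oplus>p l. (ginv (G x) k l * G x $ l $ p) * christoffel G p i j x)"
    unfolding gamma_low_def sum_distrib_left by (subst sum.swap) (simp add: mult.assoc)
  also have "\<dots> = (\<Oplus>p. (if k = p then 1 else 0) * christoffel G p i j x)"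
    by (simp only: sum_distrib_right[symmetric] ginv_left[OF posdef[OF x]])
  finally show ?thesis by (simp only: sum_delta_mult)
qed

text \<open>Jacobi's formula along a coordinate line produces the trace of
  \<open>g\<^sup>-\<^sup>1 \<partial>\<^sub>i g\<close>. By \<open>metric_compatible\<close> this
  trace splits into two equal contractions of Christoffel symbols, and the factor \<open>2\<close>
  cancels against the square root.\<close>

lemma partial_density:
  assumes x: "x \<in> U"
  shows "partial i (\<lambda>y. sqrt (det (G y))) x = sqrt (det (G x)) * (\<Oplus>m. christoffel G m m i x)"
proof -
  have pos: "det (G x) > 0" using posdef_sym_det[OF posdef[OF x]] .
  have "((\<lambda>s. det (G (x + s *\<^sub>R axis i 1))) has_real_derivative
      det (G (x + 0 *\<^sub>R axis i 1)) * (\<Oplus>k l. ginv (G (x + 0 *\<^sub>R axis i 1)) k l * partial i (\<lambda>y. G y $ l $ k) x)) (at 0)"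
    using posdef_sym_invertible[OF posdef[OF x]] by (intro DERIV_det partial_line differentiable_metric x) simp
  moreover have "(\<Oplus>k l. ginv (G x) k l * partial i (\<lambda>y. G y $ l $ k) x) = 2 * (\<Oplus>m. christoffel G m m i x)"
  proof -
    have "(\<Oplus>k l. ginv (G x) k l * partial i (\<lambda>y. G y $ l $ k) x) =
      (\<Oplus>k l. ginv (G x) k l * gamma_low k i l x) + (\<Oplus>k l. ginv (G x) k l * gamma_low l i k x)"
      by (simp add: metric_compatible[OF x] distrib_left sum.distrib)
    also have "(\<Oplus>k l. ginv (G x) k l * gamma_low k i l x) = (\<Oplus>l k. ginv (G x) l k * gamma_low k i l x)"
      by (subst sum.swap) (simp add: ginv_sym[OF posdef[OF x]])
    finally show ?thesis by (simp add: raise_gamma_low[OF x] christoffel_sym[OF x, of _ i])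
  qed
  ultimately have D: "((\<lambda>s. det (G (x + s *\<^sub>R axis i 1))) has_real_derivative
      det (G x) * (2 * (\<Oplus>m. christoffel G m m i x))) (at 0)" by simp
  have 1: "((\<lambda>s. sqrt (det (G (x + s *\<^sub>R axis i 1)))) has_real_derivative
     inverse (sqrt (det (G x))) / 2 * (det (G x) * (2 * (\<Oplus>m. christoffel G m m i x)))) (at 0)"
    by (rule DERIV_chain2[where f=sqrt, OF _ D]) (use DERIV_real_sqrt[OF pos] in simp)
  have "inverse (sqrt (det (G x))) * det (G x) = sqrt (det (G x))"
    using pos by (simp add: field_simps flip: real_sqrt_mult)
  then have 2: "inverse (sqrt (det (G x))) / 2 * (det (G x) * (2 * (\<Oplus>m. christoffel G m m i x))) = sqrt (det (G x)) * (\<Oplus>m. christoffel G m m i x)"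
    by (simp add: mult.assoc[symmetric])
  show ?thesis
    using DERIV_unique[OF partial_line 1] smooth_on_differentiable[OF smooth_density x] 2 by simp
qed

context
  fixes V :: "'n \<Rightarrow> real^'n \<Rightarrow> real"
  assumes V: "\<And>i. smooth_on U (V i)"
begin

lemma smooth_nabla: "smooth_on U (nabla G V i k)"
  unfolding nabla_def[abs_def]
  by (intro smooth_on_add smooth_on_sum smooth_on_mult smooth_Gamma smooth_on_partial V open_U)

lemma smooth_bochner_field: "smooth_on U (bochner_field G V i)"
  unfolding bochner_field_def[abs_def]
  by (intro smooth_on_diff smooth_on_sum smooth_on_mult smooth_nabla V open_U)

lemma partial_nabla:
  assumes x: "x \<in> U"
  shows "partial l (nabla G V i k) x = partial l (partial k (V i)) x +
    (\<Oplus>m. partial l (christoffel G i k m) x * V m x + christoffel G i k m x * partial l (V m) x)"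
proof -
  have "partial l (nabla G V i k) x = partial l (\<lambda>x. partial k (V i) x + (\<Oplus>m. christoffel G i k m x * V m x)) x"
    by (simp add: nabla_def[abs_def])
  also have "\<dots> = partial l (partial k (V i)) x + partial l (\<lambda>x. \<Oplus>m. christoffel G i k m x * V m x) x"
    by (intro partial_add smooth_on_differentiable[OF _ x] smooth_on_sum smooth_on_mult smooth_Gamma smooth_on_partial V open_U)
  also have "partial l (\<lambda>x. \<Oplus>m. christoffel G i k m x * V m x) x = (\<Oplus>m. partial l (\<lambda>x. christoffel G i k m x * V m x) x)"
    by (intro partial_sum smooth_on_differentiable[OF _ x] smooth_on_mult smooth_Gamma V open_U)
  also have "\<dots> = (\<Oplus>m. partial l (christoffel G i k m) x * V m x + christoffel G i k m x * partial l (V m) x)"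
    by (intro sum.cong refl partial_mult smooth_on_differentiable[OF _ x] smooth_Gamma V)
  finally show ?thesis .
qed

lemma partial_bochner_field:
  assumes x: "x \<in> U"
  shows "partial l (bochner_field G V i) x =
    (\<Oplus>k. partial l (V k) x * nabla G V i k x + V k x * partial l (nabla G V i k) x)
    - (partial l (V i) x * (\<Oplus>k. nabla G V k k x) + V i x * (\<Oplus>k. partial l (nabla G V k k) x))"
proof -
  have "partial l (bochner_field G V i) x = partial l (\<lambda>x. (\<Oplus>k. V k x * nabla G V i k x) - V i x * (\<Oplus>k. nabla G V k k x)) x"
    by (simp add: bochner_field_def[abs_def])
  also have "\<dots> = partial l (\<lambda>x. \<Oplus>k. V k x * nabla G V i k x) x - partial l (\<lambda>x. V i x * (\<Oplus>k. nabla G V k k x)) x"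
    by (intro partial_diff smooth_on_differentiable[OF _ x] smooth_on_sum smooth_on_mult smooth_nabla V open_U)
  also have "partial l (\<lambda>x. \<Oplus>k. V k x * nabla G V i k x) x = (\<Oplus>k. partial l (\<lambda>x. V k x * nabla G V i k x) x)"
    by (intro partial_sum smooth_on_differentiable[OF _ x] smooth_on_mult smooth_nabla V open_U)
  also have "\<dots> = (\<Oplus>k. partial l (V k) x * nabla G V i k x + V k x * partial l (nabla G V i k) x)"
    by (intro sum.cong refl partial_mult smooth_on_differentiable[OF _ x] smooth_nabla V)
  also have "partial l (\<lambda>x. V i x * (\<Oplus>k. nabla G V k k x)) x =
     partial l (V i) x * (\<Oplus>k. nabla G V k k x) + V i x * partial l (\<lambda>x. \<Oplus>k. nabla G V k k x) x"
    by (intro partial_mult smooth_on_differentiable[OF _ x] smooth_on_sum smooth_nabla V open_U)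
  also have "partial l (\<lambda>x. \<Oplus>k. nabla G V k k x) x = (\<Oplus>k. partial l (nabla G V k k) x)"
    by (intro partial_sum smooth_on_differentiable[OF _ x] smooth_nabla)
  finally show ?thesis .
qed

text \<open>Bochner's formula \<open>div (\<nabla>\<^sub>V V - (div V) V) = tr ((\<nabla>V)\<^sup>2) - (div V)\<^sup>2 + Ric(V, V)\<close>, for \<open>Ric = 0\<close>.\<close>

lemma bochner_formula:
  assumes x: "x \<in> U" and ric: "\<And>j k. ricci G j k x = 0"
  shows "(\<Oplus>i. partial i (\<lambda>y. sqrt (det (G y)) * bochner_field G V i y) x) =
    sqrt (det (G x)) * ((\<Oplus>i k. nabla G V i k x * nabla G V k i x) - (\<Oplus>k. nabla G V k k x)\<^sup>2)"
proof -
  have gen: "(\<Oplus>i. c * T i * X i + c * P i) = c * ((\<Oplus>i. P i) + (\<Oplus>i. T i * X i))"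
    for c :: real and T X P :: "'n \<Rightarrow> real"
    by (simp add: sum.distrib sum_distrib_left distrib_left mult.assoc)
  have "(\<Oplus>i. partial i (\<lambda>y. sqrt (det (G y)) * bochner_field G V i y) x) =
    (\<Oplus>i. sqrt (det (G x)) * (\<Oplus>m. christoffel G m m i x) * bochner_field G V i x + sqrt (det (G x)) * partial i (bochner_field G V i) x)"
    by (intro sum.cong refl trans[OF partial_mult] smooth_on_differentiable[OF _ x] smooth_density smooth_bochner_field)
       (simp add: partial_density[OF x])
  also have "\<dots> = sqrt (det (G x)) * ((\<Oplus>i. partial i (bochner_field G V i) x) + (\<Oplus>i. (\<Oplus>m. christoffel G m m i x) * bochner_field G V i x))"
    by (rule gen)
  also have "(\<Oplus>i. partial i (bochner_field G V i) x) + (\<Oplus>i. (\<Oplus>m. christoffel G m m i x) * bochner_field G V i x)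
    = (\<Oplus>i k. nabla G V i k x * nabla G V k i x) - (\<Oplus>k. nabla G V k k x)\<^sup>2"
    unfolding partial_bochner_field[OF x] bochner_field_def
  proof (rule bochner_algebra[where \<Gamma>="\<lambda>i k m. christoffel G i k m x" and B="\<lambda>i k. partial i (V k) x"
      and DD="\<lambda>l k i. partial l (partial k (V i)) x" and d\<Gamma>="\<lambda>l i k m. partial l (christoffel G i k m) x"])
    show "christoffel G i k m x = christoffel G i m k x" for i k m by (rule christoffel_sym[OF x])
    show "partial l (partial k (V i)) x = partial k (partial l (V i)) x" for l k i
      by (rule partial_commute[OF open_U V x])
    show "(\<Oplus>i. partial i (christoffel G i k m) x - partial k (christoffel G i i m) x) +
      (\<Oplus>i p. christoffel G i i p x * christoffel G p k m x - christoffel G i k p x * christoffel G p i m x) = 0" for k m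
      using ric[of k m] by (simp add: ricci_def riem_up_def sum.distrib)
  qed (rule nabla_def partial_nabla[OF x])+
  finally show ?thesis .
qed

end

end

section \<open>First and second variation of curvature\<close>

definition gradient :: "(real^'n \<Rightarrow> real^'n^'n) \<Rightarrow> (real^'n \<Rightarrow> real) \<Rightarrow> 'n::finite \<Rightarrow> real^'n \<Rightarrow> real" where
  "gradient G f k x = (\<Oplus>l. ginv (G x) k l * partial l f x)"

definition hessian :: "(real^'n \<Rightarrow> real^'n^'n) \<Rightarrow> (real^'n \<Rightarrow> real) \<Rightarrow> 'n::finite \<Rightarrow> 'n \<Rightarrow> real^'n \<Rightarrow> real" where
  "hessian G f i k x = partial i (partial k f) x - (\<Oplus>m. christoffel G m i k x * partial m f x)"

text \<open>Here \<open>C\<close> is the variation of \<open>\<Gamma>\<close> and \<open>D\<close>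
  its space derivative, \<open>L\<close> the lowered symbols, \<open>dg\<close> the metric
  derivatives, \<open>F\<close> and \<open>FF\<close> the derivatives of \<open>f\<close>,
  \<open>V\<close> the gradient with derivatives \<open>B\<close>, \<open>A\<close> its covariant
  derivative and \<open>H\<close> the Hessian. The identity is
  \<open>\<nabla>\<^sub>i C\<^sub>j - \<nabla>\<^sub>j C\<^sub>i\<close> written in coordinates:
  every term without covariant meaning cancels.\<close>

lemma riem_variation_algebra:
  fixes \<Gamma> C :: "'n::finite \<Rightarrow> 'n \<Rightarrow> 'n \<Rightarrow> real"
  assumes C: "\<And>l j k. C l j k = (1/2) * (F j * (if l = k then 1 else 0) + F k * (if l = j then 1 else 0) - V l * g j k)"
    and D: "\<And>i l j k. D i l j k = (1/2) * (FF i j * (if l = k then 1 else 0) + FF i k * (if l = j then 1 else 0) - (B i l * g j k + V l * dg i j k))"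
    and L: "\<And>i j k. L i j k = (\<Oplus>m. g i m * \<Gamma> m j k)"
    and dg: "\<And>i j k. dg i j k = L k i j + L j i k"
    and sym: "\<And>i j k. \<Gamma> i j k = \<Gamma> i k j" "\<And>i j. FF i j = FF j i"
    and A: "\<And>l i. A l i = B i l + (\<Oplus>m. \<Gamma> l i m * V m)"
    and H: "\<And>i k. H i k = FF i k - (\<Oplus>m. \<Gamma> m i k * F m)"
  shows "D i l j k - D j l i k + (\<Oplus>m. C l i m * \<Gamma> m j k + C m j k * \<Gamma> l i m - (C l j m * \<Gamma> m i k + C m i k * \<Gamma> l j m))
    = (1/2) * ((if l = j then 1 else 0) * H i k - (if l = i then 1 else 0) * H j k - g j k * A l i + g i k * A l j)"
proof -
  have 1: "(\<Oplus>m. C l i m * \<Gamma> m j k) = (1/2) * (F i * \<Gamma> l j k + (if l = i then 1 else 0) * (\<Oplus>m. \<Gamma> m j k * F m) - V l * L i j k)" for i j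
  proof -
    have "(\<Oplus>m. C l i m * \<Gamma> m j k) = (\<Oplus>m. (1/2) * (F i * ((if l = m then 1 else 0) * \<Gamma> m j k) + (if l = i then 1 else 0) * (\<Gamma> m j k * F m) - V l * (g i m * \<Gamma> m j k)))"
      by (rule sum.cong) (simp_all add: C algebra_simps)
    then show ?thesis
      by (simp only: sum_distrib_left[symmetric] sum.distrib sum_subtractf sum_delta_mult L)
  qed
  have 2: "(\<Oplus>m. C m j k * \<Gamma> l i m) = (1/2) * (F j * \<Gamma> l i k + F k * \<Gamma> l i j - (\<Oplus>m. \<Gamma> l i m * V m) * g j k)" for i j
  proof -
    have "(\<Oplus>m. C m j k * \<Gamma> l i m) = (\<Oplus>m. (1/2) * (F j * ((if m = k then 1 else 0) * \<Gamma> l i m) + F k * ((if m = j then 1 else 0) * \<Gamma> l i m) - (\<Gamma> l i m * V m) * g j k))"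
      by (rule sum.cong) (simp_all add: C algebra_simps)
    then show ?thesis
      by (simp only: sum_distrib_left[symmetric] sum_distrib_right[symmetric] sum.distrib sum_subtractf sum_delta_mult)
  qed
  have Ls: "L k j i = L k i j" by (simp add: L sym(1)[of _ j i])
  show ?thesis
    unfolding sum_subtractf sum.distrib 1 2 D A H dg Ls sym(1)[of l j i] sym(2)[of j i]
    by (simp add: algebra_simps)
qed

context metric_patch
begin

lemma lower_christoffel:
  "x \<in> U \<Longrightarrow> (\<Oplus>k. G x $ l $ k * christoffel G k i j x) =
    (1/2) * (partial i (\<lambda>y. G y $ j $ l) x + partial j (\<lambda>y. G y $ i $ l) x - partial l (\<lambda>y. G y $ i $ j) x)"
  using gamma_low_eq unfolding gamma_low_def .

lemma raise_lower:
  assumes x: "x \<in> U"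
  shows "(\<Oplus>l. ginv (G x) k l * (\<Oplus>m. G x $ l $ m * v m)) = v k"
    and "(\<Oplus>l. G x $ k $ l * (\<Oplus>m. ginv (G x) l m * v m)) = v k"
proof -
  have "(\<Oplus>l. ginv (G x) k l * (\<Oplus>m. G x $ l $ m * v m)) = (\<Oplus>m l. (ginv (G x) k l * G x $ l $ m) * v m)"
    by (simp add: sum_distrib_left mult.assoc) (rule sum.swap)
  also have "\<dots> = (\<Oplus>m. (if k = m then 1 else 0) * v m)"
    by (simp only: sum_distrib_right[symmetric] ginv_left[OF posdef[OF x]])
  finally show "(\<Oplus>l. ginv (G x) k l * (\<Oplus>m. G x $ l $ m * v m)) = v k" by simp
  have "(\<Oplus>l. G x $ k $ l * (\<Oplus>m. ginv (G x) l m * v m)) = (\<Oplus>m l. (G x $ k $ l * ginv (G x) l m) * v m)"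
    by (simp add: sum_distrib_left mult.assoc) (rule sum.swap)
  also have "\<dots> = (\<Oplus>m. (if k = m then 1 else 0) * v m)"
    by (simp only: sum_distrib_right[symmetric] ginv_right[OF posdef[OF x]])
  finally show "(\<Oplus>l. G x $ k $ l * (\<Oplus>m. ginv (G x) l m * v m)) = v k" by simp
qed

context
  fixes f :: "real^'n \<Rightarrow> real"
  assumes f: "smooth_on U f"
begin

lemma smooth_gradient: "smooth_on U (gradient G f k)"
  unfolding gradient_def[abs_def]
  by (intro smooth_on_sum smooth_on_mult smooth_ginv_static smooth_on_partial f open_U)

lemma lower_gradient: "x \<in> U \<Longrightarrow> (\<Oplus>p. G x $ k $ p * gradient G f p x) = partial k f x"
  unfolding gradient_def by (rule raise_lower(2))

lemma hessian_sym: "x \<in> U \<Longrightarrow> hessian G f i k x = hessian G f k i x"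
  unfolding hessian_def by (simp add: christoffel_sym[of x _ i k] partial_commute[OF open_U f])

text \<open>Differentiating the identity that lowers the gradient to \<open>df\<close>; as
  \<open>\<nabla> g = 0\<close>, lowering commutes with covariant differentiation.\<close>

lemma hessian_eq:
  assumes x: "x \<in> U"
  shows "hessian G f i k x = (\<Oplus>m. G x $ k $ m * nabla G (gradient G f) m i x)"
proof -
  let ?V = "gradient G f"
  have "partial i (partial k f) x = partial i (\<lambda>x. \<Oplus>p. G x $ k $ p * ?V p x) x"
    by (rule partial_cong[OF open_U x lower_gradient[symmetric]])
       (auto intro: smooth_on_differentiable[OF smooth_on_partial[OF f] x])
  also have "\<dots> = (\<Oplus>p. partial i (\<lambda>x. G x $ k $ p * ?V p x) x)"
    by (intro partial_sum smooth_on_differentiable[OF _ x] smooth_on_mult smooth_metric smooth_gradient open_U)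
  also have "\<dots> = (\<Oplus>p. (gamma_low p i k x + gamma_low k i p x) * ?V p x + G x $ k $ p * partial i (?V p) x)"
    by (intro sum.cong refl trans[OF partial_mult] smooth_on_differentiable[OF _ x] smooth_metric smooth_gradient)
       (simp add: metric_compatible[OF x])
  also have "\<dots> = (\<Oplus>p. gamma_low p i k x * ?V p x) + (\<Oplus>p. gamma_low k i p x * ?V p x) + (\<Oplus>p. G x $ k $ p * partial i (?V p) x)"
    by (simp add: sum.distrib distrib_right)
  also have "(\<Oplus>p. gamma_low p i k x * ?V p x) = (\<Oplus>m. christoffel G m i k x * partial m f x)"
  proof -
    have "(\<Oplus>p. gamma_low p i k x * ?V p x) = (\<Oplus>m p. christoffel G m i k x * (G x $ m $ p * ?V p x))"
      unfolding gamma_low_def sum_distrib_right by (subst sum.swap) (simp add: metric_sym[OF x] mult_ac)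
    then show ?thesis by (simp add: sum_distrib_left[symmetric] lower_gradient[OF x])
  qed
  also have "(\<Oplus>p. gamma_low k i p x * ?V p x) = (\<Oplus>m. G x $ k $ m * (\<Oplus>p. christoffel G m i p x * ?V p x))"
    unfolding gamma_low_def sum_distrib_right sum_distrib_left by (subst sum.swap) (simp add: mult_ac)
  finally show ?thesis
    unfolding hessian_def nabla_def by (simp add: distrib_left sum.distrib)
qed

lemma trace_hessian:
  assumes x: "x \<in> U"
  shows "(\<Oplus>j k. ginv (G x) j k * hessian G f j k x) = (\<Oplus>k. nabla G (gradient G f) k k x)"
  unfolding hessian_eq[OF x] raise_lower(1)[OF x] ..

end

end

text \<open>Only the velocity at time \<open>0\<close> is conformal. The family itself need not be,
  and its second derivative in time is arbitrary, as the definition of the second variation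
  demands.\<close>

locale conformal_variation = metric_family T U G
  for T :: "real set" and U :: "(real^'n::finite) set" and G +
  fixes f :: "real^'n \<Rightarrow> real"
  assumes zero_in_T: "0 \<in> T" and smooth_f: "smooth_on U f"
    and metric_variation: "x \<in> U \<Longrightarrow> tder (\<lambda>t x. G t x $ i $ j) 0 x = f x * G 0 x $ i $ j"
begin

sublocale g: metric_patch U "G 0"
  by (rule patch[OF zero_in_T])

lemma has_tder:
  assumes "smooth_on (T \<times> U) (\<lambda>p. F (fst p) (snd p) :: real)" "t \<in> T" "x \<in> U"
  shows "((\<lambda>t. F t x) has_real_derivative tder F t x) (at t)"
  by (rule tder_joint(1)[OF open_T open_U smooth_onD[OF assms(1)] assms(2,3)])

lemma DERIV_metric: "x \<in> U \<Longrightarrow> ((\<lambda>t. G t x $ i $ j) has_real_derivative f x * G 0 x $ i $ j) (at 0)"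
  using has_tder[where F="\<lambda>t x. G t x $ i $ j", OF smooth_component zero_in_T] metric_variation by simp

lemma DERIV_partial_metric:
  assumes x: "x \<in> U"
  shows "((\<lambda>t. partial k (\<lambda>y. G t y $ i $ j) x) has_real_derivative
    partial k f x * G 0 x $ i $ j + f x * partial k (\<lambda>y. G 0 y $ i $ j) x) (at 0)"
proof -
  have "((\<lambda>t. partial k (\<lambda>y. G t y $ i $ j) x) has_real_derivative
      tder (\<lambda>t. partial k (\<lambda>y. G t y $ i $ j)) 0 x) (at 0)"
    by (rule has_tder[where F="\<lambda>t. partial k (\<lambda>y. G t y $ i $ j)", OF _ zero_in_T x])
       (rule smooth_on_partial_joint[where F="\<lambda>t y. G t y $ i $ j", OF open_T open_U smooth_component])
  also have "tder (\<lambda>t. partial k (\<lambda>y. G t y $ i $ j)) 0 x = partial k (tder (\<lambda>t y. G t y $ i $ j) 0) x"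
    by (rule tder_partial_commute[where F="\<lambda>t y. G t y $ i $ j", OF open_T open_U smooth_component zero_in_T x])
  also have "\<dots> = partial k (\<lambda>x. f x * G 0 x $ i $ j) x"
    by (rule partial_cong[OF open_U x metric_variation, symmetric, THEN sym])
       (auto intro!: smooth_on_differentiable[OF _ x] smooth_on_slice[OF open_T open_U _ zero_in_T] smooth_on_tder open_T open_U smooth_component)
  also have "\<dots> = partial k f x * G 0 x $ i $ j + f x * partial k (\<lambda>y. G 0 y $ i $ j) x"
    by (intro partial_mult smooth_on_differentiable[OF _ x] smooth_f g.smooth_metric)
  finally show ?thesis .
qed

text \<open>The lowered symbols are differentiated instead, since their formula contains no inverse
  metric. The terms with undifferentiated \<open>f\<close> then occur equally on both sides and
  cancel, and raising the index isolates the variation.\<close>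

lemma christoffel_variation:
  assumes x: "x \<in> U"
  shows "tder (\<lambda>t. christoffel (G t) k i j) 0 x =
    (1/2) * (partial i f x * (if k = j then 1 else 0) + partial j f x * (if k = i then 1 else 0) - gradient (G 0) f k x * G 0 x $ i $ j)"
proof -
  let ?C = "\<lambda>k. tder (\<lambda>t. christoffel (G t) k i j) 0 x"
  have dC: "((\<lambda>t. christoffel (G t) k i j x) has_real_derivative ?C k) (at 0)" for k
    by (rule has_tder[OF smooth_christoffel zero_in_T x])
  have low: "(\<Oplus>k. G 0 x $ l $ k * ?C k) =
    (1/2) * (partial i f x * G 0 x $ j $ l + partial j f x * G 0 x $ i $ l - partial l f x * G 0 x $ i $ j)" for l
  proof -
    have "((\<lambda>t. \<Oplus>k. G t x $ l $ k * christoffel (G t) k i j x) has_real_derivative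
        (\<Oplus>k. f x * G 0 x $ l $ k * christoffel (G 0) k i j x + ?C k * G 0 x $ l $ k)) (at 0)"
      by (intro DERIV_sum DERIV_mult dC DERIV_metric x)
    moreover have "((\<lambda>t. \<Oplus>k. G t x $ l $ k * christoffel (G t) k i j x) has_real_derivative
       (1/2) * ((partial i f x * G 0 x $ j $ l + f x * partial i (\<lambda>y. G 0 y $ j $ l) x)
         + (partial j f x * G 0 x $ i $ l + f x * partial j (\<lambda>y. G 0 y $ i $ l) x)
         - (partial l f x * G 0 x $ i $ j + f x * partial l (\<lambda>y. G 0 y $ i $ j) x))) (at 0)"
      by (rule has_field_derivative_transform_within_open[OF _ open_T zero_in_T
           metric_patch.lower_christoffel[OF patch x, symmetric]])
         (intro DERIV_cmult DERIV_add DERIV_diff DERIV_partial_metric x)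
    ultimately have "(\<Oplus>k. f x * G 0 x $ l $ k * christoffel (G 0) k i j x + ?C k * G 0 x $ l $ k) =
       (1/2) * ((partial i f x * G 0 x $ j $ l + f x * partial i (\<lambda>y. G 0 y $ j $ l) x)
         + (partial j f x * G 0 x $ i $ l + f x * partial j (\<lambda>y. G 0 y $ i $ l) x)
         - (partial l f x * G 0 x $ i $ j + f x * partial l (\<lambda>y. G 0 y $ i $ j) x))"
      by (rule DERIV_unique)
    also have "(\<Oplus>k. f x * G 0 x $ l $ k * christoffel (G 0) k i j x + ?C k * G 0 x $ l $ k) =
      f x * (\<Oplus>k. G 0 x $ l $ k * christoffel (G 0) k i j x) + (\<Oplus>k. G 0 x $ l $ k * ?C k)"
      by (simp add: sum.distrib sum_distrib_left mult_ac)
    finally show ?thesis unfolding g.lower_christoffel[OF x] by (simp add: algebra_simps)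
  qed
  have "?C k = (\<Oplus>l. ginv (G 0 x) k l * (\<Oplus>m. G 0 x $ l $ m * ?C m))"
    by (rule g.raise_lower(1)[OF x, symmetric])
  also have "\<dots> = (\<Oplus>l. (1/2) * (partial i f x * (ginv (G 0 x) k l * G 0 x $ l $ j) + partial j f x * (ginv (G 0 x) k l * G 0 x $ l $ i)
      - (ginv (G 0 x) k l * partial l f x) * G 0 x $ i $ j))"
    unfolding low
  proof (rule sum.cong[OF refl])
    fix l
    show "ginv (G 0 x) k l * ((1/2) * (partial i f x * G 0 x $ j $ l + partial j f x * G 0 x $ i $ l - partial l f x * G 0 x $ i $ j)) =
      (1/2) * (partial i f x * (ginv (G 0 x) k l * G 0 x $ l $ j) + partial j f x * (ginv (G 0 x) k l * G 0 x $ l $ i)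
      - (ginv (G 0 x) k l * partial l f x) * G 0 x $ i $ j)"
      unfolding g.metric_sym[OF x, of j l] g.metric_sym[OF x, of i l] by (simp add: algebra_simps)
  qed
  also have "\<dots> = (1/2) * (partial i f x * (if k = j then 1 else 0) + partial j f x * (if k = i then 1 else 0) - gradient (G 0) f k x * G 0 x $ i $ j)"
    by (simp only: sum_distrib_left[symmetric] sum_distrib_right[symmetric] sum.distrib sum_subtractf
       ginv_left[OF g.posdef[OF x]] gradient_def)
  finally show ?thesis .
qed

text \<open>The initial metric is arbitrary here. Undifferentiated \<open>f\<close> does not occur,
  in accordance with the invariance of \<open>riem_up\<close> under scaling of the metric by a
  constant.\<close>

lemma riem_up_variation:
  assumes x: "x \<in> U"
  shows "((\<lambda>t. riem_up (G t) l i j k x) has_real_derivative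
    (1/2) * ((if l = j then 1 else 0) * hessian (G 0) f i k x - (if l = i then 1 else 0) * hessian (G 0) f j k x
      - G 0 x $ j $ k * nabla (G 0) (gradient (G 0) f) l i x + G 0 x $ i $ k * nabla (G 0) (gradient (G 0) f) l j x)) (at 0)"
proof -
  let ?V = "gradient (G 0) f"
  let ?C = "\<lambda>l j k. tder (\<lambda>t. christoffel (G t) l j k) 0 x"
  let ?D = "\<lambda>i l j k. tder (\<lambda>t. partial i (christoffel (G t) l j k)) 0 x"
  have dC: "((\<lambda>t. christoffel (G t) l j k x) has_real_derivative ?C l j k) (at 0)" for l j k
    by (rule has_tder[OF smooth_christoffel zero_in_T x])
  have dD: "((\<lambda>t. partial i (christoffel (G t) l j k) x) has_real_derivative ?D i l j k) (at 0)" for i l j k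
    by (rule has_tder[OF smooth_on_partial_joint[OF open_T open_U smooth_christoffel] zero_in_T x])
  have D: "?D i l j k = (1/2) * (partial i (partial j f) x * (if l = k then 1 else 0) + partial i (partial k f) x * (if l = j then 1 else 0)
       - (partial i (?V l) x * G 0 x $ j $ k + ?V l x * partial i (\<lambda>y. G 0 y $ j $ k) x))" for i l j k
  proof -
    note sm = smooth_on_partial[OF smooth_f] g.smooth_gradient[OF smooth_f] g.smooth_metric
    have "?D i l j k = partial i (tder (\<lambda>t. christoffel (G t) l j k) 0) x"
      by (rule tder_partial_commute[OF open_T open_U smooth_christoffel zero_in_T x])
    also have "\<dots> = partial i (\<lambda>x. (1/2) * (((if l = k then 1 else 0) * partial j f x + (if l = j then 1 else 0) * partial k f x) - ?V l x * G 0 x $ j $ k)) x"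
      by (rule partial_cong[OF open_U x])
         (auto intro!: smooth_on_differentiable[OF _ x] smooth_on_slice[OF open_T open_U _ zero_in_T] smooth_on_tder open_T open_U smooth_christoffel
           simp: christoffel_variation)
    also have "\<dots> = (1/2) * partial i (\<lambda>x. ((if l = k then 1 else 0) * partial j f x + (if l = j then 1 else 0) * partial k f x) - ?V l x * G 0 x $ j $ k) x"
      by (intro partial_cmult smooth_on_differentiable[OF _ x] smooth_on_add smooth_on_diff smooth_on_mult smooth_on_const sm open_U)
    also have "partial i (\<lambda>x. ((if l = k then 1 else 0) * partial j f x + (if l = j then 1 else 0) * partial k f x) - ?V l x * G 0 x $ j $ k) x
      = partial i (\<lambda>x. (if l = k then 1 else 0) * partial j f x + (if l = j then 1 else 0) * partial k f x) x - partial i (\<lambda>x. ?V l x * G 0 x $ j $ k) x"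
      by (intro partial_diff smooth_on_differentiable[OF _ x] smooth_on_add smooth_on_diff smooth_on_mult smooth_on_const sm open_U)
    also have "partial i (\<lambda>x. (if l = k then 1 else 0) * partial j f x + (if l = j then 1 else 0) * partial k f x) x
      = partial i (\<lambda>x. (if l = k then 1 else 0) * partial j f x) x + partial i (\<lambda>x. (if l = j then 1 else 0) * partial k f x) x"
      by (intro partial_add smooth_on_differentiable[OF _ x] smooth_on_add smooth_on_diff smooth_on_mult smooth_on_const sm open_U)
    also have "partial i (\<lambda>x. (if l = k then 1 else 0) * partial j f x) x = (if l = k then 1 else 0) * partial i (partial j f) x"
      by (intro partial_cmult smooth_on_differentiable[OF _ x] sm)
    also have "partial i (\<lambda>x. (if l = j then 1 else 0) * partial k f x) x = (if l = j then 1 else 0) * partial i (partial k f) x"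
      by (intro partial_cmult smooth_on_differentiable[OF _ x] sm)
    also have "partial i (\<lambda>x. ?V l x * G 0 x $ j $ k) x = partial i (?V l) x * G 0 x $ j $ k + ?V l x * partial i (\<lambda>y. G 0 y $ j $ k) x"
      by (intro partial_mult smooth_on_differentiable[OF _ x] sm)
    finally show ?thesis by (simp add: mult.commute)
  qed
  have "((\<lambda>t. riem_up (G t) l i j k x) has_real_derivative
    ?D i l j k - ?D j l i k + (\<Oplus>m. ?C l i m * christoffel (G 0) m j k x + ?C m j k * christoffel (G 0) l i m x
       - (?C l j m * christoffel (G 0) m i k x + ?C m i k * christoffel (G 0) l j m x))) (at 0)"
    unfolding riem_up_def by (intro DERIV_add DERIV_diff DERIV_sum DERIV_mult dC dD)
  also have "?D i l j k - ?D j l i k + (\<Oplus>m. ?C l i m * christoffel (G 0) m j k x + ?C m j k * christoffel (G 0) l i m x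
       - (?C l j m * christoffel (G 0) m i k x + ?C m i k * christoffel (G 0) l j m x)) =
    (1/2) * ((if l = j then 1 else 0) * hessian (G 0) f i k x - (if l = i then 1 else 0) * hessian (G 0) f j k x
      - G 0 x $ j $ k * nabla (G 0) ?V l i x + G 0 x $ i $ k * nabla (G 0) ?V l j x)"
    by (rule riem_variation_algebra[where L="\<lambda>i j k. g.gamma_low i j k x" and dg="\<lambda>k i j. partial k (\<lambda>y. G 0 y $ i $ j) x"
        and F="\<lambda>i. partial i f x" and FF="\<lambda>i j. partial i (partial j f) x" and B="\<lambda>i l. partial i (?V l) x" and V="\<lambda>l. ?V l x",
        OF christoffel_variation[OF x] D g.gamma_low_def g.metric_compatible[OF x] g.christoffel_sym[OF x]
          partial_commute[OF open_U smooth_f x] nabla_def hessian_def])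
  finally show ?thesis .
qed

context
  fixes x assumes x: "x \<in> U" and flat: "\<And>l i j k. riem_up (G 0) l i j k x = 0"
begin

abbreviation (input) "hess i k \<equiv> hessian (G 0) f i k x"
abbreviation (input) "lap \<equiv> \<Oplus>k. nabla (G 0) (gradient (G 0) f) k k x"

text \<open>Lowering the index of \<open>riem_up_variation\<close>: the variation of the lowering
  metric multiplies the initial curvature, which is zero. What remains is the Kulkarni-Nomizu form
  of metric and Hessian.\<close>

lemma riem_variation:
  "((\<lambda>t. riem (G t) i j k l x) has_real_derivative
    (1/2) * (G 0 x $ l $ j * hess i k - G 0 x $ l $ i * hess j k - G 0 x $ j $ k * hess i l + G 0 x $ i $ k * hess j l)) (at 0)"
proof -
  let ?A = "\<lambda>m i. nabla (G 0) (gradient (G 0) f) m i x"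
  let ?K = "\<lambda>m. (1/2) * ((if m = j then 1 else 0) * hess i k - (if m = i then 1 else 0) * hess j k - G 0 x $ j $ k * ?A m i + G 0 x $ i $ k * ?A m j)"
  have "((\<lambda>t. riem (G t) i j k l x) has_real_derivative (\<Oplus>m. f x * G 0 x $ l $ m * riem_up (G 0) m i j k x + ?K m * G 0 x $ l $ m)) (at 0)"
    unfolding riem_def by (intro DERIV_sum DERIV_mult DERIV_metric riem_up_variation x)
  also have "(\<Oplus>m. f x * G 0 x $ l $ m * riem_up (G 0) m i j k x + ?K m * G 0 x $ l $ m) =
    (\<Oplus>m. (1/2) * (((if m = j then 1 else 0) * G 0 x $ l $ m) * hess i k - ((if m = i then 1 else 0) * G 0 x $ l $ m) * hess j k
      - G 0 x $ j $ k * (G 0 x $ l $ m * ?A m i) + G 0 x $ i $ k * (G 0 x $ l $ m * ?A m j)))"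
    unfolding flat by (rule sum.cong) (simp_all add: algebra_simps)
  also have "\<dots> = (1/2) * (G 0 x $ l $ j * hess i k - G 0 x $ l $ i * hess j k - G 0 x $ j $ k * hess i l + G 0 x $ i $ k * hess j l)"
    by (simp only: sum_distrib_left[symmetric] sum_distrib_right[symmetric] sum.distrib sum_subtractf sum_delta_mult g.hessian_eq[OF smooth_f x])
  finally show ?thesis .
qed

lemma ricci_variation:
  "((\<lambda>t. ricci (G t) j k x) has_real_derivative
    - (1/2) * ((real CARD('n) - 2) * hess j k + lap * G 0 x $ j $ k)) (at 0)"
proof -
  let ?A = "\<lambda>m i. nabla (G 0) (gradient (G 0) f) m i x"
  have "((\<lambda>t. ricci (G t) j k x) has_real_derivative
     (\<Oplus>i. (1/2) * ((if i = j then 1 else 0) * hess i k - (if i = i then 1 else 0) * hess j k - G 0 x $ j $ k * ?A i i + G 0 x $ i $ k * ?A i j))) (at 0)"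
    unfolding ricci_def by (intro DERIV_sum riem_up_variation x)
  also have "(\<Oplus>i. (1/2) * ((if i = j then 1 else 0) * hess i k - (if i = i then 1 else 0) * hess j k - G 0 x $ j $ k * ?A i i + G 0 x $ i $ k * ?A i j))
     = (1/2) * (hess j k - real CARD('n) * hess j k - G 0 x $ j $ k * lap + hess j k)"
    unfolding g.metric_sym[OF x, of _ k]
    by (simp only: sum_distrib_left[symmetric] sum_distrib_right[symmetric] sum.distrib sum_subtractf sum_delta_mult
       g.hessian_eq[OF smooth_f x, of j k, symmetric]) simp
  also have "\<dots> = - (1/2) * ((real CARD('n) - 2) * hess j k + lap * G 0 x $ j $ k)"
    by (simp add: algebra_simps)
  finally show ?thesis .
qed

lemma scalar_curv_variation:
  "((\<lambda>t. scalar_curv (G t) x) has_real_derivative - (real CARD('n) - 1) * lap) (at 0)"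
proof -
  have ric0: "ricci (G 0) j k x = 0" for j k by (simp add: ricci_def flat)
  let ?R = "\<lambda>j k. - (1/2) * ((real CARD('n) - 2) * hess j k + lap * G 0 x $ j $ k)"
  \<comment> \<open>The variation of the inverse metric can stay unevaluated, as its coefficient is
    the vanishing initial Ricci tensor.\<close>
  have "((\<lambda>t. scalar_curv (G t) x) has_real_derivative
     (\<Oplus>j k. tder (\<lambda>t x. ginv (G t x) j k) 0 x * ricci (G 0) j k x + ?R j k * ginv (G 0 x) j k)) (at 0)"
    unfolding scalar_curv_def
    by (intro DERIV_sum DERIV_mult ricci_variation has_tder[where F="\<lambda>t x. ginv (G t x) _ _"] smooth_ginv zero_in_T x)
  also have "(\<Oplus>j k. tder (\<lambda>t x. ginv (G t x) j k) 0 x * ricci (G 0) j k x + ?R j k * ginv (G 0 x) j k) =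
    (\<Oplus>j k. - (1/2) * ((real CARD('n) - 2) * (ginv (G 0 x) j k * hess j k) + lap * (ginv (G 0 x) j k * G 0 x $ k $ j)))"
    unfolding ric0 by (intro sum.cong refl) (simp add: algebra_simps g.metric_sym[OF x])
  also have "\<dots> = - (1/2) * ((real CARD('n) - 2) * lap + lap * real CARD('n))"
    by (simp only: sum_distrib_left[symmetric] sum.distrib g.trace_hessian[OF smooth_f x] ginv_left[OF g.posdef[OF x]]) simp
  also have "\<dots> = - (real CARD('n) - 1) * lap" by (simp add: algebra_simps)
  finally show ?thesis .
qed

end

end

section \<open>Tensor norms in orthonormal frames\<close>

lemma sum_quadruple:
  "(\<Oplus>i j k l. F i j k l) = (\<Sum>(i, j, k, l)\<in>UNIV. (F i j k l :: 'a::comm_monoid_add))"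
proof -
  have "(\<Oplus>i j k l. F i j k l) = (\<Sum>z\<in>UNIV \<times> UNIV \<times> UNIV \<times> UNIV. (case z of (i, j, k, l) \<Rightarrow> F i j k l))"
    by (simp only: sum.cartesian_product' prod.case)
  then show ?thesis by (simp only: UNIV_Times_UNIV)
qed

lemma sum_pair: "(\<Oplus>i j. F i j) = (\<Sum>(i, j)\<in>UNIV. (F i j :: 'a::comm_monoid_add))"
proof -
  have "(\<Oplus>i j. F i j) = (\<Sum>z\<in>UNIV \<times> UNIV. (case z of (i, j) \<Rightarrow> F i j))"
    by (simp only: sum.cartesian_product' prod.case)
  then show ?thesis by (simp only: UNIV_Times_UNIV)
qed

text \<open>A quadratic form with Gram kernel \<open>\<Oplus>z. w x z * w y z\<close> is diagonal in
  \<open>z\<close>. With \<open>w\<close> a product of frame entries this handles tensors of any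
  rank; the ranks two and four below only repack the indices as tuples.\<close>

lemma contract_general:
  fixes R R' :: "'x::finite \<Rightarrow> real" and w :: "'x \<Rightarrow> 'z::finite \<Rightarrow> real"
  shows "(\<Oplus>x y. R x * R' y * (\<Oplus>z. w x z * w y z)) = (\<Oplus>z. (\<Oplus>x. R x * w x z) * (\<Oplus>y. R' y * w y z))"
proof -
  have "(\<Oplus>x y. R x * R' y * (\<Oplus>z. w x z * w y z)) = (\<Oplus>x y z. (R x * w x z) * (R' y * w y z))"
    by (simp add: sum_distrib_left mult_ac)
  also have "\<dots> = (\<Oplus>x z y. (R x * w x z) * (R' y * w y z))" by (rule sum.cong[OF refl], rule sum.swap)
  also have "\<dots> = (\<Oplus>z x y. (R x * w x z) * (R' y * w y z))" by (rule sum.swap)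
  finally show ?thesis by (simp only: sum_product)
qed

text \<open>With inverse metric \<open>E ** transpose E\<close>, contracting all four index pairs
  amounts to summing products of components on the columns of \<open>E\<close>; this tames the
  eightfold sum of \<open>riem_sq\<close>.\<close>

lemma contract_four:
  fixes E :: "real^'n::finite^'n"
  assumes h: "\<And>i a. h i a = (\<Oplus>p. E $ i $ p * E $ a $ p)"
  shows "(\<Oplus>i j k l a b c d. R i j k l * R' a b c d * (h i a * h j b * h k c * h l d)) =
    (\<Oplus>p q r s. quadrilinear R (column p E) (column q E) (column r E) (column s E) *
       quadrilinear R' (column p E) (column q E) (column r E) (column s E))"
proof -
  define w where "w x z = (case x of (i, j, k, l) \<Rightarrow> case z of (p, q, r, s) \<Rightarrow> E $ i $ p * E $ j $ q * E $ k $ r * E $ l $ s)"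
    for x z :: "'n \<times> 'n \<times> 'n \<times> 'n"
  have prod4: "(\<Oplus>p. F p) * ((\<Oplus>q. K q) * ((\<Oplus>r. L r) * (\<Oplus>s. M s))) = (\<Oplus>p q r s. F p * (K q * (L r * M s)))"
    for F K L M :: "'n \<Rightarrow> real"
    by (simp only: sum_distrib_right[symmetric] sum_distrib_left[symmetric])
  have hw: "h i a * h j b * h k c * h l d = (\<Oplus>z. w (i, j, k, l) z * w (a, b, c, d) z)" for i j k l a b c d
  proof -
    have "h i a * h j b * h k c * h l d = h i a * (h j b * (h k c * h l d))" by (simp only: mult.assoc)
    also have "\<dots> = (\<Oplus>p q r s. (E $ i $ p * E $ a $ p) * ((E $ j $ q * E $ b $ q) * ((E $ k $ r * E $ c $ r) * (E $ l $ s * E $ d $ s))))"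
      unfolding h by (rule prod4)
    also have "\<dots> = (\<Oplus>z. w (i, j, k, l) z * w (a, b, c, d) z)"
      unfolding sum_quadruple by (rule sum.cong) (auto simp: w_def)
    finally show ?thesis .
  qed
  have q: "quadrilinear R (column p E) (column q E) (column r E) (column s E) =
     (\<Oplus>x. (case x of (i, j, k, l) \<Rightarrow> R i j k l) * w x (p, q, r, s))" for R p q r s
    unfolding quadrilinear_def sum_quadruple by (rule sum.cong) (auto simp: w_def column_def)
  have "(\<Oplus>i j k l a b c d. R i j k l * R' a b c d * (h i a * h j b * h k c * h l d)) =
    (\<Oplus>x y. (case x of (i, j, k, l) \<Rightarrow> R i j k l) * (case y of (i, j, k, l) \<Rightarrow> R' i j k l) * (\<Oplus>z. w x z * w y z))"
  proof -
    have "(\<Oplus>a b c d. R i j k l * R' a b c d * (\<Oplus>z. w (i, j, k, l) z * w (a, b, c, d) z)) =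
      (\<Oplus>y. R i j k l * (case y of (i, j, k, l) \<Rightarrow> R' i j k l) * (\<Oplus>z. w (i, j, k, l) z * w y z))" for i j k l
      by (rule trans[OF sum_quadruple], rule sum.cong) auto
    then show ?thesis unfolding hw by (simp only:) (rule trans[OF sum_quadruple], rule sum.cong, auto)
  qed
  also have "\<dots> = (\<Oplus>z. (\<Oplus>x. (case x of (i, j, k, l) \<Rightarrow> R i j k l) * w x z) * (\<Oplus>y. (case y of (i, j, k, l) \<Rightarrow> R' i j k l) * w y z))"
    by (rule contract_general)
  also have "\<dots> = (\<Oplus>p q r s. quadrilinear R (column p E) (column q E) (column r E) (column s E) *
       quadrilinear R' (column p E) (column q E) (column r E) (column s E))"
    unfolding q sum_quadruple by (rule sum.cong) auto
  finally show ?thesis .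
qed

definition bilinear_form :: "('n \<Rightarrow> 'n \<Rightarrow> real) \<Rightarrow> real^'n::finite \<Rightarrow> real^'n \<Rightarrow> real" where
  "bilinear_form R X Y = (\<Oplus>i j. R i j * X $ i * Y $ j)"

lemma contract_two:
  fixes E :: "real^'n::finite^'n"
  assumes h: "\<And>i a. h i a = (\<Oplus>p. E $ i $ p * E $ a $ p)"
  shows "(\<Oplus>i j a b. R i j * R' a b * (h i a * h j b)) =
    (\<Oplus>p q. bilinear_form R (column p E) (column q E) * bilinear_form R' (column p E) (column q E))"
proof -
  define w where "w x z = (case x of (i, j) \<Rightarrow> case z of (p, q) \<Rightarrow> E $ i $ p * E $ j $ q)"
    for x z :: "'n \<times> 'n"
  have hw: "h i a * h j b = (\<Oplus>z. w (i, j) z * w (a, b) z)" for i j a b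
    unfolding h sum_product sum_pair by (rule sum.cong) (auto simp: w_def)
  have q: "bilinear_form R (column p E) (column q E) = (\<Oplus>x. (case x of (i, j) \<Rightarrow> R i j) * w x (p, q))" for R p q
    unfolding bilinear_form_def sum_pair by (rule sum.cong) (auto simp: w_def column_def)
  have "(\<Oplus>i j a b. R i j * R' a b * (h i a * h j b)) =
    (\<Oplus>x y. (case x of (i, j) \<Rightarrow> R i j) * (case y of (i, j) \<Rightarrow> R' i j) * (\<Oplus>z. w x z * w y z))"
  proof -
    have "(\<Oplus>a b. R i j * R' a b * (\<Oplus>z. w (i, j) z * w (a, b) z)) =
      (\<Oplus>y. R i j * (case y of (i, j) \<Rightarrow> R' i j) * (\<Oplus>z. w (i, j) z * w y z))" for i j
      by (rule trans[OF sum_pair], rule sum.cong) auto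
    then show ?thesis unfolding hw by (simp only:) (rule trans[OF sum_pair], rule sum.cong, auto)
  qed
  also have "\<dots> = (\<Oplus>z. (\<Oplus>x. (case x of (i, j) \<Rightarrow> R i j) * w x z) * (\<Oplus>y. (case y of (i, j) \<Rightarrow> R' i j) * w y z))"
    by (rule contract_general)
  also have "\<dots> = (\<Oplus>p q. bilinear_form R (column p E) (column q E) * bilinear_form R' (column p E) (column q E))"
    unfolding q sum_pair by (rule sum.cong) auto
  finally show ?thesis .
qed

lemma contract_one:
  fixes E :: "real^'n::finite^'n"
  assumes h: "\<And>i a. h i a = (\<Oplus>p. E $ i $ p * E $ a $ p)"
  shows "(\<Oplus>i j. h i j * R i j) = (\<Oplus>p. bilinear_form R (column p E) (column p E))"
proof -
  have "(\<Oplus>i j. h i j * R i j) = (\<Oplus>i j p. R i j * E $ i $ p * E $ j $ p)"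
    unfolding h by (simp add: sum_distrib_right sum_distrib_left mult_ac)
  also have "\<dots> = (\<Oplus>i p j. R i j * E $ i $ p * E $ j $ p)" by (rule sum.cong[OF refl], rule sum.swap)
  also have "\<dots> = (\<Oplus>p i j. R i j * E $ i $ p * E $ j $ p)" by (rule sum.swap)
  finally show ?thesis by (simp add: bilinear_form_def column_def)
qed

lemma bilinear_form_frame:
  fixes E G :: "real^'n::finite^'n"
  assumes "transpose E ** G ** E = mat 1"
  shows "bilinear_form (\<lambda>i j. G $ i $ j) (column p E) (column q E) = (if p = q then 1 else 0)"
proof -
  have "(transpose E ** G ** E) $ p $ q = (\<Oplus>j i. E $ i $ p * G $ i $ j * E $ j $ q)"
    by (simp add: matrix_matrix_mult_def transpose_def sum_distrib_right)
  also have "\<dots> = bilinear_form (\<lambda>i j. G $ i $ j) (column p E) (column q E)"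
    unfolding bilinear_form_def column_def by (subst sum.swap) (simp add: mult_ac)
  finally show ?thesis using assms by (simp add: mat_def)
qed

lemma sum_quadruple_split:
  fixes a b :: "'n::finite \<Rightarrow> 'n \<Rightarrow> real"
  shows "(\<Oplus>i j k l. a i k * b j l) = (\<Oplus>i k. a i k) * (\<Oplus>j l. b j l)"
    and "(\<Oplus>i j k l. a i l * b j k) = (\<Oplus>i l. a i l) * (\<Oplus>j k. b j k)"
proof -
  have "(\<Oplus>i j k l. a i k * b j l) = (\<Oplus>i k j l. a i k * b j l)" by (rule sum.cong[OF refl], rule sum.swap)
  then show "(\<Oplus>i j k l. a i k * b j l) = (\<Oplus>i k. a i k) * (\<Oplus>j l. b j l)"
    by (simp only: sum_distrib_left[symmetric] sum_distrib_right[symmetric])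
  have "(\<Oplus>i j k l. a i l * b j k) = (\<Oplus>i. (\<Oplus>l. a i l) * (\<Oplus>j k. b j k))"
  proof (rule sum.cong[OF refl])
    fix i
    have "(\<Oplus>j k l. a i l * b j k) = (\<Oplus>j k. (\<Oplus>l. a i l) * b j k)" by (simp only: sum_distrib_right)
    then show "(\<Oplus>j k l. a i l * b j k) = (\<Oplus>l. a i l) * (\<Oplus>j k. b j k)" by (simp only: sum_distrib_left)
  qed
  then show "(\<Oplus>i j k l. a i l * b j k) = (\<Oplus>i l. a i l) * (\<Oplus>j k. b j k)"
    by (simp only: sum_distrib_right)
qed

text \<open>On frame vectors the values of \<open>G\<close> become Kronecker deltas, so the
  components of the curvature variation depend only on the frame components of the Hessian.\<close>

lemma quadrilinear_kulkarni_nomizu: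
  fixes G H :: "'n::finite \<Rightarrow> 'n \<Rightarrow> real"
  shows "quadrilinear (\<lambda>i j k l. (1/2) * (G l j * H i k - G l i * H j k - G j k * H i l + G i k * H j l)) X Y Z W =
    (1/2) * (bilinear_form G W Y * bilinear_form H X Z - bilinear_form G W X * bilinear_form H Y Z
      - bilinear_form G Y Z * bilinear_form H X W + bilinear_form G X Z * bilinear_form H Y W)"
proof -
  have bl: "bilinear_form B U V = (\<Oplus>i j. B j i * U $ j * V $ i)" for B U V
    unfolding bilinear_form_def by (rule sum.swap)
  have 1: "(\<Oplus>i j k l. G l j * H i k * X $ i * Y $ j * Z $ k * W $ l) = bilinear_form G W Y * bilinear_form H X Z"
    unfolding bl[of G] unfolding bilinear_form_def
    by (subst mult.commute, subst sum_quadruple_split(1)[symmetric]) (simp add: mult_ac)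
  have 2: "(\<Oplus>i j k l. G l i * H j k * X $ i * Y $ j * Z $ k * W $ l) = bilinear_form G W X * bilinear_form H Y Z"
    unfolding bl[of G] unfolding bilinear_form_def
    by (subst sum_quadruple_split(2)[symmetric]) (simp add: mult_ac)
  have 3: "(\<Oplus>i j k l. G j k * H i l * X $ i * Y $ j * Z $ k * W $ l) = bilinear_form G Y Z * bilinear_form H X W"
    unfolding bilinear_form_def
    by (subst mult.commute, subst sum_quadruple_split(2)[symmetric]) (simp add: mult_ac)
  have 4: "(\<Oplus>i j k l. G i k * H j l * X $ i * Y $ j * Z $ k * W $ l) = bilinear_form G X Z * bilinear_form H Y W"
    unfolding bilinear_form_def
    by (subst sum_quadruple_split(1)[symmetric]) (simp add: mult_ac)
  have "quadrilinear (\<lambda>i j k l. (1/2) * (G l j * H i k - G l i * H j k - G j k * H i l + G i k * H j l)) X Y Z W =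
     (1/2) * ((\<Oplus>i j k l. G l j * H i k * X $ i * Y $ j * Z $ k * W $ l) - (\<Oplus>i j k l. G l i * H j k * X $ i * Y $ j * Z $ k * W $ l)
      - (\<Oplus>i j k l. G j k * H i l * X $ i * Y $ j * Z $ k * W $ l) + (\<Oplus>i j k l. G i k * H j l * X $ i * Y $ j * Z $ k * W $ l))"
    unfolding quadrilinear_def
    by (simp only: sum_distrib_left sum_subtractf[symmetric] sum.distrib[symmetric]) (simp add: algebra_simps)
  then show ?thesis unfolding 1 2 3 4 .
qed

text \<open>Each of the four squares contributes \<open>n\<close> times the squared norm. Of the six
  mixed products four contribute minus the squared norm and two, those with complementary index
  pairs, contribute the squared trace. With the factors \<open>2\<close> and \<open>1/4\<close> this
  gives \<open>n - 2\<close> and \<open>1\<close>.\<close>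

lemma kulkarni_nomizu_norm:
  fixes h :: "'n::finite \<Rightarrow> 'n \<Rightarrow> real"
  assumes sym: "\<And>p q. h p q = h q p"
  defines "\<delta> \<equiv> \<lambda>p q. if p = q then 1 else (0::real)"
  shows "(\<Oplus>p q r s. ((1/2) * (\<delta> s q * h p r - \<delta> s p * h q r - \<delta> q r * h p s + \<delta> p r * h q s))\<^sup>2) =
    (real CARD('n) - 2) * (\<Oplus>p q. (h p q)\<^sup>2) + (\<Oplus>p. h p p)\<^sup>2"
proof -
  let ?Q = "\<Oplus>p q. (h p q)\<^sup>2" and ?t = "\<Oplus>p. h p p"
  have d: "(\<Oplus>m. \<delta> l m * b m) = b l" "(\<Oplus>m. \<delta> m l * b m) = b l" "\<delta> l m * \<delta> l m = \<delta> l m" for l m b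
    by (simp_all add: \<delta>_def)
  have sq: "\<delta> l m * (\<delta> l m * b) = \<delta> l m * b" for l m b by (simp add: \<delta>_def)
  have Qs: "(\<Oplus>p q. h p q * h p q) = ?Q" "(\<Oplus>p q. h q p * h q p) = ?Q" "(\<Oplus>p q. h p q * h q p) = ?Q"
    by (simp_all add: power2_eq_square sym[of q p for p q, symmetric] cong: sum.cong)
  have a: "(\<Oplus>p q r s. \<delta> s q * (h p r * h p r)) = real CARD('n) * ?Q" by (simp add: d(2) Qs flip: sum_distrib_left)
  have "(\<Oplus>p q r s. ((1/2) * (\<delta> s q * h p r - \<delta> s p * h q r - \<delta> q r * h p s + \<delta> p r * h q s))\<^sup>2) =
    (1/4) * ((\<Oplus>p q r s. \<delta> s q * (h p r * h p r)) + (\<Oplus>p q r s. \<delta> s p * (h q r * h q r))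
      + (\<Oplus>p q r s. \<delta> q r * (h p s * h p s)) + (\<Oplus>p q r s. \<delta> p r * (h q s * h q s))
      + 2 * (- (\<Oplus>p q r s. \<delta> s q * (\<delta> s p * (h p r * h q r))) - (\<Oplus>p q r s. \<delta> s q * (\<delta> q r * (h p r * h p s)))
        + (\<Oplus>p q r s. \<delta> s q * (\<delta> p r * (h p r * h q s))) + (\<Oplus>p q r s. \<delta> s p * (\<delta> q r * (h q r * h p s)))
        - (\<Oplus>p q r s. \<delta> s p * (\<delta> p r * (h q r * h q s))) - (\<Oplus>p q r s. \<delta> q r * (\<delta> p r * (h p s * h q s)))))"
    by (simp only: sum_distrib_left sum_subtractf[symmetric] sum_negf[symmetric] sum.distrib[symmetric])
       (intro sum.cong refl, simp add: power2_eq_square algebra_simps sq)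
  also have "(\<Oplus>p q r s. \<delta> s p * (h q r * h q r)) = real CARD('n) * ?Q" by (simp add: d(2) Qs)
  also have "(\<Oplus>p q r s. \<delta> q r * (h p s * h p s)) = real CARD('n) * ?Q"
    by (simp add: d(1) Qs flip: sum_distrib_left)
  also have "(\<Oplus>p q r s. \<delta> p r * (h q s * h q s)) = real CARD('n) * ?Q"
    by (simp add: Qs flip: sum_distrib_left) (simp add: d(1) Qs flip: sum_distrib_left)
  also have "(\<Oplus>p q r s. \<delta> s q * (\<delta> s p * (h p r * h q r))) = ?Q"
    by (simp add: d(2)) (simp add: Qs d flip: sum_distrib_left)
  also have "(\<Oplus>p q r s. \<delta> s q * (\<delta> q r * (h p r * h p s))) = ?Q" by (simp add: d Qs)
  also have "(\<Oplus>p q r s. \<delta> s q * (\<delta> p r * (h p r * h q s))) = ?t * ?t" by (simp add: d sum_product)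
  also have "(\<Oplus>p q r s. \<delta> s p * (\<delta> q r * (h q r * h p s))) = ?t * ?t" by (simp add: d sum_product mult.commute)
  also have "(\<Oplus>p q r s. \<delta> s p * (\<delta> p r * (h q r * h q s))) = ?Q" by (simp add: d Qs)
  also have "(\<Oplus>p q r s. \<delta> q r * (\<delta> p r * (h p s * h q s))) = ?Q"
    by (simp flip: sum_distrib_left) (simp add: d Qs)
  finally show ?thesis unfolding a by (simp add: power2_eq_square algebra_simps)
qed

section \<open>Second derivatives of quadratic expressions in the curvature\<close>

lemma has_second_derivative_at_add:
  assumes "has_second_derivative_at \<phi> D a" "has_second_derivative_at \<psi> E a"
  shows "has_second_derivative_at (\<lambda>t. \<phi> t + \<psi> t) (D + E) a"
proof -
  obtain \<phi>' \<psi>' where 1: "\<forall>\<^sub>F t in nhds a. (\<phi> has_real_derivative \<phi>' t) (at t)" "(\<phi>' has_real_derivative D) (at a)"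
    and 2: "\<forall>\<^sub>F t in nhds a. (\<psi> has_real_derivative \<psi>' t) (at t)" "(\<psi>' has_real_derivative E) (at a)"
    using assms unfolding has_second_derivative_at_def by blast
  have "\<forall>\<^sub>F t in nhds a. ((\<lambda>t. \<phi> t + \<psi> t) has_real_derivative \<phi>' t + \<psi>' t) (at t)"
    using 1(1) 2(1) by eventually_elim (rule DERIV_add)
  with DERIV_add[OF 1(2) 2(2)] show ?thesis
    unfolding has_second_derivative_at_def by (intro exI[of _ "\<lambda>t. \<phi>' t + \<psi>' t"]) auto
qed

lemma has_second_derivative_at_cmult:
  assumes "has_second_derivative_at \<phi> D a"
  shows "has_second_derivative_at (\<lambda>t. c * \<phi> t) (c * D) a"
proof -
  obtain \<phi>' where 1: "\<forall>\<^sub>F t in nhds a. (\<phi> has_real_derivative \<phi>' t) (at t)" "(\<phi>' has_real_derivative D) (at a)"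
    using assms unfolding has_second_derivative_at_def by blast
  have "\<forall>\<^sub>F t in nhds a. ((\<lambda>t. c * \<phi> t) has_real_derivative c * \<phi>' t) (at t)"
    using 1(1) by eventually_elim (rule DERIV_cmult)
  with DERIV_cmult[OF 1(2)] show ?thesis
    unfolding has_second_derivative_at_def by (intro exI[of _ "\<lambda>t. c * \<phi>' t"]) auto
qed

lemma has_second_derivative_at_const: "has_second_derivative_at (\<lambda>t. c) 0 a"
  unfolding has_second_derivative_at_def by (intro exI[of _ "\<lambda>t. 0"]) auto

lemma has_second_derivative_at_sum:
  assumes "\<And>i. i \<in> I \<Longrightarrow> has_second_derivative_at (\<phi> i) (D i) a"
  shows "has_second_derivative_at (\<lambda>t. \<Sum>i\<in>I. \<phi> i t) (\<Sum>i\<in>I. D i) a"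
  using assms by (induction I rule: infinite_finite_induct)
    (auto intro: has_second_derivative_at_const has_second_derivative_at_add)

text \<open>If \<open>u\<close> and \<open>v\<close> vanish at time \<open>0\<close>, the only
  surviving term of the second derivative is \<open>2 u' v' w\<close>. Second derivatives of
  curvature and all derivatives of the weight \<open>w\<close> drop out, which makes the result
  independent of the curve.\<close>

lemma (in metric_family) has_second_derivative_triple_product:
  assumes "smooth_on (T \<times> U) (\<lambda>p. u (fst p) (snd p) :: real)" "smooth_on (T \<times> U) (\<lambda>p. v (fst p) (snd p) :: real)"
    "smooth_on (T \<times> U) (\<lambda>p. w (fst p) (snd p) :: real)"
    and x: "x \<in> U" and 0: "0 \<in> T" "u 0 x = 0" "v 0 x = 0"
    and u': "((\<lambda>t. u t x) has_real_derivative u') (at 0)" and v': "((\<lambda>t. v t x) has_real_derivative v') (at 0)"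
  shows "has_second_derivative_at (\<lambda>t. u t x * v t x * w t x) (2 * (u' * v' * w 0 x)) 0"
proof -
  have d1: "((\<lambda>t. F t x) has_real_derivative tder F t x) (at t)" if "smooth_on (T \<times> U) (\<lambda>p. F (fst p) (snd p))" "t \<in> T" for F t
    by (rule tder_joint(1)[OF open_T open_U smooth_onD[OF that(1)] that(2) x])
  note D = d1[OF assms(1)] d1[OF assms(2)] d1[OF assms(3)]
    d1[OF smooth_on_tder[OF open_T open_U assms(1)]] d1[OF smooth_on_tder[OF open_T open_U assms(2)]] d1[OF smooth_on_tder[OF open_T open_U assms(3)]]
  have u: "tder u 0 x = u'" and v: "tder v 0 x = v'"
    using u' v' by (simp_all add: tder_def DERIV_imp_deriv)
  let ?\<phi> = "\<lambda>t. (tder u t x * v t x + u t x * tder v t x) * w t x + u t x * v t x * tder w t x"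
  have "((\<lambda>t. u t x * v t x * w t x) has_real_derivative ?\<phi> t) (at t)" if "t \<in> T" for t
    by (rule derivative_eq_intros D that | (simp add: algebra_simps; fail))+
  then have "\<forall>\<^sub>F t in nhds 0. ((\<lambda>t. u t x * v t x * w t x) has_real_derivative ?\<phi> t) (at t)"
    by (rule eventually_mono[OF eventually_nhds_in_open[OF open_T 0(1)]])
  moreover have "(?\<phi> has_real_derivative 2 * (u' * v' * w 0 x)) (at 0)"
    by (rule derivative_eq_intros D 0 | (simp add: 0 u v algebra_simps; fail))+
  ultimately show ?thesis unfolding has_second_derivative_at_def by (intro exI[of _ ?\<phi>] conjI)
qed

context conformal_variation
begin

context
  fixes x assumes x: "x \<in> U" and flat: "\<And>l i j k. riem_up (G 0) l i j k x = 0"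
begin

abbreviation (input) "A i k \<equiv> nabla (G 0) (gradient (G 0) f) i k x"

text \<open>Turns the squared norm of the Hessian into the trace of the square of the covariant
  derivative of the gradient, the form in which Bochner's formula delivers it.\<close>

lemma contract_hessian:
  "(\<Oplus>i j a b. hessian (G 0) f i j x * hessian (G 0) f a b x * (ginv (G 0 x) i a * ginv (G 0 x) j b)) = (\<Oplus>i k. A i k * A k i)"
proof -
  let ?H = "\<lambda>i j. hessian (G 0) f i j x" and ?h = "\<lambda>i j. ginv (G 0 x) i j"
  have r: "(\<Oplus>b. ?h j b * ?H a b) = A j a" for j a
    unfolding g.hessian_eq[OF smooth_f x] by (rule g.raise_lower(1)[OF x])
  have "(\<Oplus>i j a b. ?H i j * ?H a b * (?h i a * ?h j b)) = (\<Oplus>i j a. ?H i j * ?h i a * (\<Oplus>b. ?h j b * ?H a b))"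
    by (simp add: sum_distrib_left mult_ac)
  also have "\<dots> = (\<Oplus>i j a. ?H i j * ?h i a * A j a)" unfolding r ..
  also have "\<dots> = (\<Oplus>j i a. ?H i j * ?h i a * A j a)" by (rule sum.swap)
  also have "\<dots> = (\<Oplus>j a i. ?H i j * ?h i a * A j a)" by (rule sum.cong[OF refl], rule sum.swap)
  also have "\<dots> = (\<Oplus>j a. (\<Oplus>i. ?h a i * ?H j i) * A j a)"
    unfolding sum_distrib_right
    by (intro sum.cong refl) (simp only: ginv_sym[OF g.posdef[OF x], of a for a] g.hessian_sym[OF smooth_f x, of j for j] mult_ac)
  also have "\<dots> = (\<Oplus>i k. A i k * A k i)" unfolding r by (simp add: mult.commute)
  finally show ?thesis .
qed

text \<open>The pointwise statement before integration, with \<open>Q\<close> the squared norm of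
  the Hessian and \<open>L\<close> the Laplacian. The coefficient \<open>3 * n - 4\<close> is
  \<open>2 * (n - 2) + n\<close>, from the mixed term and the square of the trace part in the norm
  of \<open>(n - 2) H + L g\<close>.\<close>

lemma second_variation_density:
  defines "n \<equiv> real CARD('n)" and "Q \<equiv> \<Oplus>i k. A i k * A k i" and "L \<equiv> \<Oplus>k. A k k"
  shows "has_second_derivative_at
    (\<lambda>t. (riem_sq (G t) x + s * ricci_sq (G t) x + \<tau> * (scalar_curv (G t) x)\<^sup>2) * sqrt (det (G t x)))
    (2 * ((n - 2) * Q + L\<^sup>2 + s * ((1/4) * ((n - 2)\<^sup>2 * Q + (3 * n - 4) * L\<^sup>2)) + \<tau> * ((n - 1)\<^sup>2 * L\<^sup>2)) * sqrt (det (G 0 x))) 0"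
proof -
  let ?h = "\<lambda>i j. ginv (G 0 x) i j" and ?H = "\<lambda>i j. hessian (G 0) f i j x" and ?g = "\<lambda>i j. G 0 x $ i $ j"
  let ?w = "\<lambda>t. sqrt (det (G t x))"
  let ?K = "\<lambda>i j k l. (1/2) * (?g l j * ?H i k - ?g l i * ?H j k - ?g j k * ?H i l + ?g i k * ?H j l)"
  let ?R = "\<lambda>j k. - (1/2) * ((n - 2) * ?H j k + L * ?g j k)"
  obtain E :: "real^'n^'n" where E: "transpose E ** G 0 x ** E = mat 1"
    using ex_orthonormal_frame[OF g.posdef[OF x]] by blast
  have h: "?h i a = (\<Oplus>p. E $ i $ p * E $ a $ p)" for i a by (rule ginv_frame[OF E])
  \<comment> \<open>Components of the Hessian in the orthonormal frame; its norm and trace are plain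
    sums of these.\<close>
  define c where "c p q = bilinear_form ?H (column p E) (column q E)" for p q
  have gE: "bilinear_form ?g (column p E) (column q E) = (if p = q then 1 else 0)" for p q
    by (rule bilinear_form_frame[OF E])
  have csym: "c p q = c q p" for p q
    unfolding c_def bilinear_form_def by (subst sum.swap) (simp add: g.hessian_sym[OF smooth_f x] mult_ac)
  have cQ: "(\<Oplus>p q. (c p q)\<^sup>2) = Q"
    using contract_two[OF h, of ?H ?H] contract_hessian by (simp add: Q_def c_def power2_eq_square)
  have cL: "(\<Oplus>p. c p p) = L"
    using contract_one[OF h, of ?H] g.trace_hessian[OF smooth_f x] by (simp add: c_def L_def)
  have ric0: "ricci (G 0) j k x = 0" for j k by (simp add: ricci_def flat)
  have riem0: "riem (G 0) i j k l x = 0" for i j k l by (simp add: riem_def flat)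
  have scal0: "scalar_curv (G 0) x = 0" by (simp add: scalar_curv_def ric0)

  have KK: "(\<Oplus>i j k l a b cc d. ?K i j k l * ?K a b cc d * (?h i a * ?h j b * ?h k cc * ?h l d)) = (n - 2) * Q + L\<^sup>2"
  proof -
    have "(\<Oplus>i j k l a b cc d. ?K i j k l * ?K a b cc d * (?h i a * ?h j b * ?h k cc * ?h l d)) =
      (\<Oplus>p q r s. ((1/2) * ((if s = q then 1 else 0) * c p r - (if s = p then 1 else 0) * c q r
         - (if q = r then 1 else 0) * c p s + (if p = r then 1 else 0) * c q s))\<^sup>2)"
      unfolding contract_four[OF h] quadrilinear_kulkarni_nomizu gE c_def[symmetric] power2_eq_square ..
    also have "\<dots> = (n - 2) * Q + L\<^sup>2"
      unfolding kulkarni_nomizu_norm[OF csym] cQ cL n_def ..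
    finally show ?thesis .
  qed
  have RR: "(\<Oplus>i j a b. ?R i j * ?R a b * (?h i a * ?h j b)) = (1/4) * ((n - 2)\<^sup>2 * Q + (3 * n - 4) * L\<^sup>2)"
  proof -
    have bR: "bilinear_form ?R X Y = - (1/2) * ((n - 2) * bilinear_form ?H X Y + L * bilinear_form ?g X Y)" for X Y
      unfolding bilinear_form_def
      by (simp only: sum_distrib_left sum.distrib[symmetric]) (simp add: algebra_simps)
    have "(\<Oplus>i j a b. ?R i j * ?R a b * (?h i a * ?h j b)) =
      (\<Oplus>p q. (1/4) * ((n - 2)\<^sup>2 * (c p q)\<^sup>2 + 2 * (n - 2) * L * ((if p = q then 1 else 0) * c p q) + L\<^sup>2 * ((if p = q then 1 else 0) * 1)))"
      unfolding contract_two[OF h] bR gE c_def[symmetric]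
      by (intro sum.cong refl) (simp add: power2_eq_square algebra_simps)
    also have "\<dots> = (1/4) * ((n - 2)\<^sup>2 * Q + 2 * (n - 2) * L * L + L\<^sup>2 * n)"
      by (simp only: sum_distrib_left[symmetric] sum.distrib sum_delta_mult cQ cL) (simp add: n_def)
    finally show ?thesis by (simp add: power2_eq_square algebra_simps)
  qed
  have sm: "smooth_on (T \<times> U) (\<lambda>p. ginv (G (fst p) (snd p)) i a * ginv (G (fst p) (snd p)) j b * ginv (G (fst p) (snd p)) k c * ginv (G (fst p) (snd p)) l d * sqrt (det (G (fst p) (snd p))))"
    "smooth_on (T \<times> U) (\<lambda>p. ginv (G (fst p) (snd p)) i a * ginv (G (fst p) (snd p)) j b * sqrt (det (G (fst p) (snd p))))" for i j k l a b c d
    by (intro smooth_on_mult smooth_ginv smooth_volume_density open_TU)+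
  have 1: "has_second_derivative_at (\<lambda>t. riem_sq (G t) x * ?w t) (2 * ((n - 2) * Q + L\<^sup>2) * ?w 0) 0"
  proof -
    \<comment> \<open>The inverse metrics and the volume density together form the weight of the
      triple product, so they enter only through their value at time \<open>0\<close>.\<close>
    have "has_second_derivative_at (\<lambda>t. \<Oplus>i j k l a b c d. riem (G t) i j k l x * riem (G t) a b c d x *
        (ginv (G t x) i a * ginv (G t x) j b * ginv (G t x) k c * ginv (G t x) l d * ?w t))
      (\<Oplus>i j k l a b c d. 2 * (?K i j k l * ?K a b c d * (?h i a * ?h j b * ?h k c * ?h l d * ?w 0))) 0"
      by (intro has_second_derivative_at_sum has_second_derivative_triple_product[where w="\<lambda>t x. _ (ginv (G t x)) * sqrt (det (G t x))"]
          smooth_riem sm x zero_in_T riem0 riem_variation flat)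
    moreover have "(\<lambda>t. \<Oplus>i j k l a b c d. riem (G t) i j k l x * riem (G t) a b c d x *
        (ginv (G t x) i a * ginv (G t x) j b * ginv (G t x) k c * ginv (G t x) l d * ?w t)) = (\<lambda>t. riem_sq (G t) x * ?w t)"
      unfolding riem_sq_def by (simp only: sum_distrib_right mult.assoc)
    moreover have "(\<Oplus>i j k l a b c d. 2 * (?K i j k l * ?K a b c d * (?h i a * ?h j b * ?h k c * ?h l d * ?w 0)))
        = (\<Oplus>i j k l a b c d. (2 * ?w 0) * (?K i j k l * ?K a b c d * (?h i a * ?h j b * ?h k c * ?h l d)))"
      by (intro sum.cong refl) (simp only: mult_ac)
    ultimately show ?thesis by (simp only: sum_distrib_left[symmetric] KK) (simp only: mult_ac)
  qed
  have 2: "has_second_derivative_at (\<lambda>t. ricci_sq (G t) x * ?w t) (2 * ((1/4) * ((n - 2)\<^sup>2 * Q + (3 * n - 4) * L\<^sup>2)) * ?w 0) 0"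
  proof -
    have "has_second_derivative_at (\<lambda>t. \<Oplus>i j a b. ricci (G t) i j x * ricci (G t) a b x * (ginv (G t x) i a * ginv (G t x) j b * ?w t))
      (\<Oplus>i j a b. 2 * (?R i j * ?R a b * (?h i a * ?h j b * ?w 0))) 0"
      unfolding n_def L_def
      by (intro has_second_derivative_at_sum has_second_derivative_triple_product[where w="\<lambda>t x. _ (ginv (G t x)) * sqrt (det (G t x))"]
          smooth_ricci sm x zero_in_T ric0 ricci_variation flat)
    moreover have "(\<lambda>t. \<Oplus>i j a b. ricci (G t) i j x * ricci (G t) a b x * (ginv (G t x) i a * ginv (G t x) j b * ?w t))
       = (\<lambda>t. ricci_sq (G t) x * ?w t)"
      unfolding ricci_sq_def by (simp only: sum_distrib_right mult.assoc)
    moreover have "(\<Oplus>i j a b. 2 * (?R i j * ?R a b * (?h i a * ?h j b * ?w 0))) = (\<Oplus>i j a b. (2 * ?w 0) * (?R i j * ?R a b * (?h i a * ?h j b)))"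
      by (intro sum.cong refl) (simp only: mult_ac)
    ultimately show ?thesis by (simp only: sum_distrib_left[symmetric] RR) (simp only: mult_ac)
  qed
  have 3: "has_second_derivative_at (\<lambda>t. scalar_curv (G t) x * scalar_curv (G t) x * ?w t)
     (2 * (- (n - 1) * L * (- (n - 1) * L) * ?w 0)) 0"
    unfolding n_def L_def
    by (intro has_second_derivative_triple_product[where w="\<lambda>t x. sqrt (det (G t x))"]
        smooth_scalar_curv smooth_volume_density x zero_in_T scal0 scalar_curv_variation flat)
  have "has_second_derivative_at (\<lambda>t. riem_sq (G t) x * ?w t + s * (ricci_sq (G t) x * ?w t) + \<tau> * (scalar_curv (G t) x * scalar_curv (G t) x * ?w t))
    (2 * ((n - 2) * Q + L\<^sup>2) * ?w 0 + s * (2 * ((1/4) * ((n - 2)\<^sup>2 * Q + (3 * n - 4) * L\<^sup>2)) * ?w 0) + \<tau> * (2 * (- (n - 1) * L * (- (n - 1) * L) * ?w 0))) 0"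
    by (intro has_second_derivative_at_add has_second_derivative_at_cmult 1 2 3)
  then show ?thesis by (simp add: algebra_simps power2_eq_square)
qed

end

end

section \<open>Coordinate changes\<close>

definition jac :: "(real^'n \<Rightarrow> real^'n) \<Rightarrow> 'n::finite \<Rightarrow> 'n \<Rightarrow> real^'n \<Rightarrow> real" where
  "jac \<phi> a i x = partial i (\<lambda>y. \<phi> y $ a) x"

text \<open>Invertibility of the Jacobian follows from positive definiteness of the pulled back
  metric. The locale serves for transition maps of charts and also for the identity between two
  metrics agreeing on \<open>U\<close>.\<close>

locale metric_transition = M: metric_patch U G + N: metric_patch U' H
  for U :: "(real^'n::finite) set" and G and U' :: "(real^'n) set" and H +
  fixes \<phi> :: "real^'n \<Rightarrow> real^'n"
  assumes smooth_phi: "smooth_on U \<phi>" and maps: "x \<in> U \<Longrightarrow> \<phi> x \<in> U'"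
    and pullback: "x \<in> U \<Longrightarrow> G x = transpose (matrix (frechet_derivative \<phi> (at x))) ** H (\<phi> x) ** matrix (frechet_derivative \<phi> (at x))"
begin

lemma diff_phi: "x \<in> U \<Longrightarrow> \<phi> differentiable (at x)"
  by (rule smooth_on_differentiable[OF smooth_phi])

lemma smooth_phi_component: "smooth_on U (\<lambda>y. \<phi> y $ a)"
  by (rule smooth_on_vec_nth[OF M.open_U smooth_phi])

lemma smooth_jac: "smooth_on U (jac \<phi> a i)"
  unfolding jac_def[abs_def] using smooth_on_partial[OF smooth_phi_component] .

lemma smooth_comp: "smooth_on U' f \<Longrightarrow> smooth_on U (\<lambda>x. f (\<phi> x))"
  using smooth_on_compose[OF M.open_U N.open_U _ smooth_phi] maps by blast

lemma partial_jac_sym: "x \<in> U \<Longrightarrow> partial i (jac \<phi> a j) x = partial j (jac \<phi> a i) x"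
  unfolding jac_def[abs_def] by (rule partial_commute[OF M.open_U smooth_phi_component])

lemma partial_comp:
  "x \<in> U \<Longrightarrow> smooth_on U' f \<Longrightarrow> partial i (\<lambda>x. f (\<phi> x)) x = (\<Oplus>a. jac \<phi> a i x * partial a f (\<phi> x))"
  unfolding jac_def by (rule partial_chain[OF diff_phi smooth_on_differentiable[OF _ maps]])

lemma jac_matrix: "x \<in> U \<Longrightarrow> matrix (frechet_derivative \<phi> (at x)) $ a $ i = jac \<phi> a i x"
  unfolding jac_def by (rule matrix_frechet_derivative[OF diff_phi])

lemma pullback_component:
  assumes x: "x \<in> U"
  shows "G x $ i $ j = (\<Oplus>a b. jac \<phi> a i x * H (\<phi> x) $ a $ b * jac \<phi> b j x)"
proof -
  have "G x $ i $ j = (\<Oplus>b a. jac \<phi> a i x * H (\<phi> x) $ a $ b * jac \<phi> b j x)"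
    unfolding pullback[OF x] by (simp add: matrix_matrix_mult_def transpose_def jac_matrix[OF x] sum_distrib_right)
  then show ?thesis by (subst sum.swap)
qed

text \<open>The inverse Jacobian; \<open>ginv\<close> here simply reads off entries of an inverse
  matrix.\<close>

definition K :: "real^'n \<Rightarrow> 'n \<Rightarrow> 'n \<Rightarrow> real" where
  "K x = ginv (matrix (frechet_derivative \<phi> (at x)))"

lemma jac_invertible:
  assumes x: "x \<in> U"
  shows "invertible (matrix (frechet_derivative \<phi> (at x)))"
proof -
  have "det (G x) \<noteq> 0" using posdef_sym_det[OF M.posdef[OF x]] by simp
  then have "det (matrix (frechet_derivative \<phi> (at x))) \<noteq> 0"
    unfolding pullback[OF x] by (auto simp: det_mul)
  then show ?thesis using invertible_det_nz by blast
qed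

lemma K_inverse:
  assumes x: "x \<in> U"
  shows "(\<Oplus>i. jac \<phi> a i x * K x i b) = (if a = b then 1 else 0)"
    and "(\<Oplus>a. K x i a * jac \<phi> a j x) = (if i = j then 1 else 0)"
  using matrix_inv_right[OF jac_invertible[OF x]] matrix_inv_left[OF jac_invertible[OF x]]
  by (simp_all add: vec_eq_iff matrix_matrix_mult_def mat_def K_def ginv_def jac_matrix[OF x])

lemma jac_cancel:
  assumes x: "x \<in> U" and 0: "\<And>l. (\<Oplus>a. jac \<phi> a l x * v a) = 0"
  shows "v b = 0"
proof -
  have "v b = (\<Oplus>a. (\<Oplus>l. jac \<phi> a l x * K x l b) * v a)" by (simp add: K_inverse[OF x])
  also have "\<dots> = (\<Oplus>l a. jac \<phi> a l x * K x l b * v a)" unfolding sum_distrib_right by (rule sum.swap)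
  also have "\<dots> = (\<Oplus>l. K x l b * (\<Oplus>a. jac \<phi> a l x * v a))" by (simp add: sum_distrib_left mult_ac)
  finally show ?thesis by (simp add: 0)
qed

text \<open>Transformation laws are compared after lowering with \<open>H\<close> and pulling back
  with the Jacobian, where both sides are expressed by \<open>G\<close>. Both operations are
  injective, so the law itself follows.\<close>

lemma jac_metric_cancel:
  assumes x: "x \<in> U" and 0: "\<And>l. (\<Oplus>a. jac \<phi> a l x * (\<Oplus>b. H (\<phi> x) $ a $ b * v b)) = 0"
  shows "v b = 0"
proof -
  have "(\<Oplus>b. H (\<phi> x) $ a $ b * v b) = 0" for a by (rule jac_cancel[OF x 0])
  then show ?thesis using N.raise_lower(1)[OF maps[OF x], of b v] by simp
qed

text \<open>The inhomogeneous transformation law of a connection, obtained by differentiating the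
  pullback formula and comparing Christoffel symbols of the first kind.\<close>

lemma christoffel_transition:
  assumes x: "x \<in> U"
  shows "(\<Oplus>k. jac \<phi> a k x * christoffel G k i j x) =
    partial i (jac \<phi> a j) x + (\<Oplus>b c. christoffel H a b c (\<phi> x) * jac \<phi> b i x * jac \<phi> c j x)"
proof -
  let ?J = "\<lambda>a i. jac \<phi> a i x" and ?H = "\<lambda>a b. H (\<phi> x) $ a $ b" and ?dJ = "\<lambda>i a j. partial i (jac \<phi> a j) x"
  let ?dH = "\<lambda>c a b. partial c (\<lambda>y. H y $ a $ b) (\<phi> x)" and ?\<Gamma> = "\<lambda>k i j. christoffel G k i j x"
  \<comment> \<open>\<open>P\<close> collects the second derivatives of \<open>\<phi>\<close> and
    \<open>Z\<close> the pulled back metric derivatives. Since \<open>P\<close> is symmetric in its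
    first two arguments, four of its six occurrences cancel and the other two are equal.\<close>
  define P where "P i j l = (\<Oplus>a b. ?dJ i a j * ?H a b * ?J b l)" for i j l
  define Z where "Z i j l = (\<Oplus>a b c. ?J c i * ?J a j * ?J b l * ?dH c a b)" for i j l
  have dG: "partial i (\<lambda>y. G y $ j $ l) x = P i j l + P i l j + Z i j l" for i j l
  proof -
    note sm = smooth_jac smooth_comp[OF N.smooth_metric]
    have "partial i (\<lambda>y. G y $ j $ l) x = partial i (\<lambda>y. \<Oplus>a b. jac \<phi> a j y * H (\<phi> y) $ a $ b * jac \<phi> b l y) x"
      by (rule partial_cong[OF M.open_U x pullback_component]) (auto intro: M.differentiable_metric x)
    also have "\<dots> = (\<Oplus>a b. partial i (\<lambda>y. jac \<phi> a j y * H (\<phi> y) $ a $ b * jac \<phi> b l y) x)"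
      by (subst partial_sum | intro sum.cong refl smooth_on_differentiable[OF _ x] smooth_on_sum smooth_on_mult sm M.open_U)+
    also have "\<dots> = (\<Oplus>a b. (?dJ i a j * ?H a b + ?J a j * (\<Oplus>c. ?J c i * ?dH c a b)) * ?J b l + ?J a j * ?H a b * ?dJ i b l)"
    proof (intro sum.cong refl)
      fix a b
      have "partial i (\<lambda>y. jac \<phi> a j y * H (\<phi> y) $ a $ b * jac \<phi> b l y) x =
         partial i (\<lambda>y. jac \<phi> a j y * H (\<phi> y) $ a $ b) x * ?J b l + ?J a j * ?H a b * ?dJ i b l"
        by (intro partial_mult smooth_on_differentiable[OF _ x] smooth_on_mult sm M.open_U)
      also have "partial i (\<lambda>y. jac \<phi> a j y * H (\<phi> y) $ a $ b) x = ?dJ i a j * ?H a b + ?J a j * partial i (\<lambda>y. H (\<phi> y) $ a $ b) x"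
        by (intro partial_mult smooth_on_differentiable[OF _ x] smooth_on_mult sm M.open_U)
      also have "partial i (\<lambda>y. H (\<phi> y) $ a $ b) x = (\<Oplus>c. ?J c i * ?dH c a b)"
        by (rule partial_comp[OF x N.smooth_metric])
      finally show "partial i (\<lambda>y. jac \<phi> a j y * H (\<phi> y) $ a $ b * jac \<phi> b l y) x =
        (?dJ i a j * ?H a b + ?J a j * (\<Oplus>c. ?J c i * ?dH c a b)) * ?J b l + ?J a j * ?H a b * ?dJ i b l" .
    qed
    also have "\<dots> = P i j l + Z i j l + (\<Oplus>a b. ?J a j * ?H a b * ?dJ i b l)"
      unfolding P_def Z_def by (simp add: sum.distrib distrib_left distrib_right sum_distrib_left sum_distrib_right mult_ac)
    also have "(\<Oplus>a b. ?J a j * ?H a b * ?dJ i b l) = P i l j"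
      unfolding P_def by (subst sum.swap) (simp add: N.metric_sym[OF maps[OF x]] mult_ac)
    finally show ?thesis by simp
  qed
  have Psym: "P i j l = P j i l" for i j l unfolding P_def by (simp add: partial_jac_sym[OF x, of i _ j])
  have "(\<Oplus>a. ?J a l * (\<Oplus>b. ?H a b * ((\<Oplus>k. ?J b k * ?\<Gamma> k i j) - ?dJ i b j - (\<Oplus>c d. christoffel H b c d (\<phi> x) * ?J c i * ?J d j)))) = 0" for l
  proof -
    have 1: "(\<Oplus>a. ?J a l * (\<Oplus>b. ?H a b * (\<Oplus>k. ?J b k * ?\<Gamma> k i j))) = (\<Oplus>k. G x $ l $ k * ?\<Gamma> k i j)"
    proof -
      have "(\<Oplus>k. G x $ l $ k * ?\<Gamma> k i j) = (\<Oplus>k a b. ?J a l * ?H a b * ?J b k * ?\<Gamma> k i j)"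
        by (simp add: pullback_component[OF x] sum_distrib_right)
      also have "\<dots> = (\<Oplus>a k b. ?J a l * ?H a b * ?J b k * ?\<Gamma> k i j)" by (rule sum.swap)
      also have "\<dots> = (\<Oplus>a b k. ?J a l * ?H a b * ?J b k * ?\<Gamma> k i j)" by (rule sum.cong[OF refl], rule sum.swap)
      finally show ?thesis by (simp add: sum_distrib_left mult_ac)
    qed
    have 2: "(\<Oplus>a. ?J a l * (\<Oplus>b. ?H a b * ?dJ i b j)) = P i j l"
      unfolding P_def sum_distrib_left by (subst sum.swap) (simp add: N.metric_sym[OF maps[OF x]] mult_ac)
    have 3: "(\<Oplus>a. ?J a l * (\<Oplus>b. ?H a b * (\<Oplus>c d. christoffel H b c d (\<phi> x) * ?J c i * ?J d j))) = (1/2) * (Z i j l + Z j i l - Z l i j)"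
    proof -
      have "(\<Oplus>b. ?H a b * (\<Oplus>c d. christoffel H b c d (\<phi> x) * ?J c i * ?J d j)) =
         (\<Oplus>c d. (\<Oplus>b. ?H a b * christoffel H b c d (\<phi> x)) * ?J c i * ?J d j)" for a
      proof -
        have "(\<Oplus>b. ?H a b * (\<Oplus>c d. christoffel H b c d (\<phi> x) * ?J c i * ?J d j)) = (\<Oplus>b c d. ?H a b * christoffel H b c d (\<phi> x) * ?J c i * ?J d j)"
          by (simp add: sum_distrib_left mult_ac)
        also have "\<dots> = (\<Oplus>c b d. ?H a b * christoffel H b c d (\<phi> x) * ?J c i * ?J d j)" by (rule sum.swap)
        also have "\<dots> = (\<Oplus>c d b. ?H a b * christoffel H b c d (\<phi> x) * ?J c i * ?J d j)" by (rule sum.cong[OF refl], rule sum.swap)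
        finally show ?thesis by (simp add: sum_distrib_right)
      qed
      then have "(\<Oplus>a. ?J a l * (\<Oplus>b. ?H a b * (\<Oplus>c d. christoffel H b c d (\<phi> x) * ?J c i * ?J d j))) =
        (\<Oplus>a c d. ?J a l * ((1/2) * (?dH c d a + ?dH d c a - ?dH a c d)) * ?J c i * ?J d j)"
        by (simp only: N.lower_christoffel[OF maps[OF x]] sum_distrib_left mult.assoc)
      also have "\<dots> = (\<Oplus>a c d. (1/2) * ((?J c i * ?J d j * ?J a l * ?dH c d a) + (?J d j * ?J c i * ?J a l * ?dH d c a) - (?J a l * ?J c i * ?J d j * ?dH a c d)))"
        by (intro sum.cong refl) (simp add: algebra_simps)
      also have "\<dots> = (1/2) * ((\<Oplus>a c d. ?J c i * ?J d j * ?J a l * ?dH c d a) + (\<Oplus>a c d. ?J d j * ?J c i * ?J a l * ?dH d c a) - (\<Oplus>a c d. ?J a l * ?J c i * ?J d j * ?dH a c d))"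
        by (simp only: sum_distrib_left[symmetric] sum.distrib sum_subtractf)
      also have "(\<Oplus>a c d. ?J c i * ?J d j * ?J a l * ?dH c d a) = Z i j l"
      proof -
        have "(\<Oplus>a c d. ?J c i * ?J d j * ?J a l * ?dH c d a) = (\<Oplus>a d c. ?J c i * ?J d j * ?J a l * ?dH c d a)"
          by (rule sum.cong[OF refl], rule sum.swap)
        also have "\<dots> = Z i j l" unfolding Z_def by (rule sum.swap)
        finally show ?thesis .
      qed
      also have "(\<Oplus>a c d. ?J d j * ?J c i * ?J a l * ?dH d c a) = Z j i l" unfolding Z_def by (rule sum.swap)
      also have "(\<Oplus>a c d. ?J a l * ?J c i * ?J d j * ?dH a c d) = Z l i j"
      proof -
        have "(\<Oplus>a c d. ?J a l * ?J c i * ?J d j * ?dH a c d) = (\<Oplus>c a d. ?J a l * ?J c i * ?J d j * ?dH a c d)" by (rule sum.swap)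
        also have "\<dots> = Z l i j" unfolding Z_def by (rule sum.cong[OF refl], rule sum.swap)
        finally show ?thesis .
      qed
      finally show ?thesis .
    qed
    have "(\<Oplus>k. G x $ l $ k * ?\<Gamma> k i j) = P i j l + (1/2) * (Z i j l + Z j i l - Z l i j)"
      unfolding M.lower_christoffel[OF x] dG using Psym[of i j l] Psym[of l j i] Psym[of l i j] by (simp add: field_simps)
    then show ?thesis
      by (simp only: right_diff_distrib sum_subtractf 1 2 3)
  qed
  from jac_metric_cancel[OF x this, of a] show ?thesis by linarith
qed

text \<open>Differentiating the law for the Christoffel symbols and antisymmetrising in
  \<open>i\<close> and \<open>j\<close> removes the third derivatives of \<open>\<phi>\<close>,
  which are symmetric. The terms with second derivatives cancel against those from the quadratic
  part of the curvature.\<close>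

lemma riem_up_transition:
  assumes x: "x \<in> U"
  shows "(\<Oplus>l. jac \<phi> a l x * riem_up G l i j k x) =
    (\<Oplus>b c d. riem_up H a b c d (\<phi> x) * jac \<phi> b i x * jac \<phi> c j x * jac \<phi> d k x)"
proof -
  let ?J = "\<lambda>a i. jac \<phi> a i x" and ?dJ = "\<lambda>i a j. partial i (jac \<phi> a j) x"
  let ?\<Gamma> = "\<lambda>k i j. christoffel G k i j x" and ?\<Gamma>' = "\<lambda>k i j. christoffel H k i j (\<phi> x)"
  let ?d\<Gamma>' = "\<lambda>d a b c. partial d (christoffel H a b c) (\<phi> x)"
  \<comment> \<open>The pulled back connection. It is kept as a function of the point, so that the
    transformation law \<open>T1\<close>, valid on all of \<open>U\<close>, can be
    differentiated.\<close>
  define \<Theta> where "\<Theta> a j k x = (\<Oplus>b c. christoffel H a b c (\<phi> x) * jac \<phi> b j x * jac \<phi> c k x)" for a j k x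
  have T1: "(\<Oplus>l. jac \<phi> a l y * christoffel G l j k y) = partial j (jac \<phi> a k) y + \<Theta> a j k y" if "y \<in> U" for a j k y
    unfolding \<Theta>_def by (rule christoffel_transition[OF that])
  note sm = smooth_jac smooth_comp[OF N.smooth_Gamma] M.smooth_Gamma smooth_on_partial[OF smooth_jac]
  have sm\<Theta>: "smooth_on U (\<Theta> a j k)" for a j k
    unfolding \<Theta>_def[abs_def] by (intro smooth_on_sum smooth_on_mult sm M.open_U)
  have d\<Theta>: "partial i (\<Theta> a j k) x = (\<Oplus>b c d. ?J d i * ?J b j * ?J c k * ?d\<Gamma>' d a b c)
     + (\<Oplus>b c. ?\<Gamma>' a b c * ?dJ i b j * ?J c k) + (\<Oplus>b c. ?\<Gamma>' a b c * ?J b j * ?dJ i c k)" for i j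
  proof -
    have "partial i (\<Theta> a j k) x = (\<Oplus>b c. partial i (\<lambda>x. christoffel H a b c (\<phi> x) * jac \<phi> b j x * jac \<phi> c k x) x)"
      unfolding \<Theta>_def[abs_def]
      by (subst partial_sum | intro sum.cong refl smooth_on_differentiable[OF _ x] smooth_on_sum smooth_on_mult sm M.open_U)+
    also have "\<dots> = (\<Oplus>b c. ((\<Oplus>d. ?J d i * ?d\<Gamma>' d a b c) * ?J b j + ?\<Gamma>' a b c * ?dJ i b j) * ?J c k + ?\<Gamma>' a b c * ?J b j * ?dJ i c k)"
    proof (intro sum.cong refl)
      fix b c
      have "partial i (\<lambda>x. christoffel H a b c (\<phi> x) * jac \<phi> b j x * jac \<phi> c k x) x =
        partial i (\<lambda>x. christoffel H a b c (\<phi> x) * jac \<phi> b j x) x * ?J c k + ?\<Gamma>' a b c * ?J b j * ?dJ i c k"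
        by (intro partial_mult smooth_on_differentiable[OF _ x] smooth_on_mult sm M.open_U)
      also have "partial i (\<lambda>x. christoffel H a b c (\<phi> x) * jac \<phi> b j x) x =
        partial i (\<lambda>x. christoffel H a b c (\<phi> x)) x * ?J b j + ?\<Gamma>' a b c * ?dJ i b j"
        by (intro partial_mult smooth_on_differentiable[OF _ x] smooth_on_mult sm M.open_U)
      also have "partial i (\<lambda>x. christoffel H a b c (\<phi> x)) x = (\<Oplus>d. ?J d i * ?d\<Gamma>' d a b c)"
        by (rule partial_comp[OF x N.smooth_Gamma])
      finally show "partial i (\<lambda>x. christoffel H a b c (\<phi> x) * jac \<phi> b j x * jac \<phi> c k x) x =
         ((\<Oplus>d. ?J d i * ?d\<Gamma>' d a b c) * ?J b j + ?\<Gamma>' a b c * ?dJ i b j) * ?J c k + ?\<Gamma>' a b c * ?J b j * ?dJ i c k" .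
    qed
    finally show ?thesis by (simp add: sum.distrib distrib_left distrib_right sum_distrib_left sum_distrib_right mult_ac)
  qed
  have dT1: "(\<Oplus>l. ?J a l * partial i (christoffel G l j k) x) =
     partial i (partial j (jac \<phi> a k)) x + partial i (\<Theta> a j k) x - (\<Oplus>l. ?dJ i a l * ?\<Gamma> l j k)" for i j
  proof -
    have "partial i (\<lambda>y. \<Oplus>l. jac \<phi> a l y * christoffel G l j k y) x = partial i (\<lambda>y. partial j (jac \<phi> a k) y + \<Theta> a j k y) x"
      by (rule partial_cong[OF M.open_U x T1]) (assumption, intro smooth_on_differentiable[OF _ x] smooth_on_sum smooth_on_mult sm M.open_U)+
    also have "\<dots> = partial i (partial j (jac \<phi> a k)) x + partial i (\<Theta> a j k) x"
      by (intro partial_add smooth_on_differentiable[OF _ x] sm sm\<Theta>)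
    also have "partial i (\<lambda>y. \<Oplus>l. jac \<phi> a l y * christoffel G l j k y) x = (\<Oplus>l. partial i (\<lambda>y. jac \<phi> a l y * christoffel G l j k y) x)"
      by (intro partial_sum smooth_on_differentiable[OF _ x] smooth_on_mult sm M.open_U)
    also have "\<dots> = (\<Oplus>l. ?dJ i a l * ?\<Gamma> l j k + ?J a l * partial i (christoffel G l j k) x)"
      by (intro sum.cong refl partial_mult smooth_on_differentiable[OF _ x] sm)
    finally show ?thesis by (simp add: sum.distrib)
  qed
  have quad: "(\<Oplus>l. ?J a l * (\<Oplus>m. ?\<Gamma> l i m * ?\<Gamma> m j k)) = (\<Oplus>m. ?dJ i a m * ?\<Gamma> m j k) + (\<Oplus>b c. ?\<Gamma>' a b c * ?J b i * (?dJ j c k + \<Theta> c j k x))" for i j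
  proof -
    have "(\<Oplus>l. ?J a l * (\<Oplus>m. ?\<Gamma> l i m * ?\<Gamma> m j k)) = (\<Oplus>m l. ?J a l * ?\<Gamma> l i m * ?\<Gamma> m j k)"
      unfolding sum_distrib_left by (subst sum.swap) (simp only: mult.assoc)
    also have "\<dots> = (\<Oplus>m. (?dJ i a m + \<Theta> a i m x) * ?\<Gamma> m j k)"
      by (simp only: sum_distrib_right[symmetric] T1[OF x])
    also have "\<dots> = (\<Oplus>m. ?dJ i a m * ?\<Gamma> m j k) + (\<Oplus>m. \<Theta> a i m x * ?\<Gamma> m j k)"
      by (simp only: distrib_right sum.distrib)
    also have "(\<Oplus>m. \<Theta> a i m x * ?\<Gamma> m j k) = (\<Oplus>b c. ?\<Gamma>' a b c * ?J b i * (?dJ j c k + \<Theta> c j k x))"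
    proof -
      have "(\<Oplus>m. \<Theta> a i m x * ?\<Gamma> m j k) = (\<Oplus>m b c. ?\<Gamma>' a b c * ?J b i * (?J c m * ?\<Gamma> m j k))"
        by (simp only: \<Theta>_def sum_distrib_right mult.assoc)
      also have "\<dots> = (\<Oplus>b m c. ?\<Gamma>' a b c * ?J b i * (?J c m * ?\<Gamma> m j k))" by (rule sum.swap)
      also have "\<dots> = (\<Oplus>b c m. ?\<Gamma>' a b c * ?J b i * (?J c m * ?\<Gamma> m j k))" by (rule sum.cong[OF refl], rule sum.swap)
      finally show ?thesis by (simp only: sum_distrib_left[symmetric] T1[OF x])
    qed
    finally show ?thesis .
  qed
  have \<Theta>\<Theta>: "(\<Oplus>b c. ?\<Gamma>' a b c * ?J b i * \<Theta> c j k x) = (\<Oplus>b c d m. ?\<Gamma>' a b m * ?\<Gamma>' m c d * ?J b i * ?J c j * ?J d k)" for i j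
  proof -
    have "(\<Oplus>b c. ?\<Gamma>' a b c * ?J b i * \<Theta> c j k x) = (\<Oplus>b m c d. ?\<Gamma>' a b m * ?\<Gamma>' m c d * ?J b i * ?J c j * ?J d k)"
      by (simp add: \<Theta>_def sum_distrib_left mult_ac)
    also have "\<dots> = (\<Oplus>b c m d. ?\<Gamma>' a b m * ?\<Gamma>' m c d * ?J b i * ?J c j * ?J d k)"
      by (rule sum.cong[OF refl], rule sum.swap)
    also have "\<dots> = (\<Oplus>b c d m. ?\<Gamma>' a b m * ?\<Gamma>' m c d * ?J b i * ?J c j * ?J d k)"
      by (rule sum.cong[OF refl], rule sum.cong[OF refl], rule sum.swap)
    finally show ?thesis .
  qed
  have dd: "partial i (partial j (jac \<phi> a k)) x = partial j (partial i (jac \<phi> a k)) x"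
    by (rule partial_commute[OF M.open_U smooth_jac x])
  have "(\<Oplus>l. ?J a l * riem_up G l i j k x) = (\<Oplus>l. ?J a l * partial i (christoffel G l j k) x) - (\<Oplus>l. ?J a l * partial j (christoffel G l i k) x)
    + (\<Oplus>l. ?J a l * (\<Oplus>m. ?\<Gamma> l i m * ?\<Gamma> m j k)) - (\<Oplus>l. ?J a l * (\<Oplus>m. ?\<Gamma> l j m * ?\<Gamma> m i k))"
    unfolding riem_up_def sum_subtractf by (simp only: distrib_left right_diff_distrib sum.distrib sum_subtractf)
  also have "\<dots> = ((\<Oplus>b c d. ?J d i * ?J b j * ?J c k * ?d\<Gamma>' d a b c) - (\<Oplus>b c d. ?J d j * ?J b i * ?J c k * ?d\<Gamma>' d a b c))
     + ((\<Oplus>b c. ?\<Gamma>' a b c * ?J b i * \<Theta> c j k x) - (\<Oplus>b c. ?\<Gamma>' a b c * ?J b j * \<Theta> c i k x))"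
    unfolding dT1 quad d\<Theta> by (simp add: dd partial_jac_sym[OF x, of j _ i] distrib_left sum.distrib)
  also have "(\<Oplus>b c d. ?J d i * ?J b j * ?J c k * ?d\<Gamma>' d a b c) = (\<Oplus>b c d. ?d\<Gamma>' b a c d * ?J b i * ?J c j * ?J d k)"
  proof -
    have "(\<Oplus>b c d. ?J d i * ?J b j * ?J c k * ?d\<Gamma>' d a b c) = (\<Oplus>c d b. ?d\<Gamma>' b a c d * ?J b i * ?J c j * ?J d k)" by (simp add: mult_ac)
    also have "\<dots> = (\<Oplus>c b d. ?d\<Gamma>' b a c d * ?J b i * ?J c j * ?J d k)" by (rule sum.cong[OF refl], rule sum.swap)
    also have "\<dots> = (\<Oplus>b c d. ?d\<Gamma>' b a c d * ?J b i * ?J c j * ?J d k)" by (rule sum.swap)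
    finally show ?thesis .
  qed
  also have "(\<Oplus>b c d. ?J d j * ?J b i * ?J c k * ?d\<Gamma>' d a b c) = (\<Oplus>b c d. ?d\<Gamma>' c a b d * ?J b i * ?J c j * ?J d k)"
  proof -
    have "(\<Oplus>b c d. ?J d j * ?J b i * ?J c k * ?d\<Gamma>' d a b c) = (\<Oplus>b d c. ?d\<Gamma>' c a b d * ?J b i * ?J c j * ?J d k)" by (simp add: mult_ac)
    also have "\<dots> = (\<Oplus>b c d. ?d\<Gamma>' c a b d * ?J b i * ?J c j * ?J d k)" by (rule sum.cong[OF refl], rule sum.swap)
    finally show ?thesis .
  qed
  also have "(\<Oplus>b c. ?\<Gamma>' a b c * ?J b j * \<Theta> c i k x) = (\<Oplus>b c d m. ?\<Gamma>' a c m * ?\<Gamma>' m b d * ?J b i * ?J c j * ?J d k)"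
    unfolding \<Theta>\<Theta> by (subst sum.swap) (simp add: mult_ac)
  also note \<Theta>\<Theta>
  finally show ?thesis
    unfolding riem_up_def
    by (simp only: sum.distrib[symmetric] sum_subtractf[symmetric]) (simp add: algebra_simps sum.distrib sum_subtractf sum_distrib_left sum_distrib_right)
qed

end

lemma sum_rotate_four: "(\<Oplus>a c d e. F a c d e) = (\<Oplus>c d e a. (F a c d e :: 'a::comm_monoid_add))"
proof -
  have "(\<Oplus>a c d e. F a c d e) = (\<Oplus>c a d e. F a c d e)" by (rule sum.swap)
  also have "\<dots> = (\<Oplus>c d a e. F a c d e)" by (rule sum.cong[OF refl], rule sum.swap)
  also have "\<dots> = (\<Oplus>c d e a. F a c d e)" by (rule sum.cong[OF refl], rule sum.cong[OF refl], rule sum.swap)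
  finally show ?thesis .
qed

lemma quadrilinear_substitution:
  fixes J :: "real^'n::finite^'n"
  assumes "\<And>i j k l. R i j k l = (\<Oplus>c d e a. R' c d e a * J $ c $ i * J $ d $ j * J $ e $ k * J $ a $ l)"
  shows "quadrilinear R X Y Z W = quadrilinear R' (J *v X) (J *v Y) (J *v Z) (J *v W)"
proof -
  define w where "w z y = (case z of (c, d, e, a) \<Rightarrow> case y of (i, j, k, l) \<Rightarrow> J $ c $ i * J $ d $ j * J $ e $ k * J $ a $ l)"
    for z y :: "'n \<times> 'n \<times> 'n \<times> 'n"
  define v where "v y = (case y of (i, j, k, l) \<Rightarrow> X $ i * Y $ j * Z $ k * W $ l)" for y
  have prod4: "(\<Oplus>p. F p) * ((\<Oplus>q. K q) * ((\<Oplus>r. L r) * (\<Oplus>s. M s))) = (\<Oplus>p q r s. F p * (K q * (L r * M s)))"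
    for F K L M :: "'n \<Rightarrow> real"
    by (simp only: sum_distrib_right[symmetric] sum_distrib_left[symmetric])
  have R: "R i j k l = (\<Oplus>z. (case z of (c, d, e, a) \<Rightarrow> R' c d e a) * w z (i, j, k, l))" for i j k l
    unfolding assms sum_quadruple by (rule sum.cong) (auto simp: w_def)
  have V: "(J *v X) $ c * (J *v Y) $ d * (J *v Z) $ e * (J *v W) $ a = (\<Oplus>y. w (c, d, e, a) y * v y)" for c d e a
  proof -
    have "(J *v X) $ c * (J *v Y) $ d * (J *v Z) $ e * (J *v W) $ a =
       (\<Oplus>i. J $ c $ i * X $ i) * ((\<Oplus>j. J $ d $ j * Y $ j) * ((\<Oplus>k. J $ e $ k * Z $ k) * (\<Oplus>l. J $ a $ l * W $ l)))"
      by (simp add: matrix_vector_mult_def mult.assoc)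
    also have "\<dots> = (\<Oplus>y. w (c, d, e, a) y * v y)"
      unfolding prod4 sum_quadruple by (rule sum.cong) (auto simp: w_def v_def)
    finally show ?thesis .
  qed
  have "quadrilinear R X Y Z W = (\<Oplus>y. (\<Oplus>z. (case z of (c, d, e, a) \<Rightarrow> R' c d e a) * w z y) * v y)"
    unfolding quadrilinear_def R by (rule trans[OF sum_quadruple], rule sum.cong) (auto simp: v_def mult.assoc)
  also have "\<dots> = (\<Oplus>z. (case z of (c, d, e, a) \<Rightarrow> R' c d e a) * (\<Oplus>y. w z y * v y))"
    unfolding sum_distrib_right sum_distrib_left by (subst sum.swap) (simp only: mult.assoc)
  also have "\<dots> = (\<Oplus>z. (case z of (c, d, e, a) \<Rightarrow> R' c d e a * ((J *v X) $ c * (J *v Y) $ d * (J *v Z) $ e * (J *v W) $ a)))"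
    by (rule sum.cong) (auto simp: V)
  also have "\<dots> = quadrilinear R' (J *v X) (J *v Y) (J *v Z) (J *v W)"
    unfolding quadrilinear_def mult.assoc by (rule sum_quadruple[symmetric])
  finally show ?thesis .
qed

lemma bilinear_form_substitution:
  fixes J :: "real^'n::finite^'n"
  assumes "\<And>i j. R i j = (\<Oplus>c d. R' c d * J $ c $ i * J $ d $ j)"
  shows "bilinear_form R X Y = bilinear_form R' (J *v X) (J *v Y)"
proof -
  have "bilinear_form R X Y = (\<Oplus>i j c d. R' c d * J $ c $ i * J $ d $ j * X $ i * Y $ j)"
    unfolding bilinear_form_def assms sum_distrib_right ..
  also have "\<dots> = (\<Oplus>c d i j. R' c d * J $ c $ i * J $ d $ j * X $ i * Y $ j)" by (rule sum_swap_pairs)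
  also have "\<dots> = (\<Oplus>c d. R' c d * ((\<Oplus>i. J $ c $ i * X $ i) * (\<Oplus>j. J $ d $ j * Y $ j)))"
    unfolding sum_product unfolding sum_distrib_left by (intro sum.cong refl) (simp only: mult_ac)
  finally show ?thesis by (simp add: bilinear_form_def matrix_vector_mult_def mult.assoc)
qed

section \<open>Chart independence of the curvature invariants\<close>

context metric_transition
begin

definition Jm :: "real^'n \<Rightarrow> real^'n^'n" where "Jm x = matrix (frechet_derivative \<phi> (at x))"

lemma Jm_component: "x \<in> U \<Longrightarrow> Jm x $ a $ i = jac \<phi> a i x"
  unfolding Jm_def by (rule jac_matrix)

lemma pullback_lower:
  assumes x: "x \<in> U"
  shows "(\<Oplus>a. jac \<phi> a l x * (\<Oplus>b. H (\<phi> x) $ a $ b * (\<Oplus>k. jac \<phi> b k x * y k))) = (\<Oplus>k. G x $ l $ k * y k)"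
proof -
  have "(\<Oplus>k. G x $ l $ k * y k) = (\<Oplus>k a b. jac \<phi> a l x * H (\<phi> x) $ a $ b * jac \<phi> b k x * y k)"
    by (simp add: pullback_component[OF x] sum_distrib_right)
  also have "\<dots> = (\<Oplus>a k b. jac \<phi> a l x * H (\<phi> x) $ a $ b * jac \<phi> b k x * y k)" by (rule sum.swap)
  also have "\<dots> = (\<Oplus>a b k. jac \<phi> a l x * H (\<phi> x) $ a $ b * jac \<phi> b k x * y k)" by (rule sum.cong[OF refl], rule sum.swap)
  finally show ?thesis by (simp add: sum_distrib_left mult_ac)
qed

lemma riem_transition:
  assumes x: "x \<in> U"
  shows "riem G i j k l x = (\<Oplus>c d e a. riem H c d e a (\<phi> x) * Jm x $ c $ i * Jm x $ d $ j * Jm x $ e $ k * Jm x $ a $ l)"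
proof -
  let ?J = "\<lambda>a i. jac \<phi> a i x" and ?R = "\<lambda>a b c d. riem_up H a b c d (\<phi> x)" and ?H = "\<lambda>a b. H (\<phi> x) $ a $ b"
  have "riem G i j k l x = (\<Oplus>a. ?J a l * (\<Oplus>b. ?H a b * (\<Oplus>c d e. ?R b c d e * ?J c i * ?J d j * ?J e k)))"
    unfolding riem_def pullback_lower[OF x, symmetric] riem_up_transition[OF x] ..
  also have "\<dots> = (\<Oplus>a b c d e. ?J a l * (?H a b * ?R b c d e * ?J c i * ?J d j * ?J e k))"
    by (simp only: sum_distrib_left mult.assoc)
  also have "\<dots> = (\<Oplus>a c d e b. ?J a l * (?H a b * ?R b c d e * ?J c i * ?J d j * ?J e k))"
    by (rule sum.cong[OF refl], rule sum_rotate_four)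
  also have "\<dots> = (\<Oplus>c d e a b. ?J a l * (?H a b * ?R b c d e * ?J c i * ?J d j * ?J e k))"
    by (rule sum_rotate_four)
  also have "\<dots> = (\<Oplus>c d e a. riem H c d e a (\<phi> x) * ?J c i * ?J d j * ?J e k * ?J a l)"
    unfolding riem_def sum_distrib_right by (intro sum.cong refl) (simp only: mult_ac)
  finally show ?thesis by (simp only: Jm_component[OF x])
qed

lemma ricci_transition:
  assumes x: "x \<in> U"
  shows "ricci G j k x = (\<Oplus>c d. ricci H c d (\<phi> x) * Jm x $ c $ j * Jm x $ d $ k)"
proof -
  let ?J = "\<lambda>a i. jac \<phi> a i x" and ?R = "\<lambda>a b c d. riem_up H a b c d (\<phi> x)"
  have up: "riem_up G l i j k x = (\<Oplus>a. K x l a * (\<Oplus>b c d. ?R a b c d * ?J b i * ?J c j * ?J d k))" for l i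
  proof -
    have "(\<Oplus>a. K x l a * (\<Oplus>m. ?J a m * riem_up G m i j k x)) = (\<Oplus>m a. K x l a * ?J a m * riem_up G m i j k x)"
      unfolding sum_distrib_left by (subst sum.swap) (simp only: mult.assoc)
    also have "\<dots> = riem_up G l i j k x" by (simp only: sum_distrib_right[symmetric] K_inverse[OF x] sum_delta_mult)
    finally show ?thesis unfolding riem_up_transition[OF x] by simp
  qed
  have "ricci G j k x = (\<Oplus>i a b. K x i a * ?J b i * (\<Oplus>c d. ?R a b c d * ?J c j * ?J d k))"
    unfolding ricci_def up sum_distrib_left by (intro sum.cong refl) (simp only: mult_ac)
  also have "\<dots> = (\<Oplus>a i b. K x i a * ?J b i * (\<Oplus>c d. ?R a b c d * ?J c j * ?J d k))" by (rule sum.swap)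
  also have "\<dots> = (\<Oplus>a b i. K x i a * ?J b i * (\<Oplus>c d. ?R a b c d * ?J c j * ?J d k))" by (rule sum.cong[OF refl], rule sum.swap)
  also have "\<dots> = (\<Oplus>a b. (\<Oplus>i. ?J b i * K x i a) * (\<Oplus>c d. ?R a b c d * ?J c j * ?J d k))"
    by (simp only: sum_distrib_right mult.commute[of "K x _ _"])
  also have "\<dots> = (\<Oplus>a c d. ?R a a c d * ?J c j * ?J d k)" by (simp only: K_inverse[OF x] sum_delta_mult)
  also have "\<dots> = (\<Oplus>c a d. ?R a a c d * ?J c j * ?J d k)" by (rule sum.swap)
  also have "\<dots> = (\<Oplus>c d a. ?R a a c d * ?J c j * ?J d k)" by (rule sum.cong[OF refl], rule sum.swap)
  also have "\<dots> = (\<Oplus>c d. ricci H c d (\<phi> x) * ?J c j * ?J d k)" by (simp only: ricci_def sum_distrib_right)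
  finally show ?thesis by (simp only: Jm_component[OF x])
qed

text \<open>The Jacobian maps a \<open>G\<close>-orthonormal frame \<open>E\<close> to an
  \<open>H\<close>-orthonormal frame \<open>F\<close>. In these frames the components of both
  curvature tensors coincide, hence so do the sums expressing the invariants.\<close>

lemma invariants:
  assumes x: "x \<in> U"
  shows "riem_sq G x = riem_sq H (\<phi> x)"
    and "ricci_sq G x = ricci_sq H (\<phi> x)"
    and "scalar_curv G x = scalar_curv H (\<phi> x)"
proof -
  obtain E :: "real^'n^'n" where E: "transpose E ** G x ** E = mat 1"
    using ex_orthonormal_frame[OF M.posdef[OF x]] by blast
  define F where "F = Jm x ** E"
  have F: "transpose F ** H (\<phi> x) ** F = mat 1"
    using E unfolding pullback[OF x] F_def Jm_def by (simp add: matrix_transpose_mul matrix_mul_assoc)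
  have col: "column p F = Jm x *v column p E" for p
    by (simp add: F_def column_def matrix_matrix_mult_def matrix_vector_mult_def vec_eq_iff)
  note h = ginv_frame[OF E] ginv_frame[OF F]
  show "riem_sq G x = riem_sq H (\<phi> x)"
    unfolding riem_sq_def contract_four[OF h(1), where R="\<lambda>i j k l. riem G i j k l x" and R'="\<lambda>i j k l. riem G i j k l x"]
      contract_four[OF h(2), where R="\<lambda>i j k l. riem H i j k l (\<phi> x)" and R'="\<lambda>i j k l. riem H i j k l (\<phi> x)"] col
    by (simp only: quadrilinear_substitution[OF riem_transition[OF x]])
  show "ricci_sq G x = ricci_sq H (\<phi> x)"
    unfolding ricci_sq_def contract_two[OF h(1), where R="\<lambda>i j. ricci G i j x" and R'="\<lambda>i j. ricci G i j x"]
      contract_two[OF h(2), where R="\<lambda>i j. ricci H i j (\<phi> x)" and R'="\<lambda>i j. ricci H i j (\<phi> x)"] col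
    by (simp only: bilinear_form_substitution[OF ricci_transition[OF x]])
  show "scalar_curv G x = scalar_curv H (\<phi> x)"
    unfolding scalar_curv_def contract_one[OF h(1), where R="\<lambda>i j. ricci G i j x"]
      contract_one[OF h(2), where R="\<lambda>i j. ricci H i j (\<phi> x)"] col
    by (simp only: bilinear_form_substitution[OF ricci_transition[OF x]])
qed

text \<open>The hypothesis says that the Jacobian intertwines \<open>A\<close> and
  \<open>A'\<close>, so these are conjugate matrices and have the same trace.\<close>

lemma trace_transition:
  assumes x: "x \<in> U" and A: "\<And>a k. (\<Oplus>l. jac \<phi> a l x * A l k) = (\<Oplus>b. A' a b * jac \<phi> b k x)"
  shows "(\<Oplus>k. A k k) = (\<Oplus>a. A' a a)"
proof -
  have "(\<Oplus>k. A k k) = (\<Oplus>k l. (\<Oplus>a. K x k a * jac \<phi> a l x) * A l k)" by (simp add: K_inverse[OF x])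
  also have "\<dots> = (\<Oplus>k l a. K x k a * jac \<phi> a l x * A l k)" by (simp only: sum_distrib_right)
  also have "\<dots> = (\<Oplus>k a l. K x k a * jac \<phi> a l x * A l k)" by (rule sum.cong[OF refl], rule sum.swap)
  also have "\<dots> = (\<Oplus>k a b. K x k a * (A' a b * jac \<phi> b k x))"
    by (simp only: mult.assoc sum_distrib_left[symmetric] A)
  also have "\<dots> = (\<Oplus>a k b. K x k a * (A' a b * jac \<phi> b k x))" by (rule sum.swap)
  also have "\<dots> = (\<Oplus>a b k. K x k a * (A' a b * jac \<phi> b k x))" by (rule sum.cong[OF refl], rule sum.swap)
  also have "\<dots> = (\<Oplus>a b. (\<Oplus>k. jac \<phi> b k x * K x k a) * A' a b)"
    unfolding sum_distrib_right by (intro sum.cong refl) (simp only: mult_ac)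
  also have "\<dots> = (\<Oplus>a. A' a a)" by (simp only: K_inverse[OF x] sum_delta_mult)
  finally show ?thesis .
qed

section \<open>Transformation of gradient, Hessian and Bochner field\<close>

context
  fixes f f' :: "real^'n \<Rightarrow> real"
  assumes f': "smooth_on U' f'" and ff': "\<And>x. x \<in> U \<Longrightarrow> f x = f' (\<phi> x)"
begin

lemma smooth_pulled_back: "smooth_on U f"
  using smooth_comp[OF f'] smooth_on_cong[OF M.open_U ff'] by simp

lemma gradient_transition:
  assumes x: "x \<in> U"
  shows "(\<Oplus>i. jac \<phi> a i x * gradient G f i x) = gradient H f' a (\<phi> x)"
proof -
  have df: "partial l f x = (\<Oplus>a. jac \<phi> a l x * partial a f' (\<phi> x))" for l
    using partial_cong[where i=l, OF M.open_U x ff'] partial_comp[OF x f', where i=l] smooth_on_differentiable[OF smooth_pulled_back x] by simp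
  have "(\<Oplus>a. jac \<phi> a l x * (\<Oplus>b. H (\<phi> x) $ a $ b * ((\<Oplus>k. jac \<phi> b k x * gradient G f k x) - gradient H f' b (\<phi> x)))) = 0" for l
    by (simp only: right_diff_distrib sum_subtractf pullback_lower[OF x] M.lower_gradient[OF smooth_pulled_back x]
        N.lower_gradient[OF f' maps[OF x]] df)
  from jac_metric_cancel[OF x this, of a] show ?thesis by simp
qed

text \<open>Differentiating the transformation law of the gradient produces a derivative of the
  Jacobian; it cancels the inhomogeneous term in the law of the Christoffel symbols.\<close>

lemma nabla_transition:
  assumes x: "x \<in> U"
  shows "(\<Oplus>l. jac \<phi> a l x * nabla G (gradient G f) l k x) = (\<Oplus>b. nabla H (gradient H f') a b (\<phi> x) * jac \<phi> b k x)"
proof -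
  let ?V = "gradient G f" and ?V' = "gradient H f'"
  let ?J = "\<lambda>a i. jac \<phi> a i x" and ?dJ = "\<lambda>i a j. partial i (jac \<phi> a j) x"
  note sm = smooth_jac M.smooth_gradient[OF smooth_pulled_back] smooth_comp[OF N.smooth_gradient[OF f']]
  have "partial k (\<lambda>x. \<Oplus>i. jac \<phi> a i x * ?V i x) x = partial k (\<lambda>x. ?V' a (\<phi> x)) x"
    by (rule partial_cong[OF M.open_U x gradient_transition])
       (assumption, intro smooth_on_differentiable[OF _ x] smooth_on_sum smooth_on_mult sm M.open_U)
  also have "\<dots> = (\<Oplus>b. ?J b k * partial b (?V' a) (\<phi> x))" by (rule partial_comp[OF x N.smooth_gradient[OF f']])
  also have "partial k (\<lambda>x. \<Oplus>i. jac \<phi> a i x * ?V i x) x = (\<Oplus>i. partial k (\<lambda>x. jac \<phi> a i x * ?V i x) x)"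
    by (intro partial_sum smooth_on_differentiable[OF _ x] smooth_on_mult sm M.open_U)
  also have "\<dots> = (\<Oplus>i. ?dJ k a i * ?V i x + ?J a i * partial k (?V i) x)"
    by (intro sum.cong refl partial_mult smooth_on_differentiable[OF _ x] sm)
  finally have 1: "(\<Oplus>l. ?J a l * partial k (?V l) x) = (\<Oplus>b. ?J b k * partial b (?V' a) (\<phi> x)) - (\<Oplus>m. ?dJ k a m * ?V m x)"
    by (simp add: sum.distrib)
  have "(\<Oplus>l. ?J a l * (\<Oplus>m. christoffel G l k m x * ?V m x)) = (\<Oplus>m. (\<Oplus>l. ?J a l * christoffel G l k m x) * ?V m x)"
    unfolding sum_distrib_left sum_distrib_right by (subst sum.swap) (simp only: mult.assoc)
  also have "\<dots> = (\<Oplus>m. ?dJ k a m * ?V m x) + (\<Oplus>m. (\<Oplus>b c. christoffel H a b c (\<phi> x) * ?J b k * ?J c m) * ?V m x)"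
    by (simp only: christoffel_transition[OF x] distrib_right sum.distrib)
  also have "(\<Oplus>m. (\<Oplus>b c. christoffel H a b c (\<phi> x) * ?J b k * ?J c m) * ?V m x) = (\<Oplus>b. ?J b k * (\<Oplus>c. christoffel H a b c (\<phi> x) * ?V' c (\<phi> x)))"
  proof -
    have "(\<Oplus>m. (\<Oplus>b c. christoffel H a b c (\<phi> x) * ?J b k * ?J c m) * ?V m x) = (\<Oplus>m b c. ?J b k * (christoffel H a b c (\<phi> x) * (?J c m * ?V m x)))"
      unfolding sum_distrib_right by (intro sum.cong refl) (simp only: mult_ac)
    also have "\<dots> = (\<Oplus>b m c. ?J b k * (christoffel H a b c (\<phi> x) * (?J c m * ?V m x)))" by (rule sum.swap)
    also have "\<dots> = (\<Oplus>b c m. ?J b k * (christoffel H a b c (\<phi> x) * (?J c m * ?V m x)))" by (rule sum.cong[OF refl], rule sum.swap)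
    finally show ?thesis by (simp only: sum_distrib_left[symmetric] gradient_transition[OF x])
  qed
  finally show ?thesis unfolding nabla_def distrib_left sum.distrib 1
    by (simp add: distrib_left distrib_right sum.distrib mult.commute)
qed

lemma laplacian_invariant:
  "x \<in> U \<Longrightarrow> (\<Oplus>k. nabla G (gradient G f) k k x) = (\<Oplus>k. nabla H (gradient H f') k k (\<phi> x))"
  by (rule trace_transition[OF _ nabla_transition])

text \<open>\<open>trace_transition\<close> applied to the squares of the covariant derivatives,
  which are intertwined as well.\<close>

lemma hessian_sq_invariant:
  assumes x: "x \<in> U"
  shows "(\<Oplus>i k. nabla G (gradient G f) i k x * nabla G (gradient G f) k i x) =
    (\<Oplus>i k. nabla H (gradient H f') i k (\<phi> x) * nabla H (gradient H f') k i (\<phi> x))"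
proof (rule trace_transition[OF x, where A="\<lambda>l k. \<Oplus>m. nabla G (gradient G f) l m x * nabla G (gradient G f) m k x"
      and A'="\<lambda>a c. \<Oplus>b. nabla H (gradient H f') a b (\<phi> x) * nabla H (gradient H f') b c (\<phi> x)"])
  let ?A = "\<lambda>i k. nabla G (gradient G f) i k x" and ?A' = "\<lambda>i k. nabla H (gradient H f') i k (\<phi> x)"
  fix a k
  have "(\<Oplus>l. jac \<phi> a l x * (\<Oplus>m. ?A l m * ?A m k)) = (\<Oplus>m. (\<Oplus>l. jac \<phi> a l x * ?A l m) * ?A m k)"
    unfolding sum_distrib_left sum_distrib_right by (subst sum.swap) (simp only: mult.assoc)
  also have "\<dots> = (\<Oplus>m b. ?A' a b * (jac \<phi> b m x * ?A m k))"
    unfolding nabla_transition[OF x] sum_distrib_right by (simp only: mult.assoc)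
  also have "\<dots> = (\<Oplus>b m. ?A' a b * (jac \<phi> b m x * ?A m k))" by (rule sum.swap)
  also have "\<dots> = (\<Oplus>b. ?A' a b * (\<Oplus>c. ?A' b c * jac \<phi> c k x))"
    by (simp only: sum_distrib_left[symmetric] nabla_transition[OF x])
  also have "\<dots> = (\<Oplus>c b. ?A' a b * ?A' b c * jac \<phi> c k x)"
    unfolding sum_distrib_left by (subst sum.swap) (simp only: mult.assoc)
  finally show "(\<Oplus>l. jac \<phi> a l x * (\<Oplus>m. ?A l m * ?A m k)) = (\<Oplus>c. (\<Oplus>b. ?A' a b * ?A' b c) * jac \<phi> c k x)"
    by (simp only: sum_distrib_right)
qed

lemma bochner_field_transition:
  assumes x: "x \<in> U"
  shows "(\<Oplus>i. jac \<phi> a i x * bochner_field G (gradient G f) i x) = bochner_field H (gradient H f') a (\<phi> x)"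
proof -
  let ?V = "\<lambda>i. gradient G f i x" and ?V' = "\<lambda>i. gradient H f' i (\<phi> x)"
  let ?A = "\<lambda>i k. nabla G (gradient G f) i k x" and ?A' = "\<lambda>i k. nabla H (gradient H f') i k (\<phi> x)"
  have "(\<Oplus>i. jac \<phi> a i x * (\<Oplus>k. ?V k * ?A i k)) = (\<Oplus>k. (\<Oplus>i. jac \<phi> a i x * ?A i k) * ?V k)"
    unfolding sum_distrib_left sum_distrib_right by (subst sum.swap) (simp only: mult_ac)
  also have "\<dots> = (\<Oplus>k b. ?A' a b * (jac \<phi> b k x * ?V k))"
    unfolding nabla_transition[OF x] sum_distrib_right by (simp only: mult.assoc)
  also have "\<dots> = (\<Oplus>b k. ?A' a b * (jac \<phi> b k x * ?V k))" by (rule sum.swap)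
  also have "\<dots> = (\<Oplus>b. ?V' b * ?A' a b)"
    by (simp only: sum_distrib_left[symmetric] gradient_transition[OF x]) (simp only: mult.commute)
  finally have 1: "(\<Oplus>i. jac \<phi> a i x * (\<Oplus>k. ?V k * ?A i k)) = (\<Oplus>b. ?V' b * ?A' a b)" .
  have 2: "(\<Oplus>i. jac \<phi> a i x * (?V i * c)) = ?V' a * c" for c
    by (simp only: mult.assoc[symmetric] sum_distrib_right[symmetric] gradient_transition[OF x])
  show ?thesis
    unfolding bochner_field_def right_diff_distrib sum_subtractf 1 2 laplacian_invariant[OF x] ..
qed

end

end

section \<open>Volume measure\<close>

locale closed_manifold =
  fixes A :: "('m::{t2_space, second_countable_topology}, 'n::finite) chart set"
  assumes closed_connected: "closed_connected_manifold A"
begin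

lemma atlas: "smooth_atlas A" and compact_manifold: "compact (UNIV :: 'm set)"
  using closed_connected by (auto simp: closed_connected_manifold_def)

lemma ex_chart: "\<exists>c\<in>A. p \<in> chart_dom c"
  using atlas by (auto simp: smooth_atlas_def)

lemma
  assumes "c \<in> A"
  shows open_dom: "open (chart_dom c)" and open_img: "open (chart_img c)"
    and homeo: "homeomorphism (chart_dom c) (chart_img c) (chart_map c) (chart_inv c)"
  using atlas assms by (auto simp: smooth_atlas_def)

lemma
  assumes c: "c \<in> A"
  shows inv_map: "p \<in> chart_dom c \<Longrightarrow> chart_inv c (chart_map c p) = p"
    and map_inv: "x \<in> chart_img c \<Longrightarrow> chart_map c (chart_inv c x) = x"
    and map_in_img: "p \<in> chart_dom c \<Longrightarrow> chart_map c p \<in> chart_img c"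
    and inv_in_dom: "x \<in> chart_img c \<Longrightarrow> chart_inv c x \<in> chart_dom c"
    and continuous_chart_map: "continuous_on (chart_dom c) (chart_map c)"
    and continuous_chart_inv: "continuous_on (chart_img c) (chart_inv c)"
  using homeo[OF c] unfolding homeomorphism_def by blast+

lemma map_image_eq:
  assumes "c \<in> A" "E \<subseteq> chart_dom c"
  shows "chart_map c ` E = {x \<in> chart_img c. chart_inv c x \<in> E}"
  using assms by (force simp: inv_map map_in_img map_inv image_iff)

lemma open_inv_image:
  assumes c: "c \<in> A" and "open B" "B \<subseteq> chart_img c"
  shows "open (chart_inv c ` B)"
proof -
  have "chart_inv c ` B = chart_dom c \<inter> chart_map c -` B"
    using assms by (force simp: inv_map map_inv inv_in_dom image_iff)
  then show ?thesis
    using continuous_open_preimage[OF continuous_chart_map[OF c] open_dom[OF c] assms(2)] by simp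
qed

lemma borel_map_image:
  assumes c: "c \<in> A" and E: "E \<in> sets borel" "E \<subseteq> chart_dom c"
  shows "chart_map c ` E \<in> sets borel"
proof -
  have "chart_inv c \<in> borel_measurable (restrict_space borel (chart_img c))"
    by (rule borel_measurable_continuous_on_restrict[OF continuous_chart_inv[OF c]])
  from measurable_sets[OF this E(1)]
  have "chart_inv c -` E \<inter> chart_img c \<in> sets (restrict_space borel (chart_img c))" by (simp add: space_restrict_space)
  then have "chart_inv c -` E \<inter> chart_img c \<in> sets borel"
    using open_img[OF c] by (subst (asm) sets_restrict_space_iff) auto
  also have "chart_inv c -` E \<inter> chart_img c = chart_map c ` E" using map_image_eq[OF c E(2)] by auto
  finally show ?thesis .
qed

definition overlap :: "('m, 'n) chart \<Rightarrow> ('m, 'n) chart \<Rightarrow> (real^'n) set" where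
  "overlap c d = chart_map c ` (chart_dom c \<inter> chart_dom d)"

lemma
  assumes c: "c \<in> A" and d: "d \<in> A"
  shows overlap_iff: "x \<in> overlap c d \<longleftrightarrow> x \<in> chart_img c \<and> chart_inv c x \<in> chart_dom d"
    and overlap_subset: "overlap c d \<subseteq> chart_img c"
    and open_overlap: "open (overlap c d)"
    and transition_in_img: "x \<in> overlap c d \<Longrightarrow> transition c d x \<in> chart_img d"
    and inv_transition: "x \<in> overlap c d \<Longrightarrow> chart_inv d (transition c d x) = chart_inv c x"
    and smooth_transition: "smooth_on (overlap c d) (transition c d)"
proof -
  show iff: "x \<in> overlap c d \<longleftrightarrow> x \<in> chart_img c \<and> chart_inv c x \<in> chart_dom d" for x
    unfolding overlap_def using map_image_eq[OF c, of "chart_dom c \<inter> chart_dom d"] inv_in_dom[OF c] by auto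
  then show "overlap c d \<subseteq> chart_img c" by auto
  have "overlap c d = chart_img c \<inter> chart_inv c -` chart_dom d" using iff by auto
  then show "open (overlap c d)"
    using continuous_open_preimage[OF continuous_chart_inv[OF c] open_img[OF c] open_dom[OF d]] by simp
  show "x \<in> overlap c d \<Longrightarrow> transition c d x \<in> chart_img d"
    using iff map_in_img[OF d] by (simp add: transition_def)
  show "x \<in> overlap c d \<Longrightarrow> chart_inv d (transition c d x) = chart_inv c x"
    using iff inv_map[OF d] by (simp add: transition_def)
  show "smooth_on (overlap c d) (transition c d)"
    using atlas c d by (auto simp: smooth_atlas_def overlap_def)
qed

lemma chart_patch:
  assumes "riemannian_metric A g" "c \<in> A"
  shows "metric_patch (chart_img c) (g c)"
  using assms open_img[OF assms(2)] by unfold_locales (auto simp: riemannian_metric_def posdef_sym_def)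

lemma chart_transition:
  assumes g: "riemannian_metric A g" and c: "c \<in> A" and d: "d \<in> A"
  shows "metric_transition (overlap c d) (g c) (chart_img d) (g d) (transition c d)"
proof -
  interpret C: metric_patch "chart_img c" "g c" by (rule chart_patch[OF g c])
  interpret D: metric_patch "chart_img d" "g d" by (rule chart_patch[OF g d])
  show ?thesis
  proof
    show "open (overlap c d)" by (rule open_overlap[OF c d])
    show "smooth_on (overlap c d) (g c)" by (rule smooth_on_subset[OF C.smooth_G overlap_subset[OF c d]])
    show "posdef_sym (g c x)" if "x \<in> overlap c d" for x using C.posdef overlap_subset[OF c d] that by blast
    show "smooth_on (overlap c d) (transition c d)" by (rule smooth_transition[OF c d])
    show "transition c d x \<in> chart_img d" if "x \<in> overlap c d" for x using transition_in_img[OF c d that] .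
    show "g c x = transpose (matrix (frechet_derivative (transition c d) (at x))) ** g d (transition c d x) **
        matrix (frechet_derivative (transition c d) (at x))" if "x \<in> overlap c d" for x
      using g c d that unfolding riemannian_metric_def overlap_def Let_def by blast
  qed
qed

lemma continuous_on_charts:
  assumes "\<And>c. c \<in> A \<Longrightarrow> continuous_on (chart_img c) (\<lambda>x. q (chart_inv c x))"
  shows "continuous_on UNIV q"
proof (rule continuous_at_imp_continuous_on, intro ballI)
  fix p
  obtain c where c: "c \<in> A" "p \<in> chart_dom c" using ex_chart by blast
  have "continuous_on (chart_dom c) (\<lambda>p. q (chart_inv c (chart_map c p)))"
    by (rule continuous_on_compose2[OF assms[OF c(1)] continuous_chart_map[OF c(1)]]) (use map_in_img[OF c(1)] in auto)
  then have "continuous_on (chart_dom c) q"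
    by (rule continuous_on_eq) (simp add: inv_map[OF c(1)])
  then show "isCont q p" using continuous_on_eq_continuous_at open_dom[OF c(1)] c(2) by blast
qed

text \<open>The smaller balls already cover and yield the pieces for integration; the closed balls
  of doubled radius still lie in charts and leave room for the supports of the bump
  functions.\<close>

lemma good_cover:
  "\<exists>(N::nat) cs xs rs. (\<forall>k<N. cs k \<in> A \<and> 0 < rs k \<and> cball (xs k) (2 * rs k) \<subseteq> chart_img (cs k)) \<and>
     (\<Union>k<N. chart_inv (cs k) ` ball (xs k) (rs k)) = UNIV"
proof -
  have "\<exists>c r. c \<in> A \<and> p \<in> chart_dom c \<and> 0 < r \<and> cball (chart_map c p) (2 * r) \<subseteq> chart_img c" for p
  proof -
    obtain c where c: "c \<in> A" "p \<in> chart_dom c" using ex_chart by blast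
    obtain e where "0 < e" "cball (chart_map c p) e \<subseteq> chart_img c"
      using open_img[OF c(1)] map_in_img[OF c] open_contains_cball by blast
    with c show ?thesis by (intro exI[of _ c] exI[of _ "e / 2"]) auto
  qed
  then obtain C R where CR: "\<And>p. C p \<in> A \<and> p \<in> chart_dom (C p) \<and> 0 < R p \<and> cball (chart_map (C p) p) (2 * R p) \<subseteq> chart_img (C p)"
    by metis
  define V where "V p = chart_inv (C p) ` ball (chart_map (C p) p) (R p)" for p
  have sub: "ball (chart_map (C p) p) (R p) \<subseteq> chart_img (C p)" for p
  proof -
    have "ball (chart_map (C p) p) (R p) \<subseteq> cball (chart_map (C p) p) (2 * R p)"
      using CR[of p] by auto
    then show ?thesis using CR[of p] by blast
  qed
  have oV: "open (V p)" for p unfolding V_def using CR[of p] sub[of p] by (intro open_inv_image) auto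
  have pV: "p \<in> V p" for p
    unfolding V_def using CR[of p] inv_map[of "C p" p] by (intro image_eqI[of _ _ "chart_map (C p) p"]) auto
  have UV: "UNIV \<subseteq> (\<Union>p\<in>UNIV. V p)" using pV by blast
  obtain D where D: "finite D" "UNIV \<subseteq> (\<Union>p\<in>D. V p)"
    by (rule compactE_image[OF compact_manifold oV UV])
  obtain e where e: "bij_betw e {..<card D} D" using ex_bij_betw_nat_finite[OF D(1)] by (auto simp: atLeast0LessThan)
  have "e ` {..<card D} = D" using e by (simp add: bij_betw_def)
  then have "(\<Union>k<card D. V (e k)) = (\<Union>p\<in>D. V p)" by (metis image_image)
  then have "(\<Union>k<card D. V (e k)) = UNIV" using D(2) by auto
  then show ?thesis
    using CR by (intro exI[of _ "card D"] exI[of _ "\<lambda>k. C (e k)"] exI[of _ "\<lambda>k. chart_map (C (e k)) (e k)"] exI[of _ "\<lambda>k. R (e k)"])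
      (auto simp: V_def)
qed

end

locale covered_manifold = closed_manifold A
  for A :: "('m::{t2_space, second_countable_topology}, 'n::finite) chart set" +
  fixes N :: nat and cs :: "nat \<Rightarrow> ('m, 'n) chart" and xs :: "nat \<Rightarrow> real^'n" and rs :: "nat \<Rightarrow> real"
  assumes cs: "k < N \<Longrightarrow> cs k \<in> A" and rs: "k < N \<Longrightarrow> 0 < rs k"
    and big_ball: "k < N \<Longrightarrow> cball (xs k) (2 * rs k) \<subseteq> chart_img (cs k)"
    and cover: "(\<Union>k<N. chart_inv (cs k) ` ball (xs k) (rs k)) = UNIV"
begin

text \<open>Successive differences of the covering balls: a finite Borel partition whose members lie
  in compact coordinate balls. Integrals split along it exactly, and it does not depend on any
  metric.\<close>

definition piece :: "nat \<Rightarrow> 'm set" where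
  "piece k = chart_inv (cs k) ` ball (xs k) (rs k) - (\<Union>j<k. chart_inv (cs j) ` ball (xs j) (rs j))"

lemma ball_subset_img: "k < N \<Longrightarrow> cball (xs k) (rs k) \<subseteq> chart_img (cs k)"
proof -
  assume k: "k < N"
  have "cball (xs k) (rs k) \<subseteq> cball (xs k) (2 * rs k)" using rs[OF k] by auto
  then show ?thesis using big_ball[OF k] by blast
qed

lemma piece_subset: "k < N \<Longrightarrow> piece k \<subseteq> chart_dom (cs k)"
proof -
  assume k: "k < N"
  have "ball (xs k) (rs k) \<subseteq> chart_img (cs k)" using ball_subset_img[OF k] ball_subset_cball by blast
  then show ?thesis using inv_in_dom[OF cs[OF k]] by (auto simp: piece_def)
qed

lemma map_piece_subset: "k < N \<Longrightarrow> chart_map (cs k) ` piece k \<subseteq> cball (xs k) (rs k)"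
proof
  fix x assume k: "k < N" and "x \<in> chart_map (cs k) ` piece k"
  then obtain y where y: "y \<in> ball (xs k) (rs k)" "x = chart_map (cs k) (chart_inv (cs k) y)"
    by (auto simp: piece_def)
  then have yc: "y \<in> cball (xs k) (rs k)" by simp
  then have "y \<in> chart_img (cs k)" using ball_subset_img[OF k] by blast
  with yc show "x \<in> cball (xs k) (rs k)" unfolding y(2) by (simp only: map_inv[OF cs[OF k]])
qed

lemma piece_borel: "k < N \<Longrightarrow> piece k \<in> sets borel"
proof -
  assume k: "k < N"
  have "open (chart_inv (cs j) ` ball (xs j) (rs j))" if "j < N" for j
    using ball_subset_img[OF that] ball_subset_cball by (intro open_inv_image cs that open_ball) blast
  then show ?thesis unfolding piece_def using k by (intro sets.Diff sets.finite_UN) auto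
qed

lemma piece_disjoint: "disjoint_family_on piece {..<N}"
proof -
  have "piece j \<inter> piece k = {}" if "j < k" for j k using that by (auto simp: piece_def)
  then show ?thesis unfolding disjoint_family_on_def by (metis Int_commute linorder_neqE_nat)
qed

lemma piece_cover: "(\<Union>k<N. piece k) = UNIV"
proof -
  have "\<exists>k<N. p \<in> piece k" for p
  proof -
    define P where "P k \<longleftrightarrow> k < N \<and> p \<in> chart_inv (cs k) ` ball (xs k) (rs k)" for k
    have "p \<in> (\<Union>k<N. chart_inv (cs k) ` ball (xs k) (rs k))" using cover by simp
    then have "\<exists>k. P k" unfolding P_def by blast
    then obtain k where k: "P k" and least: "\<And>j. j < k \<Longrightarrow> \<not> P j" using exists_least_iff[of P] by blast
    have "p \<notin> chart_inv (cs j) ` ball (xs j) (rs j)" if "j < k" for j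
      using least[OF that] k that unfolding P_def by linarith
    then show ?thesis using k unfolding P_def piece_def by blast
  qed
  then show ?thesis by blast
qed

lemma sum_indicator_piece: "(\<Sum>k<N. indicator (piece k) p) = (1 :: 'a::semiring_1)"
proof -
  obtain k where k: "k < N" "p \<in> piece k" using piece_cover by blast
  have "(\<Sum>j<N. indicator (piece j) p) = (\<Sum>j<N. if j = k then 1 else (0 :: 'a))"
    using k piece_disjoint by (intro sum.cong) (auto simp: disjoint_family_on_def indicator_def)
  then show ?thesis using k by simp
qed

lemma emeasure_pieces:
  assumes "sets \<mu> = sets borel" "B \<in> sets borel"
  shows "emeasure \<mu> B = (\<Sum>k<N. emeasure \<mu> (B \<inter> piece k))"
proof -
  have "(\<Union>k<N. B \<inter> piece k) = B" using piece_cover by auto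
  moreover have "disjoint_family_on (\<lambda>k. B \<inter> piece k) {..<N}"
    using piece_disjoint by (auto simp: disjoint_family_on_def)
  moreover have "(\<lambda>k. B \<inter> piece k) ` {..<N} \<subseteq> sets \<mu>" using assms piece_borel by auto
  ultimately show ?thesis
    using sum_emeasure[of "\<lambda>k. B \<inter> piece k" "{..<N}" \<mu>] by (simp only: finite_lessThan)
qed

section \<open>Existence and uniqueness of the volume measure\<close>

lemma volume_measure_unique:
  assumes \<mu>: "is_volume_measure A g \<mu>" and \<nu>: "is_volume_measure A g \<nu>"
  shows "\<mu> = \<nu>"
proof (rule measure_eqI)
  have s: "sets \<mu> = sets borel" "sets \<nu> = sets borel" using assms by (auto simp: is_volume_measure_def)
  then show "sets \<mu> = sets \<nu>" by simp
  fix B assume "B \<in> sets \<mu>"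
  then have B: "B \<in> sets borel" using s by simp
  have "emeasure \<mu> (B \<inter> piece k) = emeasure \<nu> (B \<inter> piece k)" if k: "k < N" for k
  proof -
    have "B \<inter> piece k \<in> sets borel" "B \<inter> piece k \<subseteq> chart_dom (cs k)"
      using B piece_borel[OF k] piece_subset[OF k] by auto
    then have "emeasure \<rho> (B \<inter> piece k) =
        (\<integral>\<^sup>+x. ennreal (sqrt (det (g (cs k) x))) * indicator (chart_map (cs k) ` (B \<inter> piece k)) x \<partial>lborel)"
      if "is_volume_measure A g \<rho>" for \<rho>
      using that cs[OF k] unfolding is_volume_measure_def by blast
    from this[OF \<mu>] this[OF \<nu>] show ?thesis by simp
  qed
  then show "emeasure \<mu> B = emeasure \<nu> B"
    by (simp add: emeasure_pieces[OF s(1) B] emeasure_pieces[OF s(2) B])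
qed

context
  fixes g :: "('m, 'n) tensor2"
  assumes g: "riemannian_metric A g"
begin

lemma continuous_density: "c \<in> A \<Longrightarrow> continuous_on (chart_img c) (\<lambda>x. sqrt (det (g c x)))"
  by (rule smooth_on_imp_continuous_on[OF metric_patch.smooth_density[OF chart_patch[OF g]]])

lemma borel_density:
  assumes "c \<in> A" "S \<in> sets borel" "S \<subseteq> chart_img c"
  shows "(\<lambda>x. indicator S x * sqrt (det (g c x))) \<in> borel_measurable borel"
  using borel_measurable_continuous_on_indicator[OF assms(2) continuous_on_subset[OF continuous_density[OF assms(1)] assms(3)]]
  by simp

lemma density_nonneg: "c \<in> A \<Longrightarrow> x \<in> chart_img c \<Longrightarrow> sqrt (det (g c x)) \<ge> 0"
  using posdef_sym_det[OF metric_patch.posdef[OF chart_patch[OF g]]] by (simp add: less_imp_le)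

text \<open>Taking determinants in the pullback formula shows that the densities differ by the
  absolute value of the Jacobian determinant, which is the factor in the change of variables
  formula.\<close>

lemma chart_volume_eq:
  assumes c: "c \<in> A" and d: "d \<in> A" and E: "E \<in> sets borel" "E \<subseteq> chart_dom c" "E \<subseteq> chart_dom d"
  shows "(\<integral>\<^sup>+x. ennreal (sqrt (det (g c x))) * indicator (chart_map c ` E) x \<partial>lborel) =
    (\<integral>\<^sup>+x. ennreal (sqrt (det (g d x))) * indicator (chart_map d ` E) x \<partial>lborel)"
proof -
  interpret T: metric_transition "overlap c d" "g c" "chart_img d" "g d" "transition c d"
    by (rule chart_transition[OF g c d])
  let ?S = "chart_map c ` E" and ?\<phi> = "transition c d"
  let ?\<phi>' = "\<lambda>x. frechet_derivative ?\<phi> (at x)"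
  have S: "?S \<subseteq> overlap c d" using E by (auto simp: overlap_def)
  have im: "?\<phi> ` ?S = chart_map d ` E"
    using E inv_map[OF c] by (force simp: transition_def image_image image_iff)
  have sub: "?S \<subseteq> chart_img c" "chart_map d ` E \<subseteq> chart_img d"
    using E map_in_img[OF c] map_in_img[OF d] by blast+
  have dens: "\<bar>det (matrix (?\<phi>' x))\<bar> * sqrt (det (g d (?\<phi> x))) = sqrt (det (g c x))" if "x \<in> ?S" for x
  proof -
    have "det (g c x) = (det (matrix (?\<phi>' x)))\<^sup>2 * det (g d (?\<phi> x))"
      using T.pullback[of x] S that by (auto simp: det_mul power2_eq_square)
    then show ?thesis by (simp add: real_sqrt_mult)
  qed
  have dens': "indicator ?S x * (\<bar>det (matrix (?\<phi>' x))\<bar> * sqrt (det (g d (?\<phi> x)))) = indicator ?S x * sqrt (det (g c x))" for x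
    using dens[of x] by (cases "x \<in> ?S") auto
  have "(\<integral>\<^sup>+y. ennreal (indicator (?\<phi> ` ?S) y * sqrt (det (g d y))) \<partial>lborel) =
    (\<integral>\<^sup>+x. ennreal (indicator ?S x * (\<bar>det (matrix (?\<phi>' x))\<bar> * sqrt (det (g d (?\<phi> x))))) \<partial>lborel)"
  proof (rule nn_integral_change_of_variables)
    show "?S \<in> sets borel" by (rule borel_map_image[OF c E(1,2)])
    show "inj_on ?\<phi> ?S"
    proof (rule inj_onI)
      fix x y assume xy: "x \<in> ?S" "y \<in> ?S" "?\<phi> x = ?\<phi> y"
      then have xo: "x \<in> overlap c d" "y \<in> overlap c d" using S by blast+
      have "chart_inv c x = chart_inv c y"
        using inv_transition[OF c d xo(1)] inv_transition[OF c d xo(2)] xy(3) by simp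
      note e = arg_cong[OF this, of "chart_map c"]
      have xi: "x \<in> chart_img c" "y \<in> chart_img c" using xy(1,2) sub(1) by blast+
      from e show "x = y" unfolding map_inv[OF c xi(1)] map_inv[OF c xi(2)] .
    qed
    show "(?\<phi> has_derivative ?\<phi>' x) (at x)" if "x \<in> ?S" for x
      using T.diff_phi[of x] S that by (auto simp: frechet_derivative_works)
    show "(\<lambda>y. indicator (?\<phi> ` ?S) y * sqrt (det (g d y))) \<in> borel_measurable borel"
      unfolding im by (rule borel_density[OF d borel_map_image[OF d E(1,3)] sub(2)])
    show "0 \<le> sqrt (det (g d y))" if "y \<in> ?\<phi> ` ?S" for y
      using that sub(2) density_nonneg[OF d] unfolding im by blast
    show "(\<lambda>x. indicator ?S x * (\<bar>det (matrix (?\<phi>' x))\<bar> * sqrt (det (g d (?\<phi> x))))) \<in> borel_measurable borel"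
      unfolding dens' by (rule borel_density[OF c borel_map_image[OF c E(1,2)] sub(1)])
  qed
  moreover have "ennreal (indicator S x * r) = ennreal r * indicator S x" for S :: "(real^'n) set" and x r
    by (auto simp: indicator_def)
  ultimately show ?thesis unfolding im dens' by simp
qed

text \<open>A total, Borel measurable version of the inverse chart, so that it can be used in
  \<open>distr\<close>; its value off the chart image carries no mass.\<close>

definition inv_ext :: "('m, 'n) chart \<Rightarrow> real^'n \<Rightarrow> 'm" where
  "inv_ext c x = (if x \<in> chart_img c then chart_inv c x else undefined)"

lemma inv_ext_measurable: "c \<in> A \<Longrightarrow> inv_ext c \<in> borel_measurable borel"
  unfolding inv_ext_def[abs_def]
  by (intro borel_measurable_continuous_on_if continuous_chart_inv continuous_on_const) (auto intro: borel_open open_img)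

definition chart_measure :: "('m, 'n) chart \<Rightarrow> 'm set \<Rightarrow> 'm measure" where
  "chart_measure c E = distr (density lborel (\<lambda>x. ennreal (indicator (chart_map c ` E) x * sqrt (det (g c x))))) borel (inv_ext c)"

lemma emeasure_chart_measure:
  assumes c: "c \<in> A" and E: "E \<in> sets borel" "E \<subseteq> chart_dom c" and B: "B \<in> sets borel"
  shows "emeasure (chart_measure c E) B = (\<integral>\<^sup>+x. ennreal (sqrt (det (g c x))) * indicator (chart_map c ` (B \<inter> E)) x \<partial>lborel)"
proof -
  have sub: "chart_map c ` E \<subseteq> chart_img c" using E map_in_img[OF c] by auto
  have m: "(\<lambda>x. ennreal (indicator (chart_map c ` E) x * sqrt (det (g c x)))) \<in> borel_measurable lborel"
    using borel_density[OF c borel_map_image[OF c E] sub] by simp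
  have pre: "inv_ext c -` B \<in> sets borel"
    using measurable_sets[OF inv_ext_measurable[OF c] B] by simp
  have "emeasure (chart_measure c E) B = emeasure (density lborel (\<lambda>x. ennreal (indicator (chart_map c ` E) x * sqrt (det (g c x))))) (inv_ext c -` B)"
    unfolding chart_measure_def using inv_ext_measurable[OF c] B by (subst emeasure_distr) auto
  also have "\<dots> = (\<integral>\<^sup>+x. ennreal (indicator (chart_map c ` E) x * sqrt (det (g c x))) * indicator (inv_ext c -` B) x \<partial>lborel)"
    using m pre by (subst emeasure_density) auto
  also have "\<dots> = (\<integral>\<^sup>+x. ennreal (sqrt (det (g c x))) * indicator (chart_map c ` (B \<inter> E)) x \<partial>lborel)"
  proof (rule nn_integral_cong)
    fix x
    have "x \<in> chart_map c ` (B \<inter> E) \<longleftrightarrow> x \<in> chart_map c ` E \<and> inv_ext c x \<in> B"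
      using E map_image_eq[OF c, of E] map_image_eq[OF c, of "B \<inter> E"] by (auto simp: inv_ext_def)
    then show "ennreal (indicator (chart_map c ` E) x * sqrt (det (g c x))) * indicator (inv_ext c -` B) x =
      ennreal (sqrt (det (g c x))) * indicator (chart_map c ` (B \<inter> E)) x"
      by (auto simp: indicator_def)
  qed
  finally show ?thesis .
qed

text \<open>On each piece the density is pushed forward from the chart of that piece, and the
  results are added. For a set in the domain of an arbitrary chart, \<open>chart_volume_eq\<close>
  moves each contribution into that chart, where the indicators of the pieces add up again.\<close>

lemma ex_volume_measure: "\<exists>\<mu>. is_volume_measure A g \<mu>"
proof -
  define \<nu> where "\<nu> k = chart_measure (cs k) (piece k)" for k
  define \<mu> where "\<mu> = measure_of UNIV (sets borel) (\<lambda>B. \<Sum>k<N. emeasure (\<nu> k) B)"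
  have s\<nu>: "sets (\<nu> k) = sets borel" for k by (simp add: \<nu>_def chart_measure_def)
  have sets_\<mu>: "sets \<mu> = sets borel" unfolding \<mu>_def
    using sigma_algebra.sets_measure_of_eq[of UNIV "sets borel"] sets.sigma_algebra_axioms[of "borel :: 'm measure"] by simp
  have em: "emeasure \<mu> B = (\<Sum>k<N. emeasure (\<nu> k) B)" if "B \<in> sets borel" for B
  proof (rule emeasure_measure_of[OF \<mu>_def])
    show "countably_additive (sets \<mu>) (\<lambda>B. \<Sum>k<N. emeasure (\<nu> k) B)"
    proof (rule countably_additiveI)
      fix F :: "nat \<Rightarrow> 'm set" assume F: "range F \<subseteq> sets \<mu>" "disjoint_family F"
      have "(\<Sum>i. \<Sum>k<N. emeasure (\<nu> k) (F i)) = (\<Sum>k<N. \<Sum>i. emeasure (\<nu> k) (F i))"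
        by (rule suminf_sum) (rule summableI)
      also have "\<dots> = (\<Sum>k<N. emeasure (\<nu> k) (\<Union>i. F i))"
        using F sets_\<mu> s\<nu> by (intro sum.cong refl suminf_emeasure) auto
      finally show "(\<Sum>i. \<Sum>k<N. emeasure (\<nu> k) (F i)) = (\<Sum>k<N. emeasure (\<nu> k) (\<Union>i. F i))" .
    qed
  qed (use that sets_\<mu> in \<open>auto simp: positive_def\<close>)
  have "is_volume_measure A g \<mu>" unfolding is_volume_measure_def
  proof (intro conjI ballI impI)
    show "sets \<mu> = sets borel" by (rule sets_\<mu>)
    fix c E assume c: "c \<in> A" and E: "E \<in> sets borel" "E \<subseteq> chart_dom c"
    have bor: "E \<inter> piece k \<in> sets borel" if "k < N" for k using E piece_borel[OF that] by auto
    have "emeasure \<mu> E = (\<Sum>k<N. \<integral>\<^sup>+x. ennreal (sqrt (det (g (cs k) x))) * indicator (chart_map (cs k) ` (E \<inter> piece k)) x \<partial>lborel)"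
      unfolding em[OF E(1)] \<nu>_def
      using E piece_borel piece_subset cs by (intro sum.cong refl emeasure_chart_measure) auto
    also have "\<dots> = (\<Sum>k<N. \<integral>\<^sup>+x. ennreal (sqrt (det (g c x))) * indicator (chart_map c ` (E \<inter> piece k)) x \<partial>lborel)"
      using E piece_subset cs c bor by (intro sum.cong refl chart_volume_eq) auto
    also have "\<dots> = (\<integral>\<^sup>+x. (\<Sum>k<N. ennreal (sqrt (det (g c x))) * indicator (chart_map c ` (E \<inter> piece k)) x) \<partial>lborel)"
    proof (rule nn_integral_sum[symmetric])
      fix k assume "k \<in> {..<N}"
      then have k: "k < N" by simp
      have "chart_map c ` (E \<inter> piece k) \<subseteq> chart_img c" using E map_in_img[OF c] by auto
      moreover have "E \<inter> piece k \<subseteq> chart_dom c" using E(2) by blast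
      ultimately have "(\<lambda>x. indicator (chart_map c ` (E \<inter> piece k)) x * sqrt (det (g c x))) \<in> borel_measurable borel"
        by (intro borel_density[OF c] borel_map_image[OF c bor[OF k]])
      then
      have "(\<lambda>x. ennreal (indicator (chart_map c ` (E \<inter> piece k)) x * sqrt (det (g c x)))) \<in> borel_measurable lborel" by auto
      moreover have "ennreal (indicator S x * r) = ennreal r * indicator S x" for S :: "(real^'n) set" and x r
        by (auto simp: indicator_def)
      ultimately show "(\<lambda>x. ennreal (sqrt (det (g c x))) * indicator (chart_map c ` (E \<inter> piece k)) x) \<in> borel_measurable lborel"
        by simp
    qed
    also have "\<dots> = (\<integral>\<^sup>+x. ennreal (sqrt (det (g c x))) * indicator (chart_map c ` E) x \<partial>lborel)"
    proof (rule nn_integral_cong)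
      fix x
      have "(\<Sum>k<N. indicator (chart_map c ` (E \<inter> piece k)) x) = (indicator (chart_map c ` E) x :: ennreal)"
      proof (cases "x \<in> chart_map c ` E")
        case True
        then have x: "x \<in> chart_img c" "chart_inv c x \<in> E" using map_image_eq[OF c E(2)] by auto
        have "x \<in> chart_map c ` (E \<inter> piece k) \<longleftrightarrow> chart_inv c x \<in> piece k" for k
          using map_image_eq[OF c, of "E \<inter> piece k"] E x by auto
        then have "(\<Sum>k<N. indicator (chart_map c ` (E \<inter> piece k)) x) = (\<Sum>k<N. indicator (piece k) (chart_inv c x) :: ennreal)"
          by (simp add: indicator_def)
        then show ?thesis using True sum_indicator_piece by simp
      next
        case False
        then have "x \<notin> chart_map c ` (E \<inter> piece k)" for k by auto
        then show ?thesis using False by simp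
      qed
      then show "(\<Sum>k<N. ennreal (sqrt (det (g c x))) * indicator (chart_map c ` (E \<inter> piece k)) x) =
        ennreal (sqrt (det (g c x))) * indicator (chart_map c ` E) x"
        by (simp add: sum_distrib_left[symmetric])
    qed
    finally show "emeasure \<mu> E = (\<integral>\<^sup>+x. ennreal (sqrt (det (g c x))) * indicator (chart_map c ` E) x \<partial>lborel)" .
  qed
  then show ?thesis by blast
qed

lemma vol_is_volume_measure: "is_volume_measure A g (vol A g)"
  unfolding vol_def by (rule theI') (use ex_volume_measure volume_measure_unique in blast)

lemma vol_eqI: "is_volume_measure A g \<mu> \<Longrightarrow> vol A g = \<mu>"
  using vol_is_volume_measure volume_measure_unique by blast

lemma sets_vol: "sets (vol A g) = sets borel"
  using vol_is_volume_measure by (simp add: is_volume_measure_def)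

section \<open>Integrals over the manifold in charts\<close>

lemma chart_measure_eq:
  assumes c: "c \<in> A" and E: "E \<in> sets borel" "E \<subseteq> chart_dom c"
  shows "density (vol A g) (indicator E) = chart_measure c E"
proof (rule measure_eqI)
  show "sets (density (vol A g) (indicator E)) = sets (chart_measure c E)"
    by (simp add: sets_vol chart_measure_def)
  fix B assume "B \<in> sets (density (vol A g) (indicator E))"
  then have B: "B \<in> sets borel" by (simp add: sets_vol)
  have "emeasure (density (vol A g) (indicator E)) B = emeasure (vol A g) (B \<inter> E)"
    using B E by (subst emeasure_density) (auto simp: sets_vol nn_integral_indicator[symmetric] indicator_inter_arith[symmetric] Int_commute simp del: nn_integral_indicator intro!: nn_integral_cong split: split_indicator cong: measurable_cong_sets)
  also have "\<dots> = emeasure (chart_measure c E) B"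
  proof -
    have "B \<inter> E \<in> sets borel" "B \<inter> E \<subseteq> chart_dom c" using B E by auto
    then show ?thesis unfolding emeasure_chart_measure[OF c E B]
      using vol_is_volume_measure c unfolding is_volume_measure_def by blast
  qed
  finally show "emeasure (density (vol A g) (indicator E)) B = emeasure (chart_measure c E) B" .
qed

lemma set_integral_chart:
  fixes q :: "'m \<Rightarrow> real"
  assumes c: "c \<in> A" and E: "E \<in> sets borel" "E \<subseteq> chart_dom c" and q: "q \<in> borel_measurable borel"
  shows "(LINT p|vol A g. indicator E p * q p) =
    (LINT x:chart_map c ` E|lborel. q (chart_inv c x) * sqrt (det (g c x)))"
proof -
  have sub: "chart_map c ` E \<subseteq> chart_img c" using E map_in_img[OF c] by auto
  have ms: "measurable (vol A g) borel = measurable borel borel" by (rule measurable_cong_sets[OF sets_vol refl])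
  have "(LINT p|vol A g. indicator E p * q p) = (LINT p|density (vol A g) (\<lambda>p. ennreal (indicator E p)). q p)"
    using q E(1) by (subst integral_density) (auto simp: ms)
  also have "density (vol A g) (\<lambda>p. ennreal (indicator E p)) = chart_measure c E"
    unfolding ennreal_indicator by (rule chart_measure_eq[OF c E])
  also have "(LINT p|chart_measure c E. q p) = (LINT x|density lborel (\<lambda>x. ennreal (indicator (chart_map c ` E) x * sqrt (det (g c x)))). q (inv_ext c x))"
    unfolding chart_measure_def using inv_ext_measurable[OF c] q by (subst integral_distr) auto
  also have "\<dots> = (LINT x|lborel. (indicator (chart_map c ` E) x * sqrt (det (g c x))) *\<^sub>R q (inv_ext c x))"
  proof (rule integral_density)
    show "(\<lambda>x. q (inv_ext c x)) \<in> borel_measurable lborel"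
      using measurable_compose[OF inv_ext_measurable[OF c] q] by simp
    show "(\<lambda>x. indicator (chart_map c ` E) x * sqrt (det (g c x))) \<in> borel_measurable lborel"
      using borel_density[OF c borel_map_image[OF c E] sub] by simp
    show "AE x in lborel. 0 \<le> indicator (chart_map c ` E) x * sqrt (det (g c x))"
      using sub density_nonneg[OF c] by (intro AE_I2) (auto simp: indicator_def)
  qed
  also have "\<dots> = (LINT x:chart_map c ` E|lborel. q (chart_inv c x) * sqrt (det (g c x)))"
    unfolding set_lebesgue_integral_def using sub
    by (intro Bochner_Integration.integral_cong refl) (auto simp: indicator_def inv_ext_def)
  finally show ?thesis .
qed

text \<open>The hypothesis on \<open>measure\<close> expresses finiteness: an infinite total volume
  would have \<open>measure\<close> equal to \<open>0\<close>. Continuous functions are bounded by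
  compactness.\<close>

lemma integrable_continuous:
  fixes q :: "'m \<Rightarrow> real"
  assumes fin: "measure (vol A g) UNIV \<noteq> 0" and q: "continuous_on UNIV q"
  shows "integrable (vol A g) q"
proof -
  have sp: "space (vol A g) = UNIV" using sets_eq_imp_space_eq[OF sets_vol] by simp
  have "emeasure (vol A g) UNIV \<noteq> \<infinity>" using fin by (auto simp: measure_def)
  then interpret finite_measure "vol A g" by (intro finite_measureI) (simp add: sp)
  have "compact (q ` UNIV)" using compact_continuous_image[OF q compact_manifold] .
  then obtain B where B: "\<And>p. norm (q p) \<le> B" using compact_imp_bounded bounded_iff by (metis rangeI)
  have "q \<in> borel_measurable (vol A g)"
    using borel_measurable_continuous_onI[OF q] by (simp cong: measurable_cong_sets[OF sets_vol refl])
  then show ?thesis by (rule integrable_const_bound[rotated]) (use B in auto)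
qed

lemma integral_pieces:
  fixes q :: "'m \<Rightarrow> real"
  assumes fin: "measure (vol A g) UNIV \<noteq> 0" and q: "continuous_on UNIV q"
  shows "(LINT p|vol A g. q p) = (\<Sum>k<N. LINT x:chart_map (cs k) ` piece k|lborel. q (chart_inv (cs k) x) * sqrt (det (g (cs k) x)))"
proof -
  have qb: "q \<in> borel_measurable borel" by (rule borel_measurable_continuous_onI[OF q])
  have int: "integrable (vol A g) (\<lambda>p. indicator (piece k) p * q p)" if "k < N" for k
    using integrable_mult_indicator[OF _ integrable_continuous[OF fin q], of "piece k"] piece_borel[OF that] by (simp add: sets_vol)
  have "(LINT p|vol A g. q p) = (LINT p|vol A g. (\<Sum>k<N. indicator (piece k) p * q p))"
    by (simp add: sum_distrib_right[symmetric] sum_indicator_piece)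
  also have "\<dots> = (\<Sum>k<N. LINT p|vol A g. indicator (piece k) p * q p)"
    using int by (intro Bochner_Integration.integral_sum) auto
  also have "\<dots> = (\<Sum>k<N. LINT x:chart_map (cs k) ` piece k|lborel. q (chart_inv (cs k) x) * sqrt (det (g (cs k) x)))"
    using piece_borel piece_subset cs qb by (intro sum.cong refl set_integral_chart) auto
  finally show ?thesis .
qed

end

end

section \<open>Partition of unity\<close>

lemma DERIV_pos_part_square: "((\<lambda>s::real. (max 0 s)\<^sup>2) has_real_derivative 2 * max 0 s) (at s)"
proof -
  consider "s > 0" | "s < 0" | "s = 0" by linarith
  then show ?thesis
  proof cases
    case 1
    have "((\<lambda>s::real. s\<^sup>2) has_real_derivative 2 * max 0 s) (at s)"
      using 1 by (auto intro!: derivative_eq_intros)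
    then show ?thesis
      by (rule has_field_derivative_transform_within_open[of _ _ _ "{0<..}"]) (use 1 in auto)
  next
    case 2
    have "((\<lambda>s::real. 0) has_real_derivative 2 * max 0 s) (at s)" using 2 by simp
    then show ?thesis
      by (rule has_field_derivative_transform_within_open[of _ _ _ "{..<0}"]) (use 2 in auto)
  next
    case 3
    have "isCont (\<lambda>h::real. max 0 h) 0" by (intro continuous_intros)
    then have "((\<lambda>h::real. max 0 h) \<longlongrightarrow> 0) (at 0)" by (simp add: isCont_def)
    \<comment> \<open>The difference quotient of the squared positive part at \<open>0\<close> is
      the positive part itself: \<open>h\<^sup>2 / h\<close> for positive and \<open>0\<close> for
      negative \<open>h\<close>.\<close>
    moreover have "\<forall>\<^sub>F h in at 0. max 0 h = ((max 0 h)\<^sup>2 - (max 0 0)\<^sup>2) / (h - (0::real))"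
      by (auto simp: eventually_at_filter max_def power2_eq_square)
    ultimately have "((\<lambda>h::real. ((max 0 h)\<^sup>2 - (max 0 0)\<^sup>2) / (h - 0)) \<longlongrightarrow> 0) (at 0)"
      by (rule Lim_transform_eventually)
    then show ?thesis using 3 by (simp add: has_field_derivative_iff)
  qed
qed

text \<open>The square makes the positive part of a quadratic function continuously differentiable.
  Class \<open>C\<^sup>1\<close> is all that the divergence theorem asks of cut-off
  functions.\<close>

definition bump :: "real^'n::finite \<Rightarrow> real \<Rightarrow> real^'n \<Rightarrow> real" where
  "bump a r x = (max 0 (r\<^sup>2 - (x - a) \<bullet> (x - a)))\<^sup>2"

lemma bump_nonneg: "0 \<le> bump a r x"
  by (simp add: bump_def)

lemma bump_pos: "dist a x < r \<Longrightarrow> 0 < bump a r x"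
proof -
  assume "dist a x < r"
  then have "(dist a x)\<^sup>2 < r\<^sup>2" by (intro power_strict_mono) auto
  then show ?thesis by (simp add: bump_def dist_norm norm_minus_commute power2_norm_eq_inner[symmetric] max_def)
qed

lemma bump_zero: "r > 0 \<Longrightarrow> x \<notin> cball a r \<Longrightarrow> bump a r x = 0"
proof -
  assume "r > 0" "x \<notin> cball a r"
  then have "r\<^sup>2 < (dist a x)\<^sup>2" by (intro power_strict_mono) auto
  then show ?thesis by (simp add: bump_def dist_norm norm_minus_commute power2_norm_eq_inner[symmetric] max_def)
qed

lemma Ck_on_bump: "Ck_on (Suc 0) UNIV (bump a r)"
proof -
  have "Ck_on (Suc 0) UNIV (\<lambda>s::real. (max 0 s)\<^sup>2)"
  proof (rule Ck_on_SucI[OF open_UNIV])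
    show "((\<lambda>s::real. (max 0 s)\<^sup>2) has_derivative (\<lambda>v. 2 * max 0 s * v)) (at s)" for s
      using DERIV_pos_part_square[of s] by (simp add: has_field_derivative_def)
    show "Ck_on 0 UNIV (\<lambda>s::real. 2 * max 0 s * v)" for v by (auto intro!: continuous_intros)
  qed
  moreover have "Ck_on (Suc 0) UNIV (\<lambda>x. r\<^sup>2 - (x - a) \<bullet> (x - a))"
  proof (rule Ck_on_SucI[OF open_UNIV])
    show "((\<lambda>x. r\<^sup>2 - (x - a) \<bullet> (x - a)) has_derivative (\<lambda>v. - (2 * ((x - a) \<bullet> v)))) (at x)" for x
      by (auto intro!: derivative_eq_intros simp: inner_commute)
    show "Ck_on 0 UNIV (\<lambda>x. - (2 * ((x - a) \<bullet> v)))" for v by (auto intro!: continuous_intros)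
  qed
  ultimately show ?thesis unfolding bump_def[abs_def] using Ck_on_compose[OF open_UNIV open_UNIV] by blast
qed

section \<open>Functions on the manifold given by chart expressions\<close>

context closed_manifold
begin

text \<open>The same choice of chart as in \<open>at_point\<close>, but for expressions that may
  depend on the chart itself, as those built from the coordinate form of \<open>f\<close>
  do.\<close>

definition at_chart :: "(('m, 'n) chart \<Rightarrow> real^'n \<Rightarrow> real) \<Rightarrow> 'm \<Rightarrow> real" where
  "at_chart q p = (let c = (SOME c. c \<in> A \<and> p \<in> chart_dom c) in q c (chart_map c p))"

lemma at_chart_eq:
  assumes inv: "\<And>c d x. c \<in> A \<Longrightarrow> d \<in> A \<Longrightarrow> x \<in> overlap c d \<Longrightarrow> q c x = q d (transition c d x)"
    and c: "c \<in> A" "x \<in> chart_img c"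
  shows "at_chart q (chart_inv c x) = q c x"
proof -
  define d where "d = (SOME d. d \<in> A \<and> chart_inv c x \<in> chart_dom d)"
  have d: "d \<in> A" "chart_inv c x \<in> chart_dom d"
    using someI_ex[of "\<lambda>d. d \<in> A \<and> chart_inv c x \<in> chart_dom d"] ex_chart unfolding d_def by blast+
  have "q c x = q d (transition c d x)" by (rule inv[OF c(1) d(1)]) (simp add: overlap_iff c d)
  then show ?thesis by (simp add: at_chart_def Let_def d_def[symmetric] transition_def)
qed

lemma continuous_at_chart:
  assumes inv: "\<And>c d x. c \<in> A \<Longrightarrow> d \<in> A \<Longrightarrow> x \<in> overlap c d \<Longrightarrow> q c x = q d (transition c d x)"
    and q: "\<And>c. c \<in> A \<Longrightarrow> continuous_on (chart_img c) (q c)"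
  shows "continuous_on UNIV (at_chart q)"
proof (rule continuous_on_charts)
  fix c assume c: "c \<in> A"
  show "continuous_on (chart_img c) (\<lambda>x. at_chart q (chart_inv c x))"
    by (rule continuous_on_eq[OF q[OF c]]) (rule at_chart_eq[OF inv c, symmetric])
qed

definition C1_function :: "('m \<Rightarrow> real) \<Rightarrow> bool" where
  "C1_function u \<longleftrightarrow> (\<forall>c\<in>A. Ck_on (Suc 0) (chart_img c) (\<lambda>x. u (chart_inv c x)))"

end

section \<open>Cut-off functions and the partition of unity\<close>

context covered_manifold
begin

definition manifold_bump :: "nat \<Rightarrow> 'm \<Rightarrow> real" where
  "manifold_bump k p = (if p \<in> chart_dom (cs k) then bump (xs k) (2 * rs k) (chart_map (cs k) p) else 0)"

definition support :: "nat \<Rightarrow> 'm set" where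
  "support k = chart_inv (cs k) ` cball (xs k) (2 * rs k)"

text \<open>A compact coordinate ball has compact image, and compact sets are closed in a Hausdorff
  space. This makes extension by zero across the boundary of the chart domain harmless.\<close>

lemma closed_support: "k < N \<Longrightarrow> closed (support k)"
  unfolding support_def
  by (intro compact_imp_closed compact_continuous_image compact_cball continuous_on_subset[OF continuous_chart_inv[OF cs] big_ball])

lemma support_subset: "k < N \<Longrightarrow> support k \<subseteq> chart_dom (cs k)"
  unfolding support_def using big_ball inv_in_dom[OF cs] by blast

lemma inv_not_in_support:
  assumes k: "k < N" and y: "y \<in> chart_img (cs k) - cball (xs k) (2 * rs k)"
  shows "chart_inv (cs k) y \<notin> support k"
proof
  assume "chart_inv (cs k) y \<in> support k"
  then obtain z where z: "z \<in> cball (xs k) (2 * rs k)" "chart_inv (cs k) y = chart_inv (cs k) z"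
    unfolding support_def by blast
  have zi: "z \<in> chart_img (cs k)" and yi: "y \<in> chart_img (cs k)" using z(1) y big_ball[OF k] by blast+
  have "y = z"
    using arg_cong[OF z(2), of "chart_map (cs k)"] unfolding map_inv[OF cs[OF k] zi] map_inv[OF cs[OF k] yi] .
  with z y show False by simp
qed

lemma manifold_bump_zero:
  assumes k: "k < N" and p: "p \<notin> support k"
  shows "manifold_bump k p = 0"
proof (cases "p \<in> chart_dom (cs k)")
  case True
  have "chart_map (cs k) p \<notin> cball (xs k) (2 * rs k)"
  proof
    assume "chart_map (cs k) p \<in> cball (xs k) (2 * rs k)"
    then have "chart_inv (cs k) (chart_map (cs k) p) \<in> support k" unfolding support_def by blast
    with p show False by (simp add: inv_map[OF cs[OF k] True])
  qed
  then show ?thesis using rs[OF k] by (simp add: manifold_bump_def bump_zero)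
qed (simp add: manifold_bump_def)

lemma open_off_support:
  assumes k: "k < N" and d: "d \<in> A"
  shows "open {x \<in> chart_img d. chart_inv d x \<notin> support k}"
proof -
  have "{x \<in> chart_img d. chart_inv d x \<notin> support k} = chart_img d \<inter> chart_inv d -` (- support k)" by auto
  then show ?thesis
    using continuous_open_preimage[OF continuous_chart_inv[OF d] open_img[OF d]] closed_support[OF k]
    by (simp add: open_Compl)
qed

text \<open>Seen in a chart \<open>d\<close>, a point of the support lies in the overlap, where the
  function is \<open>bump\<close> composed with a transition map; any other point has a
  neighbourhood on which the function is zero.\<close>

lemma C1_manifold_bump:
  assumes k: "k < N"
  shows "C1_function (manifold_bump k)"
  unfolding C1_function_def
proof
  fix d assume d: "d \<in> A"
  note c = cs[OF k]
  let ?b = "\<lambda>x. manifold_bump k (chart_inv d x)"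
  show "Ck_on (Suc 0) (chart_img d) ?b"
  proof (rule Ck_on_local)
    fix x assume x: "x \<in> chart_img d"
    show "\<exists>W. open W \<and> x \<in> W \<and> Ck_on (Suc 0) W ?b"
    proof (cases "chart_inv d x \<in> support k")
      case True
      then have xo: "x \<in> overlap d (cs k)" using support_subset[OF k] x by (auto simp: overlap_iff[OF d c])
      have "Ck_on (Suc 0) (overlap d (cs k)) (\<lambda>x. bump (xs k) (2 * rs k) (transition d (cs k) x))"
        by (rule Ck_on_compose[OF open_overlap[OF d c] open_UNIV _ smooth_onD[OF smooth_transition[OF d c]] Ck_on_bump]) auto
      then have "Ck_on (Suc 0) (overlap d (cs k)) ?b"
        by (rule Ck_on_cong_imp[OF open_overlap[OF d c], rotated])
           (simp add: manifold_bump_def overlap_iff[OF d c] transition_def)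
      then show ?thesis using xo open_overlap[OF d c] by blast
    next
      case False
      let ?W = "{x \<in> chart_img d. chart_inv d x \<notin> support k}"
      have "Ck_on (Suc 0) ?W ?b"
        by (rule Ck_on_cong_imp[OF open_off_support[OF k d] _ Ck_on_const[OF open_off_support[OF k d], of "Suc 0" 0]])
           (simp add: manifold_bump_zero[OF k])
      then show ?thesis using False x open_off_support[OF k d] by blast
    qed
  qed
qed

definition bump_sum :: "'m \<Rightarrow> real" where
  "bump_sum p = (\<Sum>k<N. manifold_bump k p)"

lemma bump_sum_pos: "bump_sum p > 0"
proof -
  have "p \<in> (\<Union>k<N. chart_inv (cs k) ` ball (xs k) (rs k))" using cover by simp
  then obtain k y where k: "k < N" "y \<in> ball (xs k) (rs k)" "p = chart_inv (cs k) y" by blast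
  have y: "y \<in> chart_img (cs k)" using ball_subset_img[OF k(1)] k(2) by auto
  have "dist (xs k) y < 2 * rs k" using k(2) rs[OF k(1)] by simp
  then have "manifold_bump k p > 0"
    using bump_pos inv_in_dom[OF cs[OF k(1)] y] map_inv[OF cs[OF k(1)] y] by (simp add: manifold_bump_def k(3))
  moreover have "manifold_bump j p \<ge> 0" for j by (simp add: manifold_bump_def bump_nonneg)
  ultimately show ?thesis unfolding bump_sum_def using k(1) by (intro sum_pos2[of _ k]) auto
qed

text \<open>The quotient by the sum is written with exponent \<open>-1\<close>, so that its
  regularity comes from \<open>Ck_on_powr\<close>.\<close>

definition partition_fun :: "nat \<Rightarrow> 'm \<Rightarrow> real" where
  "partition_fun k p = manifold_bump k p * bump_sum p powr (-1)"

lemma C1_partition_fun: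
  assumes k: "k < N"
  shows "C1_function (partition_fun k)"
  unfolding C1_function_def partition_fun_def
proof (intro ballI Ck_on_bilinear[OF _ bounded_bilinear_mult])
  fix c assume c: "c \<in> A"
  show "open (chart_img c)" by (rule open_img[OF c])
  have b: "Ck_on (Suc 0) (chart_img c) (\<lambda>x. manifold_bump j (chart_inv c x))" if "j < N" for j
    using C1_manifold_bump[OF that] c by (simp only: C1_function_def)
  then show "Ck_on (Suc 0) (chart_img c) (\<lambda>x. manifold_bump k (chart_inv c x))" using k .
  have "Ck_on (Suc 0) (chart_img c) (\<lambda>x. bump_sum (chart_inv c x))"
    unfolding bump_sum_def using b by (intro Ck_on_sum open_img[OF c]) simp
  then show "Ck_on (Suc 0) (chart_img c) (\<lambda>x. bump_sum (chart_inv c x) powr (-1))"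
    by (intro Ck_on_compose[OF open_img[OF c] open_greaterThan _ _ Ck_on_powr]) (auto simp: bump_sum_pos)
qed

lemma sum_partition_fun: "(\<Sum>k<N. partition_fun k p) = 1"
  using bump_sum_pos[of p] by (simp add: partition_fun_def sum_distrib_right[symmetric] bump_sum_def[symmetric] powr_minus)

lemma partition_fun_zero: "k < N \<Longrightarrow> p \<notin> support k \<Longrightarrow> partition_fun k p = 0"
  by (simp add: partition_fun_def manifold_bump_zero)

end

section \<open>The integrated Bochner formula\<close>

text \<open>Bochner's formula asks only for vanishing Ricci curvature; flatness is added in a later
  extension. The condition on \<open>volume\<close> encodes finite volume, as in
  \<open>integrable_continuous\<close>.\<close>

locale ricci_flat_manifold = covered_manifold A N cs xs rs
  for A :: "('m::{t2_space, second_countable_topology}, 'n::finite) chart set" and N cs xs rs +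
  fixes g :: "('m, 'n) tensor2" and f :: "'m \<Rightarrow> real"
  assumes g: "riemannian_metric A g" and volume: "measure (vol A g) UNIV \<noteq> 0"
    and ricci_flat: "c \<in> A \<Longrightarrow> x \<in> chart_img c \<Longrightarrow> ricci (g c) j k x = 0"
    and f: "smooth_function A f"
begin

abbreviation fc :: "('m, 'n) chart \<Rightarrow> real^'n \<Rightarrow> real" where
  "fc c x \<equiv> f (chart_inv c x)"

lemma smooth_fc: "c \<in> A \<Longrightarrow> smooth_on (chart_img c) (fc c)"
  using f by (simp add: smooth_function_def comp_def)

lemma fc_transition: "c \<in> A \<Longrightarrow> d \<in> A \<Longrightarrow> x \<in> overlap c d \<Longrightarrow> fc c x = fc d (transition c d x)"
  by (simp add: inv_transition)

definition lap :: "('m, 'n) chart \<Rightarrow> real^'n \<Rightarrow> real" where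
  "lap c x = (\<Oplus>k. nabla (g c) (gradient (g c) (fc c)) k k x)"

definition hess_sq :: "('m, 'n) chart \<Rightarrow> real^'n \<Rightarrow> real" where
  "hess_sq c x = (\<Oplus>i k. nabla (g c) (gradient (g c) (fc c)) i k x * nabla (g c) (gradient (g c) (fc c)) k i x)"

text \<open>The derivative of \<open>u\<close> along the Bochner field of the gradient: the extra
  term in the divergence of \<open>u\<close> times that field.\<close>

definition flux :: "(('m \<Rightarrow> real)) \<Rightarrow> ('m, 'n) chart \<Rightarrow> real^'n \<Rightarrow> real" where
  "flux u c x = (\<Oplus>i. partial i (\<lambda>x. u (chart_inv c x)) x * bochner_field (g c) (gradient (g c) (fc c)) i x)"

lemma
  assumes c: "c \<in> A" and d: "d \<in> A" and x: "x \<in> overlap c d"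
  shows lap_transition: "lap c x = lap d (transition c d x)"
    and hess_sq_transition: "hess_sq c x = hess_sq d (transition c d x)"
    and flux_transition: "C1_function u \<Longrightarrow> flux u c x = flux u d (transition c d x)"
proof -
  interpret T: metric_transition "overlap c d" "g c" "chart_img d" "g d" "transition c d"
    by (rule chart_transition[OF g c d])
  note tr = smooth_fc[OF d] fc_transition[OF c d]
  show "lap c x = lap d (transition c d x)" unfolding lap_def by (rule T.laplacian_invariant[OF tr x])
  show "hess_sq c x = hess_sq d (transition c d x)" unfolding hess_sq_def by (rule T.hessian_sq_invariant[OF tr x])
  assume u: "C1_function u"
  let ?y = "transition c d x" and ?J = "\<lambda>a i. jac (transition c d) a i x"
  let ?X = "\<lambda>i. bochner_field (g c) (gradient (g c) (fc c)) i x"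
  have du: "partial i (\<lambda>x. u (chart_inv c x)) x = (\<Oplus>a. ?J a i * partial a (\<lambda>x. u (chart_inv d x)) ?y)" for i
  proof -
    have diff: "(\<lambda>x. u (chart_inv d x)) differentiable (at ?y)"
      using u d T.maps[OF x] by (auto simp: C1_function_def)
    have "x \<in> chart_img c" using x overlap_subset[OF c d] by blast
    then have "(\<lambda>x. u (chart_inv c x)) differentiable (at x)"
      using u c by (auto simp: C1_function_def)
    then have "partial i (\<lambda>x. u (chart_inv c x)) x = partial i (\<lambda>x. u (chart_inv d (transition c d x))) x"
      by (intro partial_cong[OF open_overlap[OF c d] x]) (simp_all add: inv_transition[OF c d])
    also have "\<dots> = (\<Oplus>a. ?J a i * partial a (\<lambda>x. u (chart_inv d x)) ?y)"
      unfolding jac_def by (rule partial_chain[OF T.diff_phi[OF x] diff])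
    finally show ?thesis .
  qed
  have "flux u c x = (\<Oplus>i a. partial a (\<lambda>x. u (chart_inv d x)) ?y * (?J a i * ?X i))"
    unfolding flux_def du sum_distrib_right by (simp only: mult_ac)
  also have "\<dots> = (\<Oplus>a i. partial a (\<lambda>x. u (chart_inv d x)) ?y * (?J a i * ?X i))" by (rule sum.swap)
  also have "\<dots> = flux u d ?y"
    unfolding flux_def by (simp only: sum_distrib_left[symmetric] T.bochner_field_transition[OF tr x])
  finally show "flux u c x = flux u d ?y" .
qed

lemma
  assumes c: "c \<in> A"
  shows smooth_lap: "smooth_on (chart_img c) (lap c)" and smooth_hess_sq: "smooth_on (chart_img c) (hess_sq c)"
    and continuous_flux: "C1_function u \<Longrightarrow> continuous_on (chart_img c) (flux u c)"
proof -
  interpret C: metric_patch "chart_img c" "g c" by (rule chart_patch[OF g c])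
  note sm = C.smooth_nabla[OF C.smooth_gradient[OF smooth_fc[OF c]]]
  show "smooth_on (chart_img c) (lap c)" unfolding lap_def[abs_def]
    by (intro smooth_on_sum sm C.open_U)
  show "smooth_on (chart_img c) (hess_sq c)" unfolding hess_sq_def[abs_def]
    by (intro smooth_on_sum smooth_on_mult sm C.open_U)
  assume "C1_function u"
  then have d: "continuous_on (chart_img c) (partial i (\<lambda>x. u (chart_inv c x)))" for i
    using c by (auto simp: C1_function_def partial_def[abs_def])
  note X = smooth_on_imp_continuous_on[OF C.smooth_bochner_field[OF C.smooth_gradient[OF smooth_fc[OF c]]]]
  show "continuous_on (chart_img c) (flux u c)" unfolding flux_def[abs_def]
    by (intro continuous_on_sum continuous_on_mult d X)
qed

definition bochner_density :: "'m \<Rightarrow> real" where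
  "bochner_density = at_chart (\<lambda>c x. hess_sq c x - (lap c x)\<^sup>2)"

lemma continuous_bochner_density: "continuous_on UNIV bochner_density"
  unfolding bochner_density_def
  by (intro continuous_at_chart continuous_on_diff continuous_on_power smooth_on_imp_continuous_on smooth_lap smooth_hess_sq)
     (simp_all add: lap_transition hess_sq_transition)

lemma continuous_at_chart_flux: "C1_function u \<Longrightarrow> continuous_on UNIV (at_chart (flux u))"
  by (intro continuous_at_chart continuous_flux flux_transition)

lemma continuous_C1_function: "C1_function u \<Longrightarrow> continuous_on UNIV u"
  by (rule continuous_on_charts, rule Ck_on_imp_continuous_on[where k="Suc 0"]) (simp only: C1_function_def)

text \<open>By Bochner's formula the integrand is the divergence of the cut-off Bochner field. The
  cut-off confines it to one chart, where a divergence times the volume density is a sum of partial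
  derivatives of compactly supported functions.\<close>

lemma integral_local_bochner:
  assumes k: "k < N"
  shows "(LINT p|vol A g. partition_fun k p * bochner_density p + at_chart (flux (partition_fun k)) p) = 0"
proof -
  let ?c = "cs k" and ?u = "partition_fun k"
  let ?U = "chart_img ?c" and ?K = "cball (xs k) (2 * rs k)"
  note c = cs[OF k] and u = C1_partition_fun[OF k]
  interpret C: metric_patch ?U "g ?c" by (rule chart_patch[OF g c])
  let ?uc = "\<lambda>x. ?u (chart_inv ?c x)" and ?X = "bochner_field (g ?c) (gradient (g ?c) (fc ?c))"
  let ?dens = "\<lambda>x. sqrt (det (g ?c x))"
  let ?q = "\<lambda>p. ?u p * bochner_density p + at_chart (flux ?u) p"
  have sX: "smooth_on ?U (?X i)" for i by (rule C.smooth_bochner_field[OF C.smooth_gradient[OF smooth_fc[OF c]]])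
  have uc: "Ck_on (Suc 0) ?U ?uc" using u c by (simp only: C1_function_def)
  \<comment> \<open>Outside the chart the flux is evaluated in some other chart. There the cut-off
    function vanishes on a whole neighbourhood, hence so does its derivative.\<close>
  have off: "?q p = 0" if p: "p \<notin> chart_dom ?c" for p
  proof -
    obtain d where d: "d \<in> A" "p \<in> chart_dom d" using ex_chart by blast
    define y where "y = chart_map d p"
    have y: "y \<in> chart_img d" "chart_inv d y = p" using d map_in_img inv_map by (auto simp: y_def)
    have ps: "p \<notin> support k" using p support_subset[OF k] by blast
    have "partial i (\<lambda>x. ?u (chart_inv d x)) y = 0" for i
    proof -
      have "((\<lambda>x. ?u (chart_inv d x)) has_derivative (\<lambda>_. 0)) (at y)"
        by (rule has_derivative_transform_within_open[OF has_derivative_const open_off_support[OF k d(1)], of y 0])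
           (use y ps partition_fun_zero[OF k] in auto)
      then show ?thesis by (rule partialI)
    qed
    then have "flux ?u d y = 0" by (simp add: flux_def)
    moreover have "at_chart (flux ?u) (chart_inv d y) = flux ?u d y"
      by (rule at_chart_eq[OF flux_transition[OF _ _ _ u] d(1) y(1)])
    ultimately show ?thesis using y ps partition_fun_zero[OF k] by simp
  qed
  have "(LINT p|vol A g. ?q p) = (LINT p|vol A g. indicator (chart_dom ?c) p * ?q p)"
    by (rule Bochner_Integration.integral_cong) (use off in \<open>auto simp: indicator_def\<close>)
  also have "\<dots> = (LINT x:chart_map ?c ` chart_dom ?c|lborel. ?q (chart_inv ?c x) * ?dens x)"
  proof (rule set_integral_chart[OF g c])
    have "continuous_on UNIV ?q"
      by (intro continuous_on_add continuous_on_mult continuous_C1_function[OF u] continuous_bochner_density continuous_at_chart_flux[OF u])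
    then show "?q \<in> borel_measurable borel" by (rule borel_measurable_continuous_onI)
  qed (auto intro: borel_open open_dom[OF c])
  also have "chart_map ?c ` chart_dom ?c = ?U" by (simp add: chart_img_def)
  also have "(LINT x:?U|lborel. ?q (chart_inv ?c x) * ?dens x) = (LINT x:?U|lborel. \<Oplus>i. partial i (\<lambda>x. ?uc x * (?dens x * ?X i x)) x)"
  proof (rule set_lebesgue_integral_cong)
    show "?U \<in> sets lborel" using C.open_U by simp
    show "\<forall>x. x \<in> ?U \<longrightarrow> ?q (chart_inv ?c x) * ?dens x = (\<Oplus>i. partial i (\<lambda>x. ?uc x * (?dens x * ?X i x)) x)"
    proof (intro allI impI)
      fix x assume x: "x \<in> ?U"
      have e1: "?q (chart_inv ?c x) = ?uc x * (hess_sq ?c x - (lap ?c x)\<^sup>2) + flux ?u ?c x"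
        unfolding bochner_density_def
        by (subst (1 2) at_chart_eq[OF _ c x]) (simp_all add: flux_transition u lap_transition hess_sq_transition)
      have ud: "?uc differentiable (at x)" using uc x by auto
      have Xd: "(\<lambda>x. ?dens x * ?X i x) differentiable (at x)" for i
        by (intro smooth_on_differentiable[OF _ x] smooth_on_mult C.smooth_density sX C.open_U)
      have e2: "(\<Oplus>i. partial i (\<lambda>x. ?uc x * (?dens x * ?X i x)) x) =
        (\<Oplus>i. partial i ?uc x * (?dens x * ?X i x)) + ?uc x * (\<Oplus>i. partial i (\<lambda>x. ?dens x * ?X i x) x)"
        unfolding partial_mult[OF ud Xd] by (simp only: sum.distrib sum_distrib_left)
      have e3: "(\<Oplus>i. partial i ?uc x * (?dens x * ?X i x)) = flux ?u ?c x * ?dens x"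
        unfolding flux_def sum_distrib_right by (simp only: mult_ac)
      have e4: "(\<Oplus>i. partial i (\<lambda>x. ?dens x * ?X i x) x) = ?dens x * (hess_sq ?c x - (lap ?c x)\<^sup>2)"
        unfolding hess_sq_def lap_def
        by (rule C.bochner_formula[OF C.smooth_gradient[OF smooth_fc[OF c]] x ricci_flat[OF c x]])
      show "?q (chart_inv ?c x) * ?dens x = (\<Oplus>i. partial i (\<lambda>x. ?uc x * (?dens x * ?X i x)) x)"
        unfolding e1 e2 e3 e4 by (simp add: algebra_simps)
    qed
  qed
  also have "\<dots> = (\<Oplus>i. LINT x:?U|lborel. partial i (\<lambda>x. ?uc x * (?dens x * ?X i x)) x)"
  proof -
    have "set_integrable lborel ?U (partial i (\<lambda>x. ?uc x * (?dens x * ?X i x)))" for i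
    proof -
      have C1: "Ck_on (Suc 0) ?U (\<lambda>x. ?uc x * (?dens x * ?X i x))"
        by (intro Ck_on_bilinear[OF C.open_U bounded_bilinear_mult] uc smooth_onD C.smooth_density sX)
      then have cont: "continuous_on ?U (partial i (\<lambda>x. ?uc x * (?dens x * ?X i x)))"
        by (auto simp: partial_def[abs_def])
      have z: "partial i (\<lambda>x. ?uc x * (?dens x * ?X i x)) x = 0" if x: "x \<in> ?U - ?K" for x
      proof (rule partialI)
        show "((\<lambda>x. ?uc x * (?dens x * ?X i x)) has_derivative (\<lambda>_. 0)) (at x)"
        proof (rule has_derivative_transform_within_open[OF has_derivative_const _ x, of 0])
          show "open (?U - ?K)" using C.open_U by (intro open_Diff) auto
          show "0 = ?uc y * (?dens y * ?X i y)" if y: "y \<in> ?U - ?K" for y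
          proof -
            have "chart_inv ?c y \<notin> support k" by (rule inv_not_in_support[OF k y])
            then show ?thesis using partition_fun_zero[OF k] by simp
          qed
        qed
      qed
      \<comment> \<open>The partial derivatives vanish off the closed ball of doubled radius, so
        integrability over the open chart image reduces to a compact set.\<close>
      have eq: "(\<lambda>x. indicator ?U x *\<^sub>R partial i (\<lambda>x. ?uc x * (?dens x * ?X i x)) x) =
          (\<lambda>x. indicator ?K x *\<^sub>R partial i (\<lambda>x. ?uc x * (?dens x * ?X i x)) x)"
      proof
        fix x
        show "indicator ?U x *\<^sub>R partial i (\<lambda>x. ?uc x * (?dens x * ?X i x)) x = indicator ?K x *\<^sub>R partial i (\<lambda>x. ?uc x * (?dens x * ?X i x)) x"
          using z[of x] big_ball[OF k] by (auto simp: indicator_def)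
      qed
      show ?thesis unfolding set_integrable_def eq
        by (rule borel_integrable_compact[OF compact_cball continuous_on_subset[OF cont big_ball[OF k]]])
    qed
    then show ?thesis unfolding set_integrable_def set_lebesgue_integral_def scaleR_sum_right
      by (intro Bochner_Integration.integral_sum)
  qed
  also have "\<dots> = 0"
  proof (rule sum.neutral, intro ballI)
    fix i
    show "(LINT x:?U|lborel. partial i (\<lambda>x. ?uc x * (?dens x * ?X i x)) x) = 0"
    proof (rule set_integral_partial_eq_0[OF C.open_U _ compact_cball big_ball[OF k]])
      show "Ck_on (Suc 0) ?U (\<lambda>x. ?uc x * (?dens x * ?X i x))"
        by (intro Ck_on_bilinear[OF C.open_U bounded_bilinear_mult] uc smooth_onD C.smooth_density sX)
      fix y assume y: "y \<in> ?U - ?K"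
      have "chart_inv ?c y \<notin> support k" by (rule inv_not_in_support[OF k y])
      then show "?uc y * (?dens y * ?X i y) = 0" using partition_fun_zero[OF k] by simp
    qed
  qed
  finally show ?thesis .
qed

text \<open>Summing the local identities over the partition of unity: the cut-offs add up to
  \<open>1\<close>, so the flux terms add up to the derivative of a constant, and the Bochner
  density remains.\<close>

theorem integral_bochner: "(LINT p|vol A g. bochner_density p) = 0"
proof -
  let ?q = "\<lambda>k p. partition_fun k p * bochner_density p + at_chart (flux (partition_fun k)) p"
  have flux0: "(\<Sum>k<N. at_chart (flux (partition_fun k)) p) = 0" for p
  proof -
    obtain c where c: "c \<in> A" "p \<in> chart_dom c" using ex_chart by blast
    define x where "x = chart_map c p"
    have x: "x \<in> chart_img c" "chart_inv c x = p" using c map_in_img inv_map by (auto simp: x_def)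
    have diff: "(\<lambda>x. partition_fun k (chart_inv c x)) differentiable (at x)" if "k < N" for k
      using C1_partition_fun[OF that] c(1) x(1) by (auto simp: C1_function_def)
    have "at_chart (flux (partition_fun k)) p = flux (partition_fun k) c x" if "k < N" for k
      using at_chart_eq[OF flux_transition[OF _ _ _ C1_partition_fun[OF that]] c(1) x(1)] x(2) by simp
    then have "(\<Sum>k<N. at_chart (flux (partition_fun k)) p) =
       (\<Sum>k<N. \<Oplus>i. partial i (\<lambda>x. partition_fun k (chart_inv c x)) x * bochner_field (g c) (gradient (g c) (fc c)) i x)"
      by (simp add: flux_def)
    also have "\<dots> = (\<Oplus>i. (\<Sum>k<N. partial i (\<lambda>x. partition_fun k (chart_inv c x)) x) * bochner_field (g c) (gradient (g c) (fc c)) i x)"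
      by (subst sum.swap) (simp add: sum_distrib_right)
    also have "\<dots> = (\<Oplus>i. partial i (\<lambda>x. \<Sum>k<N. partition_fun k (chart_inv c x)) x * bochner_field (g c) (gradient (g c) (fc c)) i x)"
      using diff by (subst partial_sum) auto
    finally show ?thesis by (simp add: sum_partition_fun)
  qed
  have "(LINT p|vol A g. bochner_density p) = (LINT p|vol A g. (\<Sum>k<N. ?q k p))"
    by (simp add: sum.distrib flux0 sum_distrib_right[symmetric] sum_partition_fun)
  also have "\<dots> = (\<Sum>k<N. LINT p|vol A g. ?q k p)"
    by (intro Bochner_Integration.integral_sum integrable_continuous[OF g volume] continuous_on_add continuous_on_mult
        continuous_C1_function C1_partition_fun continuous_bochner_density continuous_at_chart_flux) auto
  also have "\<dots> = 0" using integral_local_bochner by simp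
  finally show ?thesis .
qed

end

section \<open>Second variation of the functional\<close>

lemma has_second_derivative_at_cong:
  assumes "open T" "a \<in> T" "\<And>t. t \<in> T \<Longrightarrow> \<phi> t = \<psi> t" "has_second_derivative_at \<phi> D a"
  shows "has_second_derivative_at \<psi> D a"
proof -
  obtain \<phi>' where 1: "\<forall>\<^sub>F t in nhds a. (\<phi> has_real_derivative \<phi>' t) (at t)" "(\<phi>' has_real_derivative D) (at a)"
    using assms(4) unfolding has_second_derivative_at_def by blast
  have "\<forall>\<^sub>F t in nhds a. (\<psi> has_real_derivative \<phi>' t) (at t)"
    using 1(1) eventually_nhds_in_open[OF assms(1,2)]
  proof eventually_elim
    case (elim t)
    then show ?case by (intro has_field_derivative_transform_within_open[OF _ assms(1) _ assms(3)]) auto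
  qed
  with 1(2) show ?thesis unfolding has_second_derivative_at_def by blast
qed

text \<open>The first derivative inside \<open>has_second_derivative_at\<close> is existential, but
  near \<open>a\<close> any two first derivatives agree, so the second derivative is
  determined.\<close>

lemma has_second_derivative_at_unique:
  assumes "has_second_derivative_at \<phi> D a" "open T" "a \<in> T"
    and "\<And>t. t \<in> T \<Longrightarrow> (\<phi> has_real_derivative \<phi>1 t) (at t)" "(\<phi>1 has_real_derivative E) (at a)"
  shows "E = D"
proof -
  obtain \<phi>' where 1: "\<forall>\<^sub>F t in nhds a. (\<phi> has_real_derivative \<phi>' t) (at t)" "(\<phi>' has_real_derivative D) (at a)"
    using assms(1) unfolding has_second_derivative_at_def by blast
  have "\<forall>\<^sub>F t in nhds a. \<phi>1 t = \<phi>' t"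
    using 1(1) eventually_nhds_in_open[OF assms(2,3)]
    by eventually_elim (rule DERIV_unique[OF assms(4)])
  then have "(\<phi>1 has_real_derivative D) (at a)"
    using DERIV_cong_ev[of a a \<phi>1 \<phi>' D D] 1(2) by simp
  with assms(5) show ?thesis by (rule DERIV_unique)
qed

lemma has_second_derivative_integral:
  fixes I :: "real \<Rightarrow> 'a::euclidean_space \<Rightarrow> real"
  assumes "open T" "open U" "smooth_on (T \<times> U) (\<lambda>p. I (fst p) (snd p))"
    and K: "compact K" "K \<subseteq> U" "E \<in> sets lborel" "E \<subseteq> K" and "a \<in> T"
  shows "has_second_derivative_at (\<lambda>t. LINT x:E|lborel. I t x) (LINT x:E|lborel. tder (tder I) a x) a"
  unfolding has_second_derivative_at_def
proof (intro exI[of _ "\<lambda>t. LINT x:E|lborel. tder I t x"] conjI)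
  have 1: "((\<lambda>t. LINT x:E|lborel. I t x) has_real_derivative (LINT x:E|lborel. tder I t x)) (at t)" if "t \<in> T" for t
    by (rule leibniz_rule_compact[OF assms(1,2) smooth_onD[OF assms(3)] K that])
  show "\<forall>\<^sub>F t in nhds a. ((\<lambda>t. LINT x:E|lborel. I t x) has_real_derivative (LINT x:E|lborel. tder I t x)) (at t)"
    using eventually_nhds_in_open[OF assms(1,8)] by eventually_elim (rule 1)
  show "((\<lambda>t. LINT x:E|lborel. tder I t x) has_real_derivative (LINT x:E|lborel. tder (tder I) a x)) (at a)"
    by (rule leibniz_rule_compact[OF assms(1,2) smooth_onD[OF smooth_on_tder[OF assms(1-3)]] K assms(8)])
qed

text \<open>At time \<open>0\<close> the curve agrees with \<open>g\<close> only on chart images,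
  while curvature is defined through derivatives of the whole component functions. Viewing the
  identity as a coordinate change makes the transformation laws supply all the required
  congruences.\<close>

lemma metric_transition_ident:
  assumes "metric_patch U G" "metric_patch U H" "\<And>x. x \<in> U \<Longrightarrow> G x = H x"
  shows "metric_transition U G U H (\<lambda>x. x)"
proof -
  interpret M: metric_patch U G by fact
  interpret N: metric_patch U H by fact
  show ?thesis
  proof
    show "smooth_on U (\<lambda>x. x)" by (rule smooth_on_linear[OF M.open_U bounded_linear_ident])
    have "matrix (frechet_derivative (\<lambda>x::real^'a. x) (at x)) = mat 1" for x :: "real^'a"
      by (simp add: frechet_derivative_ident matrix_def mat_def axis_def vec_eq_iff)
    then show "G x = transpose (matrix (frechet_derivative (\<lambda>x. x) (at x))) ** H x ** matrix (frechet_derivative (\<lambda>x. x) (at x))"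
      if "x \<in> U" for x using assms(3)[OF that] by (simp add: transpose_mat)
  qed simp
qed

lemma jac_ident: "jac (\<lambda>x. x) a i x = (if a = i then 1 else 0)"
  unfolding jac_def by (simp add: partialI[OF bounded_linear_imp_has_derivative[OF bounded_linear_vec_nth]] axis_def)

definition curvature_density :: "real \<Rightarrow> real \<Rightarrow> (real^'n \<Rightarrow> real^'n^'n) \<Rightarrow> real^'n::finite \<Rightarrow> real" where
  "curvature_density s \<tau> G x = riem_sq G x + s * ricci_sq G x + \<tau> * (scalar_curv G x)\<^sup>2"

lemma (in metric_family) smooth_curvature_density:
  "smooth_on (T \<times> U) (\<lambda>p. curvature_density s \<tau> (G (fst p)) (snd p))"
  unfolding curvature_density_def
  by (intro smooth_on_add smooth_on_mult smooth_on_const smooth_on_power smooth_riem_sq smooth_ricci_sq smooth_scalar_curv open_TU)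

context covered_manifold
begin

text \<open>Eliminates the volume measure and the choice of charts. Domains and charts on the right
  are fixed, so along a curve of metrics only the integrands depend on time and the Leibniz rule
  applies.\<close>

lemma curv_functional_eq:
  assumes h: "riemannian_metric A h" and vol: "measure (vol A h) UNIV \<noteq> 0"
  shows "curv_functional A s \<tau> h =
    (\<Sum>k<N. LINT x:chart_map (cs k) ` piece k|lborel. curvature_density s \<tau> (h (cs k)) x * sqrt (det (h (cs k) x)))"
proof -
  have at: "at_point A q h = at_chart (\<lambda>c. q (h c))" for q
    by (simp add: at_point_def at_chart_def fun_eq_iff)
  have sm: "continuous_on (chart_img c) (riem_sq (h c))" "continuous_on (chart_img c) (ricci_sq (h c))"
    "continuous_on (chart_img c) (scalar_curv (h c))" if c: "c \<in> A" for c
  proof -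
    interpret C: metric_patch "chart_img c" "h c" by (rule chart_patch[OF h c])
    show "continuous_on (chart_img c) (riem_sq (h c))" 
      by (rule smooth_on_imp_continuous_on[OF smooth_on_slice[where F="\<lambda>_. riem_sq (h c)" and t=0, OF open_UNIV C.open_U C.const.smooth_riem_sq UNIV_I]])
    show "continuous_on (chart_img c) (ricci_sq (h c))" 
      by (rule smooth_on_imp_continuous_on[OF smooth_on_slice[where F="\<lambda>_. ricci_sq (h c)" and t=0, OF open_UNIV C.open_U C.const.smooth_ricci_sq UNIV_I]])
    show "continuous_on (chart_img c) (scalar_curv (h c))" 
      by (rule smooth_on_imp_continuous_on[OF smooth_on_slice[where F="\<lambda>_. scalar_curv (h c)" and t=0, OF open_UNIV C.open_U C.const.smooth_scalar_curv UNIV_I]])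
  qed
  have inv: "riem_sq (h c) x = riem_sq (h d) (transition c d x)" "ricci_sq (h c) x = ricci_sq (h d) (transition c d x)"
    "scalar_curv (h c) x = scalar_curv (h d) (transition c d x)" if "c \<in> A" "d \<in> A" "x \<in> overlap c d" for c d x
    using metric_transition.invariants[OF chart_transition[OF h that(1,2)] that(3)] by simp_all
  have cont: "continuous_on UNIV (at_point A riem_sq h)" "continuous_on UNIV (at_point A ricci_sq h)"
    "continuous_on UNIV (at_point A scalar_curv h)"
    unfolding at by (intro continuous_at_chart inv sm; assumption)+
  let ?q = "\<lambda>p. at_point A riem_sq h p + s * at_point A ricci_sq h p + \<tau> * (at_point A scalar_curv h p)\<^sup>2"
  note int = integrable_continuous[OF h vol]
  have "curv_functional A s \<tau> h = (LINT p|vol A h. ?q p)"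
    unfolding curv_functional_def
    by (simp add: int[OF cont(1)] int[OF cont(2)] int[OF continuous_on_power[OF cont(3)]])
  also have "\<dots> = (\<Sum>k<N. LINT x:chart_map (cs k) ` piece k|lborel. ?q (chart_inv (cs k) x) * sqrt (det (h (cs k) x)))"
    by (intro integral_pieces[OF h vol] continuous_on_add continuous_on_mult continuous_on_const continuous_on_power cont)
  also have "\<dots> = (\<Sum>k<N. LINT x:chart_map (cs k) ` piece k|lborel. curvature_density s \<tau> (h (cs k)) x * sqrt (det (h (cs k) x)))"
  proof (rule sum.cong[OF refl])
    fix k assume "k \<in> {..<N}"
    then have k: "k < N" by simp
    show "(LINT x:chart_map (cs k) ` piece k|lborel. ?q (chart_inv (cs k) x) * sqrt (det (h (cs k) x))) =
      (LINT x:chart_map (cs k) ` piece k|lborel. curvature_density s \<tau> (h (cs k)) x * sqrt (det (h (cs k) x)))"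
    proof (rule set_lebesgue_integral_cong)
      show "chart_map (cs k) ` piece k \<in> sets lborel"
        using borel_map_image[OF cs[OF k] piece_borel[OF k] piece_subset[OF k]] by simp
      show "\<forall>x. x \<in> chart_map (cs k) ` piece k \<longrightarrow> ?q (chart_inv (cs k) x) * sqrt (det (h (cs k) x)) =
        curvature_density s \<tau> (h (cs k)) x * sqrt (det (h (cs k) x))"
      proof (intro allI impI)
        fix x assume "x \<in> chart_map (cs k) ` piece k"
        then have x: "x \<in> chart_img (cs k)" using map_piece_subset[OF k] ball_subset_img[OF k] by blast
        have "at_point A riem_sq h (chart_inv (cs k) x) = riem_sq (h (cs k)) x"
          "at_point A ricci_sq h (chart_inv (cs k) x) = ricci_sq (h (cs k)) x"
          "at_point A scalar_curv h (chart_inv (cs k) x) = scalar_curv (h (cs k)) x"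
          unfolding at by (intro at_chart_eq[OF _ cs[OF k] x] inv; assumption)+
        then show "?q (chart_inv (cs k) x) * sqrt (det (h (cs k) x)) = curvature_density s \<tau> (h (cs k)) x * sqrt (det (h (cs k) x))"
          by (simp add: curvature_density_def)
      qed
    qed
  qed
  finally show ?thesis .
qed

end

section \<open>The second variation at a flat metric\<close>

locale flat_manifold = ricci_flat_manifold A N cs xs rs g f
  for A :: "('m::{t2_space, second_countable_topology}, 'n::finite) chart set" and N cs xs rs g f +
  assumes flat: "c \<in> A \<Longrightarrow> x \<in> chart_img c \<Longrightarrow> riem_up (g c) l i j k x = 0"
begin

lemma curve_conformal_variation:
  assumes \<gamma>: "unit_metric_curve A g (conformal_tensor f g) \<gamma>"
    and \<epsilon>: "\<epsilon> > 0" "\<And>t. t \<in> {-\<epsilon><..<\<epsilon>} \<Longrightarrow> unit_metric A (\<gamma> t)"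
      "\<And>c. c \<in> A \<Longrightarrow> smooth_on ({-\<epsilon><..<\<epsilon>} \<times> chart_img c) (\<lambda>(t, x). \<gamma> t c x)"
    and c: "c \<in> A"
  shows "conformal_variation {-\<epsilon><..<\<epsilon>} (chart_img c) (\<lambda>t. \<gamma> t c) (fc c)"
proof
  show "open {-\<epsilon><..<\<epsilon>}" "open (chart_img c)" by (auto intro: open_img[OF c])
  show "smooth_on ({-\<epsilon><..<\<epsilon>} \<times> chart_img c) (\<lambda>p. \<gamma> (fst p) c (snd p))"
    using \<epsilon>(3)[OF c] by (simp add: case_prod_beta')
  show "posdef_sym (\<gamma> t c x)" if "t \<in> {-\<epsilon><..<\<epsilon>}" "x \<in> chart_img c" for t x
    using metric_patch.posdef[OF chart_patch[OF _ c] that(2)] \<epsilon>(2)[OF that(1)] by (simp add: unit_metric_def)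
  show "0 \<in> {-\<epsilon><..<\<epsilon>}" using \<epsilon>(1) by simp
  show "smooth_on (chart_img c) (fc c)" by (rule smooth_fc[OF c])
  fix x i j assume x: "x \<in> chart_img c"
  have 0: "\<gamma> 0 c x = g c x" and "((\<lambda>t. \<gamma> t c x) has_vector_derivative f (chart_inv c x) *\<^sub>R g c x) (at 0)"
    using \<gamma> c x unfolding unit_metric_curve_def by (auto simp: conformal_tensor_def)
  then have "((\<lambda>t. \<gamma> t c x) has_derivative (\<lambda>t. t *\<^sub>R f (chart_inv c x) *\<^sub>R g c x)) (at 0)"
    by (simp add: has_vector_derivative_def)
  from bounded_linear.has_derivative[OF bounded_linear_vec_nth bounded_linear.has_derivative[OF bounded_linear_vec_nth this]]
  have "((\<lambda>t. \<gamma> t c x $ i $ j) has_derivative (\<lambda>t. t * (f (chart_inv c x) * g c x $ i $ j))) (at 0)" by (simp add: mult.assoc)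
  then have "((\<lambda>t. \<gamma> t c x $ i $ j) has_real_derivative f (chart_inv c x) * g c x $ i $ j) (at 0)"
    by (rule has_derivative_imp_has_field_derivative) simp
  then show "tder (\<lambda>t x. \<gamma> t c x $ i $ j) 0 x = fc c x * \<gamma> 0 c x $ i $ j"
    by (simp add: tder_def DERIV_imp_deriv 0)
qed

definition lap_sq_integral :: real where
  "lap_sq_integral = (LINT p|vol A g. at_chart (\<lambda>c x. (lap c x)\<^sup>2) p)"

lemma lap_sq_integral_nonneg: "lap_sq_integral \<ge> 0"
  unfolding lap_sq_integral_def by (intro Bochner_Integration.integral_nonneg) (simp add: at_chart_def Let_def)

lemma continuous_quadratic: "continuous_on UNIV (at_chart (\<lambda>c x. a * hess_sq c x + b * (lap c x)\<^sup>2))"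
  by (intro continuous_at_chart continuous_on_add continuous_on_mult continuous_on_const continuous_on_power
      smooth_on_imp_continuous_on smooth_lap smooth_hess_sq)
     (simp_all add: lap_transition hess_sq_transition)

text \<open>Splits the integrand as \<open>a\<close> times the Bochner density plus
  \<open>a + b\<close> times the squared Laplacian; the first part integrates to zero.\<close>

lemma integral_quadratic:
  "(LINT p|vol A g. at_chart (\<lambda>c x. a * hess_sq c x + b * (lap c x)\<^sup>2) p) = (a + b) * lap_sq_integral"
proof -
  have cont: "continuous_on UNIV (at_chart (\<lambda>c x. (lap c x)\<^sup>2))"
    using continuous_quadratic[of 0 1] by simp
  have "at_chart (\<lambda>c x. a * hess_sq c x + b * (lap c x)\<^sup>2) p = a * bochner_density p + (a + b) * at_chart (\<lambda>c x. (lap c x)\<^sup>2) p" for p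
    by (simp add: at_chart_def bochner_density_def Let_def algebra_simps)
  then have "(LINT p|vol A g. at_chart (\<lambda>c x. a * hess_sq c x + b * (lap c x)\<^sup>2) p) =
    (LINT p|vol A g. a * bochner_density p + (a + b) * at_chart (\<lambda>c x. (lap c x)\<^sup>2) p)" by simp
  also have "\<dots> = a * (LINT p|vol A g. bochner_density p) + (a + b) * lap_sq_integral"
    unfolding lap_sq_integral_def
    using integrable_continuous[OF g volume continuous_bochner_density] integrable_continuous[OF g volume cont] by simp
  finally show ?thesis by (simp add: integral_bochner)
qed

text \<open>The local integrals are differentiated twice, the pointwise second derivative is
  inserted, and the pieces are reassembled into one integral over the manifold, to which the
  integrated Bochner formula applies.\<close>

lemma second_variation_along_curve:
  assumes \<gamma>: "unit_metric_curve A g (conformal_tensor f g) \<gamma>"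
  defines "n \<equiv> real CARD('n)"
  shows "has_second_derivative_at (\<lambda>t. curv_functional A s \<tau> (\<gamma> t))
    (2 * (n - 1) * (1 + s * n / 4 + \<tau> * (n - 1)) * lap_sq_integral) 0"
proof -
  obtain \<epsilon> where \<epsilon>: "\<epsilon> > 0" "\<And>t. t \<in> {-\<epsilon><..<\<epsilon>} \<Longrightarrow> unit_metric A (\<gamma> t)"
      "\<And>c. c \<in> A \<Longrightarrow> smooth_on ({-\<epsilon><..<\<epsilon>} \<times> chart_img c) (\<lambda>(t, x). \<gamma> t c x)"
    and start: "\<And>c x. c \<in> A \<Longrightarrow> x \<in> chart_img c \<Longrightarrow> \<gamma> 0 c x = g c x"
    using \<gamma> unfolding unit_metric_curve_def by blast
  let ?T = "{-\<epsilon><..<\<epsilon>}"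
  \<comment> \<open>\<open>\<alpha>\<close> and \<open>\<beta>\<close> are the coefficients of the
    squared Hessian and the squared Laplacian in the second derivative of the density. Only their
    sum survives integration; since \<open>(n - 2)\<^sup>2 + 3 * n - 4 = n * (n - 1)\<close>, it has
    the factor \<open>2 * (n - 1)\<close>.\<close>
  define \<alpha> where "\<alpha> = 2 * (n - 2 + s * ((1/4) * (n - 2)\<^sup>2))"
  define \<beta> where "\<beta> = 2 * (1 + s * ((1/4) * (3 * n - 4)) + \<tau> * (n - 1)\<^sup>2)"
  define I where "I k t x = curvature_density s \<tau> (\<gamma> t (cs k)) x * sqrt (det (\<gamma> t (cs k) x))" for k t x
  have T: "open ?T" "0 \<in> ?T" using \<epsilon>(1) by auto
  have piece: "chart_map (cs k) ` piece k \<in> sets lborel" if k: "k < N" for k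
    using borel_map_image[OF cs[OF k] piece_borel[OF k] piece_subset[OF k]] by simp
  have tt: "tder (tder (I k)) 0 x = (\<alpha> * hess_sq (cs k) x + \<beta> * (lap (cs k) x)\<^sup>2) * sqrt (det (g (cs k) x))"
    and smI: "smooth_on (?T \<times> chart_img (cs k)) (\<lambda>p. I k (fst p) (snd p))"
    if k: "k < N" and x: "x \<in> chart_img (cs k)" for k x
  proof -
    let ?c = "cs k"
    note c = cs[OF k]
    interpret C: conformal_variation ?T "chart_img ?c" "\<lambda>t. \<gamma> t ?c" "fc ?c"
      by (rule curve_conformal_variation[OF \<gamma> \<epsilon> c])
    interpret J: metric_transition "chart_img ?c" "\<gamma> 0 ?c" "chart_img ?c" "g ?c" "\<lambda>x. x"
      by (rule metric_transition_ident[OF C.g.metric_patch_axioms chart_patch[OF g c] start[OF c]])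
    show smI: "smooth_on (?T \<times> chart_img ?c) (\<lambda>p. I k (fst p) (snd p))"
      unfolding I_def by (intro smooth_on_mult C.smooth_curvature_density C.smooth_volume_density C.open_TU)
    have flat0: "riem_up (\<gamma> 0 ?c) l i j m x = 0" for l i j m
      using J.riem_up_transition[OF x, of l i j m] by (simp only: jac_ident flat[OF c x] mult_zero_left sum.neutral_const sum_delta_mult)
    have "has_second_derivative_at (\<lambda>t. I k t x)
      (2 * ((n - 2) * hess_sq ?c x + (lap ?c x)\<^sup>2 + s * ((1/4) * ((n - 2)\<^sup>2 * hess_sq ?c x + (3 * n - 4) * (lap ?c x)\<^sup>2))
        + \<tau> * ((n - 1)\<^sup>2 * (lap ?c x)\<^sup>2)) * sqrt (det (\<gamma> 0 ?c x))) 0"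
      using C.second_variation_density[OF x flat0, of s \<tau>]
      unfolding I_def curvature_density_def n_def hess_sq_def lap_def
        J.laplacian_invariant[OF smooth_fc[OF c] refl x] J.hessian_sq_invariant[OF smooth_fc[OF c] refl x] .
    \<comment> \<open>The Leibniz rule yields the iterated \<open>tder\<close>, the pointwise
      computation only the existence of a second derivative with a given value; uniqueness
      identifies the two.\<close>
    from has_second_derivative_at_unique[OF this T C.has_tder[OF smI _ x] C.has_tder[OF smooth_on_tder[OF T(1) C.open_U smI] T(2) x]]
    show "tder (tder (I k)) 0 x = (\<alpha> * hess_sq ?c x + \<beta> * (lap ?c x)\<^sup>2) * sqrt (det (g ?c x))"
      by (simp add: start[OF c x] \<alpha>_def \<beta>_def algebra_simps)
  qed
  have "has_second_derivative_at (\<lambda>t. \<Sum>k<N. LINT x:chart_map (cs k) ` piece k|lborel. I k t x)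
    (\<Sum>k<N. LINT x:chart_map (cs k) ` piece k|lborel. tder (tder (I k)) 0 x) 0"
  proof (intro has_second_derivative_at_sum)
    fix k assume "k \<in> {..<N}"
    then have k: "k < N" by simp
    have "xs k \<in> chart_img (cs k)" using ball_subset_img[OF k] rs[OF k] by auto
    from has_second_derivative_integral[OF T(1) open_img[OF cs[OF k]] smI[OF k this] compact_cball ball_subset_img[OF k] piece[OF k] map_piece_subset[OF k] T(2)]
    show "has_second_derivative_at (\<lambda>t. LINT x:chart_map (cs k) ` piece k|lborel. I k t x)
      (LINT x:chart_map (cs k) ` piece k|lborel. tder (tder (I k)) 0 x) 0" .
  qed
  also have "(\<Sum>k<N. LINT x:chart_map (cs k) ` piece k|lborel. tder (tder (I k)) 0 x) =
    (\<Sum>k<N. LINT x:chart_map (cs k) ` piece k|lborel. at_chart (\<lambda>c x. \<alpha> * hess_sq c x + \<beta> * (lap c x)\<^sup>2) (chart_inv (cs k) x) * sqrt (det (g (cs k) x)))"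
  proof (intro sum.cong refl set_lebesgue_integral_cong allI impI)
    fix k x assume k: "k \<in> {..<N}" and "x \<in> chart_map (cs k) ` piece k"
    then have k: "k < N" and x: "x \<in> chart_img (cs k)" using map_piece_subset ball_subset_img by auto
    have "at_chart (\<lambda>c x. \<alpha> * hess_sq c x + \<beta> * (lap c x)\<^sup>2) (chart_inv (cs k) x) = \<alpha> * hess_sq (cs k) x + \<beta> * (lap (cs k) x)\<^sup>2"
      by (rule at_chart_eq[OF _ cs[OF k] x]) (simp add: lap_transition hess_sq_transition)
    then show "tder (tder (I k)) 0 x = at_chart (\<lambda>c x. \<alpha> * hess_sq c x + \<beta> * (lap c x)\<^sup>2) (chart_inv (cs k) x) * sqrt (det (g (cs k) x))"
      by (simp add: tt[OF k x])
  qed (use piece in auto)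
  also have "\<dots> = (LINT p|vol A g. at_chart (\<lambda>c x. \<alpha> * hess_sq c x + \<beta> * (lap c x)\<^sup>2) p)"
    by (rule integral_pieces[OF g volume continuous_quadratic, symmetric])
  also have "\<dots> = 2 * (n - 1) * (1 + s * n / 4 + \<tau> * (n - 1)) * lap_sq_integral"
    unfolding integral_quadratic \<alpha>_def \<beta>_def by (simp add: power2_eq_square field_simps)
  finally have 1: "has_second_derivative_at (\<lambda>t. \<Sum>k<N. LINT x:chart_map (cs k) ` piece k|lborel. I k t x)
    (2 * (n - 1) * (1 + s * n / 4 + \<tau> * (n - 1)) * lap_sq_integral) 0" .
  show ?thesis
  proof (rule has_second_derivative_at_cong[OF T _ 1])
    fix t assume t: "t \<in> ?T"
    have "riemannian_metric A (\<gamma> t)" "measure (vol A (\<gamma> t)) UNIV \<noteq> 0"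
      using \<epsilon>(2)[OF t] by (auto simp: unit_metric_def)
    from curv_functional_eq[OF this]
    show "(\<Sum>k<N. LINT x:chart_map (cs k) ` piece k|lborel. I k t x) = curv_functional A s \<tau> (\<gamma> t)"
      by (simp add: I_def)
  qed
qed

end

section \<open>Unit volume curves in conformal directions\<close>

context covered_manifold
begin

text \<open>The conformal factor is chosen such that the volume density of \<open>conformal_curve f g t\<close> is
  \<open>1 + (n/2) t f\<close> times that of \<open>g\<close>, so the total volume stays constant.\<close>

definition conformal_curve :: "('m \<Rightarrow> real) \<Rightarrow> ('m, 'n) tensor2 \<Rightarrow> real \<Rightarrow> ('m, 'n) tensor2" where
  "conformal_curve f g t = conformal_tensor (\<lambda>p. (1 + real CARD('n) / 2 * t * f p) powr (2 / real CARD('n))) g"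

context
  fixes f :: "'m \<Rightarrow> real" and g :: "('m, 'n) tensor2"
  assumes f: "smooth_function A f" and unit: "unit_metric A g" and mean: "(LINT p|vol A g. f p) = 0"
begin

lemma g_metric: "riemannian_metric A g" and g_volume: "measure (vol A g) UNIV = 1"
  using unit by (auto simp: unit_metric_def)

lemma smooth_f_chart: "c \<in> A \<Longrightarrow> smooth_on (chart_img c) (\<lambda>x. f (chart_inv c x))"
  using f by (simp add: smooth_function_def comp_def)

lemma continuous_f: "continuous_on UNIV f"
  by (intro continuous_on_charts smooth_on_imp_continuous_on smooth_f_chart)

lemma riemannian_conformal_curve:
  assumes pos: "\<And>p. 1 + real CARD('n) / 2 * t * f p > 0"
  shows "riemannian_metric A (conformal_curve f g t)"
proof -
  let ?u = "\<lambda>p. (1 + real CARD('n) / 2 * t * f p) powr (2 / real CARD('n))"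
  have u: "?u p > 0" for p using pos[of p] by simp
  show ?thesis unfolding riemannian_metric_def
  proof (intro conjI ballI)
    fix c assume c: "c \<in> A"
    note o = open_img[OF c]
    interpret C: metric_patch "chart_img c" "g c" by (rule chart_patch[OF g_metric c])
    show "smooth_on (chart_img c) (conformal_curve f g t c)"
      unfolding conformal_curve_def conformal_tensor_def
      by (intro smooth_on_scaleR smooth_on_powr smooth_on_add smooth_on_mult smooth_on_const smooth_f_chart c o C.smooth_G pos)
    fix x assume x: "x \<in> chart_img c"
    have sym: "transpose (g c x) = g c x" and p: "\<And>v. v \<noteq> 0 \<Longrightarrow> v \<bullet> (g c x *v v) > 0"
      using C.posdef[OF x] by (auto simp: posdef_sym_def)
    show "transpose (conformal_curve f g t c x) = conformal_curve f g t c x"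
      using sym by (simp add: conformal_curve_def conformal_tensor_def transpose_scalar)
    show "\<forall>v. v \<noteq> 0 \<longrightarrow> v \<bullet> (conformal_curve f g t c x *v v) > 0"
      using p u by (simp add: conformal_curve_def conformal_tensor_def scaleR_matrix_vector_assoc[symmetric])
  next
    fix c d x assume c: "c \<in> A" and d: "d \<in> A" and x: "x \<in> chart_map c ` (chart_dom c \<inter> chart_dom d)"
    then have xo: "x \<in> overlap c d" by (simp add: overlap_def)
    let ?J = "matrix (frechet_derivative (transition c d) (at x))"
    have "g c x = transpose ?J ** g d (transition c d x) ** ?J"
      by (rule metric_transition.pullback[OF chart_transition[OF g_metric c d] xo])
    then show "let J = matrix (frechet_derivative (transition c d) (at x)) in
        conformal_curve f g t c x = transpose J ** conformal_curve f g t d (transition c d x) ** J"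
      unfolding Let_def conformal_curve_def conformal_tensor_def inv_transition[OF c d xo]
      by (simp add: matrix_scalar_ac scalar_matrix_assoc)
  qed
qed

lemma density_conformal_curve:
  assumes pos: "\<And>p. 1 + real CARD('n) / 2 * t * f p > 0"
  shows "sqrt (det (conformal_curve f g t c x)) = (1 + real CARD('n) / 2 * t * f (chart_inv c x)) * sqrt (det (g c x))"
proof -
  let ?w = "1 + real CARD('n) / 2 * t * f (chart_inv c x)"
  have w: "?w > 0" by (rule pos)
  have "(?w powr (2 / real CARD('n))) ^ CARD('n) = (?w powr (2 / real CARD('n))) powr real CARD('n)"
    by (rule powr_realpow[symmetric]) (use w in simp)
  also have "\<dots> = ?w powr (2 / real CARD('n) * real CARD('n))" by (rule powr_powr)
  also have "\<dots> = ?w ^ 2" using w by simp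
  finally have "(?w powr (2 / real CARD('n))) ^ CARD('n) = ?w ^ 2" .
  moreover have "det (a *\<^sub>R M) = a ^ CARD('n) * det M" for a and M :: "real^'n^'n"
    unfolding det_def by (simp add: prod.distrib sum_distrib_left mult_ac)
  ultimately show ?thesis using w by (simp add: conformal_curve_def conformal_tensor_def real_sqrt_mult)
qed

text \<open>The measure with density \<open>1 + (n/2) t f\<close> relative to \<open>vol A g\<close>
  satisfies the defining property of the new volume measure. Its total mass is \<open>1\<close>,
  because \<open>f\<close> has integral zero.\<close>

lemma unit_conformal_curve:
  assumes pos: "\<And>p. 1 + real CARD('n) / 2 * t * f p > 0"
  shows "unit_metric A (conformal_curve f g t)"
proof -
  let ?w = "\<lambda>p. 1 + real CARD('n) / 2 * t * f p" and ?h = "conformal_curve f g t"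
  have wc: "continuous_on UNIV ?w" by (intro continuous_intros continuous_f)
  then have wb: "?w \<in> borel_measurable borel" by (rule borel_measurable_continuous_onI)
  have ms: "measurable (vol A g) borel = measurable borel borel" by (rule measurable_cong_sets[OF sets_vol[OF g_metric] refl])
  have "is_volume_measure A ?h (density (vol A g) (\<lambda>p. ennreal (?w p)))"
    unfolding is_volume_measure_def
  proof (intro conjI ballI impI)
    show "sets (density (vol A g) (\<lambda>p. ennreal (?w p))) = sets borel" by (simp add: sets_vol[OF g_metric])
    fix c E assume c: "c \<in> A" and E: "E \<in> sets borel" "E \<subseteq> chart_dom c"
    have sub: "chart_map c ` E \<subseteq> chart_img c" using E map_in_img[OF c] by auto
    note inv = inv_ext_measurable[OF g_metric c]
    have dm: "(\<lambda>x. ennreal (indicator (chart_map c ` E) x * sqrt (det (g c x)))) \<in> borel_measurable lborel"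
      using borel_density[OF g_metric c borel_map_image[OF c E] sub] by simp
    have "emeasure (density (vol A g) (\<lambda>p. ennreal (?w p))) E = (\<integral>\<^sup>+p. ennreal (?w p) * indicator E p \<partial>vol A g)"
      using wb E by (subst emeasure_density) (auto simp: ms sets_vol[OF g_metric])
    also have "\<dots> = (\<integral>\<^sup>+p. ennreal (?w p) \<partial>density (vol A g) (indicator E))"
      using wb E(1) by (subst nn_integral_density) (auto simp: ms mult.commute)
    also have "\<dots> = (\<integral>\<^sup>+p. ennreal (?w p) \<partial>chart_measure g c E)" by (simp only: chart_measure_eq[OF g_metric c E])
    also have "\<dots> = (\<integral>\<^sup>+x. ennreal (?w (inv_ext c x)) \<partial>density lborel (\<lambda>x. ennreal (indicator (chart_map c ` E) x * sqrt (det (g c x)))))"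
      unfolding chart_measure_def[OF g_metric] using inv wb by (subst nn_integral_distr) auto
    also have "\<dots> = (\<integral>\<^sup>+x. ennreal (indicator (chart_map c ` E) x * sqrt (det (g c x))) * ennreal (?w (inv_ext c x)) \<partial>lborel)"
      using dm measurable_compose[OF inv wb] by (subst nn_integral_density) auto
    also have "\<dots> = (\<integral>\<^sup>+x. ennreal (sqrt (det (?h c x))) * indicator (chart_map c ` E) x \<partial>lborel)"
    proof (rule nn_integral_cong)
      fix x
      show "ennreal (indicator (chart_map c ` E) x * sqrt (det (g c x))) * ennreal (?w (inv_ext c x)) =
        ennreal (sqrt (det (?h c x))) * indicator (chart_map c ` E) x"
      proof (cases "x \<in> chart_map c ` E")
        case True
        then have x: "x \<in> chart_img c" using sub by blast
        have w: "0 \<le> ?w (chart_inv c x)" using pos[of "chart_inv c x"] by linarith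
        have "ennreal (sqrt (det (g c x))) * ennreal (?w (chart_inv c x)) = ennreal (sqrt (det (?h c x)))"
          unfolding density_conformal_curve[OF pos] ennreal_mult[OF density_nonneg[OF g_metric c x] w, symmetric]
          by (simp only: mult.commute)
        then show ?thesis using True x by (simp add: inv_ext_def[OF g_metric])
      qed simp
    qed
    finally show "emeasure (density (vol A g) (\<lambda>p. ennreal (?w p))) E = (\<integral>\<^sup>+x. ennreal (sqrt (det (?h c x))) * indicator (chart_map c ` E) x \<partial>lborel)" .
  qed
  from vol_eqI[OF riemannian_conformal_curve[OF pos] this]
  have v: "vol A ?h = density (vol A g) (\<lambda>p. ennreal (?w p))" .
  have vol0: "measure (vol A g) UNIV \<noteq> 0" using g_volume by simp
  note int = integrable_continuous[OF g_metric vol0]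
  have sp: "space (vol A g) = UNIV" using sets_eq_imp_space_eq[OF sets_vol[OF g_metric]] by simp
  have "emeasure (vol A ?h) UNIV = (\<integral>\<^sup>+p. ennreal (?w p) \<partial>vol A g)"
    unfolding v using wb sp by (subst emeasure_density) (auto simp: ms sets_vol[OF g_metric])
  also have "\<dots> = ennreal (LINT p|vol A g. ?w p)"
    by (rule nn_integral_eq_integral[OF int[OF wc]]) (use pos in \<open>auto intro: less_imp_le\<close>)
  also have "(LINT p|vol A g. ?w p) = 1"
    using int[OF continuous_f] int[OF continuous_on_const[of UNIV 1]] mean g_volume by (simp add: sp)
  finally have "measure (vol A ?h) UNIV = 1" by (simp add: measure_def)
  then show ?thesis using riemannian_conformal_curve[OF pos] by (simp add: unit_metric_def)
qed

lemma ex_unit_metric_curve: "\<exists>\<gamma>. unit_metric_curve A g (conformal_tensor f g) \<gamma>"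
proof -
  have "compact (f ` UNIV)" using compact_continuous_image[OF continuous_f compact_manifold] .
  then obtain B where B: "\<And>p. \<bar>f p\<bar> \<le> B" using compact_imp_bounded bounded_iff by (metis rangeI real_norm_def)
  have B0: "B \<ge> 0" using B[of undefined] by linarith
  define n where "n = real CARD('n)"
  have n: "n > 0" by (simp add: n_def)
  \<comment> \<open>With \<open>B\<close> a bound for \<open>\<bar>f\<bar>\<close>, the perturbation
    of the density is at most \<open>(1/2) * (B / (B + 1))\<close>, which keeps the base of the
    power positive; \<open>B + 1\<close> covers the case \<open>f = 0\<close>.\<close>
  define \<epsilon> where "\<epsilon> = 1 / (n * (B + 1))"
  have \<epsilon>: "\<epsilon> > 0" using B0 n by (simp add: \<epsilon>_def)
  have pos: "1 + real CARD('n) / 2 * t * f p > 0" if t: "t \<in> {-\<epsilon><..<\<epsilon>}" for t p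
  proof -
    have "\<bar>n / 2 * t * f p\<bar> \<le> n / 2 * (\<epsilon> * B)"
      using t B[of p] n B0 unfolding abs_mult by (simp add: mult.assoc) (intro mult_mono, auto)
    also have "n / 2 * (\<epsilon> * B) = 1 / 2 * (B / (B + 1))" using n by (simp add: \<epsilon>_def)
    also have "\<dots> < 1" using B0 by (simp add: divide_less_eq)
    finally show ?thesis unfolding n_def by linarith
  qed
  have "unit_metric_curve A g (conformal_tensor f g) (conformal_curve f g)"
    unfolding unit_metric_curve_def
  proof (intro conjI ballI exI[of _ \<epsilon>] \<epsilon>)
    fix t assume "t \<in> {-\<epsilon><..<\<epsilon>}"
    then show "unit_metric A (conformal_curve f g t)" by (intro unit_conformal_curve pos)
  next
    fix c assume c: "c \<in> A"
    let ?W = "{-\<epsilon><..<\<epsilon>} \<times> chart_img c"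
    have W: "open ?W" by (intro open_Times open_greaterThanLessThan open_img[OF c])
    interpret C: metric_patch "chart_img c" "g c" by (rule chart_patch[OF g_metric c])
    have 1: "smooth_on ?W fst" by (rule smooth_on_linear[OF W bounded_linear_fst])
    have 2: "smooth_on ?W snd" by (rule smooth_on_linear[OF W bounded_linear_snd])
    have 3: "smooth_on ?W (\<lambda>p. f (chart_inv c (snd p)))" "smooth_on ?W (\<lambda>p. g c (snd p))"
      by (rule smooth_on_compose[OF W open_img[OF c] _ 2 smooth_f_chart[OF c]], force)
         (rule smooth_on_compose[OF W open_img[OF c] _ 2 C.smooth_G], force)
    have "smooth_on ?W (\<lambda>p. (1 + real CARD('n) / 2 * fst p * f (chart_inv c (snd p))) powr (2 / real CARD('n)) *\<^sub>R g c (snd p))"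
      by (intro smooth_on_scaleR smooth_on_powr smooth_on_add smooth_on_mult smooth_on_const 1 3 W) (rule pos, auto)
    then show "smooth_on ?W (\<lambda>(t, x). conformal_curve f g t c x)"
      by (simp add: conformal_curve_def conformal_tensor_def case_prod_beta')
  next
    fix c x
    show "conformal_curve f g 0 c x = g c x" by (simp add: conformal_curve_def conformal_tensor_def)
    let ?a = "f (chart_inv c x)"
    \<comment> \<open>The exponent \<open>2 / n\<close> cancels the slope \<open>n / 2\<close>, so
      the initial velocity is exactly \<open>f g\<close>.\<close>
    have "((\<lambda>t. (1 + n / 2 * t * ?a) powr (2 / n)) has_real_derivative ?a) (at 0)"
      using n by (auto intro!: derivative_eq_intros)
    then have "((\<lambda>t. (1 + n / 2 * t * ?a) powr (2 / n)) has_vector_derivative ?a) (at 0)"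
      by (simp add: has_real_derivative_iff_has_vector_derivative)
    from has_vector_derivative_scaleR[OF _ has_vector_derivative_const, of "\<lambda>t. (1 + n / 2 * t * ?a) powr (2 / n)" ?a 0 UNIV "g c x"] this
    show "((\<lambda>t. conformal_curve f g t c x) has_vector_derivative conformal_tensor f g c x) (at 0)"
      by (simp add: conformal_curve_def conformal_tensor_def n_def has_real_derivative_iff_has_vector_derivative)
  qed
  then show ?thesis by blast
qed

end

end

text \<open>The witness \<open>Q\<close> is the integral of the squared Laplacian of
  \<open>f\<close>; being independent of \<open>s\<close> and \<open>\<tau>\<close>, it leaves the
  sign of the second variation to the explicit coefficient.\<close>

lemma flat_second_variation:
  fixes A :: "('m::{t2_space, second_countable_topology}, 'n::finite) chart set"
    and g :: "('m, 'n) tensor2"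
  assumes M: "closed_connected_manifold A" and unit: "unit_metric A g" and flat: "constant_sectional_curvature A g 0"
    and f: "smooth_function A f" and mean: "(LINT p|vol A g. f p) = 0"
  shows "\<exists>Q\<ge>0. \<forall>s \<tau>. has_second_variation A s \<tau> g (conformal_tensor f g)
    (2 * (real CARD('n) - 1) * (1 + s * real CARD('n) / 4 + \<tau> * (real CARD('n) - 1)) * Q)"
proof -
  interpret closed_manifold A by unfold_locales (rule M)
  obtain N :: nat and cs xs rs where cov: "\<forall>k<N. cs k \<in> A \<and> 0 < rs k \<and> cball (xs k) (2 * rs k) \<subseteq> chart_img (cs k)"
    "(\<Union>k<N. chart_inv (cs k) ` ball (xs k) (rs k)) = UNIV"
    using good_cover by blast
  interpret covered_manifold A N cs xs rs by unfold_locales (use cov in auto)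
  have g: "riemannian_metric A g" and vol: "measure (vol A g) UNIV = 1" using unit by (auto simp: unit_metric_def)
  have up: "riem_up (g c) l i j k x = 0" if c: "c \<in> A" and x: "x \<in> chart_img c" for c l i j k x
  proof -
    interpret C: metric_patch "chart_img c" "g c" by (rule chart_patch[OF g c])
    have "riem (g c) i j k l x = 0" for i j k l
      by (rule C.flat_imp_riem_eq_0[OF x]) (use flat c x in \<open>auto simp: constant_sectional_curvature_def\<close>)
    then show ?thesis by (simp add: C.riem_up_from_riem[OF x])
  qed
  interpret flat_manifold A N cs xs rs g f
    by unfold_locales (use g vol f up in \<open>auto simp: ricci_def\<close>)
  show ?thesis
    unfolding has_second_variation_def
    using lap_sq_integral_nonneg ex_unit_metric_curve[OF f unit mean] second_variation_along_curve by blast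
qed

theorem theorem1p4:
  fixes A :: "('m::{t2_space, second_countable_topology}, 'n::finite) chart set"
    and g :: "('m, 'n) tensor2" and s \<tau> :: real
  assumes "CARD('n) \<ge> 3"
    and "closed_connected_manifold A"
    and "unit_metric A g"
    and "constant_sectional_curvature A g 0"
  shows "(s + 4 * \<tau> > 4 / real CARD('n) * (\<tau> - 1) \<longrightarrow>
           (\<forall>f. smooth_function A f \<and> (LINT p|vol A g. f p) = 0 \<longrightarrow>
              (\<exists>D. has_second_variation A s \<tau> g (conformal_tensor f g) D \<and> D \<ge> 0))) \<and>
         (s + 4 * \<tau> < 4 / real CARD('n) * (\<tau> - 1) \<longrightarrow>
           (\<forall>f. smooth_function A f \<and> (LINT p|vol A g. f p) = 0 \<longrightarrow>
              (\<exists>D. has_second_variation A s \<tau> g (conformal_tensor f g) D \<and> D \<le> 0)))"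
proof -
  define n where "n = real CARD('n)"
  have n: "n \<ge> 3" using assms(1) by (simp add: n_def)
  \<comment> \<open>The positive factor is \<open>n / 4\<close>: it turns
    \<open>(4 / n) * (\<tau> - 1)\<close> into \<open>\<tau> - 1\<close>, so the threshold of the
    theorem is where this factor of the coefficient changes sign.\<close>
  have coeff: "1 + s * n / 4 + \<tau> * (n - 1) = n / 4 * (s + 4 * \<tau> - 4 / n * (\<tau> - 1))"
    using n by (simp add: field_simps)
  have var: "\<exists>Q\<ge>0. has_second_variation A s \<tau> g (conformal_tensor f g)
      (2 * (n - 1) * (n / 4 * (s + 4 * \<tau> - 4 / n * (\<tau> - 1))) * Q)"
    if "smooth_function A f \<and> (LINT p|vol A g. f p) = 0" for f
    using flat_second_variation[OF assms(2-4), of f] that unfolding coeff[symmetric] unfolding n_def by blast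
  have "0 \<le> 2 * (n - 1) * (n / 4 * (s + 4 * \<tau> - 4 / n * (\<tau> - 1))) * Q" if "Q \<ge> 0" "s + 4 * \<tau> > 4 / n * (\<tau> - 1)" for Q
    using that n by (intro mult_nonneg_nonneg) auto
  moreover have "2 * (n - 1) * (n / 4 * (s + 4 * \<tau> - 4 / n * (\<tau> - 1))) * Q \<le> 0" if "Q \<ge> 0" "s + 4 * \<tau> < 4 / n * (\<tau> - 1)" for Q
    using that n by (intro mult_nonpos_nonneg mult_nonneg_nonpos) auto
  ultimately show ?thesis using var unfolding n_def by meson
qed

end
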